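(* Under the standing assumptions given in the context, let $h$ be a bounded continuous function defined on an open set that contains the support of $H$. For $1\le i\le n$ let $d_i^{(h)}=\hat{w}_i^\intercal h(A_n)\hat{w}_i$ be the oracle quantities, and let $d_1^*,\dots,d_n^*$ be the output of the Monte-Carlo nonlinear shrinkage procedure (described in the context) with input $\tilde\sigma,\tilde\lambda_1,\dots,\tilde\lambda_n$ and a positive integer $K\ge 1$. Assume that $\tilde\sigma\to\sigma$ and that $n^{-1}\sum_{i=1}^n\delta_{\tilde\lambda_i}\to H$ (weakly) almost surely as $n\to\infty$. Then for any $a,b\in[0,1]$, $$\frac{1}{n}\sum_{i=[na]}^{[nb]}d_i^{(h)}-\frac{1}{n}\sum_{i=[na]}^{[nb]}d_i^*\longrightarrow 0\qquad\text{almost surely as } n\to\infty.$$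
   Context: Standing assumptions. For each $n$, $A_n\in\mathbb{R}^{n\times n}$ is a real symmetric matrix (deterministic or random), $\sigma>0$ is fixed, and $\hat{A}_n=A_n+\sigma n^{-1/2}Z_n$, with $n\to\infty$. (i) The empirical spectral distribution $n^{-1}\sum_{k=1}^n\delta_{\lambda_k}$ of the eigenvalues $\lambda_1\ge\dots\ge\lambda_n$ of $A_n$ converges weakly almost surely to a deterministic probability measure $H$. (ii) $H$ is supported on a compact interval of $\mathbb{R}$, and eventually (for all large $n$) all eigenvalues of $A_n$ lie in a compact interval $[h_1,h_2]\subset\mathbb{R}$; the function $h$ to be estimated is continuous on an open set that contains $[h_1,h_2]$. (iii) $Z_n$ is real symmetric and independent of $A_n$; it is the top-left $n\times n$ submatrix of an infinite symmetric matrix $(Z_{ij})_{i,j\ge1}$ whose entries on and above the diagonal are i.i.d. with mean $0$, variance $1$ and finite fourth moment. Notation. $\hat\lambda_1\ge\dots\ge\hat\lambda_n$ are the eigenvalues of $\hat A_n$ and $\hat w_1,\dots,\hat w_n$ corresponding orthonormal eigenvectors. $[x]$ denotes the integer part of $x$; sums run only over indices in $\{1,\dots,n\}$. $GOE(n)$ denotes the Gaussian Orthogonal Ensemble on real symmetric $n\times n$ matrices (independent centered Gaussian entries on and above the diagonal, off-diagonal variance $1$, diagonal variance $2$). Monte-Carlo nonlinear shrinkage procedure. Inputs: $\tilde\sigma$, reals $\tilde\lambda_1,\dots,\tilde\lambda_n$ (in the domain of $h$), and a positive integer $K$. For $k=1,\dots,K$: generate (independently of each other and of all the other data) $\hat Z_k\sim\tilde\sigma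 n^{-1/2}GOE(n)$; let $\hat g_{1,k},\dots,\hat g_{n,k}$ be orthonormal eigenvectors of $\operatorname{diag}(\tilde\lambda_1,\dots,\tilde\lambda_n)+\hat Z_k$, with $\hat g_{i,k}$ corresponding to the $i$-th largest eigenvalue; set $\hat d_{i,k}=\hat g_{i,k}^\intercal\operatorname{diag}(h(\tilde\lambda_1),\dots,h(\tilde\lambda_n))\hat g_{i,k}$. Output: $d_i^*=K^{-1}\sum_{k=1}^K\hat d_{i,k}$, $1\le i\le n$. *)

theory Defs
  imports "HOL-Probability.Probability" "Jordan_Normal_Form.Char_Poly"
begin

unbundle no vec_syntax
unbundle no inner_syntax

text \<open>
  Real \<open>n \<times> n\<close> matrices are elements of \<^term>\<open>carrier_mat n n :: real mat set\<close>; matrix rows and columns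
  are indexed by \<open>0, \<dots>, n - 1\<close>, whereas eigenvalues and eigenvectors are indexed by \<open>1, \<dots>, n\<close>.
\<close>

definition ordered_eigensystem ::
  "nat \<Rightarrow> real mat \<Rightarrow> (nat \<Rightarrow> real) \<Rightarrow> (nat \<Rightarrow> real vec) \<Rightarrow> bool" where
  "ordered_eigensystem n A l v \<longleftrightarrow>
     A \<in> carrier_mat n n \<and>
     (\<forall>i\<in>{1..n}. eigenvector A (v i) (l i)) \<and>
     (\<forall>i\<in>{1..n}. \<forall>j\<in>{1..n}. scalar_prod (v i) (v j) = (if i = j then 1 else 0)) \<and>
     (\<forall>i\<in>{1..n}. \<forall>j\<in>{1..n}. i \<le> j \<longrightarrow> l j \<le> l i)"

definition spectral_sum ::
  "nat \<Rightarrow> (real \<Rightarrow> real) \<Rightarrow> (nat \<Rightarrow> real) \<Rightarrow> (nat \<Rightarrow> real vec) \<Rightarrow> real mat" where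
  "spectral_sum n h l v = mat n n (\<lambda>(r, s). \<Sum>i = 1..n. h (l i) * (v i $ r) * (v i $ s))"

text \<open>
  Functional calculus \<open>h(A) = \<Sum>\<^sub>i h(\<lambda>\<^sub>i) v\<^sub>i v\<^sub>i\<^sup>T\<close> for a symmetric matrix \<open>A\<close>; lemma
  \<open>fun_of_mat_eq\<close> shows that every orthonormal eigenbasis gives the same matrix.
\<close>

definition fun_of_mat :: "(real \<Rightarrow> real) \<Rightarrow> real mat \<Rightarrow> real mat" where
  "fun_of_mat h A =
     (THE B. \<exists>l v. ordered_eigensystem (dim_row A) A l v \<and> B = spectral_sum (dim_row A) h l v)"

lemma orthonormal_completeness:
  assumes "ordered_eigensystem n A l v" and rs: "r < n" "s < n"
  shows "(\<Sum>i = 1..n. (v i $ r) * (v i $ s)) = (if r = s then 1 else 0)"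
proof -
  have c: "v i \<in> carrier_vec n" if "i \<in> {1..n}" for i
    using assms that unfolding ordered_eigensystem_def eigenvector_def by auto
  have o: "scalar_prod (v i) (v j) = (if i = j then 1 else 0)" if "i \<in> {1..n}" "j \<in> {1..n}" for i j
    using assms that unfolding ordered_eigensystem_def by auto
  define V where "V = mat n n (\<lambda>(r, i). v (Suc i) $ r)"
  have V: "V \<in> carrier_mat n n" "transpose_mat V \<in> carrier_mat n n" by (auto simp: V_def)
  have "transpose_mat V * V = 1\<^sub>m n"
  proof (rule eq_matI)
    fix i j assume ij: "i < dim_row (1\<^sub>m n :: real mat)" "j < dim_col (1\<^sub>m n :: real mat)"
    have "(transpose_mat V * V) $$ (i, j) = scalar_prod (v (Suc i)) (v (Suc j))"
      using ij c[of "Suc j"] by (auto simp: V_def scalar_prod_def intro!: sum.cong)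
    then show "(transpose_mat V * V) $$ (i, j) = 1\<^sub>m n $$ (i, j)"
      using ij o[of "Suc i" "Suc j"] by auto
  qed (auto simp: V_def)
  then have "V * transpose_mat V = 1\<^sub>m n"
    using mat_mult_left_right_inverse V by blast
  then have "(V * transpose_mat V) $$ (r, s) = (if r = s then 1 else 0)"
    using rs by simp
  also have "(V * transpose_mat V) $$ (r, s) = (\<Sum>i<n. (v (Suc i) $ r) * (v (Suc i) $ s))"
    using rs by (auto simp: V_def scalar_prod_def atLeast0LessThan intro!: sum.cong)
  also have "\<dots> = (\<Sum>i = 1..n. (v i $ r) * (v i $ s))"
    by (simp add: sum.atLeast1_atMost_eq)
  finally show ?thesis .
qed

lemma spectral_sum_unique:
  assumes "transpose_mat A = A" and L: "ordered_eigensystem n A l v" and M: "ordered_eigensystem n A m w"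
  shows "spectral_sum n h l v = spectral_sum n h m w"
proof -
  have A: "A \<in> carrier_mat n n" using L unfolding ordered_eigensystem_def by auto
  have v: "v i \<in> carrier_vec n" "A *\<^sub>v v i = l i \<cdot>\<^sub>v v i" if "i \<in> {1..n}" for i
    using L that A unfolding ordered_eigensystem_def eigenvector_def by auto
  have w: "w i \<in> carrier_vec n" "A *\<^sub>v w i = m i \<cdot>\<^sub>v w i" if "i \<in> {1..n}" for i
    using M that A unfolding ordered_eigensystem_def eigenvector_def by auto
  define c where "c i j = scalar_prod (v i) (w j)" for i j
  have c_sum: "c i j = (\<Sum>r<n. (v i $ r) * (w j $ r))" if "j \<in> {1..n}" for i j
    using w(1)[OF that] by (auto simp: c_def scalar_prod_def atLeast0LessThan)
  have hc: "h (l i) * c i j = h (m j) * c i j" if i: "i \<in> {1..n}" and j: "j \<in> {1..n}" for i j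
  proof -
    have "l i * c i j = scalar_prod (A *\<^sub>v v i) (w j)"
      using v[OF i] w[OF j] by (simp add: c_def)
    also have "\<dots> = scalar_prod (v i) (A *\<^sub>v w j)"
      using transpose_vec_mult_scalar[OF A w(1)[OF j] v(1)[OF i]] assms(1)
      by (metis A v(1)[OF i] w(1)[OF j] comm_scalar_prod mult_mat_vec_carrier)
    also have "\<dots> = m j * c i j"
      using v[OF i] w[OF j] by (simp add: c_def)
    finally show ?thesis by auto
  qed
  have vw: "v i $ s = (\<Sum>j = 1..n. c i j * (w j $ s))" if s: "s < n" for i s
  proof -
    have "(\<Sum>j = 1..n. c i j * (w j $ s)) = (\<Sum>j = 1..n. \<Sum>r<n. (v i $ r) * ((w j $ r) * (w j $ s)))"
      by (intro sum.cong refl) (simp add: c_sum sum_distrib_right mult.assoc)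
    also have "\<dots> = (\<Sum>r<n. (v i $ r) * (\<Sum>j = 1..n. (w j $ r) * (w j $ s)))"
      by (subst sum.swap) (simp add: sum_distrib_left)
    also have "\<dots> = (\<Sum>r<n. if r = s then v i $ r else 0)"
      using s by (intro sum.cong refl) (simp add: orthonormal_completeness[OF M] del: One_nat_def)
    also have "\<dots> = v i $ s" using s by simp
    finally show ?thesis by simp
  qed
  have wv: "w j $ s = (\<Sum>i = 1..n. c i j * (v i $ s))" if s: "s < n" and j: "j \<in> {1..n}" for j s
  proof -
    have "(\<Sum>i = 1..n. c i j * (v i $ s)) = (\<Sum>i = 1..n. \<Sum>r<n. (w j $ r) * ((v i $ r) * (v i $ s)))"
      by (intro sum.cong refl) (simp add: c_sum[OF j] sum_distrib_left sum_distrib_right mult_ac)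
    also have "\<dots> = (\<Sum>r<n. (w j $ r) * (\<Sum>i = 1..n. (v i $ r) * (v i $ s)))"
      by (subst sum.swap) (simp add: sum_distrib_left)
    also have "\<dots> = (\<Sum>r<n. if r = s then w j $ r else 0)"
      using s by (intro sum.cong refl) (simp add: orthonormal_completeness[OF L] del: One_nat_def)
    also have "\<dots> = w j $ s" using s by simp
    finally show ?thesis by simp
  qed
  have "(\<Sum>i = 1..n. h (l i) * (v i $ r) * (v i $ s)) = (\<Sum>j = 1..n. h (m j) * (w j $ r) * (w j $ s))"
    if r: "r < n" and s: "s < n" for r s
  proof -
    have "(\<Sum>i = 1..n. h (l i) * (v i $ r) * (v i $ s)) =
        (\<Sum>i = 1..n. \<Sum>j = 1..n. (h (l i) * c i j) * (v i $ r) * (w j $ s))"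
      by (intro sum.cong refl, subst vw[OF s]) (simp add: sum_distrib_left mult_ac)
    also have "\<dots> = (\<Sum>i = 1..n. \<Sum>j = 1..n. (h (m j) * c i j) * (v i $ r) * (w j $ s))"
      using hc by (intro sum.cong refl) simp
    also have "\<dots> = (\<Sum>j = 1..n. \<Sum>i = 1..n. (h (m j) * c i j) * (v i $ r) * (w j $ s))"
      by (rule sum.swap)
    also have "\<dots> = (\<Sum>j = 1..n. h (m j) * (w j $ r) * (w j $ s))"
    proof (intro sum.cong refl)
      fix j assume j: "j \<in> {1..n}"
      show "(\<Sum>i = 1..n. (h (m j) * c i j) * (v i $ r) * (w j $ s)) = h (m j) * (w j $ r) * (w j $ s)"
        unfolding wv[OF r j] by (simp add: sum_distrib_left sum_distrib_right mult_ac)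
    qed
    finally show ?thesis .
  qed
  then show ?thesis by (intro eq_matI) (auto simp: spectral_sum_def)
qed

lemma fun_of_mat_eq:
  assumes "transpose_mat A = A" and "ordered_eigensystem n A l v"
  shows "fun_of_mat h A = spectral_sum n h l v"
proof -
  have "dim_row A = n" using assms(2) unfolding ordered_eigensystem_def by auto
  then show ?thesis
    unfolding fun_of_mat_def using assms spectral_sum_unique by (intro the_equality) blast+
qed

definition empirical_distr :: "nat \<Rightarrow> (nat \<Rightarrow> real) \<Rightarrow> real measure" where
  "empirical_distr n x = distr (uniform_count_measure {1..n}) borel x"

definition measure_support :: "real measure \<Rightarrow> real set" where
  "measure_support \<mu> = {x. \<forall>T. open T \<and> x \<in> T \<longrightarrow> 0 < emeasure \<mu> T}"

definition top_left :: "nat \<Rightarrow> (nat \<Rightarrow> nat \<Rightarrow> 'w \<Rightarrow> real) \<Rightarrow> 'w \<Rightarrow> real mat" where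
  "top_left n Z \<omega> = mat n n (\<lambda>(i, j). Z i j \<omega>)"

text \<open>Matrix entries as a point of a finite product space, used to express measurability and independence.\<close>

definition entries :: "nat \<Rightarrow> real mat \<Rightarrow> nat \<times> nat \<Rightarrow> real" where
  "entries n A = restrict (\<lambda>p. A $$ p) ({..<n} \<times> {..<n})"

definition entry_space :: "nat \<Rightarrow> (nat \<times> nat \<Rightarrow> real) measure" where
  "entry_space n = PiM ({..<n} \<times> {..<n}) (\<lambda>_. borel)"

definition iid_symmetric_array :: "'w measure \<Rightarrow> (nat \<Rightarrow> nat \<Rightarrow> 'w \<Rightarrow> real) \<Rightarrow> bool" where
  "iid_symmetric_array M Z \<longleftrightarrow>
     (\<forall>i j. \<forall>\<omega>\<in>space M. Z i j \<omega> = Z j i \<omega>) \<and>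
     prob_space.indep_vars M (\<lambda>_. borel) (\<lambda>(i, j). Z i j) {(i, j). i \<le> j} \<and>
     (\<forall>i j. i \<le> j \<longrightarrow> distr M borel (Z i j) = distr M borel (Z 0 0))"

text \<open>\<open>GOE(n)\<close>: \<open>normal_density\<close> takes the standard deviation, hence diagonal variance 2 is \<open>sqrt 2\<close>.\<close>

definition is_GOE :: "'w measure \<Rightarrow> nat \<Rightarrow> ('w \<Rightarrow> real mat) \<Rightarrow> bool" where
  "is_GOE M n G \<longleftrightarrow>
     (\<forall>\<omega>\<in>space M. G \<omega> \<in> carrier_mat n n \<and> transpose_mat (G \<omega>) = G \<omega>) \<and>
     prob_space.indep_vars M (\<lambda>_. borel) (\<lambda>p \<omega>. G \<omega> $$ p) {(i, j). i \<le> j \<and> j < n} \<and>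
     (\<forall>i j. i \<le> j \<and> j < n \<longrightarrow>
        distributed M lborel (\<lambda>\<omega>. G \<omega> $$ (i, j)) (normal_density 0 (if i = j then sqrt 2 else 1)))"

text \<open>
  Monte-Carlo nonlinear shrinkage with inputs \<open>s\<close>, \<open>x 1, \<dots>, x n\<close> and \<open>K\<close>: in the \<open>k\<close>-th run the
  matrix is \<open>diag(x) + s n\<^sup>-\<^sup>1\<^sup>/\<^sup>2 G k\<close>, with \<open>G k\<close> a realisation of \<open>GOE(n)\<close>, and \<open>g k i\<close> is its
  \<open>i\<close>-th eigenvector.
\<close>

definition diag_of :: "nat \<Rightarrow> (nat \<Rightarrow> real) \<Rightarrow> real mat" where
  "diag_of n x = mat_diag n (\<lambda>i. x (Suc i))"

definition mc_matrix :: "nat \<Rightarrow> real \<Rightarrow> (nat \<Rightarrow> real) \<Rightarrow> real mat \<Rightarrow> real mat" where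
  "mc_matrix n s x G = diag_of n x + (s / sqrt (real n)) \<cdot>\<^sub>m G"

definition quad_form :: "real mat \<Rightarrow> real vec \<Rightarrow> real" where
  "quad_form B u = scalar_prod u (B *\<^sub>v u)"

definition mc_shrinkage ::
  "nat \<Rightarrow> nat \<Rightarrow> (real \<Rightarrow> real) \<Rightarrow> (nat \<Rightarrow> real) \<Rightarrow> (nat \<Rightarrow> nat \<Rightarrow> real vec) \<Rightarrow> nat \<Rightarrow> real" where
  "mc_shrinkage n K h x g i =
     (1 / real K) * (\<Sum>k = 1..K. quad_form (diag_of n (\<lambda>j. h (x j))) (g k i))"

text \<open>The \<open>\<sigma>\<close>-algebra on \<open>space M\<close> generated by \<open>X\<close> with values in \<open>N\<close>.\<close>

definition events_of :: "'w measure \<Rightarrow> 'b measure \<Rightarrow> ('w \<Rightarrow> 'b) \<Rightarrow> 'w set set" where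
  "events_of M N X = {X -` B \<inter> space M | B. B \<in> sets N}"

text \<open>
  Randomness of the procedure at stage \<open>n\<close>: \<open>G 1, \<dots>, G K\<close> are \<open>GOE(n)\<close> matrices, independent of
  each other and of all other data, i.e. of \<open>A\<^sub>n\<close>, \<open>Z\<^sub>n\<close> and the inputs \<open>s\<close>, \<open>x\<close>. In the family
  of independent \<open>\<sigma>\<close>-algebras, index 0 stands for these data. Since \<open>indep_sets\<close> only admits
  families of events, the data are in particular measurable.
\<close>

definition mc_sampling ::
  "'w measure \<Rightarrow> nat \<Rightarrow> nat \<Rightarrow> (nat \<Rightarrow> 'w \<Rightarrow> real mat) \<Rightarrow>
   ('w \<Rightarrow> real mat) \<Rightarrow> ('w \<Rightarrow> real mat) \<Rightarrow> ('w \<Rightarrow> real) \<Rightarrow> ('w \<Rightarrow> nat \<Rightarrow> real) \<Rightarrow> bool" where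
  "mc_sampling M n K G A Z s x \<longleftrightarrow>
     (\<forall>k\<in>{1..K}. is_GOE M n (G k)) \<and>
     prob_space.indep_sets M
       (\<lambda>k. if k = 0
            then events_of M
              ((entry_space n \<Otimes>\<^sub>M entry_space n) \<Otimes>\<^sub>M (borel \<Otimes>\<^sub>M PiM {1..n} (\<lambda>_. borel)))
              (\<lambda>\<omega>. ((entries n (A \<omega>), entries n (Z \<omega>)), (s \<omega>, restrict (x \<omega>) {1..n})))
            else events_of M (entry_space n) (\<lambda>\<omega>. entries n (G k \<omega>)))
       {0..K}"

end

theory Submission
  imports Defs "HOL-Real_Asymp.Real_Asymp"
begin

text \<open>
  Both procedures average quadratic forms of eigenvectors in the same model: a symmetric matrix \<open>A\<close> whose
  spectral distribution tends to \<open>H\<close> is perturbed by \<open>s n\<^sup>-\<^sup>1\<^sup>/\<^sup>2\<close> times an independent Wigner matrix, and a matrix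
  \<open>B\<close> is tested on the eigenvectors of the sum. On one side \<open>A = A\<^sub>n\<close>, \<open>B = h(A\<^sub>n)\<close> and the noise is \<open>Z\<^sub>n\<close>; in each
  Monte-Carlo run \<open>A\<close> and \<open>B\<close> are diagonal and the noise is Gaussian. The theorem holds because block averages of
  the quadratic forms are determined, up to \<open>o(1)\<close>, by \<open>H\<close>, \<open>\<sigma>\<close> and \<open>h\<close> alone.

  The link to analysis is the resolvent \<open>R = (A + s n\<^sup>-\<^sup>1\<^sup>/\<^sup>2 Z - z)\<^sup>-\<^sup>1\<close>, \<open>Im z > 0\<close>: the normalized trace of \<open>B R\<close> is
  \<open>1/n \<Sum>\<^sub>i d\<^sub>i / (l\<^sub>i - z)\<close> with \<open>l\<^sub>i\<close> the eigenvalues and \<open>d\<^sub>i\<close> the quadratic forms in question, so it is the Stieltjes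
  transform of the weights \<open>d\<^sub>i / n\<close> placed at \<open>l\<^sub>i\<close>. Write \<open>m\<close> for the normalized trace of \<open>R\<close>. Almost surely
  \<open>tr (B R) / n - tr (B (A - z - s\<^sup>2 m)\<^sup>-\<^sup>1) / n \<rightarrow> 0\<close> (\<open>wigner_law.AE_deterministic_equivalent\<close>). The fluctuations around the
  mean are small because the trace is Lipschitz in every entry of the noise with a constant of order \<open>n\<^sup>-\<^sup>3\<^sup>/\<^sup>2\<close>;
  a martingale-type induction over the entries (\<open>real_product_prob.coordinate_lipschitz_moments\<close>) bounds the fourth central
  moment by \<open>O(n\<^sup>-\<^sup>2)\<close>, which is summable. The mean is computed by expanding \<open>R\<close> to second order in one entry at a time:
  only the first two moments of the entry survive, and the second moments add up to the term \<open>s\<^sup>2 m\<close>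
  (\<open>wigner_law.mean_deterministic_equivalent\<close>). Since only means and variances enter, the law of the noise is forgotten.

  As the spectral distribution of \<open>A\<close> tends to \<open>H\<close>, the equivalent is asymptotically
  \<open>\<integral> f(x) / (x - z - \<sigma>\<^sup>2 m) dH(x)\<close>, where \<open>f = h\<close> on the support of \<open>H\<close> (\<open>wigner_law.AE_approx_subordinated\<close>). For \<open>f = 1\<close> this is a
  fixed point equation for \<open>m\<close>; taking imaginary parts shows that it is a strict contraction at every approximate solution,
  so both models have the same \<open>m\<close> and then the same weighted transforms, up to \<open>o(1)\<close>
  (\<open>stieltjes_diff_tendsto_if_approx_subordinated\<close>). The same computation gives, for each \<open>z\<close>, eventually \<open>|m| \<le> 2 / \<sigma>\<close>. This bound does not depend on \<open>z\<close>, so the eigenvalues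
  do not concentrate at any point. Therefore integrating the imaginary part over a line parallel to the real axis recovers the sums over
  spectral windows, and a threshold can be chosen above which a prescribed fraction of the eigenvalues lies; this turns windows
  into blocks of indices (\<open>top_sums_diff_if_approx_subordinated\<close>).

  All almost sure statements are used at the countably many \<open>z\<close> with rational coordinates and extended by equicontinuity. The function
  \<open>h\<close> is first replaced by \<open>f(x) = h(max h\<^sub>1 (min h\<^sub>2 x))\<close>, which is continuous on the whole line and agrees with \<open>h\<close> on the spectrum of \<open>A\<^sub>n\<close>
  for large \<open>n\<close>; on the Monte-Carlo side the replacement costs an average of \<open>|h - f|\<close> over the inputs, which tends to zero.
\<close>

section \<open>Resolvents of real symmetric matrices\<close>

definition vnorm :: "complex vec \<Rightarrow> real" where
  "vnorm u = L2_set (\<lambda>i. cmod (u $ i)) {..<dim_vec u}"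

text \<open>
  \<open>op_bound n C X\<close>: the operator norm of \<open>X\<close> is at most \<open>C\<close>. Keeping the
  bound as a parameter avoids the supremum in the definition of the norm.
\<close>

definition op_bound :: "nat \<Rightarrow> real \<Rightarrow> complex mat \<Rightarrow> bool" where
  "op_bound n C X \<longleftrightarrow> X \<in> carrier_mat n n \<and> (\<forall>u\<in>carrier_vec n. vnorm (X *\<^sub>v u) \<le> C * vnorm u)"

definition mat_trace :: "'a::comm_monoid_add mat \<Rightarrow> 'a" where
  "mat_trace X = (\<Sum>i<dim_row X. X $$ (i, i))"

abbreviation cmat :: "real mat \<Rightarrow> complex mat" where
  "cmat \<equiv> map_mat complex_of_real"

text \<open>
  \<open>(S - z)\<^sup>-\<^sup>1\<close>, written with the adjugate so that its entries are visibly rational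
  functions of \<open>z\<close> and the entries of \<open>S\<close>; this gives measurability.
\<close>

definition resolvent :: "real mat \<Rightarrow> complex \<Rightarrow> complex mat" where
  "resolvent S z = (let X = cmat S - z \<cdot>\<^sub>m 1\<^sub>m (dim_row S) in (1 / det X) \<cdot>\<^sub>m adj_mat X)"

lemma vnorm_nonneg [simp]: "0 \<le> vnorm u"
  by (simp add: vnorm_def L2_set_nonneg)

lemma vnorm_sq: "(vnorm u)\<^sup>2 = (\<Sum>i<dim_vec u. (cmod (u $ i))\<^sup>2)"
  by (simp add: vnorm_def L2_set_def sum_nonneg)

lemma vnorm_unit_vec: "i < n \<Longrightarrow> vnorm (unit_vec n i) = 1"
proof -
  assume i: "i < n"
  have "(\<Sum>k<n. (cmod (unit_vec n i $ k))\<^sup>2) = (\<Sum>k<n. if k = i then 1 else (0::real))"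
    by (intro sum.cong) (auto simp: unit_vec_def)
  then show ?thesis using i by (simp add: vnorm_def L2_set_def)
qed

lemma cmod_index_le_vnorm: "i < dim_vec u \<Longrightarrow> cmod (u $ i) \<le> vnorm u"
  unfolding vnorm_def by (rule member_le_L2_set) auto

lemma op_bound_carrier: "op_bound n C X \<Longrightarrow> X \<in> carrier_mat n n"
  by (simp add: op_bound_def)

lemma op_bound_mult:
  assumes "op_bound n C X" "op_bound n D Y" "0 \<le> C"
  shows "op_bound n (C * D) (X * Y)"
  unfolding op_bound_def
proof (intro conjI ballI)
  have c: "X \<in> carrier_mat n n" "Y \<in> carrier_mat n n" using assms by (auto simp: op_bound_def)
  then show "X * Y \<in> carrier_mat n n" by simp
  fix u :: "complex vec" assume u: "u \<in> carrier_vec n"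
  have "vnorm (X * Y *\<^sub>v u) = vnorm (X *\<^sub>v (Y *\<^sub>v u))" using c u by simp
  also have "\<dots> \<le> C * vnorm (Y *\<^sub>v u)" using assms c u by (auto simp: op_bound_def)
  also have "\<dots> \<le> C * (D * vnorm u)" using assms u by (intro mult_left_mono) (auto simp: op_bound_def)
  finally show "vnorm (X * Y *\<^sub>v u) \<le> C * D * vnorm u" by simp
qed

lemma op_bound_entry:
  assumes "op_bound n C X" "i < n" "j < n"
  shows "cmod (X $$ (i, j)) \<le> C"
proof -
  have X: "X \<in> carrier_mat n n" using assms by (simp add: op_bound_def)
  have e: "(X *\<^sub>v unit_vec n j) $ i = X $$ (i, j)" using X assms(2,3) by simp
  have "cmod ((X *\<^sub>v unit_vec n j) $ i) \<le> vnorm (X *\<^sub>v unit_vec n j)"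
    using X assms by (intro cmod_index_le_vnorm) auto
  also have "\<dots> \<le> C * vnorm (unit_vec n j :: complex vec)" using assms unfolding op_bound_def by simp
  finally show ?thesis using e assms by (simp add: vnorm_unit_vec)
qed

lemma op_bound_mat_trace:
  assumes "op_bound n C X"
  shows "cmod (mat_trace X) \<le> real n * C"
proof -
  have X: "X \<in> carrier_mat n n" using assms by (simp add: op_bound_def)
  have "cmod (mat_trace X) \<le> (\<Sum>i<n. cmod (X $$ (i, i)))"
    unfolding mat_trace_def using X by (simp add: norm_sum)
  also have "\<dots> \<le> (\<Sum>i<n. C)" using assms by (intro sum_mono op_bound_entry) auto
  finally show ?thesis by simp
qed

lemma mat_trace_add: "X \<in> carrier_mat n n \<Longrightarrow> Y \<in> carrier_mat n n \<Longrightarrow> mat_trace (X + Y) = mat_trace X + mat_trace Y"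
  by (simp add: mat_trace_def sum.distrib)

lemma mat_trace_minus: "X \<in> carrier_mat n n \<Longrightarrow> Y \<in> carrier_mat n n \<Longrightarrow> mat_trace (X - Y) = mat_trace X - (mat_trace Y :: 'a::ab_group_add)"
  by (simp add: mat_trace_def sum_subtractf)

lemma mat_trace_smult: "X \<in> carrier_mat n n \<Longrightarrow> mat_trace (c \<cdot>\<^sub>m X) = c * (mat_trace X :: 'a::comm_semiring_0)"
  by (simp add: mat_trace_def sum_distrib_left)

lemma mat_trace_mult: "X \<in> carrier_mat n n \<Longrightarrow> Y \<in> carrier_mat n n \<Longrightarrow>
   mat_trace (X * Y) = (\<Sum>i<n. \<Sum>j<n. X $$ (i, j) * Y $$ (j, i))"
  by (auto simp: mat_trace_def scalar_prod_def atLeast0LessThan intro!: sum.cong)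

lemma mat_trace_comm: "X \<in> carrier_mat n n \<Longrightarrow> Y \<in> carrier_mat n n \<Longrightarrow> mat_trace (X * Y) = mat_trace (Y * (X :: 'a::comm_semiring_0 mat))"
  by (subst (1 2) mat_trace_mult, assumption+, subst sum.swap) (simp add: mult.commute)

text \<open>
  The quadratic form of a real symmetric matrix is real even on complex vectors, so only \<open>z\<close>
  contributes to the imaginary part. Invertibility, the norm bound and the positivity of the diagonal of the
  resolvent all follow from this identity.
\<close>

lemma im_quadratic_form_symmetric:
  fixes S :: "real mat"
  assumes S: "S \<in> carrier_mat n n" "transpose_mat S = S" and u: "u \<in> carrier_vec n"
  shows "Im (\<Sum>i<n. ((cmat S - z \<cdot>\<^sub>m 1\<^sub>m n) *\<^sub>v u) $ i * cnj (u $ i)) = - Im z * (vnorm u)\<^sup>2"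
proof -
  have sym: "S $$ (i, j) = S $$ (j, i)" if "i < n" "j < n" for i j
    using S that by (metis carrier_matD index_transpose_mat(1))
  have e: "((cmat S - z \<cdot>\<^sub>m 1\<^sub>m n) *\<^sub>v u) $ i = (\<Sum>j<n. complex_of_real (S $$ (i,j)) * u $ j) - z * u $ i"
    if i: "i < n" for i
  proof -
    have "((cmat S - z \<cdot>\<^sub>m 1\<^sub>m n) *\<^sub>v u) $ i =
      (\<Sum>j<n. (complex_of_real (S $$ (i,j)) - z * (if i = j then 1 else 0)) * u $ j)"
      using S u i by (auto simp: scalar_prod_def atLeast0LessThan intro!: sum.cong)
    also have "\<dots> = (\<Sum>j<n. complex_of_real (S $$ (i,j)) * u $ j) - (\<Sum>j<n. if i = j then z * u $ j else 0)"
      unfolding sum_subtractf[symmetric] by (intro sum.cong) (auto simp: algebra_simps)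
    finally show ?thesis using i by simp
  qed
  define q where "q = (\<Sum>i<n. \<Sum>j<n. complex_of_real (S $$ (i,j)) * u $ j * cnj (u $ i))"
  have "cnj q = q"
    unfolding q_def cnj_sum by (subst (2) sum.swap) (auto intro!: sum.cong simp: sym)
  then have q: "Im q = 0" by (metis Reals_cnj_iff complex_is_Real_iff)
  have "(\<Sum>i<n. ((cmat S - z \<cdot>\<^sub>m 1\<^sub>m n) *\<^sub>v u) $ i * cnj (u $ i)) = q - z * (\<Sum>i<n. u $ i * cnj (u $ i))"
  proof -
    have "(\<Sum>i<n. ((cmat S - z \<cdot>\<^sub>m 1\<^sub>m n) *\<^sub>v u) $ i * cnj (u $ i)) =
        (\<Sum>i<n. ((\<Sum>j<n. complex_of_real (S $$ (i,j)) * u $ j) - z * u $ i) * cnj (u $ i))"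
      by (intro sum.cong refl) (simp only: e lessThan_iff)
    then show ?thesis
      unfolding q_def by (simp add: sum_subtractf sum_distrib_left sum_distrib_right left_diff_distrib mult.assoc)
  qed
  also have "(\<Sum>i<n. u $ i * cnj (u $ i)) = complex_of_real ((vnorm u)\<^sup>2)"
    using u by (simp only: complex_norm_square[symmetric] vnorm_sq carrier_vecD of_real_sum)
  finally show ?thesis using q by simp
qed

lemma shifted_lower_bound:
  fixes S :: "real mat"
  assumes S: "S \<in> carrier_mat n n" "transpose_mat S = S" and u: "u \<in> carrier_vec n" and z: "Im z > 0"
  shows "Im z * vnorm u \<le> vnorm ((cmat S - z \<cdot>\<^sub>m 1\<^sub>m n) *\<^sub>v u)"
proof -
  define w where "w = (cmat S - z \<cdot>\<^sub>m 1\<^sub>m n) *\<^sub>v u"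
  have dw: "dim_vec w = n" using S by (simp add: w_def)
  have du: "dim_vec u = n" using u by simp
  have "Im z * (vnorm u)\<^sup>2 = - Im (\<Sum>i<n. w $ i * cnj (u $ i))"
    unfolding w_def by (subst im_quadratic_form_symmetric[OF S u]) simp
  also have "\<dots> \<le> cmod (\<Sum>i<n. w $ i * cnj (u $ i))"
    using abs_Im_le_cmod[of "\<Sum>i<n. w $ i * cnj (u $ i)"] by linarith
  also have "\<dots> \<le> (\<Sum>i<n. \<bar>cmod (w $ i)\<bar> * \<bar>cmod (u $ i)\<bar>)"
    by (rule order_trans[OF norm_sum]) (simp add: norm_mult)
  also have "\<dots> \<le> vnorm w * vnorm u"
    unfolding vnorm_def dw du by (rule L2_set_mult_ineq)
  finally have "vnorm u * (Im z * vnorm u) \<le> vnorm u * vnorm w" by (simp add: power2_eq_square mult_ac)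
  moreover have "vnorm u > 0 \<or> vnorm u = 0" using vnorm_nonneg[of u] by linarith
  ultimately show ?thesis unfolding w_def[symmetric] by (auto simp: mult_le_cancel_left)
qed

lemma vnorm_eq_0: "u \<in> carrier_vec n \<Longrightarrow> vnorm u = 0 \<Longrightarrow> u = 0\<^sub>v n"
  unfolding vnorm_def by (auto simp: L2_set_eq_0_iff intro!: eq_vecI)

lemma resolvent_carrier [simp]: "S \<in> carrier_mat n n \<Longrightarrow> resolvent S z \<in> carrier_mat n n"
  unfolding resolvent_def Let_def by (auto intro!: smult_carrier_mat adj_mat)

lemma resolvent_inverse:
  assumes S: "S \<in> carrier_mat n n" "transpose_mat S = S" and z: "Im z > 0"
  shows "(cmat S - z \<cdot>\<^sub>m 1\<^sub>m n) * resolvent S z = 1\<^sub>m n"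
    and "resolvent S z * (cmat S - z \<cdot>\<^sub>m 1\<^sub>m n) = 1\<^sub>m n"
proof -
  define X where "X = cmat S - z \<cdot>\<^sub>m 1\<^sub>m n"
  have X: "X \<in> carrier_mat n n" using S by (simp add: X_def minus_carrier_mat)
  have d: "det X \<noteq> 0"
  proof
    assume "det X = 0"
    then obtain u where u: "u \<in> carrier_vec n" "u \<noteq> 0\<^sub>v n" "X *\<^sub>v u = 0\<^sub>v n"
      using det_0_iff_vec_prod_zero[OF X] by auto
    have "Im z * vnorm u \<le> vnorm (0\<^sub>v n)"
      using shifted_lower_bound[OF S u(1) z] u(3) by (simp add: X_def)
    also have "vnorm (0\<^sub>v n) = 0" by (simp add: vnorm_def L2_set_def)
    finally have "vnorm u = 0" using z vnorm_nonneg[of u]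
      by (meson mult_pos_pos not_le order_antisym_conv)
    then show False using vnorm_eq_0 u by blast
  qed
  have r: "resolvent S z = (1 / det X) \<cdot>\<^sub>m adj_mat X"
    using S by (auto simp: resolvent_def X_def Let_def)
  have i: "(1 / det X) \<cdot>\<^sub>m (det X \<cdot>\<^sub>m 1\<^sub>m n) = 1\<^sub>m n" using d by (intro eq_matI) auto
  show "(cmat S - z \<cdot>\<^sub>m 1\<^sub>m n) * resolvent S z = 1\<^sub>m n"
    unfolding r X_def[symmetric] using adj_mat[OF X] X by (simp add: mult_smult_distrib i)
  show "resolvent S z * (cmat S - z \<cdot>\<^sub>m 1\<^sub>m n) = 1\<^sub>m n"
    unfolding r X_def[symmetric] using adj_mat[OF X] X by (simp add: mult_smult_assoc_mat i)
qed

lemma resolvent_op_bound: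
  assumes S: "S \<in> carrier_mat n n" "transpose_mat S = S" and z: "Im z > 0"
  shows "op_bound n (1 / Im z) (resolvent S z)"
  unfolding op_bound_def
proof (intro conjI ballI)
  show c: "resolvent S z \<in> carrier_mat n n" using S by simp
  fix u :: "complex vec" assume u: "u \<in> carrier_vec n"
  have c2: "cmat S - z \<cdot>\<^sub>m 1\<^sub>m n \<in> carrier_mat n n" using S by (simp add: minus_carrier_mat)
  have "Im z * vnorm (resolvent S z *\<^sub>v u) \<le> vnorm ((cmat S - z \<cdot>\<^sub>m 1\<^sub>m n) *\<^sub>v (resolvent S z *\<^sub>v u))"
    using shifted_lower_bound[OF S _ z] c u by auto
  also have "(cmat S - z \<cdot>\<^sub>m 1\<^sub>m n) *\<^sub>v (resolvent S z *\<^sub>v u) = u"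
    using assoc_mult_mat_vec[OF c2 c u] resolvent_inverse(1)[OF assms] u by simp
  finally show "vnorm (resolvent S z *\<^sub>v u) \<le> 1 / Im z * vnorm u" using z by (simp add: field_simps)
qed

lemma resolvent_unique:
  assumes S: "S \<in> carrier_mat n n" "transpose_mat S = S" and z: "Im z > 0"
    and Y: "Y \<in> carrier_mat n n" "(cmat S - z \<cdot>\<^sub>m 1\<^sub>m n) * Y = 1\<^sub>m n"
  shows "resolvent S z = Y"
proof -
  have c2: "cmat S - z \<cdot>\<^sub>m 1\<^sub>m n \<in> carrier_mat n n" using S by (simp add: minus_carrier_mat)
  have c: "resolvent S z \<in> carrier_mat n n" using S by simp
  have "resolvent S z = resolvent S z * ((cmat S - z \<cdot>\<^sub>m 1\<^sub>m n) * Y)" using Y c by simp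
  also have "\<dots> = (resolvent S z * (cmat S - z \<cdot>\<^sub>m 1\<^sub>m n)) * Y"
    using assoc_mult_mat[OF c c2 Y(1)] by simp
  also have "\<dots> = Y" using resolvent_inverse(2)[OF S z] Y by simp
  finally show ?thesis .
qed

lemma resolvent_transpose:
  assumes S: "S \<in> carrier_mat n n" "transpose_mat S = S" and z: "Im z > 0"
  shows "transpose_mat (resolvent S z) = resolvent S z"
proof (rule resolvent_unique[OF assms, symmetric])
  have c2: "cmat S - z \<cdot>\<^sub>m 1\<^sub>m n \<in> carrier_mat n n" using S by (simp add: minus_carrier_mat)
  have c: "resolvent S z \<in> carrier_mat n n" using S by simp
  then show "transpose_mat (resolvent S z) \<in> carrier_mat n n" by simp
  have sym: "S $$ (i, j) = S $$ (j, i)" if "i < n" "j < n" for i j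
    using S that by (metis carrier_matD index_transpose_mat(1))
  have t: "transpose_mat (cmat S - z \<cdot>\<^sub>m 1\<^sub>m n) = cmat S - z \<cdot>\<^sub>m 1\<^sub>m n"
    using S by (intro eq_matI) (auto simp: sym)
  have "(cmat S - z \<cdot>\<^sub>m 1\<^sub>m n) * transpose_mat (resolvent S z) = transpose_mat (resolvent S z * (cmat S - z \<cdot>\<^sub>m 1\<^sub>m n))"
    by (simp add: transpose_mult[OF c c2] t)
  then show "(cmat S - z \<cdot>\<^sub>m 1\<^sub>m n) * transpose_mat (resolvent S z) = 1\<^sub>m n"
    using resolvent_inverse(2)[OF assms] by simp
qed

text \<open>
  With \<open>u = R e\<^sub>i\<close> the diagonal entry is \<open>\<langle>u, (S - z) u\<rangle>\<close> up
  to conjugation, whose imaginary part is \<open>Im z |u|\<^sup>2\<close>.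
\<close>

lemma resolvent_Im_diag:
  assumes S: "S \<in> carrier_mat n n" "transpose_mat S = S" and z: "Im z > 0" and i: "i < n"
  shows "0 \<le> Im (resolvent S z $$ (i, i))"
proof -
  have c2: "cmat S - z \<cdot>\<^sub>m 1\<^sub>m n \<in> carrier_mat n n" using S by (simp add: minus_carrier_mat)
  have c: "resolvent S z \<in> carrier_mat n n" using S by simp
  define u where "u = resolvent S z *\<^sub>v unit_vec n i"
  have u: "u \<in> carrier_vec n" using c by (simp add: u_def)
  have e: "(cmat S - z \<cdot>\<^sub>m 1\<^sub>m n) *\<^sub>v u = unit_vec n i"
    unfolding u_def using assoc_mult_mat_vec[OF c2 c, of "unit_vec n i"] resolvent_inverse(1)[OF S z] by simp
  have "- Im z * (vnorm u)\<^sup>2 = Im (\<Sum>k<n. unit_vec n i $ k * cnj (u $ k))"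
    using im_quadratic_form_symmetric[OF S u, of z] unfolding e by simp
  also have "(\<Sum>k<n. unit_vec n i $ k * cnj (u $ k)) = (\<Sum>k<n. if k = i then cnj (u $ k) else 0)"
    by (intro sum.cong) (auto simp: unit_vec_def)
  also have "\<dots> = cnj (u $ i)" using i by simp
  also have "u $ i = resolvent S z $$ (i, i)" using c i unfolding u_def by simp
  finally have "Im (resolvent S z $$ (i, i)) = Im z * (vnorm u)\<^sup>2" by simp
  then show ?thesis using z by simp
qed

lemma resolvent_identity:
  assumes S: "S \<in> carrier_mat n n" "transpose_mat S = S" and T: "T \<in> carrier_mat n n" "transpose_mat T = T"
    and z: "Im z > 0"
  shows "resolvent S z = resolvent T z - resolvent T z * cmat (S - T) * resolvent S z"
proof -
  define X where "X = cmat S - z \<cdot>\<^sub>m 1\<^sub>m n"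
  define Y where "Y = cmat T - z \<cdot>\<^sub>m 1\<^sub>m n"
  define R where "R = resolvent S z"
  define Q where "Q = resolvent T z"
  have c: "X \<in> carrier_mat n n" "Y \<in> carrier_mat n n" "R \<in> carrier_mat n n" "Q \<in> carrier_mat n n"
    using S T by (auto simp: X_def Y_def R_def Q_def minus_carrier_mat)
  have d: "cmat (S - T) = X - Y" unfolding X_def Y_def using S T by (intro eq_matI) auto
  have "Q * (X - Y) * R = Q * X * R - Q * Y * R"
    using c by (simp add: mult_minus_distrib_mat minus_mult_distrib_mat[of _ n n _ _ n])
  also have "Q * X * R = Q * (X * R)" using c by simp
  also have "X * R = 1\<^sub>m n" using resolvent_inverse(1)[OF S z] by (simp add: X_def R_def)
  also have "Q * Y = 1\<^sub>m n" using resolvent_inverse(2)[OF T z] by (simp add: Y_def Q_def)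
  finally have "Q * (X - Y) * R = Q - R" using c by simp
  moreover have "Q - (Q - R) = R" using c by (intro eq_matI) auto
  ultimately show ?thesis unfolding d R_def[symmetric] Q_def[symmetric] by simp
qed


lemma ordered_eigensystemD:
  assumes "ordered_eigensystem n S l v"
  shows "S \<in> carrier_mat n n"
    and "i \<in> {1..n} \<Longrightarrow> v i \<in> carrier_vec n"
    and "i \<in> {1..n} \<Longrightarrow> S *\<^sub>v v i = l i \<cdot>\<^sub>v v i"
    and "i \<in> {1..n} \<Longrightarrow> j \<in> {1..n} \<Longrightarrow> (\<Sum>r<n. v i $ r * v j $ r) = (if i = j then 1 else 0)"
    and "i \<in> {1..n} \<Longrightarrow> j \<in> {1..n} \<Longrightarrow> i \<le> j \<Longrightarrow> l j \<le> l i"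
proof -
  show S: "S \<in> carrier_mat n n" using assms by (simp add: ordered_eigensystem_def)
  show v: "v i \<in> carrier_vec n" if "i \<in> {1..n}" for i
    using assms S that unfolding ordered_eigensystem_def eigenvector_def by auto
  show "i \<in> {1..n} \<Longrightarrow> S *\<^sub>v v i = l i \<cdot>\<^sub>v v i"
    using assms S unfolding ordered_eigensystem_def eigenvector_def by auto
  show "(\<Sum>r<n. v i $ r * v j $ r) = (if i = j then 1 else 0)" if "i \<in> {1..n}" "j \<in> {1..n}"
  proof -
    have "scalar_prod (v i) (v j) = (if i = j then 1 else 0)"
      using assms that unfolding ordered_eigensystem_def by blast
    then show ?thesis using v[OF that(2)] by (simp add: scalar_prod_def atLeast0LessThan)
  qed
  show "i \<in> {1..n} \<Longrightarrow> j \<in> {1..n} \<Longrightarrow> i \<le> j \<Longrightarrow> l j \<le> l i"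
    using assms unfolding ordered_eigensystem_def by blast
qed

lemma resolvent_spectral:
  assumes E: "ordered_eigensystem n S l v" and S: "transpose_mat S = S" and z: "Im z > 0"
  shows "resolvent S z = mat n n (\<lambda>(r, s). \<Sum>i = 1..n. of_real (v i $ r * v i $ s) / (of_real (l i) - z))"
proof -
  note D = ordered_eigensystemD[OF E]
  define Y where "Y = mat n n (\<lambda>(r, s). \<Sum>i = 1..n. complex_of_real (v i $ r * v i $ s) / (of_real (l i) - z))"
  have nz: "complex_of_real x \<noteq> z" for x using z by auto
  have Sv: "(\<Sum>k<n. S $$ (r, k) * v i $ k) = l i * v i $ r" if "r < n" "i \<in> {1..n}" for r i
  proof -
    have "(\<Sum>k<n. S $$ (r, k) * v i $ k) = (S *\<^sub>v v i) $ r"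
      using D(1) D(2)[OF that(2)] that by (auto simp: scalar_prod_def atLeast0LessThan intro!: sum.cong)
    then show ?thesis using D(2,3)[OF that(2)] that by simp
  qed
  show ?thesis unfolding Y_def[symmetric]
  proof (rule resolvent_unique[OF D(1) S z])
    show "Y \<in> carrier_mat n n" by (simp add: Y_def)
    show "(cmat S - z \<cdot>\<^sub>m 1\<^sub>m n) * Y = 1\<^sub>m n"
    proof (rule eq_matI)
      fix r s assume "r < dim_row (1\<^sub>m n :: complex mat)" "s < dim_col (1\<^sub>m n :: complex mat)"
      then have rs: "r < n" "s < n" by auto
      have "((cmat S - z \<cdot>\<^sub>m 1\<^sub>m n) * Y) $$ (r, s) =
          (\<Sum>k<n. (of_real (S $$ (r, k)) - z * (if r = k then 1 else 0)) * Y $$ (k, s))"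
        using rs D(1) by (auto simp: Y_def scalar_prod_def atLeast0LessThan intro!: sum.cong)
      also have "\<dots> = (\<Sum>k<n. of_real (S $$ (r, k)) * Y $$ (k, s)) - (\<Sum>k<n. if r = k then z * Y $$ (k, s) else 0)"
        unfolding sum_subtractf[symmetric] by (intro sum.cong) (auto simp: algebra_simps)
      also have "(\<Sum>k<n. if r = k then z * Y $$ (k, s) else 0) = z * Y $$ (r, s)" using rs by simp
      also have "(\<Sum>k<n. of_real (S $$ (r, k)) * Y $$ (k, s)) =
          (\<Sum>k<n. \<Sum>i=1..n. of_real (S $$ (r, k) * v i $ k) * (of_real (v i $ s) / (of_real (l i) - z)))"
        using rs by (intro sum.cong) (auto simp: Y_def sum_distrib_left mult.assoc)
      also have "\<dots> = (\<Sum>i=1..n. of_real (\<Sum>k<n. S $$ (r, k) * v i $ k) * (of_real (v i $ s) / (of_real (l i) - z)))"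
        by (subst sum.swap) (simp only: of_real_sum sum_distrib_right)
      also have "\<dots> = (\<Sum>i=1..n. of_real (l i * v i $ r) * (of_real (v i $ s) / (of_real (l i) - z)))"
        using rs by (intro sum.cong refl) (simp only: Sv)
      also have "\<dots> - z * Y $$ (r, s) = (\<Sum>i=1..n. of_real (v i $ r * v i $ s))"
      proof -
        have *: "of_real (l i * v i $ r) * (of_real (v i $ s) / (of_real (l i) - z)) -
            z * (of_real (v i $ r * v i $ s) / (of_real (l i) - z)) = of_real (v i $ r * v i $ s)" for i
        proof -
          have "of_real (l i * v i $ r) * (of_real (v i $ s) / (of_real (l i) - z)) -
            z * (of_real (v i $ r * v i $ s) / (of_real (l i) - z)) =
            (of_real (l i) - z) * of_real (v i $ r * v i $ s) / (of_real (l i) - z)"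
            by (simp add: algebra_simps diff_divide_distrib)
          then show ?thesis using nz[of "l i"] by simp
        qed
        have "z * Y $$ (r, s) = (\<Sum>i=1..n. z * (of_real (v i $ r * v i $ s) / (of_real (l i) - z)))"
          using rs by (simp add: Y_def sum_distrib_left)
        then show ?thesis by (simp only: sum_subtractf[symmetric] *)
      qed
      also have "\<dots> = of_real (\<Sum>i=1..n. v i $ r * v i $ s)" by (simp only: of_real_sum)
      also have "\<dots> = (1\<^sub>m n) $$ (r, s)"
        using orthonormal_completeness[OF E rs] rs by simp
      finally show "((cmat S - z \<cdot>\<^sub>m 1\<^sub>m n) * Y) $$ (r, s) = (1\<^sub>m n) $$ (r, s)" .
    qed (use D(1) in \<open>auto simp: Y_def\<close>)
  qed
qed

lemma quad_form_sum:
  assumes "B \<in> carrier_mat n n" "u \<in> carrier_vec n"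
  shows "quad_form B u = (\<Sum>r<n. \<Sum>s<n. u $ r * B $$ (r, s) * u $ s)"
  using assms unfolding quad_form_def
  by (auto simp: scalar_prod_def atLeast0LessThan sum_distrib_left mult.assoc intro!: sum.cong)

text \<open>
  Turns traces of resolvents into sums over eigenvalues, weighted by the quadratic forms of the eigenvectors.
\<close>

lemma mat_trace_mult_resolvent_spectral:
  assumes E: "ordered_eigensystem n S l v" and S: "transpose_mat S = S" and z: "Im z > 0"
    and B: "B \<in> carrier_mat n n"
  shows "mat_trace (cmat B * resolvent S z) = (\<Sum>i = 1..n. of_real (quad_form B (v i)) / (of_real (l i) - z))"
proof -
  note D = ordered_eigensystemD[OF E]
  have "mat_trace (cmat B * resolvent S z) = (\<Sum>r<n. \<Sum>s<n. of_real (B $$ (r, s)) * resolvent S z $$ (s, r))"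
    using B D(1) by (subst mat_trace_mult[of _ n]) auto
  also have "\<dots> = (\<Sum>r<n. \<Sum>s<n. \<Sum>i=1..n. of_real (v i $ r * B $$ (r, s) * v i $ s) / (of_real (l i) - z))"
    unfolding resolvent_spectral[OF E S z] by (intro sum.cong refl) (simp add: sum_distrib_left mult_ac)
  also have "\<dots> = (\<Sum>r<n. \<Sum>i=1..n. \<Sum>s<n. of_real (v i $ r * B $$ (r, s) * v i $ s) / (of_real (l i) - z))"
    by (intro sum.cong refl sum.swap)
  also have "\<dots> = (\<Sum>i=1..n. \<Sum>r<n. \<Sum>s<n. of_real (v i $ r * B $$ (r, s) * v i $ s) / (of_real (l i) - z))"
    by (rule sum.swap)
  also have "\<dots> = (\<Sum>i = 1..n. of_real (quad_form B (v i)) / (of_real (l i) - z))"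
    using D(2) by (intro sum.cong refl) (simp only: quad_form_sum[OF B] of_real_sum sum_divide_distrib)
  finally show ?thesis .
qed

lemma quad_form_spectral_sum:
  assumes E: "ordered_eigensystem n S l v" and i: "i \<in> {1..n}"
  shows "quad_form (spectral_sum n h l v) (v i) = h (l i)"
proof -
  note D = ordered_eigensystemD[OF E]
  have B: "spectral_sum n h l v \<in> carrier_mat n n" by (simp add: spectral_sum_def)
  have "quad_form (spectral_sum n h l v) (v i) =
     (\<Sum>r<n. \<Sum>s<n. \<Sum>j=1..n. h (l j) * (v j $ r * v i $ r) * (v j $ s * v i $ s))"
    by (subst quad_form_sum[OF B D(2)[OF i]], unfold spectral_sum_def)
      (intro sum.cong refl, simp add: sum_distrib_left sum_distrib_right mult_ac)
  also have "\<dots> = (\<Sum>r<n. \<Sum>j=1..n. \<Sum>s<n. h (l j) * (v j $ r * v i $ r) * (v j $ s * v i $ s))"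
    by (intro sum.cong refl sum.swap)
  also have "\<dots> = (\<Sum>j=1..n. \<Sum>r<n. \<Sum>s<n. h (l j) * (v j $ r * v i $ r) * (v j $ s * v i $ s))"
    by (rule sum.swap)
  also have "\<dots> = (\<Sum>j=1..n. h (l j) * (\<Sum>r<n. v j $ r * v i $ r) * (\<Sum>s<n. v j $ s * v i $ s))"
  proof (intro sum.cong refl)
    fix j
    have "(\<Sum>r<n. \<Sum>s<n. h (l j) * (v j $ r * v i $ r) * (v j $ s * v i $ s)) =
        (\<Sum>r<n. h (l j) * (v j $ r * v i $ r)) * (\<Sum>s<n. v j $ s * v i $ s)"
      by (simp only: sum_product)
    then show "(\<Sum>r<n. \<Sum>s<n. h (l j) * (v j $ r * v i $ r) * (v j $ s * v i $ s)) =
        h (l j) * (\<Sum>r<n. v j $ r * v i $ r) * (\<Sum>s<n. v j $ s * v i $ s)"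
      by (simp only: sum_distrib_left)
  qed
  also have "\<dots> = (\<Sum>j=1..n. if j = i then h (l j) else 0)"
    using i by (intro sum.cong refl) (simp only: D(4) split: if_splits, auto)
  finally show ?thesis using i by simp
qed

text \<open>
  Parseval's identity for the eigenbasis with complex coefficients.
\<close>

lemma orthonormal_isometry:
  assumes E: "ordered_eigensystem n S l v"
  shows "(\<Sum>r<n. (cmod (\<Sum>i=1..n. c i * of_real (v i $ r)))\<^sup>2) = (\<Sum>i=1..n. (cmod (c i))\<^sup>2)"
proof -
  note D = ordered_eigensystemD[OF E]
  have "complex_of_real (\<Sum>r<n. (cmod (\<Sum>i=1..n. c i * of_real (v i $ r)))\<^sup>2) =
     (\<Sum>r<n. \<Sum>i=1..n. \<Sum>j=1..n. c i * cnj (c j) * of_real (v i $ r * v j $ r))"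
    by (simp only: of_real_sum complex_norm_square)
      (intro sum.cong refl, simp add: sum_product mult_ac)
  also have "\<dots> = (\<Sum>i=1..n. \<Sum>r<n. \<Sum>j=1..n. c i * cnj (c j) * of_real (v i $ r * v j $ r))"
    by (rule sum.swap)
  also have "\<dots> = (\<Sum>i=1..n. \<Sum>j=1..n. \<Sum>r<n. c i * cnj (c j) * of_real (v i $ r * v j $ r))"
    by (intro sum.cong refl sum.swap)
  also have "\<dots> = (\<Sum>i=1..n. \<Sum>j=1..n. if j = i then c i * cnj (c j) else 0)"
    by (intro sum.cong refl) (simp only: sum_distrib_left[symmetric] of_real_sum[symmetric] D(4), auto)
  also have "\<dots> = (\<Sum>i=1..n. c i * cnj (c i))" by simp
  also have "\<dots> = complex_of_real (\<Sum>i=1..n. (cmod (c i))\<^sup>2)"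
    by (simp only: of_real_sum complex_norm_square)
  finally show ?thesis by (simp only: of_real_eq_iff)
qed

lemma spectral_sum_op_bound:
  assumes E: "ordered_eigensystem n S l v" and h: "\<And>i. i \<in> {1..n} \<Longrightarrow> \<bar>h (l i)\<bar> \<le> C" and C: "0 \<le> C"
  shows "op_bound n C (cmat (spectral_sum n h l v))"
  unfolding op_bound_def
proof (intro conjI ballI)
  note D = ordered_eigensystemD[OF E]
  show "cmat (spectral_sum n h l v) \<in> carrier_mat n n" by (simp add: spectral_sum_def)
  fix u :: "complex vec" assume u: "u \<in> carrier_vec n"
  define c where "c i = (\<Sum>s<n. of_real (v i $ s) * u $ s)" for i
  have Bu: "(cmat (spectral_sum n h l v) *\<^sub>v u) $ r = (\<Sum>i=1..n. (of_real (h (l i)) * c i) * of_real (v i $ r))"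
    if r: "r < n" for r
  proof -
    have "(cmat (spectral_sum n h l v) *\<^sub>v u) $ r = (\<Sum>s<n. \<Sum>i=1..n. of_real (h (l i) * v i $ r * v i $ s) * u $ s)"
      using r u by (auto simp: spectral_sum_def scalar_prod_def atLeast0LessThan sum_distrib_right intro!: sum.cong)
    also have "\<dots> = (\<Sum>i=1..n. \<Sum>s<n. of_real (h (l i) * v i $ r * v i $ s) * u $ s)" by (rule sum.swap)
    finally show ?thesis by (simp add: c_def sum_distrib_left sum_distrib_right mult_ac)
  qed
  have dB: "dim_row (spectral_sum n h l v) = n" by (simp add: spectral_sum_def)
  have ur: "u $ r = (\<Sum>i=1..n. c i * of_real (v i $ r))" if r: "r < n" for r
  proof -
    have "(\<Sum>i=1..n. c i * of_real (v i $ r)) = (\<Sum>i=1..n. \<Sum>s<n. of_real (v i $ r * v i $ s) * u $ s)"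
      by (simp add: c_def sum_distrib_left sum_distrib_right mult_ac)
    also have "\<dots> = (\<Sum>s<n. \<Sum>i=1..n. of_real (v i $ r * v i $ s) * u $ s)" by (rule sum.swap)
    also have "\<dots> = (\<Sum>s<n. if s = r then u $ s else 0)"
      using r by (intro sum.cong refl)
        (simp only: sum_distrib_right[symmetric] of_real_sum[symmetric] orthonormal_completeness[OF E] lessThan_iff, auto)
    finally show ?thesis using r by simp
  qed
  have "(vnorm (cmat (spectral_sum n h l v) *\<^sub>v u))\<^sup>2 = (\<Sum>i=1..n. (cmod (of_real (h (l i)) * c i))\<^sup>2)"
    unfolding orthonormal_isometry[OF E, symmetric] vnorm_sq
    by (intro sum.cong) (simp_all only: Bu lessThan_iff dim_mult_mat_vec index_map_mat(2) dB)
  also have "\<dots> \<le> (\<Sum>i=1..n. C\<^sup>2 * (cmod (c i))\<^sup>2)"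
  proof (intro sum_mono)
    fix i assume "i \<in> {1..n}"
    then have "\<bar>h (l i)\<bar>\<^sup>2 \<le> C\<^sup>2" using h by (intro power_mono) auto
    then show "(cmod (of_real (h (l i)) * c i))\<^sup>2 \<le> C\<^sup>2 * (cmod (c i))\<^sup>2"
      by (simp add: norm_mult power_mult_distrib mult_right_mono)
  qed
  also have "\<dots> = C\<^sup>2 * (\<Sum>r<n. (cmod (u $ r))\<^sup>2)"
    unfolding sum_distrib_left[symmetric] orthonormal_isometry[OF E, symmetric]
    by (intro arg_cong2[where f="(*)"] sum.cong refl) (simp only: lessThan_iff ur[symmetric])
  also have "\<dots> = (C * vnorm u)\<^sup>2" using u by (simp add: power_mult_distrib vnorm_sq)
  finally show "vnorm (cmat (spectral_sum n h l v) *\<^sub>v u) \<le> C * vnorm u"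
    by (rule power2_le_imp_le) (use C in simp)
qed

lemma quad_form_bound:
  assumes B: "op_bound n C (cmat B)" and w: "w \<in> carrier_vec n" "(\<Sum>r<n. w $ r * w $ r) = 1"
  shows "\<bar>quad_form B w\<bar> \<le> C"
proof -
  define u where "u = map_vec complex_of_real w"
  have u: "u \<in> carrier_vec n" using w by (simp add: u_def)
  have Bc: "B \<in> carrier_mat n n" using B by (simp add: op_bound_def)
  have nu: "vnorm u = 1" using w by (simp add: vnorm_def L2_set_def u_def power2_eq_square)
  have d: "dim_vec (cmat B *\<^sub>v u) = n" "dim_vec u = n" using Bc u by auto
  have "of_real (quad_form B w) = (\<Sum>r<n. u $ r * (cmat B *\<^sub>v u) $ r)"
    unfolding quad_form_sum[OF Bc w(1)] using Bc w(1)
    by (auto simp: u_def scalar_prod_def atLeast0LessThan sum_distrib_left mult.assoc intro!: sum.cong)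
  then have "\<bar>quad_form B w\<bar> = cmod (\<Sum>r<n. u $ r * (cmat B *\<^sub>v u) $ r)"
    by (metis norm_of_real real_norm_def)
  also have "\<dots> \<le> (\<Sum>r<n. \<bar>cmod (u $ r)\<bar> * \<bar>cmod ((cmat B *\<^sub>v u) $ r)\<bar>)"
    by (rule order_trans[OF norm_sum]) (simp add: norm_mult)
  also have "\<dots> \<le> vnorm u * vnorm (cmat B *\<^sub>v u)"
    unfolding vnorm_def d by (rule L2_set_mult_ineq)
  also have "\<dots> \<le> C" using B u nu by (simp add: op_bound_def) (metis mult.right_neutral)
  finally show ?thesis .
qed

lemma diag_of_carrier [simp]: "diag_of n x \<in> carrier_mat n n"
  by (simp add: diag_of_def)

lemma diag_of_transpose [simp]: "transpose_mat (diag_of n x) = diag_of n x"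
  by (intro eq_matI) (auto simp: diag_of_def mat_diag_def)

lemma mat_trace_diag_resolvent:
  assumes z: "Im z > 0"
  shows "mat_trace (cmat (diag_of n f) * resolvent (diag_of n x) z) = (\<Sum>i = 1..n. of_real (f i) / (of_real (x i) - z))"
proof -
  have nz: "complex_of_real y \<noteq> z" for y using z by auto
  define Y where "Y = mat_diag n (\<lambda>i. 1 / (complex_of_real (x (Suc i)) - z))"
  have e: "cmat (diag_of n x) - z \<cdot>\<^sub>m 1\<^sub>m n = mat_diag n (\<lambda>i. complex_of_real (x (Suc i)) - z)"
    by (intro eq_matI) (auto simp: diag_of_def mat_diag_def)
  have "resolvent (diag_of n x) z = Y"
  proof (rule resolvent_unique[OF _ _ z])
    show "(cmat (diag_of n x) - z \<cdot>\<^sub>m 1\<^sub>m n) * Y = 1\<^sub>m n"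
      unfolding e Y_def mat_diag_diag by (simp add: nz)
  qed (simp_all add: Y_def)
  moreover have "cmat (diag_of n f) = mat_diag n (\<lambda>i. complex_of_real (f (Suc i)))"
    by (intro eq_matI) (auto simp: diag_of_def mat_diag_def)
  ultimately have "mat_trace (cmat (diag_of n f) * resolvent (diag_of n x) z) =
      (\<Sum>i<n. of_real (f (Suc i)) / (of_real (x (Suc i)) - z))"
    by (simp only: Y_def mat_diag_diag) (simp add: mat_trace_def mat_diag_def)
  then show ?thesis by (simp add: sum.atLeast1_atMost_eq)
qed

lemma diag_of_op_bound:
  assumes "\<And>i. i \<in> {1..n} \<Longrightarrow> \<bar>f i\<bar> \<le> C" "0 \<le> C"
  shows "op_bound n C (cmat (diag_of n f))"
  unfolding op_bound_def
proof (intro conjI ballI)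
  show "cmat (diag_of n f) \<in> carrier_mat n n" by simp
  fix u :: "complex vec" assume u: "u \<in> carrier_vec n"
  have dD: "dim_row (diag_of n f) = n" by (rule carrier_matD(1)[OF diag_of_carrier])
  have e: "(cmat (diag_of n f) *\<^sub>v u) $ r = of_real (f (Suc r)) * u $ r" if "r < n" for r
  proof -
    have "(cmat (diag_of n f) *\<^sub>v u) $ r = (\<Sum>s<n. of_real (if r = s then f (Suc s) else 0) * u $ s)"
      using u that by (auto simp: diag_of_def mat_diag_def scalar_prod_def atLeast0LessThan intro!: sum.cong)
    also have "\<dots> = (\<Sum>s<n. if s = r then of_real (f (Suc r)) * u $ r else 0)"
      by (intro sum.cong) auto
    finally have "(cmat (diag_of n f) *\<^sub>v u) $ r = (\<Sum>s<n. if s = r then of_real (f (Suc r)) * u $ r else 0)" .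
    then show ?thesis using that by simp
  qed
  have "(vnorm (cmat (diag_of n f) *\<^sub>v u))\<^sup>2 = (\<Sum>r<n. (cmod (of_real (f (Suc r)) * u $ r))\<^sup>2)"
    unfolding vnorm_sq by (intro sum.cong) (simp_all only: e lessThan_iff dim_mult_mat_vec index_map_mat(2) dD)
  also have "\<dots> \<le> (\<Sum>r<n. C\<^sup>2 * (cmod (u $ r))\<^sup>2)"
  proof (intro sum_mono)
    fix r assume "r \<in> {..<n}"
    then have "\<bar>f (Suc r)\<bar>\<^sup>2 \<le> C\<^sup>2" using assms by (intro power_mono) auto
    then show "(cmod (of_real (f (Suc r)) * u $ r))\<^sup>2 \<le> C\<^sup>2 * (cmod (u $ r))\<^sup>2"
      by (simp add: norm_mult power_mult_distrib mult_right_mono)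
  qed
  also have "\<dots> = (C * vnorm u)\<^sup>2" using u by (simp add: power_mult_distrib vnorm_sq sum_distrib_left)
  finally show "vnorm (cmat (diag_of n f) *\<^sub>v u) \<le> C * vnorm u"
    by (rule power2_le_imp_le) (use assms in simp)
qed

section \<open>Measurability of resolvent traces\<close>

definition meas_mat :: "'x measure \<Rightarrow> nat \<Rightarrow> ('x \<Rightarrow> 'a::{topological_space} mat) \<Rightarrow> bool" where
  "meas_mat M n F \<longleftrightarrow> (\<forall>\<omega>\<in>space M. F \<omega> \<in> carrier_mat n n) \<and>
     (\<forall>i<n. \<forall>j<n. (\<lambda>\<omega>. F \<omega> $$ (i, j)) \<in> borel_measurable M)"

text \<open>
  Matrix identities hold only for matrices of the right dimensions, that is, only on the space of the measure;
  this form allows rewriting there.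
\<close>

lemma borel_measurable_eq_on_space:
  "(\<And>\<omega>. \<omega> \<in> space M \<Longrightarrow> f \<omega> = g \<omega>) \<Longrightarrow> g \<in> borel_measurable M \<Longrightarrow> f \<in> borel_measurable M"
  using measurable_cong[of M f g borel] by simp

lemma meas_mat_cmat:
  assumes F: "meas_mat M n F"
  shows "meas_mat M n (\<lambda>\<omega>. cmat (F \<omega>))"
proof -
  have "i < n \<Longrightarrow> j < n \<Longrightarrow> (\<lambda>\<omega>. F \<omega> $$ (i, j)) \<in> borel_measurable M" for i j
    using F by (simp add: meas_mat_def)
  then have "i < n \<Longrightarrow> j < n \<Longrightarrow> (\<lambda>\<omega>. complex_of_real (F \<omega> $$ (i, j))) \<in> borel_measurable M" for i j
    by simp
  have "(\<lambda>\<omega>. cmat (F \<omega>) $$ (i, j)) \<in> borel_measurable M" if "i < n" "j < n" for i j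
    by (rule borel_measurable_eq_on_space[where g="\<lambda>\<omega>. complex_of_real (F \<omega> $$ (i, j))"])
      (use F that \<open>i < n \<Longrightarrow> j < n \<Longrightarrow> (\<lambda>\<omega>. complex_of_real (F \<omega> $$ (i, j))) \<in> borel_measurable M\<close>
        in \<open>auto simp: meas_mat_def\<close>)
  then show ?thesis using F by (auto simp: meas_mat_def)
qed

lemma meas_mat_mult:
  fixes F G :: "'x \<Rightarrow> 'a::{real_normed_field,second_countable_topology} mat"
  assumes F: "meas_mat M n F" and G: "meas_mat M n G"
  shows "meas_mat M n (\<lambda>\<omega>. F \<omega> * G \<omega>)"
proof -
  have [measurable]: "i < n \<Longrightarrow> j < n \<Longrightarrow> (\<lambda>\<omega>. F \<omega> $$ (i, j)) \<in> borel_measurable M"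
     "i < n \<Longrightarrow> j < n \<Longrightarrow> (\<lambda>\<omega>. G \<omega> $$ (i, j)) \<in> borel_measurable M" for i j
    using assms by (auto simp: meas_mat_def)
  have "(\<lambda>\<omega>. (F \<omega> * G \<omega>) $$ (i, j)) \<in> borel_measurable M" if ij: "i < n" "j < n" for i j
  proof (rule borel_measurable_eq_on_space)
    fix \<omega> assume w: "\<omega> \<in> space M"
    then have "F \<omega> \<in> carrier_mat n n" "G \<omega> \<in> carrier_mat n n" using assms by (auto simp: meas_mat_def)
    then show "(F \<omega> * G \<omega>) $$ (i, j) = (\<Sum>k<n. F \<omega> $$ (i, k) * G \<omega> $$ (k, j))"
      using ij by (auto simp: scalar_prod_def atLeast0LessThan intro!: sum.cong)
  next
    show "(\<lambda>\<omega>. \<Sum>k<n. F \<omega> $$ (i, k) * G \<omega> $$ (k, j)) \<in> borel_measurable M"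
      using ij by (intro borel_measurable_sum borel_measurable_times) auto
  qed
  then show ?thesis using assms by (auto simp: meas_mat_def)
qed

lemma meas_mat_minus_smult_one:
  fixes F :: "'x \<Rightarrow> complex mat"
  assumes F: "meas_mat M n F" and [measurable]: "f \<in> borel_measurable M"
  shows "meas_mat M n (\<lambda>\<omega>. F \<omega> - f \<omega> \<cdot>\<^sub>m 1\<^sub>m n)"
proof -
  have [measurable]: "i < n \<Longrightarrow> j < n \<Longrightarrow> (\<lambda>\<omega>. F \<omega> $$ (i, j)) \<in> borel_measurable M" for i j
    using assms by (auto simp: meas_mat_def)
  have "(\<lambda>\<omega>. (F \<omega> - f \<omega> \<cdot>\<^sub>m 1\<^sub>m n) $$ (i, j)) \<in> borel_measurable M" if ij: "i < n" "j < n" for i j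
  proof (rule borel_measurable_eq_on_space)
    fix \<omega> assume w: "\<omega> \<in> space M"
    then have "F \<omega> \<in> carrier_mat n n" using assms by (auto simp: meas_mat_def)
    then show "(F \<omega> - f \<omega> \<cdot>\<^sub>m 1\<^sub>m n) $$ (i, j) = F \<omega> $$ (i, j) - f \<omega> * (if i = j then 1 else 0)"
      using ij by auto
  qed (use ij in measurable)
  then show ?thesis using assms by (auto simp: meas_mat_def minus_carrier_mat)
qed

lemma meas_mat_det:
  fixes F :: "'x \<Rightarrow> complex mat"
  assumes F: "meas_mat M n F"
  shows "(\<lambda>\<omega>. det (F \<omega>)) \<in> borel_measurable M"
proof (rule borel_measurable_eq_on_space)
  fix \<omega> assume w: "\<omega> \<in> space M"
  then have "F \<omega> \<in> carrier_mat n n" using F by (auto simp: meas_mat_def)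
  then show "det (F \<omega>) = (\<Sum>p\<in>{p. p permutes {0..<n}}. signof p * (\<Prod>i = 0..<n. F \<omega> $$ (i, p i)))"
    by (rule det_def')
next
  show "(\<lambda>\<omega>. \<Sum>p\<in>{p. p permutes {0..<n}}. signof p * (\<Prod>i = 0..<n. F \<omega> $$ (i, p i))) \<in> borel_measurable M"
  proof (intro borel_measurable_sum borel_measurable_times borel_measurable_const borel_measurable_prod)
    fix p i assume p: "p \<in> {p. p permutes {0..<n}}" and i: "i \<in> {0..<n}"
    then have "p i < n" using permutes_in_image[of p "{0..<n}" i] by auto
    then show "(\<lambda>\<omega>. F \<omega> $$ (i, p i)) \<in> borel_measurable M" using F i by (auto simp: meas_mat_def)
  qed
qed

lemma meas_mat_resolvent:
  assumes F: "meas_mat M n F" and f [measurable]: "f \<in> borel_measurable M"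
  shows "meas_mat M n (\<lambda>\<omega>. resolvent (F \<omega>) (f \<omega>))"
proof -
  define X where "X = (\<lambda>\<omega>. cmat (F \<omega>) - f \<omega> \<cdot>\<^sub>m 1\<^sub>m n)"
  have X: "meas_mat M n X" unfolding X_def by (intro meas_mat_minus_smult_one meas_mat_cmat F f)
  have [measurable]: "(\<lambda>\<omega>. det (X \<omega>)) \<in> borel_measurable M" by (rule meas_mat_det[OF X])
  have del: "meas_mat M (n - 1) (\<lambda>\<omega>. mat_delete (X \<omega>) j i)" if ij: "i < n" "j < n" for i j
  proof -
    have c: "mat_delete (X \<omega>) j i \<in> carrier_mat (n - 1) (n - 1)" if "\<omega> \<in> space M" for \<omega>
      using X that by (auto simp: meas_mat_def mat_delete_def)
    have "(\<lambda>\<omega>. mat_delete (X \<omega>) j i $$ (r, s)) \<in> borel_measurable M" if rs: "r < n - 1" "s < n - 1" for r s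
    proof (rule borel_measurable_eq_on_space)
      fix \<omega> assume w: "\<omega> \<in> space M"
      then have "X \<omega> \<in> carrier_mat n n" using X by (auto simp: meas_mat_def)
      then show "mat_delete (X \<omega>) j i $$ (r, s) = X \<omega> $$ (if r < j then r else Suc r, if s < i then s else Suc s)"
        using rs by (auto simp: mat_delete_def)
    next
      show "(\<lambda>\<omega>. X \<omega> $$ (if r < j then r else Suc r, if s < i then s else Suc s)) \<in> borel_measurable M"
        using X rs by (auto simp: meas_mat_def)
    qed
    then show ?thesis using c by (auto simp: meas_mat_def)
  qed
  have "(\<lambda>\<omega>. resolvent (F \<omega>) (f \<omega>) $$ (i, j)) \<in> borel_measurable M" if ij: "i < n" "j < n" for i j
  proof (rule borel_measurable_eq_on_space)
    fix \<omega> assume w: "\<omega> \<in> space M"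
    then have c: "F \<omega> \<in> carrier_mat n n" using F by (auto simp: meas_mat_def)
    then have "resolvent (F \<omega>) (f \<omega>) = (1 / det (X \<omega>)) \<cdot>\<^sub>m adj_mat (X \<omega>)"
      by (auto simp: resolvent_def X_def Let_def)
    moreover have "X \<omega> \<in> carrier_mat n n" using X w by (auto simp: meas_mat_def)
    ultimately show "resolvent (F \<omega>) (f \<omega>) $$ (i, j) = (1 / det (X \<omega>)) * ((-1) ^ (j + i) * det (mat_delete (X \<omega>) j i))"
      using ij by (auto simp: adj_mat_def cofactor_def)
  next
    have [measurable]: "(\<lambda>\<omega>. det (mat_delete (X \<omega>) j i)) \<in> borel_measurable M"
      by (rule meas_mat_det[OF del[OF ij]])
    show "(\<lambda>\<omega>. (1 / det (X \<omega>)) * ((-1) ^ (j + i) * det (mat_delete (X \<omega>) j i))) \<in> borel_measurable M"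
      by measurable
  qed
  then show ?thesis using F by (auto simp: meas_mat_def)
qed

lemma meas_mat_mat_trace:
  fixes F :: "'x \<Rightarrow> complex mat"
  assumes F: "meas_mat M n F"
  shows "(\<lambda>\<omega>. mat_trace (F \<omega>)) \<in> borel_measurable M"
proof (rule borel_measurable_eq_on_space)
  fix \<omega> assume w: "\<omega> \<in> space M"
  then show "mat_trace (F \<omega>) = (\<Sum>i<n. F \<omega> $$ (i, i))" using F by (auto simp: meas_mat_def mat_trace_def)
next
  show "(\<lambda>\<omega>. \<Sum>i<n. F \<omega> $$ (i, i)) \<in> borel_measurable M"
    using F by (intro borel_measurable_sum) (auto simp: meas_mat_def)
qed

section \<open>Moments of coordinatewise Lipschitz functions\<close>

text \<open>
  The term linear in \<open>d\<close> is kept exactly because it vanishes in expectation when \<open>d\<close>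
  is centred; the cubic term is absorbed by Young's inequality.
\<close>

lemma pow4_add_le:
  fixes s d :: real
  shows "(s + d) ^ 4 \<le> s ^ 4 + 4 * s ^ 3 * d + 8 * s\<^sup>2 * d\<^sup>2 + 3 * d ^ 4"
proof -
  have "4 * s * d ^ 3 \<le> 2 * s\<^sup>2 * d\<^sup>2 + 2 * d ^ 4"
  proof -
    have "0 \<le> 2 * d\<^sup>2 * (s - d)\<^sup>2" by simp
    then show ?thesis by (simp add: power2_eq_square power4_eq_xxxx power3_eq_cube algebra_simps)
  qed
  then show ?thesis by (simp add: power2_eq_square power4_eq_xxxx power3_eq_cube algebra_simps)
qed

text \<open>
  One step of the induction over coordinates: averaging \<open>g\<close> over one coordinate leaves
  \<open>expectation g\<close>, a function of the other coordinates, and the increment is centred given them.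
\<close>

lemma (in prob_space) centered_increment_moment4:
  fixes g :: "'a \<Rightarrow> real"
  assumes g[measurable]: "g \<in> borel_measurable M" and B: "\<And>x. x \<in> space M \<Longrightarrow> \<bar>g x\<bar> \<le> B"
    and d2: "expectation (\<lambda>x. (g x - expectation g)\<^sup>2) \<le> c" and d4: "expectation (\<lambda>x. (g x - expectation g) ^ 4) \<le> c\<^sup>2"
  shows "expectation (\<lambda>x. (g x - a) ^ 4) \<le> (expectation g - a) ^ 4 + 8 * c * (expectation g - a)\<^sup>2 + 3 * c\<^sup>2"
proof -
  define s where "s = expectation g - a"
  define d where "d x = g x - expectation g" for x
  have [measurable]: "d \<in> borel_measurable M" unfolding d_def by measurable
  have intg: "integrable M g" by (rule integrable_const_bound[where B=B]) (use B in auto)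
  have bd: "\<bar>d x\<bar> \<le> B + \<bar>expectation g\<bar>" if "x \<in> space M" for x
    using B[OF that] unfolding d_def by linarith
  have int: "integrable M (\<lambda>x. d x ^ k)" for k
    by (rule integrable_const_bound[where B="(B + \<bar>expectation g\<bar>) ^ k"])
      (use bd in \<open>auto simp: power_abs intro!: power_mono\<close>)
  have int1: "integrable M d" using int[of 1] by simp
  have z: "expectation d = 0" unfolding d_def using intg by (simp add: prob_space)
  have "expectation (\<lambda>x. (g x - a) ^ 4) = expectation (\<lambda>x. (s + d x) ^ 4)"
    by (simp add: s_def d_def)
  also have "\<dots> \<le> expectation (\<lambda>x. s ^ 4 + 4 * s ^ 3 * d x + 8 * s\<^sup>2 * (d x)\<^sup>2 + 3 * d x ^ 4)"
  proof (rule integral_mono)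
    show "integrable M (\<lambda>x. (s + d x) ^ 4)"
    proof (rule integrable_const_bound[where B="(\<bar>s\<bar> + (B + \<bar>expectation g\<bar>)) ^ 4"])
      show "AE x in M. norm ((s + d x) ^ 4) \<le> (\<bar>s\<bar> + (B + \<bar>expectation g\<bar>)) ^ 4"
      proof (rule AE_I2)
        fix x assume "x \<in> space M"
        then have "\<bar>s + d x\<bar> \<le> \<bar>s\<bar> + (B + \<bar>expectation g\<bar>)" using bd[of x] by linarith
        then show "norm ((s + d x) ^ 4) \<le> (\<bar>s\<bar> + (B + \<bar>expectation g\<bar>)) ^ 4"
          by (simp only: real_norm_def power_abs) (intro power_mono, auto)
      qed
    qed measurable
    show "integrable M (\<lambda>x. s ^ 4 + 4 * s ^ 3 * d x + 8 * s\<^sup>2 * (d x)\<^sup>2 + 3 * d x ^ 4)"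
      using int int1 by (intro Bochner_Integration.integrable_add integrable_mult_right) auto
    show "(s + d x) ^ 4 \<le> s ^ 4 + 4 * s ^ 3 * d x + 8 * s\<^sup>2 * (d x)\<^sup>2 + 3 * d x ^ 4" for x
      by (rule pow4_add_le)
  qed
  also have "\<dots> = s ^ 4 + 8 * s\<^sup>2 * expectation (\<lambda>x. (d x)\<^sup>2) + 3 * expectation (\<lambda>x. d x ^ 4)"
    using int int1 z by (simp add: prob_space)
  also have "\<dots> \<le> s ^ 4 + 8 * s\<^sup>2 * c + 3 * c\<^sup>2"
    using d2 d4 unfolding d_def by (intro add_mono mult_left_mono) auto
  finally show ?thesis unfolding s_def by (simp add: mult_ac)
qed

lemma (in prob_space) centered_increment_moment2:
  fixes g :: "'a \<Rightarrow> real"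
  assumes g[measurable]: "g \<in> borel_measurable M" and B: "\<And>x. x \<in> space M \<Longrightarrow> \<bar>g x\<bar> \<le> B"
    and d2: "expectation (\<lambda>x. (g x - expectation g)\<^sup>2) \<le> c"
  shows "expectation (\<lambda>x. (g x - a)\<^sup>2) \<le> (expectation g - a)\<^sup>2 + c"
proof -
  have intg: "integrable M g" by (rule integrable_const_bound[where B=B]) (use B in auto)
  have "integrable M (\<lambda>x. (g x)\<^sup>2)"
  proof (rule integrable_const_bound[where B="B\<^sup>2"])
    show "AE x in M. norm ((g x)\<^sup>2) \<le> B\<^sup>2"
      using B by (intro AE_I2) (simp add: abs_le_square_iff[symmetric] abs_le_iff, smt (verit))
  qed measurable
  then have e: "expectation (\<lambda>x. (g x - b)\<^sup>2) = expectation (\<lambda>x. (g x)\<^sup>2) - 2 * b * expectation g + b\<^sup>2" for b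
    using intg by (simp add: power2_diff prob_space)
  show ?thesis using d2 unfolding e by (simp add: power2_eq_square algebra_simps)
qed

text \<open>
  The increment is compared with \<open>g x - g 0\<close>, which is at most \<open>L \<bar>x\<bar>\<close>;
  centring costs the factor 4.
\<close>

lemma lipschitz_increment:
  fixes g :: "real \<Rightarrow> real" and M :: "real measure"
  assumes M: "prob_space M"
    and g[measurable]: "g \<in> borel_measurable M" and B: "\<And>x. \<bar>g x\<bar> \<le> B"
    and L: "\<And>x. \<bar>g x - g 0\<bar> \<le> L * \<bar>x\<bar>" and L0: "0 \<le> L"
    and i4: "integrable M (\<lambda>x. x ^ 4)" and m4: "(\<integral>x. x ^ 4 \<partial>M) \<le> q\<^sup>2"
    and i2: "integrable M (\<lambda>x. x\<^sup>2)" and m2: "(\<integral>x. x\<^sup>2 \<partial>M) \<le> q" and q: "0 \<le> q"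
  shows "(\<integral>x. (g x - integral\<^sup>L M g)\<^sup>2 \<partial>M) \<le> 4 * L\<^sup>2 * q"
    and "(\<integral>x. (g x - integral\<^sup>L M g) ^ 4 \<partial>M) \<le> (4 * L\<^sup>2 * q)\<^sup>2"
proof -
  interpret prob_space M by (rule M)
  define f where "f x = g x - g 0" for x
  have [measurable]: "f \<in> borel_measurable M" unfolding f_def by measurable
  have fB: "\<bar>f x\<bar> \<le> 2 * B" for x using B[of x] B[of 0] unfolding f_def by linarith
  have intp: "integrable M (\<lambda>x. f x ^ k)" for k
  proof (rule integrable_const_bound[where B="(2 * B) ^ k"])
    show "AE x in M. norm (f x ^ k) \<le> (2 * B) ^ k"
      unfolding real_norm_def power_abs by (intro AE_I2 power_mono fB) simp
  qed measurable
  have intg: "integrable M g" by (rule integrable_const_bound[where B=B]) (use B in auto)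
  define m where "m = expectation f"
  have gm: "g x - expectation g = f x - m" for x
    using intg unfolding m_def f_def by (simp add: prob_space)
  have f2: "expectation (\<lambda>x. (f x)\<^sup>2) \<le> L\<^sup>2 * q"
  proof -
    have "expectation (\<lambda>x. (f x)\<^sup>2) \<le> expectation (\<lambda>x. L\<^sup>2 * x\<^sup>2)"
    proof (rule integral_mono[OF intp])
      show "integrable M (\<lambda>x. L\<^sup>2 * x\<^sup>2)" using i2 by simp
      fix x show "(f x)\<^sup>2 \<le> L\<^sup>2 * x\<^sup>2"
        using power_mono[OF L[of x], of 2] by (simp add: f_def power_mult_distrib)
    qed
    also have "\<dots> \<le> L\<^sup>2 * q" using m2 by (simp add: mult_left_mono)
    finally show ?thesis .
  qed
  have f4: "expectation (\<lambda>x. f x ^ 4) \<le> L ^ 4 * q\<^sup>2"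
  proof -
    have "expectation (\<lambda>x. f x ^ 4) \<le> expectation (\<lambda>x. L ^ 4 * x ^ 4)"
    proof (rule integral_mono[OF intp])
      show "integrable M (\<lambda>x. L ^ 4 * x ^ 4)" using i4 by simp
      fix x show "f x ^ 4 \<le> L ^ 4 * x ^ 4"
        using power_mono[OF L[of x], of 4] by (simp add: f_def power_mult_distrib)
    qed
    also have "\<dots> \<le> L ^ 4 * q\<^sup>2" using m4 by (simp add: mult_left_mono)
    finally show ?thesis .
  qed
  have "expectation (\<lambda>x. (f x - m)\<^sup>2) = expectation (\<lambda>x. (f x)\<^sup>2) - 2 * m * expectation f + m\<^sup>2"
    using intp[of 2] intp[of 1] by (simp add: power2_diff prob_space)
  then have v: "expectation (\<lambda>x. (f x - m)\<^sup>2) = expectation (\<lambda>x. (f x)\<^sup>2) - m\<^sup>2"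
    by (simp add: m_def[symmetric] power2_eq_square)
  have "0 \<le> expectation (\<lambda>x. (f x - m)\<^sup>2)" by (intro Bochner_Integration.integral_nonneg) simp
  then have m2': "m\<^sup>2 \<le> L\<^sup>2 * q" using v f2 by linarith
  have "expectation (\<lambda>x. (f x - m)\<^sup>2) \<le> L\<^sup>2 * q" using v f2 by (smt (verit) zero_le_power2)
  also have "\<dots> \<le> 4 * L\<^sup>2 * q" using q by simp
  finally show "expectation (\<lambda>x. (g x - expectation g)\<^sup>2) \<le> 4 * L\<^sup>2 * q" by (simp add: gm)
  have "expectation (\<lambda>x. (f x - m) ^ 4) \<le> expectation (\<lambda>x. 8 * f x ^ 4 + 8 * m ^ 4)"
  proof (rule integral_mono)
    have "\<bar>f x - m\<bar> \<le> 2 * B + \<bar>m\<bar>" for x using fB[of x] by linarith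
    then have "norm ((f x - m) ^ 4) \<le> (2 * B + \<bar>m\<bar>) ^ 4" for x
      by (simp only: real_norm_def power_abs) (intro power_mono, auto)
    then show "integrable M (\<lambda>x. (f x - m) ^ 4)"
      by (intro integrable_const_bound[where B="(2 * B + \<bar>m\<bar>) ^ 4"]) auto
    show "integrable M (\<lambda>x. 8 * f x ^ 4 + 8 * m ^ 4)" using intp by simp
    show "(f x - m) ^ 4 \<le> 8 * f x ^ 4 + 8 * m ^ 4" for x
    proof -
      have 1: "(a - b)\<^sup>2 \<le> 2 * a\<^sup>2 + 2 * b\<^sup>2" for a b :: real
        using zero_le_power2[of "a + b"] by (simp add: power2_eq_square algebra_simps)
      have 2: "(a + b)\<^sup>2 \<le> 2 * a\<^sup>2 + 2 * b\<^sup>2" for a b :: real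
        using zero_le_power2[of "a - b"] by (simp add: power2_eq_square algebra_simps)
      have "(f x - m) ^ 4 = ((f x - m)\<^sup>2)\<^sup>2" by simp
      also have "\<dots> \<le> (2 * (f x)\<^sup>2 + 2 * m\<^sup>2)\<^sup>2" by (intro power_mono 1) simp
      also have "\<dots> \<le> 2 * (2 * (f x)\<^sup>2)\<^sup>2 + 2 * (2 * m\<^sup>2)\<^sup>2" by (rule 2)
      finally show ?thesis by (simp add: power_mult_distrib)
    qed
  qed
  also have "\<dots> = 8 * expectation (\<lambda>x. f x ^ 4) + 8 * (m\<^sup>2)\<^sup>2"
    using intp by (simp add: prob_space)
  also have "\<dots> \<le> 8 * (L ^ 4 * q\<^sup>2) + 8 * (L\<^sup>2 * q)\<^sup>2"
    using f4 m2' by (intro add_mono mult_left_mono power_mono) auto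
  also have "\<dots> = (4 * L\<^sup>2 * q)\<^sup>2" by (simp add: power_mult_distrib)
  finally show "expectation (\<lambda>x. (g x - expectation g) ^ 4) \<le> (4 * L\<^sup>2 * q)\<^sup>2" by (simp add: gm)
qed

text \<open>
  The coordinates may have different laws, subject to uniform moment bounds, because the entries on the
  diagonal of a Wigner matrix may differ in law from the others.
\<close>

locale real_product_prob =
  fixes \<nu> :: "'i \<Rightarrow> real measure" and q :: real
  assumes prob: "\<And>i. prob_space (\<nu> i)" and sets_eq: "\<And>i. sets (\<nu> i) = sets borel"
    and i4: "\<And>i. integrable (\<nu> i) (\<lambda>x. x ^ 4)" and m4: "\<And>i. integral\<^sup>L (\<nu> i) (\<lambda>x. x ^ 4) \<le> q\<^sup>2"
    and i2: "\<And>i. integrable (\<nu> i) (\<lambda>x. x\<^sup>2)" and m2: "\<And>i. integral\<^sup>L (\<nu> i) (\<lambda>x. x\<^sup>2) \<le> q" and q: "0 \<le> q"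
begin

sublocale product_sigma_finite \<nu>
  by (simp add: product_sigma_finite_def prob prob_space_imp_sigma_finite)

lemma space_nu [simp]: "space (\<nu> i) = UNIV"
  using sets_eq_imp_space_eq[OF sets_eq] by simp

lemma measure_nu [simp]: "measure (\<nu> i) UNIV = 1"
  using prob_space.prob_space[OF prob, of i] by simp

lemma prob_Pi: "prob_space (Pi\<^sub>M I \<nu>)"
  by (rule prob_space_PiM) (rule prob)

lemma fun_upd_in_space:
  "x \<in> space (Pi\<^sub>M I \<nu>) \<Longrightarrow> x(i := t) \<in> space (Pi\<^sub>M (insert i I) \<nu>)"
  by (auto simp: space_PiM PiE_def extensional_def Pi_def)

lemma integrable_bounded_Pi:
  fixes f :: "_ \<Rightarrow> real"
  assumes "f \<in> borel_measurable (Pi\<^sub>M I \<nu>)" "\<And>x. x \<in> space (Pi\<^sub>M I \<nu>) \<Longrightarrow> \<bar>f x\<bar> \<le> B"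
  shows "integrable (Pi\<^sub>M I \<nu>) f"
proof -
  interpret PP: prob_space "Pi\<^sub>M I \<nu>" by (rule prob_Pi)
  show ?thesis by (rule PP.integrable_const_bound[where B=B]) (use assms in auto)
qed

text \<open>
  An Efron-Stein type inequality with fourth moments. Integrating out the coordinates one by one writes
  \<open>f - m\<close> as a sum of \<open>card I\<close> martingale differences, each of conditional second
  moment at most \<open>c\<close> and fourth moment at most \<open>c\<^sup>2\<close>; hence the fourth moment
  grows quadratically, not like the fourth power, in the number of coordinates.
\<close>

lemma coordinate_lipschitz_moments:
  fixes f :: "('i \<Rightarrow> real) \<Rightarrow> real"
  assumes "finite I" and L0: "0 \<le> L"
    and "f \<in> borel_measurable (Pi\<^sub>M I \<nu>)"
    and "\<And>x. x \<in> space (Pi\<^sub>M I \<nu>) \<Longrightarrow> \<bar>f x\<bar> \<le> B"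
    and "\<And>x i t. x \<in> space (Pi\<^sub>M I \<nu>) \<Longrightarrow> i \<in> I \<Longrightarrow> \<bar>f (x(i := t)) - f x\<bar> \<le> L * \<bar>t - x i\<bar>"
  defines "c \<equiv> 4 * L\<^sup>2 * q" and "m \<equiv> integral\<^sup>L (Pi\<^sub>M I \<nu>) f"
  shows "(\<integral>x. (f x - m)\<^sup>2 \<partial>Pi\<^sub>M I \<nu>) \<le> real (card I) * c \<and>
     (\<integral>x. (f x - m) ^ 4 \<partial>Pi\<^sub>M I \<nu>) \<le> 8 * (real (card I) * c)\<^sup>2"
  using assms(1,3-5) unfolding m_def
proof (induction I arbitrary: f rule: finite_induct)
  case empty
  interpret PP: prob_space "Pi\<^sub>M {} \<nu>" by (rule prob_Pi)
  have "f x = f (\<lambda>_. undefined)" if "x \<in> space (Pi\<^sub>M {} \<nu>)" for x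
    using that by (simp add: space_PiM_empty)
  then have i: "(\<integral>x. F (f x) \<partial>Pi\<^sub>M {} \<nu>) = F (f (\<lambda>_. undefined))" for F :: "real \<Rightarrow> real"
  proof -
    have "(\<integral>x. F (f x) \<partial>Pi\<^sub>M {} \<nu>) = (\<integral>x. F (f (\<lambda>_. undefined)) \<partial>Pi\<^sub>M {} \<nu>)"
      by (intro Bochner_Integration.integral_cong refl) (metis \<open>\<And>x. x \<in> space (Pi\<^sub>M {} \<nu>) \<Longrightarrow> f x = f (\<lambda>_. undefined)\<close>)
    then show ?thesis by (simp add: PP.prob_space del: space_PiM_empty)
  qed
  define y where "y = f (\<lambda>_. undefined)"
  have m: "integral\<^sup>L (Pi\<^sub>M {} \<nu>) f = y" using i[of "\<lambda>t. t"] unfolding y_def .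
  have "(\<integral>x. (f x - y)\<^sup>2 \<partial>Pi\<^sub>M {} \<nu>) = (y - y)\<^sup>2" "(\<integral>x. (f x - y) ^ 4 \<partial>Pi\<^sub>M {} \<nu>) = (y - y) ^ 4"
    using i[of "\<lambda>t. (t - y)\<^sup>2"] i[of "\<lambda>t. (t - y) ^ 4"] unfolding y_def .
  then show ?case unfolding m by simp
next
  case (insert i I)
  note [measurable] = insert.prems(1)
  interpret PP: prob_space "Pi\<^sub>M I \<nu>" by (rule prob_Pi)
  interpret N: prob_space "\<nu> i" by (rule prob)
  \<comment> \<open>Averaging over the new coordinate preserves the bound and the Lipschitz constants in the others, so the induction hypothesis applies to the average.\<close>
  define \<phi> where "\<phi> x = (\<integral>t. f (x(i := t)) \<partial>\<nu> i)" for x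
  define m where "m = integral\<^sup>L (Pi\<^sub>M (insert i I) \<nu>) f"
  have upd [measurable]: "(\<lambda>(x, t). x(i := t)) \<in> measurable (Pi\<^sub>M I \<nu> \<Otimes>\<^sub>M \<nu> i) (Pi\<^sub>M (insert i I) \<nu>)"
    by (rule measurable_add_dim)
  have fm: "(\<lambda>(x, t). f (x(i := t))) \<in> borel_measurable (Pi\<^sub>M I \<nu> \<Otimes>\<^sub>M \<nu> i)"
    using measurable_compose[OF upd insert.prems(1)] by (simp add: case_prod_beta')
  have \<phi>m[measurable]: "\<phi> \<in> borel_measurable (Pi\<^sub>M I \<nu>)"
    unfolding \<phi>_def[abs_def] using fm
    by (rule sigma_finite_measure.borel_measurable_lebesgue_integral[OF prob_space_imp_sigma_finite[OF prob]])
  have sec: "(\<lambda>t. f (x(i := t))) \<in> borel_measurable (\<nu> i)" if "x \<in> space (Pi\<^sub>M I \<nu>)" for x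
    using measurable_compose[OF measurable_Pair1'[OF that] fm] by simp
  have bd: "\<bar>f (x(i := t))\<bar> \<le> B" if "x \<in> space (Pi\<^sub>M I \<nu>)" for x t
    using insert.prems(2)[OF fun_upd_in_space[OF that]] .
  have secint: "integrable (\<nu> i) (\<lambda>t. f (x(i := t)))" if "x \<in> space (Pi\<^sub>M I \<nu>)" for x
    by (rule N.integrable_const_bound[where B=B]) (use bd[OF that] sec[OF that] in auto)
  have \<phi>b: "\<bar>\<phi> x\<bar> \<le> B" if "x \<in> space (Pi\<^sub>M I \<nu>)" for x
  proof -
    have "\<bar>\<phi> x\<bar> \<le> (\<integral>t. \<bar>f (x(i := t))\<bar> \<partial>\<nu> i)" unfolding \<phi>_def by (rule integral_abs_bound)
    also have "\<dots> \<le> (\<integral>t. B \<partial>\<nu> i)" using secint[OF that] bd[OF that] by (intro integral_mono) auto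
    finally show ?thesis by (simp add: N.prob_space)
  qed
  have \<phi>L: "\<bar>\<phi> (x(j := t)) - \<phi> x\<bar> \<le> L * \<bar>t - x j\<bar>" if x: "x \<in> space (Pi\<^sub>M I \<nu>)" and j: "j \<in> I" for x j t
  proof -
    have x': "x(j := t) \<in> space (Pi\<^sub>M I \<nu>)"
      using fun_upd_in_space[OF x, of j t] j by (simp add: insert_absorb)
    have ji: "j \<noteq> i" using j insert.hyps by auto
    have "\<phi> (x(j := t)) - \<phi> x = (\<integral>s. f ((x(j := t))(i := s)) - f (x(i := s)) \<partial>\<nu> i)"
      unfolding \<phi>_def using secint[OF x] secint[OF x'] by simp
    also have "\<bar>\<dots>\<bar> \<le> (\<integral>s. \<bar>f ((x(j := t))(i := s)) - f (x(i := s))\<bar> \<partial>\<nu> i)" by (rule integral_abs_bound)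
    also have "\<dots> \<le> (\<integral>s. L * \<bar>t - x j\<bar> \<partial>\<nu> i)"
    proof (rule integral_mono)
      show "integrable (\<nu> i) (\<lambda>s. \<bar>f ((x(j := t))(i := s)) - f (x(i := s))\<bar>)"
        using secint[OF x] secint[OF x'] by simp
      fix s
      have "\<bar>f ((x(i := s))(j := t)) - f (x(i := s))\<bar> \<le> L * \<bar>t - (x(i := s)) j\<bar>"
        using j by (intro insert.prems(3) fun_upd_in_space x) simp
      then show "\<bar>f ((x(j := t))(i := s)) - f (x(i := s))\<bar> \<le> L * \<bar>t - x j\<bar>"
        using ji by (simp only: fun_upd_twist[OF ji] fun_upd_other[OF ji])
    qed simp
    finally show ?thesis by (simp add: N.prob_space)
  qed
  have ins: "(\<integral>x. F x \<partial>Pi\<^sub>M (insert i I) \<nu>) = (\<integral>x. (\<integral>t. F (x(i := t)) \<partial>\<nu> i) \<partial>Pi\<^sub>M I \<nu>)"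
    if "integrable (Pi\<^sub>M (insert i I) \<nu>) F" for F :: "_ \<Rightarrow> real"
    by (rule product_integral_insert) (use insert.hyps that in auto)
  have m: "m = integral\<^sup>L (Pi\<^sub>M I \<nu>) \<phi>"
    unfolding m_def \<phi>_def by (rule ins) (rule integrable_bounded_Pi[OF insert.prems(1,2)])
  have mb: "\<bar>m\<bar> \<le> B"
  proof -
    have "\<bar>m\<bar> \<le> (\<integral>x. \<bar>\<phi> x\<bar> \<partial>Pi\<^sub>M I \<nu>)" unfolding m by (rule integral_abs_bound)
    also have "\<dots> \<le> (\<integral>x. B \<partial>Pi\<^sub>M I \<nu>)"
      using integrable_bounded_Pi[OF \<phi>m \<phi>b] \<phi>b by (intro integral_mono) auto
    finally show ?thesis by (simp add: PP.prob_space)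
  qed
  have intk: "integrable (Pi\<^sub>M J \<nu>) (\<lambda>x. (F x - m) ^ k)"
    if [measurable]: "F \<in> borel_measurable (Pi\<^sub>M J \<nu>)" and b: "\<And>x. x \<in> space (Pi\<^sub>M J \<nu>) \<Longrightarrow> \<bar>F x\<bar> \<le> B" for F k J
  proof (rule integrable_bounded_Pi[where B="(2 * B) ^ k"])
    fix x assume "x \<in> space (Pi\<^sub>M J \<nu>)"
    then have "\<bar>F x - m\<bar> \<le> 2 * B" using b[of x] mb by linarith
    then show "\<bar>(F x - m) ^ k\<bar> \<le> (2 * B) ^ k" by (simp only: power_abs) (intro power_mono, auto)
  qed measurable
  have step: "(\<integral>t. (f (x(i := t)) - m)\<^sup>2 \<partial>\<nu> i) \<le> (\<phi> x - m)\<^sup>2 + c"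
    "(\<integral>t. (f (x(i := t)) - m) ^ 4 \<partial>\<nu> i) \<le> (\<phi> x - m) ^ 4 + 8 * c * (\<phi> x - m)\<^sup>2 + 3 * c\<^sup>2"
    if x: "x \<in> space (Pi\<^sub>M I \<nu>)" for x
  proof -
    have Lg: "\<bar>f (x(i := t)) - f (x(i := 0))\<bar> \<le> L * \<bar>t\<bar>" for t
      using insert.prems(3)[OF fun_upd_in_space[OF x, of i 0] insertI1, of t]
      by (simp only: fun_upd_upd fun_upd_same diff_zero)
    note li = lipschitz_increment[OF prob sec[OF x] bd[OF x] Lg L0 i4 m4 i2 m2 q, folded c_def \<phi>_def]
    show "(\<integral>t. (f (x(i := t)) - m)\<^sup>2 \<partial>\<nu> i) \<le> (\<phi> x - m)\<^sup>2 + c"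
      using N.centered_increment_moment2[OF sec[OF x] bd[OF x]] li unfolding \<phi>_def by blast
    show "(\<integral>t. (f (x(i := t)) - m) ^ 4 \<partial>\<nu> i) \<le> (\<phi> x - m) ^ 4 + 8 * c * (\<phi> x - m)\<^sup>2 + 3 * c\<^sup>2"
      using N.centered_increment_moment4[OF sec[OF x] bd[OF x]] li unfolding \<phi>_def by blast
  qed
  have IH: "(\<integral>x. (\<phi> x - m)\<^sup>2 \<partial>Pi\<^sub>M I \<nu>) \<le> real (card I) * c"
     "(\<integral>x. (\<phi> x - m) ^ 4 \<partial>Pi\<^sub>M I \<nu>) \<le> 8 * (real (card I) * c)\<^sup>2"
    using insert.IH[OF \<phi>m \<phi>b \<phi>L] unfolding m by auto
  have i1: "integrable (Pi\<^sub>M I \<nu>) (\<lambda>x. (\<phi> x - m) ^ k)" for k by (rule intk[OF \<phi>m \<phi>b])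
  have outer: "integrable (Pi\<^sub>M I \<nu>) (\<lambda>x. \<integral>t. (f (x(i := t)) - m) ^ k \<partial>\<nu> i)" for k
  proof (rule integrable_bounded_Pi[where B="(2 * B) ^ k"])
    have "(\<lambda>(x, t). (f (x(i := t)) - m) ^ k) \<in> borel_measurable (Pi\<^sub>M I \<nu> \<Otimes>\<^sub>M \<nu> i)"
      using fm by (simp add: case_prod_beta')
    then show "(\<lambda>x. \<integral>t. (f (x(i := t)) - m) ^ k \<partial>\<nu> i) \<in> borel_measurable (Pi\<^sub>M I \<nu>)"
      by (rule sigma_finite_measure.borel_measurable_lebesgue_integral[OF prob_space_imp_sigma_finite[OF prob]])
    fix x assume x: "x \<in> space (Pi\<^sub>M I \<nu>)"
    have b: "\<bar>(f (x(i := t)) - m) ^ k\<bar> \<le> (2 * B) ^ k" for t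
    proof -
      have "\<bar>f (x(i := t)) - m\<bar> \<le> 2 * B" using bd[OF x, of t] mb by linarith
      then show ?thesis by (simp only: power_abs) (intro power_mono, auto)
    qed
    have "\<bar>\<integral>t. (f (x(i := t)) - m) ^ k \<partial>\<nu> i\<bar> \<le> (\<integral>t. \<bar>(f (x(i := t)) - m) ^ k\<bar> \<partial>\<nu> i)"
      by (rule integral_abs_bound)
    also have "\<dots> \<le> (\<integral>t. (2 * B) ^ k \<partial>\<nu> i)"
    proof (rule integral_mono)
      show "integrable (\<nu> i) (\<lambda>t. \<bar>(f (x(i := t)) - m) ^ k\<bar>)"
        by (rule N.integrable_const_bound[where B="(2 * B) ^ k"]) (use b sec[OF x] in auto)
    qed (use b in auto)
    finally show "\<bar>\<integral>t. (f (x(i := t)) - m) ^ k \<partial>\<nu> i\<bar> \<le> (2 * B) ^ k" by (simp add: N.prob_space)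
  qed
  have "(\<integral>x. (f x - m)\<^sup>2 \<partial>Pi\<^sub>M (insert i I) \<nu>) = (\<integral>x. (\<integral>t. (f (x(i := t)) - m)\<^sup>2 \<partial>\<nu> i) \<partial>Pi\<^sub>M I \<nu>)"
    by (rule ins) (rule intk[OF insert.prems(1,2)])
  also have "\<dots> \<le> (\<integral>x. (\<phi> x - m)\<^sup>2 + c \<partial>Pi\<^sub>M I \<nu>)"
    using outer i1 step by (intro integral_mono) auto
  also have "\<dots> = (\<integral>x. (\<phi> x - m)\<^sup>2 \<partial>Pi\<^sub>M I \<nu>) + c" using i1 by (simp add: PP.prob_space)
  also have "\<dots> \<le> real (card (insert i I)) * c"
    using IH(1) insert.hyps by (simp add: algebra_simps)
  finally have A: "(\<integral>x. (f x - m)\<^sup>2 \<partial>Pi\<^sub>M (insert i I) \<nu>) \<le> real (card (insert i I)) * c" .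
  have c0: "0 \<le> c" using q by (simp add: c_def)
  have "(\<integral>x. (f x - m) ^ 4 \<partial>Pi\<^sub>M (insert i I) \<nu>) = (\<integral>x. (\<integral>t. (f (x(i := t)) - m) ^ 4 \<partial>\<nu> i) \<partial>Pi\<^sub>M I \<nu>)"
    by (rule ins) (rule intk[OF insert.prems(1,2)])
  also have "\<dots> \<le> (\<integral>x. (\<phi> x - m) ^ 4 + 8 * c * (\<phi> x - m)\<^sup>2 + 3 * c\<^sup>2 \<partial>Pi\<^sub>M I \<nu>)"
    using outer i1 step by (intro integral_mono) auto
  also have "\<dots> = (\<integral>x. (\<phi> x - m) ^ 4 \<partial>Pi\<^sub>M I \<nu>) + 8 * c * (\<integral>x. (\<phi> x - m)\<^sup>2 \<partial>Pi\<^sub>M I \<nu>) + 3 * c\<^sup>2"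
    using i1 by (simp add: PP.prob_space)
  also have "\<dots> \<le> 8 * (real (card I) * c)\<^sup>2 + 8 * c * (real (card I) * c) + 3 * c\<^sup>2"
    using IH c0 by (intro add_mono mult_left_mono) auto
  also have "\<dots> \<le> 8 * (real (card (insert i I)) * c)\<^sup>2"
    using insert.hyps c0 by (simp add: power2_eq_square algebra_simps)
  finally show ?case using A unfolding m_def by blast
qed

end

section \<open>Symmetric matrices as functions of their entries on and above the diagonal\<close>

definition upper :: "nat \<Rightarrow> (nat \<times> nat) set" where
  "upper n = {(i, j). i \<le> j \<and> j < n}"

definition symmat :: "nat \<Rightarrow> (nat \<times> nat \<Rightarrow> real) \<Rightarrow> real mat" where
  "symmat n \<xi> = mat n n (\<lambda>(i, j). \<xi> (min i j, max i j))"

text \<open>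
  The derivative of \<open>symmat\<close> in the coordinate \<open>p\<close>.
\<close>

definition unit_sym :: "nat \<Rightarrow> nat \<times> nat \<Rightarrow> real mat" where
  "unit_sym n p = mat n n (\<lambda>(r, s). if (r, s) = p \<or> (s, r) = p then 1 else 0)"

lemma upper_subset: "upper n \<subseteq> {..<n} \<times> {..<n}"
  by (auto simp: upper_def)

lemma finite_upper [simp]: "finite (upper n)"
  by (rule finite_subset[OF upper_subset]) simp

lemma card_upper_le: "card (upper n) \<le> n\<^sup>2"
  using card_mono[OF _ upper_subset[of n]] by (simp add: power2_eq_square)

lemma symmat_carrier [simp]: "symmat n \<xi> \<in> carrier_mat n n"
  by (simp add: symmat_def)

lemma unit_sym_carrier [simp]: "unit_sym n p \<in> carrier_mat n n"
  by (simp add: unit_sym_def)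

lemma symmat_transpose [simp]: "transpose_mat (symmat n \<xi>) = symmat n \<xi>"
  by (intro eq_matI) (auto simp: symmat_def min.commute max.commute)

lemma symmat_upd:
  assumes p: "p \<in> upper n"
  shows "symmat n (\<xi>(p := t)) = symmat n \<xi> + (t - \<xi> p) \<cdot>\<^sub>m unit_sym n p"
proof (rule eq_matI)
  fix r s assume "r < dim_row (symmat n \<xi> + (t - \<xi> p) \<cdot>\<^sub>m unit_sym n p)" "s < dim_col (symmat n \<xi> + (t - \<xi> p) \<cdot>\<^sub>m unit_sym n p)"
  then have rs: "r < n" "s < n" by (auto simp: unit_sym_def)
  have "(min r s, max r s) = p \<longleftrightarrow> (r, s) = p \<or> (s, r) = p"
    using p by (cases p) (auto simp: upper_def min_def max_def)
  then show "symmat n (\<xi>(p := t)) $$ (r, s) = (symmat n \<xi> + (t - \<xi> p) \<cdot>\<^sub>m unit_sym n p) $$ (r, s)"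
    using rs by (auto simp: symmat_def unit_sym_def)
qed (auto simp: symmat_def unit_sym_def)

lemma unit_sym_mult_entry:
  assumes p: "(i, j) \<in> upper n" and X: "X \<in> carrier_mat n n" and rs: "r < n" "s < n"
  shows "(cmat (unit_sym n (i, j)) * X) $$ (r, s) = (if r = i then X $$ (j, s) else if r = j then X $$ (i, s) else 0)"
proof -
  have ij: "i < n" "j < n" "i \<le> j" using p by (auto simp: upper_def)
  have "(cmat (unit_sym n (i, j)) * X) $$ (r, s) = (\<Sum>k<n. cmat (unit_sym n (i, j)) $$ (r, k) * X $$ (k, s))"
    using X rs by (auto simp: scalar_prod_def atLeast0LessThan unit_sym_def intro!: sum.cong)
  also have "\<dots> = (\<Sum>k<n. if k = (if r = i then j else i) then (if r = i \<or> r = j then X $$ (k, s) else 0) else 0)"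
    using rs ij by (intro sum.cong) (auto simp: unit_sym_def)
  also have "\<dots> = (if r = i then X $$ (j, s) else if r = j then X $$ (i, s) else 0)"
    using ij by auto
  finally show ?thesis .
qed

lemma mat_trace_unit_sym:
  assumes p: "(i, j) \<in> upper n" and X: "X \<in> carrier_mat n n"
  shows "mat_trace (cmat (unit_sym n (i, j)) * X) = (if i = j then X $$ (i, i) else X $$ (j, i) + X $$ (i, j))"
proof -
  have ij: "i < n" "j < n" "i \<le> j" using p by (auto simp: upper_def)
  have "mat_trace (cmat (unit_sym n (i, j)) * X) = (\<Sum>r<n. if r = i then X $$ (j, i) else if r = j then X $$ (i, j) else 0)"
    unfolding mat_trace_def using X by (intro sum.cong) (auto simp: unit_sym_mult_entry[OF p X] simp del: index_mult_mat(1), simp_all add: unit_sym_def)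
  also have "\<dots> = (\<Sum>r<n. (if r = i then X $$ (j, i) else 0) + (if r = j then (if i = j then 0 else X $$ (i, j)) else 0))"
    by (intro sum.cong) auto
  also have "\<dots> = (if i = j then X $$ (i, i) else X $$ (j, i) + X $$ (i, j))"
    using ij by (simp add: sum.distrib)
  finally show ?thesis .
qed

text \<open>
  The matrix unit has at most two nonzero entries, so the trace does not grow with \<open>n\<close>. This is
  what makes resolvent traces insensitive to a single entry.
\<close>

lemma mat_trace_unit_sym_le:
  assumes p: "p \<in> upper n" and X: "op_bound n C X" "0 \<le> C"
  shows "cmod (mat_trace (cmat (unit_sym n p) * X)) \<le> 2 * C"
proof -
  obtain i j where ij: "p = (i, j)" by force
  have b: "i < n" "j < n" using p ij by (auto simp: upper_def)
  have "cmod (X $$ (i, i)) \<le> C" "cmod (X $$ (j, i)) \<le> C" "cmod (X $$ (i, j)) \<le> C" using X b by (auto intro!: op_bound_entry)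
  then show ?thesis using p X unfolding ij
    by (auto simp: mat_trace_unit_sym op_bound_carrier intro: order_trans[OF norm_triangle_ineq])
qed

text \<open>
  Apart from zeroing coordinates, the matrix unit acts by transposing two of them.
\<close>

lemma unit_sym_op_bound:
  assumes p: "p \<in> upper n"
  shows "op_bound n 1 (cmat (unit_sym n p))"
  unfolding op_bound_def
proof (intro conjI ballI)
  show "cmat (unit_sym n p) \<in> carrier_mat n n" by simp
  fix u :: "complex vec" assume u: "u \<in> carrier_vec n"
  obtain i j where ij: "p = (i, j)" by force
  have b: "i < n" "j < n" using p ij by (auto simp: upper_def)
  define \<pi> where "\<pi> r = (if r = i then j else if r = j then i else r)" for r
  have bij: "bij_betw \<pi> {..<n} {..<n}"
    by (rule bij_betwI[where g=\<pi>]) (use b in \<open>auto simp: \<pi>_def\<close>)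
  have e: "(cmat (unit_sym n p) *\<^sub>v u) $ r = (if r = i then u $ j else if r = j then u $ i else 0)" if r: "r < n" for r
  proof -
    have "(cmat (unit_sym n p) *\<^sub>v u) $ r = (\<Sum>k<n. cmat (unit_sym n p) $$ (r, k) * u $ k)"
      using u r by (auto simp: scalar_prod_def atLeast0LessThan unit_sym_def intro!: sum.cong)
    also have "\<dots> = (\<Sum>k<n. if k = (if r = i then j else i) then (if r = i \<or> r = j then u $ k else 0) else 0)"
      using r b by (intro sum.cong) (auto simp: unit_sym_def ij)
    also have "\<dots> = (if r = i then u $ j else if r = j then u $ i else 0)" using b by auto
    finally show ?thesis .
  qed
  have d: "dim_vec (cmat (unit_sym n p) *\<^sub>v u) = n" "dim_vec u = n" using u by (auto simp: unit_sym_def)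
  have "(vnorm (cmat (unit_sym n p) *\<^sub>v u))\<^sup>2 \<le> (\<Sum>r<n. (cmod (u $ \<pi> r))\<^sup>2)"
    unfolding vnorm_sq d by (intro sum_mono) (simp only: e lessThan_iff, auto simp: \<pi>_def)
  also have "\<dots> = (\<Sum>r<n. (cmod (u $ r))\<^sup>2)" by (rule sum.reindex_bij_betw[OF bij])
  finally have "(vnorm (cmat (unit_sym n p) *\<^sub>v u))\<^sup>2 \<le> (vnorm u)\<^sup>2" unfolding vnorm_sq d .
  then show "vnorm (cmat (unit_sym n p) *\<^sub>v u) \<le> 1 * vnorm u" by (simp only: mult_1) (rule power2_le_imp_le[OF _ vnorm_nonneg])
qed

lemma sum_upper:
  fixes f :: "nat \<Rightarrow> nat \<Rightarrow> 'a::comm_ring_1"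
  shows "(\<Sum>(i, j)\<in>upper n. if i = j then f i i else f i j + f j i) = (\<Sum>i<n. \<Sum>j<n. f i j)"
proof -
  define L where "L = {(i, j). i < j \<and> j < n}"
  define D where "D = {(i, j). i = j \<and> j < n}"
  have U: "upper n = L \<union> D" by (auto simp: upper_def L_def D_def)
  then have fin: "finite L" "finite D" using finite_upper[of n] by auto
  have LD: "L \<inter> D = {}" by (auto simp: L_def D_def)
  have sw: "prod.swap ` L = {(i, j). j < i \<and> i < n}" by (force simp: L_def image_def)
  have sq: "{..<n} \<times> {..<n} = (L \<union> D) \<union> prod.swap ` L" unfolding sw by (auto simp: L_def D_def)
  have "(\<Sum>(i, j)\<in>upper n. if i = j then f i i else f i j + f j i) = (\<Sum>(i, j)\<in>L. f i j + f j i) + (\<Sum>(i, j)\<in>D. f i j)"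
    unfolding U sum.union_disjoint[OF fin LD]
    by (intro arg_cong2[where f="(+)"] sum.cong) (auto simp: L_def D_def)
  also have "(\<Sum>(i, j)\<in>L. f i j + f j i) = (\<Sum>(i, j)\<in>L. f i j) + (\<Sum>(i, j)\<in>L. f j i)"
    by (simp add: sum.distrib case_prod_beta)
  also have "(\<Sum>(i, j)\<in>L. f j i) = (\<Sum>(i, j)\<in>prod.swap ` L. f i j)"
    by (subst sum.reindex) (auto simp: case_prod_beta)
  also have "(\<Sum>(i, j)\<in>L. f i j) + (\<Sum>(i, j)\<in>prod.swap ` L. f i j) + (\<Sum>(i, j)\<in>D. f i j) = (\<Sum>(i, j)\<in>{..<n} \<times> {..<n}. f i j)"
  proof -
    have "(L \<union> D) \<inter> prod.swap ` L = {}" unfolding sw by (auto simp: L_def D_def)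
    then show ?thesis unfolding sq
      using sum.union_disjoint[of "L \<union> D" "prod.swap ` L" "\<lambda>(i, j). f i j"] sum.union_disjoint[OF fin LD, of "\<lambda>(i, j). f i j"] fin
      by (simp add: add_ac)
  qed
  also have "\<dots> = (\<Sum>i<n. \<Sum>j<n. f i j)" by (rule sum.cartesian_product[symmetric])
  finally show ?thesis .
qed

lemma mat_trace_symmat:
  assumes X: "X \<in> carrier_mat n n"
  shows "mat_trace (cmat (symmat n \<xi>) * X) = (\<Sum>p\<in>upper n. of_real (\<xi> p) * mat_trace (cmat (unit_sym n p) * X))"
proof -
  have "mat_trace (cmat (symmat n \<xi>) * X) = (\<Sum>i<n. \<Sum>j<n. of_real (\<xi> (min i j, max i j)) * X $$ (j, i))"
    using X by (subst mat_trace_mult[of _ n]) (auto simp: symmat_def)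
  also have "\<dots> = (\<Sum>(i, j)\<in>upper n. if i = j then of_real (\<xi> (min i i, max i i)) * X $$ (i, i)
      else of_real (\<xi> (min i j, max i j)) * X $$ (j, i) + of_real (\<xi> (min j i, max j i)) * X $$ (i, j))"
    by (rule sum_upper[symmetric])
  also have "\<dots> = (\<Sum>p\<in>upper n. of_real (\<xi> p) * mat_trace (cmat (unit_sym n p) * X))"
  proof (rule sum.cong[OF refl], safe)
    fix i j assume p: "(i, j) \<in> upper n"
    then have "i \<le> j" by (auto simp: upper_def)
    then show "(if i = j then of_real (\<xi> (min i i, max i i)) * X $$ (i, i)
      else of_real (\<xi> (min i j, max i j)) * X $$ (j, i) + of_real (\<xi> (min j i, max j i)) * X $$ (i, j)) =
      of_real (\<xi> (i, j)) * mat_trace (cmat (unit_sym n (i, j)) * X)"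
      using mat_trace_unit_sym[OF p X] by (auto simp: min_def max_def distrib_left)
  qed
  finally show ?thesis .
qed

text \<open>
  The contraction over all entries that produces the quadratic term of the subordination equation: the leading
  term is the product of the traces, of order \<open>n\<^sup>2\<close>, and the remaining terms are of order
  \<open>n\<close>.
\<close>

lemma sum_unit_sym_contraction:
  assumes R: "R \<in> carrier_mat n n" and Y: "Y \<in> carrier_mat n n" and sym: "transpose_mat R = R"
  shows "(\<Sum>p\<in>upper n. mat_trace (cmat (unit_sym n p) * (R * (cmat (unit_sym n p) * Y)))) =
     mat_trace R * mat_trace Y + mat_trace (R * Y) - (\<Sum>i<n. R $$ (i, i) * Y $$ (i, i))"
proof -
  have Rs: "R $$ (i, j) = R $$ (j, i)" if "i < n" "j < n" for i j
    using R sym that by (metis carrier_matD index_transpose_mat(1))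
  define f where "f i j = R $$ (i, j) * Y $$ (j, i) + R $$ (i, i) * Y $$ (j, j) - (if i = j then R $$ (i, i) * Y $$ (i, i) else 0)" for i j
  have t: "mat_trace (cmat (unit_sym n (i, j)) * (R * (cmat (unit_sym n (i, j)) * Y))) = (if i = j then f i i else f i j + f j i)"
    if p: "(i, j) \<in> upper n" for i j
  proof -
    have ij: "i < n" "j < n" "i \<le> j" using p by (auto simp: upper_def)
    define W where "W = R * (cmat (unit_sym n (i, j)) * Y)"
    have W: "W \<in> carrier_mat n n" using R Y unfolding W_def by (meson mult_carrier_mat map_carrier_mat unit_sym_carrier)
    have We: "W $$ (a, b) = (if i = j then R $$ (a, i) * Y $$ (i, b) else R $$ (a, i) * Y $$ (j, b) + R $$ (a, j) * Y $$ (i, b))"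
      if ab: "a < n" "b < n" for a b
    proof -
      have EY: "cmat (unit_sym n (i, j)) * Y \<in> carrier_mat n n" using Y by (meson mult_carrier_mat map_carrier_mat unit_sym_carrier)
      have "(R * V) $$ (a, b) = (\<Sum>r<n. R $$ (a, r) * V $$ (r, b))" if "V \<in> carrier_mat n n" for V
        using R ab that by (auto simp: scalar_prod_def atLeast0LessThan intro!: sum.cong)
      from this[OF EY] have "W $$ (a, b) = (\<Sum>r<n. R $$ (a, r) * (cmat (unit_sym n (i, j)) * Y) $$ (r, b))"
        unfolding W_def .
      also have "\<dots> = (\<Sum>r<n. (if r = i then R $$ (a, r) * Y $$ (j, b) else 0) + (if r = j then (if i = j then 0 else R $$ (a, r) * Y $$ (i, b)) else 0))"
        using ab by (intro sum.cong refl) (simp only: unit_sym_mult_entry[OF p Y] lessThan_iff, auto)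
      finally show ?thesis using ij by (auto simp: sum.distrib)
    qed
    show ?thesis
      unfolding W_def[symmetric] mat_trace_unit_sym[OF p W] using ij Rs[of i j] by (auto simp: We f_def)
  qed
  have "(\<Sum>p\<in>upper n. mat_trace (cmat (unit_sym n p) * (R * (cmat (unit_sym n p) * Y)))) =
      (\<Sum>(i, j)\<in>upper n. if i = j then f i i else f i j + f j i)"
    by (intro sum.cong) (auto simp: t)
  also have "\<dots> = (\<Sum>i<n. \<Sum>j<n. f i j)" by (rule sum_upper)
  also have "\<dots> = (\<Sum>i<n. \<Sum>j<n. R $$ (i, j) * Y $$ (j, i)) + (\<Sum>i<n. \<Sum>j<n. R $$ (i, i) * Y $$ (j, j)) - (\<Sum>i<n. R $$ (i, i) * Y $$ (i, i))"
    by (simp add: f_def sum.distrib sum_subtractf)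
  also have "(\<Sum>i<n. \<Sum>j<n. R $$ (i, j) * Y $$ (j, i)) = mat_trace (R * Y)" using mat_trace_mult[OF R Y] by simp
  also have "(\<Sum>i<n. \<Sum>j<n. R $$ (i, i) * Y $$ (j, j)) = mat_trace R * mat_trace Y"
    using R Y by (simp add: mat_trace_def sum_product)
  finally show ?thesis by (simp add: add.commute)
qed

definition noisy_resolvent :: "nat \<Rightarrow> real mat \<Rightarrow> real \<Rightarrow> complex \<Rightarrow> (nat \<times> nat \<Rightarrow> real) \<Rightarrow> complex mat" where
  "noisy_resolvent n A c z \<xi> = resolvent (A + c \<cdot>\<^sub>m symmat n \<xi>) z"

context
  fixes n :: nat and A :: "real mat" and c :: real and z :: complex
  assumes A: "A \<in> carrier_mat n n" "transpose_mat A = A" and z: "0 < Im z"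
begin

lemma perturbed_symmetric: "A + c \<cdot>\<^sub>m symmat n \<xi> \<in> carrier_mat n n" "transpose_mat (A + c \<cdot>\<^sub>m symmat n \<xi>) = A + c \<cdot>\<^sub>m symmat n \<xi>"
proof -
  show "A + c \<cdot>\<^sub>m symmat n \<xi> \<in> carrier_mat n n" using A by simp
  have "c \<cdot>\<^sub>m symmat n \<xi> = symmat n (\<lambda>p. c * \<xi> p)" by (intro eq_matI) (auto simp: symmat_def)
  then have "transpose_mat (c \<cdot>\<^sub>m symmat n \<xi>) = c \<cdot>\<^sub>m symmat n \<xi>" by simp
  then show "transpose_mat (A + c \<cdot>\<^sub>m symmat n \<xi>) = A + c \<cdot>\<^sub>m symmat n \<xi>"
    using A transpose_add[of A n n "c \<cdot>\<^sub>m symmat n \<xi>"] by simp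
qed

lemma noisy_resolvent_op_bound: "op_bound n (1 / Im z) (noisy_resolvent n A c z \<xi>)"
  unfolding noisy_resolvent_def by (rule resolvent_op_bound[OF perturbed_symmetric z])

lemma noisy_resolvent_carrier [simp]: "noisy_resolvent n A c z \<xi> \<in> carrier_mat n n"
  using noisy_resolvent_op_bound op_bound_carrier by blast

lemma noisy_resolvent_transpose: "transpose_mat (noisy_resolvent n A c z \<xi>) = noisy_resolvent n A c z \<xi>"
  unfolding noisy_resolvent_def by (rule resolvent_transpose[OF perturbed_symmetric z])

text \<open>
  The resolvent identity for a change of a single entry.
\<close>

lemma noisy_resolvent_upd:
  assumes p: "p \<in> upper n"
  shows "noisy_resolvent n A c z \<xi> = noisy_resolvent n A c z (\<xi>(p := t)) -
    of_real (c * (\<xi> p - t)) \<cdot>\<^sub>m (noisy_resolvent n A c z (\<xi>(p := t)) * (cmat (unit_sym n p) * noisy_resolvent n A c z \<xi>))"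
proof -
  have d: "(A + c \<cdot>\<^sub>m symmat n \<xi>) - (A + c \<cdot>\<^sub>m symmat n (\<xi>(p := t))) = (c * (\<xi> p - t)) \<cdot>\<^sub>m unit_sym n p"
    unfolding symmat_upd[OF p] using A by (intro eq_matI) (auto simp: symmat_def unit_sym_def algebra_simps)
  have e: "cmat ((c * (\<xi> p - t)) \<cdot>\<^sub>m unit_sym n p) = of_real (c * (\<xi> p - t)) \<cdot>\<^sub>m cmat (unit_sym n p)"
    by (intro eq_matI) auto
  have cE: "cmat (unit_sym n p) \<in> carrier_mat n n" by simp
  have "noisy_resolvent n A c z \<xi> = noisy_resolvent n A c z (\<xi>(p := t)) -
     noisy_resolvent n A c z (\<xi>(p := t)) * (of_real (c * (\<xi> p - t)) \<cdot>\<^sub>m cmat (unit_sym n p)) * noisy_resolvent n A c z \<xi>"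
    using resolvent_identity[OF perturbed_symmetric perturbed_symmetric z] unfolding noisy_resolvent_def d[symmetric] e[symmetric] .
  also have "noisy_resolvent n A c z (\<xi>(p := t)) * (of_real (c * (\<xi> p - t)) \<cdot>\<^sub>m cmat (unit_sym n p)) * noisy_resolvent n A c z \<xi> =
     of_real (c * (\<xi> p - t)) \<cdot>\<^sub>m (noisy_resolvent n A c z (\<xi>(p := t)) * (cmat (unit_sym n p) * noisy_resolvent n A c z \<xi>))"
    using mult_smult_distrib[OF noisy_resolvent_carrier cE] mult_smult_assoc_mat[of "noisy_resolvent n A c z (\<xi>(p := t)) * cmat (unit_sym n p)" n n "noisy_resolvent n A c z \<xi>" n]
      assoc_mult_mat[OF noisy_resolvent_carrier cE noisy_resolvent_carrier] by (metis mult_carrier_mat noisy_resolvent_carrier cE)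
  finally show ?thesis .
qed

lemma mat_trace_noisy_resolvent_upd:
  assumes p: "p \<in> upper n" and X: "X \<in> carrier_mat n n" and Y: "Y \<in> carrier_mat n n"
  shows "mat_trace (X * (noisy_resolvent n A c z \<xi> * Y)) = mat_trace (X * (noisy_resolvent n A c z (\<xi>(p := t)) * Y)) -
    of_real (c * (\<xi> p - t)) * mat_trace (X * (noisy_resolvent n A c z (\<xi>(p := t)) * (cmat (unit_sym n p) * (noisy_resolvent n A c z \<xi> * Y))))"
proof -
  define R where "R = noisy_resolvent n A c z \<xi>"
  define R0 where "R0 = noisy_resolvent n A c z (\<xi>(p := t))"
  define E where "E = cmat (unit_sym n p)"
  define k where "k = complex_of_real (c * (\<xi> p - t))"
  have c: "R \<in> carrier_mat n n" "R0 \<in> carrier_mat n n" "E \<in> carrier_mat n n" by (auto simp: R_def R0_def E_def)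
  have c2: "E * R \<in> carrier_mat n n" "R0 * (E * R) \<in> carrier_mat n n" "E * (R * Y) \<in> carrier_mat n n" "R * Y \<in> carrier_mat n n"
     "R0 * Y \<in> carrier_mat n n" "R0 * (E * (R * Y)) \<in> carrier_mat n n" "R0 * (E * R) * Y \<in> carrier_mat n n" using c Y by auto
  have "R * Y = (R0 - k \<cdot>\<^sub>m (R0 * (E * R))) * Y"
    using noisy_resolvent_upd[OF p, of \<xi> t] by (simp add: R_def R0_def E_def k_def)
  also have "\<dots> = R0 * Y - (k \<cdot>\<^sub>m (R0 * (E * R))) * Y"
    using c c2 Y by (intro minus_mult_distrib_mat) auto
  also have "(k \<cdot>\<^sub>m (R0 * (E * R))) * Y = k \<cdot>\<^sub>m ((R0 * (E * R)) * Y)"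
    using c2 Y by (intro mult_smult_assoc_mat) auto
  also have "(R0 * (E * R)) * Y = R0 * (E * (R * Y))"
    using assoc_mult_mat[OF c(2) c2(1) Y] assoc_mult_mat[OF c(3) c(1) Y] by simp
  finally have "X * (R * Y) = X * (R0 * Y) - X * (k \<cdot>\<^sub>m (R0 * (E * (R * Y))))"
    using mult_minus_distrib_mat[OF X c2(5), of "k \<cdot>\<^sub>m (R0 * (E * (R * Y)))"] c2 by simp
  also have "X * (k \<cdot>\<^sub>m (R0 * (E * (R * Y)))) = k \<cdot>\<^sub>m (X * (R0 * (E * (R * Y))))"
    using mult_smult_distrib[OF X c2(6)] .
  finally show ?thesis
    unfolding R_def[symmetric] R0_def[symmetric] E_def[symmetric] k_def[symmetric]
    using X c2 mat_trace_minus[of "X * (R0 * Y)" n "k \<cdot>\<^sub>m (X * (R0 * (E * (R * Y))))"] mat_trace_smult[of "X * (R0 * (E * (R * Y)))" n k]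
    by simp
qed

end

lemma meas_mat_perturbed:
  fixes A :: "'x \<Rightarrow> real mat"
  assumes A: "meas_mat M n A" and s [measurable]: "s \<in> borel_measurable M"
    and X: "\<And>p. p \<in> upper n \<Longrightarrow> (\<lambda>\<omega>. X \<omega> p) \<in> borel_measurable M"
  shows "meas_mat M n (\<lambda>\<omega>. A \<omega> + s \<omega> \<cdot>\<^sub>m symmat n (X \<omega>))"
proof -
  have "(\<lambda>\<omega>. (A \<omega> + s \<omega> \<cdot>\<^sub>m symmat n (X \<omega>)) $$ (i, j)) \<in> borel_measurable M" if ij: "i < n" "j < n" for i j
  proof (rule borel_measurable_eq_on_space)
    fix \<omega> assume "\<omega> \<in> space M"
    then have "A \<omega> \<in> carrier_mat n n" using A by (simp add: meas_mat_def)
    then show "(A \<omega> + s \<omega> \<cdot>\<^sub>m symmat n (X \<omega>)) $$ (i, j) = A \<omega> $$ (i, j) + s \<omega> * X \<omega> (min i j, max i j)"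
      using ij by (auto simp: symmat_def)
  next
    have [measurable]: "(\<lambda>\<omega>. A \<omega> $$ (i, j)) \<in> borel_measurable M" using A ij by (simp add: meas_mat_def)
    have [measurable]: "(\<lambda>\<omega>. X \<omega> (min i j, max i j)) \<in> borel_measurable M" using ij by (intro X) (auto simp: upper_def)
    show "(\<lambda>\<omega>. A \<omega> $$ (i, j) + s \<omega> * X \<omega> (min i j, max i j)) \<in> borel_measurable M" by measurable
  qed
  then show ?thesis using A by (auto simp: meas_mat_def)
qed

lemma meas_mat_const: "X \<in> carrier_mat n n \<Longrightarrow> meas_mat M n (\<lambda>_. X)"
  by (simp add: meas_mat_def)

section \<open>Expansion of resolvent traces in one entry\<close>

definition normalized_trace :: "nat \<Rightarrow> complex mat \<Rightarrow> complex" where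
  "normalized_trace n X = mat_trace X / of_nat n"

lemma normalized_trace_le:
  assumes "op_bound n C X" "0 \<le> C"
  shows "cmod (normalized_trace n X) \<le> C"
proof (cases "n = 0")
  case False
  then show ?thesis using op_bound_mat_trace[OF assms(1)] by (simp add: normalized_trace_def norm_divide divide_le_eq mult.commute)
qed (use assms in \<open>simp add: normalized_trace_def\<close>)

context
  fixes n :: nat and A :: "real mat" and c :: real and z :: complex and B :: "complex mat" and \<beta> :: real
  assumes A: "A \<in> carrier_mat n n" "transpose_mat A = A" and z: "0 < Im z" and B: "op_bound n \<beta> B" and \<beta>: "0 \<le> \<beta>"
begin

lemma mat_trace_noisy_resolvent_lipschitz:
  assumes p: "p \<in> upper n"
  shows "cmod (mat_trace (B * noisy_resolvent n A c z (\<xi>(p := t))) - mat_trace (B * noisy_resolvent n A c z \<xi>)) \<le> \<bar>c\<bar> * (2 * \<beta> / (Im z)\<^sup>2) * \<bar>t - \<xi> p\<bar>"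
proof -
  define R where "R = noisy_resolvent n A c z \<xi>"
  define R0 where "R0 = noisy_resolvent n A c z (\<xi>(p := t))"
  define E where "E = cmat (unit_sym n p)"
  have o: "op_bound n (1 / Im z) R" "op_bound n (1 / Im z) R0" unfolding R_def R0_def by (rule noisy_resolvent_op_bound[OF A z])+
  note cr = op_bound_carrier[OF o(1)] op_bound_carrier[OF o(2)] op_bound_carrier[OF B]
  have E: "E \<in> carrier_mat n n" by (simp add: E_def)
  have "mat_trace (B * (R * 1\<^sub>m n)) = mat_trace (B * (R0 * 1\<^sub>m n)) - of_real (c * (\<xi> p - t)) * mat_trace (B * (R0 * (E * (R * 1\<^sub>m n))))"
    unfolding R_def R0_def E_def by (rule mat_trace_noisy_resolvent_upd[OF A z p cr(3)]) simp
  then have "mat_trace (B * R0) - mat_trace (B * R) = of_real (c * (\<xi> p - t)) * mat_trace (B * (R0 * (E * R)))" using cr by simp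
  also have "B * (R0 * (E * R)) = (B * R0) * (E * R)"
    using assoc_mult_mat[OF cr(3) cr(2), of "E * R" n] cr E by simp
  also have "mat_trace ((B * R0) * (E * R)) = mat_trace (E * (R * (B * R0)))"
    using mat_trace_comm[of "B * R0" n "E * R"] assoc_mult_mat[OF E cr(1), of "B * R0" n] cr E by simp
  finally have e: "mat_trace (B * R0) - mat_trace (B * R) = of_real (c * (\<xi> p - t)) * mat_trace (E * (R * (B * R0)))" .
  have "op_bound n (1 / Im z * (\<beta> * (1 / Im z))) (R * (B * R0))" using o B \<beta> z by (intro op_bound_mult) auto
  then have "cmod (mat_trace (E * (R * (B * R0)))) \<le> 2 * (1 / Im z * (\<beta> * (1 / Im z)))"
    unfolding E_def using \<beta> z by (intro mat_trace_unit_sym_le[OF p]) auto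
  then have "\<bar>c\<bar> * \<bar>\<xi> p - t\<bar> * cmod (mat_trace (E * (R * (B * R0)))) \<le> \<bar>c\<bar> * \<bar>\<xi> p - t\<bar> * (2 * (1 / Im z * (\<beta> * (1 / Im z))))"
    by (intro mult_left_mono) auto
  also have "\<dots> = \<bar>c\<bar> * (2 * \<beta> / (Im z)\<^sup>2) * \<bar>t - \<xi> p\<bar>" by (simp add: power2_eq_square abs_minus_commute)
  finally show ?thesis unfolding R_def[symmetric] R0_def[symmetric] e
    by (simp only: norm_mult norm_of_real abs_mult)
qed

text \<open>
  The entry \<open>p\<close> contributes \<open>\<xi> p * term0 p \<xi>\<close> to the trace of \<open>symmat
  n \<xi> R B\<close>, and the derivative of \<open>term0 p\<close> in \<open>\<xi> p\<close> is \<open>- c *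
  term1 p\<close>.
\<close>

definition term0 where "term0 p \<xi> = mat_trace (cmat (unit_sym n p) * (noisy_resolvent n A c z \<xi> * B))"
definition term1 where "term1 p \<xi> = mat_trace (cmat (unit_sym n p) * (noisy_resolvent n A c z \<xi> * (cmat (unit_sym n p) * (noisy_resolvent n A c z \<xi> * B))))"

lemma term0_le: "p \<in> upper n \<Longrightarrow> cmod (term0 p \<xi>) \<le> 2 * (\<beta> / Im z)"
proof -
  assume p: "p \<in> upper n"
  have "op_bound n (1 / Im z * \<beta>) (noisy_resolvent n A c z \<xi> * B)" using noisy_resolvent_op_bound[OF A z] B z by (intro op_bound_mult) auto
  then show ?thesis unfolding term0_def using mat_trace_unit_sym_le[OF p, of "1 / Im z * \<beta>"] \<beta> z by simp
qed

lemma term1_le: "p \<in> upper n \<Longrightarrow> cmod (term1 p \<xi>) \<le> 2 * (\<beta> / (Im z)\<^sup>2)"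
proof -
  assume p: "p \<in> upper n"
  have "op_bound n (1 / Im z * (1 * (1 / Im z * \<beta>))) (noisy_resolvent n A c z \<xi> * (cmat (unit_sym n p) * (noisy_resolvent n A c z \<xi> * B)))"
    using noisy_resolvent_op_bound[OF A z] B z unit_sym_op_bound[OF p] by (intro op_bound_mult) auto
  then show ?thesis unfolding term1_def
    using mat_trace_unit_sym_le[OF p, of "1 / Im z * (1 * (1 / Im z * \<beta>))"] \<beta> z by (simp add: power2_eq_square)
qed

text \<open>
  Expanding \<open>\<xi>\<^sub>p tr (E R B)\<close> around \<open>\<xi>\<^sub>p = 0\<close> yields
  \<open>\<xi>\<^sub>p tr (E R\<^sub>0 B) - c \<xi>\<^sub>p\<^sup>2 tr (E R\<^sub>0 E R\<^sub>0 B)\<close> up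
  to \<open>c\<^sup>2\<close>. Here \<open>R\<^sub>0\<close> does not depend on \<open>\<xi>\<^sub>p\<close>,
  so if \<open>v\<close> is the second moment of a centred entry then both terms of the second line have mean
  zero.
\<close>

lemma second_order_expansion:
  fixes \<xi> :: "nat \<times> nat \<Rightarrow> real"
  assumes p: "p \<in> upper n"
  defines "\<xi>0 \<equiv> \<xi>(p := 0)"
  shows "cmod ((of_real (\<xi> p) * term0 p \<xi> + of_real (c * v) * term1 p \<xi>)
      - (of_real (\<xi> p) * term0 p \<xi>0 - of_real (c * ((\<xi> p)\<^sup>2 - v)) * term1 p \<xi>0))
    \<le> 2 * \<beta> * c\<^sup>2 / (Im z) ^ 3 * (\<bar>\<xi> p\<bar> ^ 3 + 2 * \<bar>v\<bar> * \<bar>\<xi> p\<bar>)"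
proof -
  define R where "R = noisy_resolvent n A c z \<xi>"
  define R0 where "R0 = noisy_resolvent n A c z \<xi>0"
  define E where "E = cmat (unit_sym n p)"
  define x where "x = \<xi> p"
  have o: "op_bound n (1 / Im z) R" "op_bound n (1 / Im z) R0" unfolding R_def R0_def by (rule noisy_resolvent_op_bound[OF A z])+
  have oE: "op_bound n 1 E" unfolding E_def by (rule unit_sym_op_bound[OF p])
  note cr = op_bound_carrier[OF o(1)] op_bound_carrier[OF o(2)] op_bound_carrier[OF B] op_bound_carrier[OF oE]
  have i0: "0 \<le> 1 / Im z" using z by simp
  have upd: "mat_trace (X * (R * Y)) = mat_trace (X * (R0 * Y)) - of_real (c * x) * mat_trace (X * (R0 * (E * (R * Y))))"
    if "X \<in> carrier_mat n n" "Y \<in> carrier_mat n n" for X Y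
    using mat_trace_noisy_resolvent_upd[OF A z p that, of c \<xi> 0] unfolding R_def R0_def E_def x_def \<xi>0_def by simp
  define t0 where "t0 = mat_trace (E * (R0 * B))"
  define t1 where "t1 = mat_trace (E * (R0 * (E * (R0 * B))))"
  define t2 where "t2 = mat_trace (E * (R0 * (E * (R0 * (E * (R * B))))))"
  define t3 where "t3 = mat_trace (E * (R0 * (E * (R * (E * (R * B))))))"
  have as: "E * (R0 * (E * V)) = (E * (R0 * E)) * V" if "V \<in> carrier_mat n n" for V
    using assoc_mult_mat[OF cr(4), of "R0 * E" n V n] assoc_mult_mat[OF cr(2,4) that] cr that by simp
  have c2: "R * B \<in> carrier_mat n n" "R0 * B \<in> carrier_mat n n" "E * (R0 * E) \<in> carrier_mat n n"
    "R0 * (E * (R * B)) \<in> carrier_mat n n" "E * (R * B) \<in> carrier_mat n n" using cr by auto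
  have a: "term0 p \<xi> = t0 - of_real (c * x) * mat_trace (E * (R0 * (E * (R * B))))"
    unfolding term0_def t0_def R_def[symmetric] E_def[symmetric] by (rule upd[OF cr(4,3)])
  have b: "mat_trace (E * (R0 * (E * (R * B)))) = t1 - of_real (c * x) * t2"
  proof -
    have "t1 = mat_trace ((E * (R0 * E)) * (R0 * B))" by (simp only: t1_def as[OF c2(2)])
    moreover have "t2 = mat_trace ((E * (R0 * E)) * (R0 * (E * (R * B))))" by (simp only: t2_def as[OF c2(4)])
    ultimately show ?thesis unfolding as[OF c2(1)] by (simp only: upd[OF c2(3) cr(3)])
  qed
  have d: "term1 p \<xi> = mat_trace (E * (R0 * (E * (R * B)))) - of_real (c * x) * t3"
    unfolding term1_def t3_def R_def[symmetric] E_def[symmetric] by (rule upd[OF cr(4) c2(5)])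
  have bound: "cmod t2 \<le> 2 * \<beta> / (Im z) ^ 3" "cmod t3 \<le> 2 * \<beta> / (Im z) ^ 3"
  proof -
    have "op_bound n (1 / Im z * (1 * (1 / Im z * (1 * (1 / Im z * \<beta>))))) (R0 * (E * (R0 * (E * (R * B)))))"
      "op_bound n (1 / Im z * (1 * (1 / Im z * (1 * (1 / Im z * \<beta>))))) (R0 * (E * (R * (E * (R * B)))))"
      using o oE B i0 by (intro op_bound_mult; simp)+
    then have "cmod t2 \<le> 2 * (1 / Im z * (1 * (1 / Im z * (1 * (1 / Im z * \<beta>)))))"
      "cmod t3 \<le> 2 * (1 / Im z * (1 * (1 / Im z * (1 * (1 / Im z * \<beta>)))))"
      unfolding t2_def t3_def E_def using \<beta> z by (intro mat_trace_unit_sym_le[OF p]; simp)+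
    then show "cmod t2 \<le> 2 * \<beta> / (Im z) ^ 3" "cmod t3 \<le> 2 * \<beta> / (Im z) ^ 3" by (simp_all add: power3_eq_cube)
  qed
  have e1: "term0 p \<xi>0 = t0" by (simp add: term0_def t0_def R0_def E_def)
  have e2: "term1 p \<xi>0 = t1" by (simp add: term1_def t1_def R0_def E_def)
  have "(of_real x * term0 p \<xi> + of_real (c * v) * term1 p \<xi>) - (of_real x * term0 p \<xi>0 - of_real (c * (x\<^sup>2 - v)) * term1 p \<xi>0)
      = of_real (c\<^sup>2 * x ^ 3) * t2 - of_real (c\<^sup>2 * v * x) * (t2 + t3)"
    unfolding a b d e1 e2 by (simp add: algebra_simps power2_eq_square power3_eq_cube)
  also have "cmod \<dots> \<le> c\<^sup>2 * \<bar>x\<bar> ^ 3 * cmod t2 + c\<^sup>2 * \<bar>v\<bar> * \<bar>x\<bar> * (cmod t2 + cmod t3)"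
  proof -
    have "cmod (of_real (c\<^sup>2 * x ^ 3) * t2 - of_real (c\<^sup>2 * v * x) * (t2 + t3)) \<le>
        cmod (of_real (c\<^sup>2 * x ^ 3) * t2) + cmod (of_real (c\<^sup>2 * v * x) * (t2 + t3))" by (rule norm_triangle_ineq4)
    also have "\<dots> = c\<^sup>2 * \<bar>x\<bar> ^ 3 * cmod t2 + c\<^sup>2 * \<bar>v\<bar> * \<bar>x\<bar> * cmod (t2 + t3)"
      by (simp only: norm_mult norm_of_real abs_mult power_abs abs_power2 power2_abs)
    also have "\<dots> \<le> c\<^sup>2 * \<bar>x\<bar> ^ 3 * cmod t2 + c\<^sup>2 * \<bar>v\<bar> * \<bar>x\<bar> * (cmod t2 + cmod t3)"
      by (intro add_left_mono mult_left_mono norm_triangle_ineq) auto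
    finally show ?thesis .
  qed
  also have "\<dots> \<le> c\<^sup>2 * \<bar>x\<bar> ^ 3 * (2 * \<beta> / (Im z) ^ 3) + c\<^sup>2 * \<bar>v\<bar> * \<bar>x\<bar> * (2 * \<beta> / (Im z) ^ 3 + 2 * \<beta> / (Im z) ^ 3)"
    using bound by (intro add_mono mult_left_mono) auto
  also have "\<dots> = 2 * \<beta> * c\<^sup>2 / (Im z) ^ 3 * (\<bar>x\<bar> ^ 3 + 2 * \<bar>v\<bar> * \<bar>x\<bar>)"
    by (simp add: algebra_simps add_divide_distrib)
  finally show ?thesis unfolding x_def .
qed

end

section \<open>Fluctuations of resolvent traces\<close>

text \<open>
  The laws of the entries on and above the diagonal. Above the diagonal the variance is 1; on the diagonal it
  is only bounded, which covers i.i.d. entries as well as the Gaussian Orthogonal Ensemble.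
\<close>

locale wigner_law = real_product_prob \<nu> q for \<nu> :: "nat \<times> nat \<Rightarrow> real measure" and q :: real +
  assumes mean0: "\<And>p. integral\<^sup>L (\<nu> p) (\<lambda>x. x) = 0"
    and var1: "\<And>i j. i < j \<Longrightarrow> integral\<^sup>L (\<nu> (i, j)) (\<lambda>x. x\<^sup>2) = 1"
begin

abbreviation W :: "nat \<Rightarrow> (nat \<times> nat \<Rightarrow> real) measure" where
  "W n \<equiv> Pi\<^sub>M (upper n) \<nu>"

lemma component_measurable [measurable]: "p \<in> upper n \<Longrightarrow> (\<lambda>\<xi>. \<xi> p) \<in> borel_measurable (W n)"
  using measurable_component_singleton[of p "upper n" \<nu>] measurable_cong_sets[OF refl sets_eq] by blast

lemma integral_component:
  fixes g :: "real \<Rightarrow> real"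
  assumes p: "p \<in> upper n" and g: "g \<in> borel_measurable borel"
  shows "integral\<^sup>L (W n) (\<lambda>\<xi>. g (\<xi> p)) = integral\<^sup>L (\<nu> p) g"
    and "integrable (\<nu> p) g \<Longrightarrow> integrable (W n) (\<lambda>\<xi>. g (\<xi> p))"
proof -
  have d: "distr (W n) (\<nu> p) (\<lambda>\<xi>. \<xi> p) = \<nu> p" by (rule distr_PiM_component) (use prob p in auto)
  have [measurable]: "(\<lambda>\<xi>. \<xi> p) \<in> measurable (W n) (\<nu> p)" using p by measurable
  have [measurable]: "g \<in> borel_measurable (\<nu> p)" using g measurable_cong_sets[OF sets_eq refl] by blast
  show "integral\<^sup>L (W n) (\<lambda>\<xi>. g (\<xi> p)) = integral\<^sup>L (\<nu> p) g"
    using integral_distr[of "\<lambda>\<xi>. \<xi> p" "W n" "\<nu> p" g] unfolding d by simp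
  show "integrable (\<nu> p) g \<Longrightarrow> integrable (W n) (\<lambda>\<xi>. g (\<xi> p))"
    using integrable_distr[of "\<lambda>\<xi>. \<xi> p" "W n" "\<nu> p" g] unfolding d by simp
qed

text \<open>
  A centred function of the entry \<open>p\<close> is orthogonal to every bounded function of the other
  entries; resetting the entry to 0 expresses that a function does not depend on it.
\<close>

lemma integral_component_mult_zero:
  fixes g :: "real \<Rightarrow> real" and \<phi> :: "_ \<Rightarrow> complex"
  assumes p: "p \<in> upper n" and g: "g \<in> borel_measurable borel" "integrable (\<nu> p) g" "integral\<^sup>L (\<nu> p) g = 0"
    and \<phi>: "(\<lambda>\<xi>. \<phi> (\<xi>(p := 0))) \<in> borel_measurable (W n)" "\<And>\<xi>. cmod (\<phi> \<xi>) \<le> C"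
  shows "integrable (W n) (\<lambda>\<xi>. of_real (g (\<xi> p)) * \<phi> (\<xi>(p := 0)))"
    and "integral\<^sup>L (W n) (\<lambda>\<xi>. of_real (g (\<xi> p)) * \<phi> (\<xi>(p := 0))) = 0"
proof -
  note [measurable] = \<phi>(1)
  note [measurable] = g(1)
  have m: "(\<lambda>\<xi>. g (\<xi> p)) \<in> borel_measurable (W n)" using integral_component(2)[OF p g(1,2)] by auto
  show i: "integrable (W n) (\<lambda>\<xi>. of_real (g (\<xi> p)) * \<phi> (\<xi>(p := 0)))"
  proof (rule Bochner_Integration.integrable_bound[where f="\<lambda>\<xi>. C * g (\<xi> p)"])
    show "integrable (W n) (\<lambda>\<xi>. C * g (\<xi> p))" using integral_component(2)[OF p g(1,2)] by simp
    show "AE \<xi> in W n. norm (of_real (g (\<xi> p)) * \<phi> (\<xi>(p := 0))) \<le> norm (C * g (\<xi> p))"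
    proof (rule AE_I2)
      fix \<xi>
      have "0 \<le> C" using \<phi>(2)[of \<xi>] norm_ge_zero[of "\<phi> \<xi>"] by linarith
      then show "norm (of_real (g (\<xi> p)) * \<phi> (\<xi>(p := 0))) \<le> norm (C * g (\<xi> p))"
        using mult_right_mono[OF \<phi>(2)[of "\<xi>(p := 0)"], of "\<bar>g (\<xi> p)\<bar>"] by (simp add: norm_mult abs_mult mult.commute)
    qed
  qed (use m in measurable)
  have ins: "insert p (upper n - {p}) = upper n" using p by auto
  have gi: "integrable (\<nu> p) (\<lambda>t. complex_of_real (g t))" using g(2) by (rule integrable_of_real)
  have "integral\<^sup>L (W n) (\<lambda>\<xi>. of_real (g (\<xi> p)) * \<phi> (\<xi>(p := 0))) =
      (\<integral>x. (\<integral>t. of_real (g ((x(p := t)) p)) * \<phi> ((x(p := t))(p := 0)) \<partial>\<nu> p) \<partial>Pi\<^sub>M (upper n - {p}) \<nu>)"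
    using product_integral_insert[of "upper n - {p}" p "\<lambda>\<xi>. of_real (g (\<xi> p)) * \<phi> (\<xi>(p := 0))"] i unfolding ins by simp
  also have "\<dots> = (\<integral>x. 0 \<partial>Pi\<^sub>M (upper n - {p}) \<nu>)"
    using g(3) by (simp add: integral_mult_left_zero)
  finally show "integral\<^sup>L (W n) (\<lambda>\<xi>. of_real (g (\<xi> p)) * \<phi> (\<xi>(p := 0))) = 0" by simp
qed

lemma integrable_bounded_complex:
  fixes f :: "_ \<Rightarrow> complex"
  assumes "f \<in> borel_measurable (W n)" "\<And>\<xi>. \<xi> \<in> space (W n) \<Longrightarrow> cmod (f \<xi>) \<le> C"
  shows "integrable (W n) f"
proof -
  interpret PP: prob_space "W n" by (rule prob_Pi)
  show ?thesis by (rule PP.integrable_const_bound[where B=C]) (use assms in auto)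
qed

lemma integral_W_le:
  fixes f :: "_ \<Rightarrow> complex"
  assumes "f \<in> borel_measurable (W n)" "\<And>\<xi>. \<xi> \<in> space (W n) \<Longrightarrow> cmod (f \<xi>) \<le> C"
  shows "cmod (integral\<^sup>L (W n) f) \<le> C"
proof -
  interpret PP: prob_space "W n" by (rule prob_Pi)
  have i: "integrable (W n) f" by (rule integrable_bounded_complex[OF assms])
  have "cmod (integral\<^sup>L (W n) f) \<le> (\<integral>\<xi>. cmod (f \<xi>) \<partial>W n)" by (rule integral_norm_bound)
  also have "\<dots> \<le> (\<integral>\<xi>. C \<partial>W n)" using i assms by (intro integral_mono) auto
  finally show ?thesis by (simp add: PP.prob_space)
qed

lemma integrable_id: "integrable (\<nu> p) (\<lambda>x. x)"
proof (rule Bochner_Integration.integrable_bound[where f="\<lambda>x. 1 + x\<^sup>2"])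
  interpret N: prob_space "\<nu> p" by (rule prob)
  show "integrable (\<nu> p) (\<lambda>x. 1 + x\<^sup>2)" using i2[of p] by simp
  show "AE x in \<nu> p. norm x \<le> norm (1 + x\<^sup>2)"
  proof (rule AE_I2)
    fix x :: real
    have "0 \<le> (\<bar>x\<bar> - 1)\<^sup>2" "(0::real) \<le> x\<^sup>2" by simp_all
    then show "norm x \<le> norm (1 + x\<^sup>2)" by (simp add: power2_diff)
  qed
  show "(\<lambda>x. x) \<in> borel_measurable (\<nu> p)" unfolding measurable_cong_sets[OF sets_eq[of p] refl] by simp
qed

context
  fixes n :: nat and A :: "real mat" and z :: complex
  assumes n: "0 < n" and A: "A \<in> carrier_mat n n" "transpose_mat A = A" and z: "0 < Im z"
begin

lemma meas_noisy_resolvent: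
  assumes "\<And>p. p \<in> upper n \<Longrightarrow> (\<lambda>\<omega>. X \<omega> p) \<in> borel_measurable M"
  shows "meas_mat M n (\<lambda>\<omega>. noisy_resolvent n A c z (X \<omega>))"
  unfolding noisy_resolvent_def using A assms by (intro meas_mat_resolvent meas_mat_perturbed meas_mat_const) auto

lemma meas_noisy_resolvent_W: "meas_mat (W n) n (noisy_resolvent n A c z)"
  using meas_noisy_resolvent[of "\<lambda>\<xi>. \<xi>" "W n" c] component_measurable by simp

lemma meas_pres0: "meas_mat (W n) n (\<lambda>\<xi>. noisy_resolvent n A c z (\<xi>(p := 0)))"
proof (rule meas_noisy_resolvent)
  fix p' assume "p' \<in> upper n"
  then show "(\<lambda>\<xi>. (\<xi>(p := 0)) p') \<in> borel_measurable (W n)" by (cases "p' = p") (auto intro: component_measurable)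
qed

text \<open>
  The Lipschitz constant per entry is \<open>O(n\<^sup>-\<^sup>3\<^sup>/\<^sup>2)\<close> and there are at
  most \<open>n\<^sup>2\<close> entries, so the variance is \<open>O(n\<^sup>-\<^sup>1)\<close>. Real and
  imaginary part are treated separately because \<open>coordinate_lipschitz_moments\<close> is about real
  functions.
\<close>

lemma mat_trace_noisy_resolvent_moments:
  assumes B: "op_bound n \<beta> B" and \<beta>: "0 \<le> \<beta>" and s: "0 \<le> s" and F: "F = Re \<or> F = Im"
  defines "f \<equiv> \<lambda>\<xi>. F (normalized_trace n (B * noisy_resolvent n A (s / sqrt (real n)) z \<xi>))"
    and "V \<equiv> 16 * s\<^sup>2 * \<beta>\<^sup>2 * q / (Im z) ^ 4"
  shows "f \<in> borel_measurable (W n)"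
    and "\<And>\<xi>. \<bar>f \<xi>\<bar> \<le> \<beta> / Im z"
    and "(\<integral>\<xi>. (f \<xi> - integral\<^sup>L (W n) f)\<^sup>2 \<partial>W n) \<le> V / real n"
    and "(\<integral>\<xi>. (f \<xi> - integral\<^sup>L (W n) f) ^ 4 \<partial>W n) \<le> 8 * (V / real n)\<^sup>2"
proof -
  define c where "c = s / sqrt (real n)"
  have c0: "0 \<le> c" using s by (simp add: c_def)
  have FX: "\<bar>F x\<bar> \<le> cmod x" "F x - F y = F (x - y)" for x y
    using F abs_Re_le_cmod abs_Im_le_cmod by auto
  have Bc: "B \<in> carrier_mat n n" using B by (rule op_bound_carrier)
  have "(\<lambda>\<xi>. mat_trace (B * noisy_resolvent n A c z \<xi>)) \<in> borel_measurable (W n)"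
    by (rule meas_mat_mat_trace[OF meas_mat_mult[OF meas_mat_const[OF Bc] meas_noisy_resolvent_W]])
  then have "(\<lambda>\<xi>. normalized_trace n (B * noisy_resolvent n A c z \<xi>)) \<in> borel_measurable (W n)" by (simp add: normalized_trace_def)
  then show fm: "f \<in> borel_measurable (W n)" using F unfolding f_def c_def[symmetric] by auto
  show fb: "\<bar>f \<xi>\<bar> \<le> \<beta> / Im z" for \<xi>
  proof -
    have "op_bound n (\<beta> * (1 / Im z)) (B * noisy_resolvent n A c z \<xi>)" using B \<beta> noisy_resolvent_op_bound[OF A z] by (intro op_bound_mult) auto
    then have "cmod (normalized_trace n (B * noisy_resolvent n A c z \<xi>)) \<le> \<beta> * (1 / Im z)" using \<beta> z by (intro normalized_trace_le) auto
    then show ?thesis using FX(1)[of "normalized_trace n (B * noisy_resolvent n A c z \<xi>)"] unfolding f_def c_def[symmetric] by simp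
  qed
  define L where "L = c * (2 * \<beta> / (Im z)\<^sup>2) / real n"
  have L0: "0 \<le> L" using c0 \<beta> by (simp add: L_def)
  have fL: "\<bar>f (\<xi>(p := t)) - f \<xi>\<bar> \<le> L * \<bar>t - \<xi> p\<bar>" if p: "p \<in> upper n" for \<xi> p t
  proof -
    have "\<bar>f (\<xi>(p := t)) - f \<xi>\<bar> \<le> cmod (normalized_trace n (B * noisy_resolvent n A c z (\<xi>(p := t))) - normalized_trace n (B * noisy_resolvent n A c z \<xi>))"
      unfolding f_def c_def[symmetric] FX(2) by (rule FX(1))
    also have "\<dots> = cmod (mat_trace (B * noisy_resolvent n A c z (\<xi>(p := t))) - mat_trace (B * noisy_resolvent n A c z \<xi>)) / real n"
      by (simp add: normalized_trace_def diff_divide_distrib[symmetric] norm_divide)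
    also have "\<dots> \<le> (\<bar>c\<bar> * (2 * \<beta> / (Im z)\<^sup>2) * \<bar>t - \<xi> p\<bar>) / real n"
      by (intro divide_right_mono mat_trace_noisy_resolvent_lipschitz[OF A z B \<beta> p]) simp
    finally show ?thesis using c0 by (simp add: L_def)
  qed
  have V0: "0 \<le> V" using q by (simp add: V_def)
  have "L\<^sup>2 = s\<^sup>2 / real n * (4 * \<beta>\<^sup>2 / (Im z) ^ 4) / (real n)\<^sup>2"
    unfolding L_def c_def by (simp add: power_mult_distrib power_divide)
  then have "L\<^sup>2 * real n ^ 3 = 4 * s\<^sup>2 * \<beta>\<^sup>2 / (Im z) ^ 4"
    using n by (simp add: power2_eq_square power3_eq_cube)
  then have "V = 4 * q * (L\<^sup>2 * real n ^ 3)" by (simp add: V_def)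
  then have LV: "4 * L\<^sup>2 * q * real n ^ 2 = V / real n"
    using n by (simp add: power2_eq_square power3_eq_cube)
  have cV: "real (card (upper n)) * (4 * L\<^sup>2 * q) \<le> V / real n"
  proof -
    have "real (card (upper n)) \<le> real n ^ 2" using card_upper_le[of n] by (metis of_nat_le_iff of_nat_power)
    then have "real (card (upper n)) * (4 * L\<^sup>2 * q) \<le> real n ^ 2 * (4 * L\<^sup>2 * q)" using q by (intro mult_right_mono) auto
    then show ?thesis using LV by (simp add: mult_ac)
  qed
  note M = coordinate_lipschitz_moments[OF finite_upper L0 fm fb fL]
  show "(\<integral>\<xi>. (f \<xi> - integral\<^sup>L (W n) f)\<^sup>2 \<partial>W n) \<le> V / real n" using M cV by linarith
  have "(real (card (upper n)) * (4 * L\<^sup>2 * q))\<^sup>2 \<le> (V / real n)\<^sup>2" using cV q by (intro power_mono) auto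
  then show "(\<integral>\<xi>. (f \<xi> - integral\<^sup>L (W n) f) ^ 4 \<partial>W n) \<le> 8 * (V / real n)\<^sup>2" using M by linarith
qed

lemma normalized_trace_noisy_resolvent_mean_deviation:
  assumes B: "op_bound n \<beta> B" and \<beta>: "0 \<le> \<beta>" and s: "0 \<le> s"
  defines "f \<equiv> \<lambda>\<xi>. normalized_trace n (B * noisy_resolvent n A (s / sqrt (real n)) z \<xi>)"
    and "V \<equiv> 16 * s\<^sup>2 * \<beta>\<^sup>2 * q / (Im z) ^ 4"
  shows "(\<integral>\<xi>. cmod (f \<xi> - integral\<^sup>L (W n) f) \<partial>W n) \<le> (1 + V) / sqrt (real n)"
    and "integrable (W n) f"
proof -
  interpret PP: prob_space "W n" by (rule prob_Pi)
  note R = mat_trace_noisy_resolvent_moments[OF B \<beta> s, where F=Re, folded f_def V_def, simplified]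
  note I = mat_trace_noisy_resolvent_moments[OF B \<beta> s, where F=Im, folded f_def V_def, simplified]
  have int: "integrable (W n) f"
    unfolding f_def
  proof (rule integrable_bounded_complex[where C="\<beta> * (1 / Im z)"])
    show "(\<lambda>\<xi>. normalized_trace n (B * noisy_resolvent n A (s / sqrt (real n)) z \<xi>)) \<in> borel_measurable (W n)"
      unfolding normalized_trace_def using meas_mat_mat_trace[OF meas_mat_mult[OF meas_mat_const[OF op_bound_carrier[OF B]] meas_noisy_resolvent_W]] by simp
    fix \<xi> show "cmod (normalized_trace n (B * noisy_resolvent n A (s / sqrt (real n)) z \<xi>)) \<le> \<beta> * (1 / Im z)"
      by (rule normalized_trace_le, rule op_bound_mult[OF B noisy_resolvent_op_bound[OF A z] \<beta>]) (use \<beta> z in simp)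
  qed
  then show "integrable (W n) f" .
  define m where "m = integral\<^sup>L (W n) f"
  have m: "Re m = (\<integral>\<xi>. Re (f \<xi>) \<partial>W n)" "Im m = (\<integral>\<xi>. Im (f \<xi>) \<partial>W n)" unfolding m_def using int by auto
  define t where "t = sqrt (real n)"
  have t: "0 < t" "t * t = real n" using n by (auto simp: t_def)
  have l1: "(\<integral>\<xi>. \<bar>g \<xi> - integral\<^sup>L (W n) g\<bar> \<partial>W n) \<le> (1 + V) / (2 * t)"
    if gm: "g \<in> borel_measurable (W n)" and gb: "\<And>\<xi>. \<bar>g \<xi>\<bar> \<le> \<beta> / Im z"
      and g2: "(\<integral>\<xi>. (g \<xi> - integral\<^sup>L (W n) g)\<^sup>2 \<partial>W n) \<le> V / real n" for g :: "_ \<Rightarrow> real"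
  proof -
    note [measurable] = gm
    define d where "d \<xi> = g \<xi> - integral\<^sup>L (W n) g" for \<xi>
    have [measurable]: "d \<in> borel_measurable (W n)" unfolding d_def by measurable
    have db: "\<bar>d \<xi>\<bar> \<le> \<beta> / Im z + \<bar>integral\<^sup>L (W n) g\<bar>" for \<xi> using gb[of \<xi>] unfolding d_def by linarith
    have i1: "integrable (W n) d" by (rule integrable_bounded_Pi[OF _ db]) measurable
    have i2: "integrable (W n) (\<lambda>\<xi>. (d \<xi>)\<^sup>2)"
      by (rule integrable_bounded_Pi[where B="(\<beta> / Im z + \<bar>integral\<^sup>L (W n) g\<bar>)\<^sup>2"])
        (use power_mono[OF db, where n=2] in auto)
    \<comment> \<open>The arithmetic-geometric mean inequality with weight \<open>t\<close> replaces Cauchy-Schwarz.\<close>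
    have "(\<integral>\<xi>. \<bar>d \<xi>\<bar> \<partial>W n) \<le> (\<integral>\<xi>. 1 / (2 * t) + t / 2 * (d \<xi>)\<^sup>2 \<partial>W n)"
    proof (rule integral_mono)
      show "integrable (W n) (\<lambda>\<xi>. \<bar>d \<xi>\<bar>)" using i1 by simp
      show "integrable (W n) (\<lambda>\<xi>. 1 / (2 * t) + t / 2 * (d \<xi>)\<^sup>2)" using i2 by simp
      fix \<xi>
      have "2 * 1 * (t * \<bar>d \<xi>\<bar>) \<le> 1\<^sup>2 + (t * \<bar>d \<xi>\<bar>)\<^sup>2" by (rule sum_squares_bound)
      then show "\<bar>d \<xi>\<bar> \<le> 1 / (2 * t) + t / 2 * (d \<xi>)\<^sup>2" using t by (simp add: field_simps power2_eq_square)
    qed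
    also have "\<dots> = 1 / (2 * t) + t / 2 * (\<integral>\<xi>. (d \<xi>)\<^sup>2 \<partial>W n)" using i2 by (simp add: PP.prob_space)
    also have "\<dots> \<le> 1 / (2 * t) + t / 2 * (V / real n)"
      using g2 t unfolding d_def by (intro add_left_mono mult_left_mono) auto
    also have "\<dots> = (1 + V) / (2 * t)" unfolding t(2)[symmetric] using t(1) by (simp add: field_simps)
    finally show ?thesis unfolding d_def .
  qed
  have iR: "integrable (W n) (\<lambda>\<xi>. \<bar>Re (f \<xi>) - Re m\<bar>)" "integrable (W n) (\<lambda>\<xi>. \<bar>Im (f \<xi>) - Im m\<bar>)" using int by auto
  have "(\<integral>\<xi>. cmod (f \<xi> - m) \<partial>W n) \<le> (\<integral>\<xi>. \<bar>Re (f \<xi>) - Re m\<bar> + \<bar>Im (f \<xi>) - Im m\<bar> \<partial>W n)"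
  proof (rule integral_mono)
    show "integrable (W n) (\<lambda>\<xi>. cmod (f \<xi> - m))" using int by auto
    show "integrable (W n) (\<lambda>\<xi>. \<bar>Re (f \<xi>) - Re m\<bar> + \<bar>Im (f \<xi>) - Im m\<bar>)" using iR by simp
    show "cmod (f \<xi> - m) \<le> \<bar>Re (f \<xi>) - Re m\<bar> + \<bar>Im (f \<xi>) - Im m\<bar>" for \<xi>
      using cmod_le[of "f \<xi> - m"] by simp
  qed
  also have "\<dots> = (\<integral>\<xi>. \<bar>Re (f \<xi>) - Re m\<bar> \<partial>W n) + (\<integral>\<xi>. \<bar>Im (f \<xi>) - Im m\<bar> \<partial>W n)" using iR by simp
  also have "\<dots> \<le> (1 + V) / (2 * t) + (1 + V) / (2 * t)"
    unfolding m f_def using l1[OF R(1-3)] l1[OF I(1-3)] by (intro add_mono)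
  also have "\<dots> = (1 + V) / t" using t by (simp add: field_simps)
  finally show "(\<integral>\<xi>. cmod (f \<xi> - integral\<^sup>L (W n) f) \<partial>W n) \<le> (1 + V) / sqrt (real n)" unfolding m_def t_def .
qed

end

end

section \<open>The mean of a resolvent trace\<close>

lemma resolvent_difference_two_matrices:
  assumes A: "A \<in> carrier_mat n n" "transpose_mat A = A" and T: "T \<in> carrier_mat n n" "transpose_mat T = T"
    and z: "0 < Im z" and w: "0 < Im w"
  shows "resolvent A w = resolvent T z + (resolvent A w * (cmat (T - A) + (w - z) \<cdot>\<^sub>m 1\<^sub>m n)) * resolvent T z"
proof -
  define X where "X = cmat T - z \<cdot>\<^sub>m 1\<^sub>m n"
  define Y where "Y = cmat A - w \<cdot>\<^sub>m 1\<^sub>m n"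
  define R where "R = resolvent T z"
  define Q where "Q = resolvent A w"
  have c: "X \<in> carrier_mat n n" "Y \<in> carrier_mat n n" "R \<in> carrier_mat n n" "Q \<in> carrier_mat n n"
    using A T by (auto simp: X_def Y_def R_def Q_def minus_carrier_mat)
  have d: "cmat (T - A) + (w - z) \<cdot>\<^sub>m 1\<^sub>m n = X - Y" unfolding X_def Y_def using A T
    by (intro eq_matI) (auto simp: algebra_simps)
  have "Q * (X - Y) * R = Q * X * R - Q * Y * R"
    using c by (simp add: mult_minus_distrib_mat minus_mult_distrib_mat[of _ n n _ _ n])
  also have "Q * X * R = Q * (X * R)" using c by simp
  also have "X * R = 1\<^sub>m n" using resolvent_inverse(1)[OF T z] by (simp add: X_def R_def)
  also have "Q * Y = 1\<^sub>m n" using resolvent_inverse(2)[OF A w] by (simp add: Y_def Q_def)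
  finally have "Q * (X - Y) * R = Q - R" using c by simp
  moreover have "R + (Q - R) = Q" using c by (intro eq_matI) auto
  ultimately show ?thesis unfolding d R_def[symmetric] Q_def[symmetric] by simp
qed

text \<open>
  An exact identity. The choice \<open>B' = B (A - w)\<^sup>-\<^sup>1\<close> makes the left side the error of
  replacing \<open>R\<close> by \<open>(A - w)\<^sup>-\<^sup>1\<close>; the point \<open>w\<close> will be
  chosen so that the two terms on the right cancel in the mean.
\<close>

lemma mat_trace_deterministic_equivalent:
  fixes c :: real and \<xi> :: "nat \<times> nat \<Rightarrow> real"
  assumes A: "A \<in> carrier_mat n n" "transpose_mat A = A" and z: "0 < Im z" and w: "0 < Im w"
    and B: "B \<in> carrier_mat n n"
  defines "R \<equiv> noisy_resolvent n A c z \<xi>" and "B' \<equiv> B * resolvent A w"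
  shows "mat_trace B' - mat_trace (B * R) = of_real c * mat_trace (cmat (symmat n \<xi>) * (R * B')) + (w - z) * mat_trace (R * B')"
proof -
  define S where "S = cmat (symmat n \<xi>)"
  define Q where "Q = resolvent A w"
  have cr: "Q \<in> carrier_mat n n" "R \<in> carrier_mat n n" "S \<in> carrier_mat n n" "B' \<in> carrier_mat n n"
    using A B z by (auto simp: Q_def R_def S_def B'_def)
  have "(A + c \<cdot>\<^sub>m symmat n \<xi>) - A = c \<cdot>\<^sub>m symmat n \<xi>" using A by (intro eq_matI) (auto simp: symmat_def)
  moreover have "cmat (c \<cdot>\<^sub>m symmat n \<xi>) = of_real c \<cdot>\<^sub>m S" unfolding S_def by (intro eq_matI) auto
  ultimately have Q: "Q = R + (Q * (of_real c \<cdot>\<^sub>m S + (w - z) \<cdot>\<^sub>m 1\<^sub>m n)) * R"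
    using resolvent_difference_two_matrices[OF A perturbed_symmetric[OF A z] z w, of c \<xi>]
    unfolding R_def noisy_resolvent_def Q_def by simp
  have D: "of_real c \<cdot>\<^sub>m S + (w - z) \<cdot>\<^sub>m 1\<^sub>m n \<in> carrier_mat n n" using cr by simp
  have "B' = B * R + B * ((Q * (of_real c \<cdot>\<^sub>m S + (w - z) \<cdot>\<^sub>m 1\<^sub>m n)) * R)"
    unfolding B'_def Q_def[symmetric] by (subst Q) (rule mult_add_distrib_mat[OF B], use cr D in auto)
  also have "B * ((Q * (of_real c \<cdot>\<^sub>m S + (w - z) \<cdot>\<^sub>m 1\<^sub>m n)) * R) = B' * ((of_real c \<cdot>\<^sub>m S + (w - z) \<cdot>\<^sub>m 1\<^sub>m n) * R)"
    unfolding B'_def Q_def[symmetric]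
    by (simp only: assoc_mult_mat[OF cr(1) D cr(2)] assoc_mult_mat[OF B cr(1) mult_carrier_mat[OF D cr(2)]])
  finally have "mat_trace B' = mat_trace (B * R) + mat_trace (B' * ((of_real c \<cdot>\<^sub>m S + (w - z) \<cdot>\<^sub>m 1\<^sub>m n) * R))"
    using mat_trace_add[of "B * R" n "B' * ((of_real c \<cdot>\<^sub>m S + (w - z) \<cdot>\<^sub>m 1\<^sub>m n) * R)"] B cr D by simp
  also have "mat_trace (B' * ((of_real c \<cdot>\<^sub>m S + (w - z) \<cdot>\<^sub>m 1\<^sub>m n) * R)) = mat_trace ((of_real c \<cdot>\<^sub>m S + (w - z) \<cdot>\<^sub>m 1\<^sub>m n) * (R * B'))"
    using mat_trace_comm[OF cr(4), of "(of_real c \<cdot>\<^sub>m S + (w - z) \<cdot>\<^sub>m 1\<^sub>m n) * R"] assoc_mult_mat[OF D cr(2,4)] D cr by simp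
  also have "(of_real c \<cdot>\<^sub>m S + (w - z) \<cdot>\<^sub>m 1\<^sub>m n) * (R * B') = of_real c \<cdot>\<^sub>m (S * (R * B')) + (w - z) \<cdot>\<^sub>m (R * B')"
  proof -
    have Y: "R * B' \<in> carrier_mat n n" using cr by simp
    show ?thesis
      using add_mult_distrib_mat[of "of_real c \<cdot>\<^sub>m S" n n "(w - z) \<cdot>\<^sub>m 1\<^sub>m n" "R * B'" n] cr(3) Y
        mult_smult_assoc_mat[OF cr(3) Y] mult_smult_assoc_mat[OF one_carrier_mat Y] left_mult_one_mat[OF Y] by simp
  qed
  also have "mat_trace \<dots> = of_real c * mat_trace (S * (R * B')) + (w - z) * mat_trace (R * B')"
    using cr by (subst mat_trace_add[of _ n]) (auto simp: mat_trace_smult[of _ n])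
  finally show ?thesis by (simp add: S_def)
qed

lemma op_bound_mono: "op_bound n C X \<Longrightarrow> C \<le> D \<Longrightarrow> op_bound n D X"
  unfolding op_bound_def by (meson mult_right_mono order_trans vnorm_nonneg)

context wigner_law
begin

context
  fixes n :: nat and A :: "real mat" and z :: complex
  assumes n: "0 < n" and A: "A \<in> carrier_mat n n" "transpose_mat A = A" and z: "0 < Im z"
begin

text \<open>
  Integration by parts in one entry, up to an error \<open>O(c\<^sup>2)\<close>: the mean of
  \<open>\<xi>\<^sub>p tr (E R B)\<close> is \<open>- c v\<close> times the mean of \<open>tr (E R E R
  B)\<close>. For centred Gaussian entries this is Stein's identity, without error; for a general law it
  follows from the second-order expansion.
\<close>

lemma entry_bias:
  fixes c :: real
  assumes B: "op_bound n \<beta> B" and \<beta>: "0 \<le> \<beta>" and p: "p \<in> upper n"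
  defines "v \<equiv> integral\<^sup>L (\<nu> p) (\<lambda>x. x\<^sup>2)"
  defines "\<Psi> \<equiv> \<lambda>\<xi>. of_real (\<xi> p) * term0 n A c z B p \<xi> + of_real (c * v) * term1 n A c z B p \<xi>"
  shows "integrable (W n) \<Psi>" and "cmod (integral\<^sup>L (W n) \<Psi>) \<le> 3 * \<beta> * c\<^sup>2 * (q + q\<^sup>2) / (Im z) ^ 3"
proof -
  interpret PP: prob_space "W n" by (rule prob_Pi)
  note Bc = op_bound_carrier[OF B]
  have mB: "meas_mat (W n) n (\<lambda>_. B)" by (rule meas_mat_const[OF Bc])
  have mE: "meas_mat (W n) n (\<lambda>_. cmat (unit_sym n p))" by (rule meas_mat_const) simp
  note mR = meas_noisy_resolvent_W[OF n A z, of c] and mR0 = meas_pres0[OF n A z, of c p]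
  have m0: "meas_mat (W n) n (\<lambda>\<xi>. noisy_resolvent n A c z \<xi> * B)" "meas_mat (W n) n (\<lambda>\<xi>. noisy_resolvent n A c z (\<xi>(p := 0)) * B)"
    by (rule meas_mat_mult[OF mR mB], rule meas_mat_mult[OF mR0 mB])
  have mt0[measurable]: "(\<lambda>\<xi>. term0 n A c z B p \<xi>) \<in> borel_measurable (W n)"
      "(\<lambda>\<xi>. term0 n A c z B p (\<xi>(p := 0))) \<in> borel_measurable (W n)"
    unfolding term0_def[OF A z B \<beta>]
    by (rule meas_mat_mat_trace[OF meas_mat_mult[OF mE m0(1)]], rule meas_mat_mat_trace[OF meas_mat_mult[OF mE m0(2)]])
  have mt1[measurable]: "(\<lambda>\<xi>. term1 n A c z B p \<xi>) \<in> borel_measurable (W n)"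
      "(\<lambda>\<xi>. term1 n A c z B p (\<xi>(p := 0))) \<in> borel_measurable (W n)"
    unfolding term1_def[OF A z B \<beta>]
    by (rule meas_mat_mat_trace[OF meas_mat_mult[OF mE meas_mat_mult[OF mR meas_mat_mult[OF mE m0(1)]]]],
        rule meas_mat_mat_trace[OF meas_mat_mult[OF mE meas_mat_mult[OF mR0 meas_mat_mult[OF mE m0(2)]]]])
  have [measurable]: "(\<lambda>\<xi>. \<xi> p) \<in> borel_measurable (W n)" using p by (rule component_measurable)
  have v: "0 \<le> v" "v \<le> q" unfolding v_def using m2[of p] by (auto intro!: Bochner_Integration.integral_nonneg)
  interpret N: prob_space "\<nu> p" by (rule prob)
  define a where "a \<xi> = complex_of_real (\<xi> p) * term0 n A c z B p (\<xi>(p := 0))" for \<xi>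
  define b where "b \<xi> = complex_of_real (c * ((\<xi> p)\<^sup>2 - v)) * term1 n A c z B p (\<xi>(p := 0))" for \<xi>
  have a: "integrable (W n) a" "integral\<^sup>L (W n) a = 0"
    unfolding a_def
    by (rule integral_component_mult_zero[where g="\<lambda>x. x", OF p _ integrable_id mean0 mt0(2) term0_le[OF A z B \<beta> p]], simp)+
  have gi: "integrable (\<nu> p) (\<lambda>x. c * (x\<^sup>2 - v))" using i2[of p] by simp
  have g0: "integral\<^sup>L (\<nu> p) (\<lambda>x. c * (x\<^sup>2 - v)) = 0" using i2[of p] by (simp add: v_def)
  have b: "integrable (W n) b" "integral\<^sup>L (W n) b = 0"
    unfolding b_def
    by (rule integral_component_mult_zero[where g="\<lambda>x. c * (x\<^sup>2 - v)", OF p _ gi g0 mt1(2) term1_le[OF A z B \<beta> p]], simp)+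
  define K where "K = 2 * \<beta> * c\<^sup>2 / (Im z) ^ 3"
  have K: "0 \<le> K" using \<beta> z by (simp add: K_def)
  \<comment> \<open>An upper bound of \<open>\<bar>\<xi> p\<bar>\<^sup>3 + 2 v \<bar>\<xi> p\<bar>\<close> in terms of even powers, whose moments are controlled.\<close>
  define D where "D \<xi> = (\<xi> p ^ 4 + (\<xi> p)\<^sup>2) / 2 + v * (1 + (\<xi> p)\<^sup>2)" for \<xi> :: "nat \<times> nat \<Rightarrow> real"
  have c4: "integrable (W n) (\<lambda>\<xi>. \<xi> p ^ 4)" "integral\<^sup>L (W n) (\<lambda>\<xi>. \<xi> p ^ 4) \<le> q\<^sup>2"
  proof -
    show "integrable (W n) (\<lambda>\<xi>. \<xi> p ^ 4)" by (rule integral_component(2)[where g="\<lambda>x. x ^ 4", OF p _ i4]) simp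
    have "integral\<^sup>L (W n) (\<lambda>\<xi>. \<xi> p ^ 4) = integral\<^sup>L (\<nu> p) (\<lambda>x. x ^ 4)"
      by (rule integral_component(1)[where g="\<lambda>x. x ^ 4", OF p]) simp
    then show "integral\<^sup>L (W n) (\<lambda>\<xi>. \<xi> p ^ 4) \<le> q\<^sup>2" using m4[of p] by (rule ord_eq_le_trans)
  qed
  have c2: "integrable (W n) (\<lambda>\<xi>. (\<xi> p)\<^sup>2)" "integral\<^sup>L (W n) (\<lambda>\<xi>. (\<xi> p)\<^sup>2) = v"
  proof -
    show "integrable (W n) (\<lambda>\<xi>. (\<xi> p)\<^sup>2)" by (rule integral_component(2)[where g="\<lambda>x. x\<^sup>2", OF p _ i2]) simp
    show "integral\<^sup>L (W n) (\<lambda>\<xi>. (\<xi> p)\<^sup>2) = v"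
      unfolding v_def by (rule integral_component(1)[where g="\<lambda>x. x\<^sup>2", OF p]) simp
  qed
  have D: "integrable (W n) D" unfolding D_def using c4 c2 by auto
  have ID: "integral\<^sup>L (W n) D \<le> 3 / 2 * (q + q\<^sup>2)"
  proof -
    have "integral\<^sup>L (W n) D = (integral\<^sup>L (W n) (\<lambda>\<xi>. \<xi> p ^ 4) + v) / 2 + v * (1 + v)"
      unfolding D_def using c4 c2 by (simp add: PP.prob_space)
    also have "\<dots> \<le> (q\<^sup>2 + q) / 2 + q * (1 + q)"
      using c4 v by (intro add_mono divide_right_mono mult_mono) auto
    finally show ?thesis by (simp add: power2_eq_square field_simps)
  qed
  have rem: "cmod (\<Psi> \<xi> - (a \<xi> - b \<xi>)) \<le> K * D \<xi>" for \<xi>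
  proof -
    define x where "x = \<xi> p"
    have x1: "2 * \<bar>x\<bar> \<le> 1 + x\<^sup>2" using sum_squares_bound[of 1 "\<bar>x\<bar>"] by simp
    have "\<bar>x\<bar> ^ 3 = x\<^sup>2 * \<bar>x\<bar>" by (simp add: power3_eq_cube power2_eq_square)
    also have "\<dots> \<le> x\<^sup>2 * ((1 + x\<^sup>2) / 2)" using x1 by (intro mult_left_mono) auto
    finally have x3: "\<bar>x\<bar> ^ 3 \<le> (x ^ 4 + x\<^sup>2) / 2" by (simp add: power4_eq_xxxx power2_eq_square field_simps)
    have "\<bar>x\<bar> ^ 3 + 2 * \<bar>v\<bar> * \<bar>x\<bar> \<le> D \<xi>"
    proof -
      have "2 * v * \<bar>x\<bar> = v * (2 * \<bar>x\<bar>)" by simp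
      then show ?thesis using x3 mult_left_mono[OF x1 v(1)] unfolding D_def x_def[symmetric] abs_of_nonneg[OF v(1)] by linarith
    qed
    then have "K * (\<bar>x\<bar> ^ 3 + 2 * \<bar>v\<bar> * \<bar>x\<bar>) \<le> K * D \<xi>" using K by (intro mult_left_mono)
    then show ?thesis
      using second_order_expansion[OF A z B \<beta> p, of \<xi> c v]
      unfolding \<Psi>_def a_def b_def K_def x_def by (rule order_trans[rotated])
  qed
  have [measurable]: "\<Psi> \<in> borel_measurable (W n)" unfolding \<Psi>_def by measurable
  have [measurable]: "a \<in> borel_measurable (W n)" "b \<in> borel_measurable (W n)" using a b by auto
  have iR: "integrable (W n) (\<lambda>\<xi>. \<Psi> \<xi> - (a \<xi> - b \<xi>))"
  proof (rule Bochner_Integration.integrable_bound)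
    show "integrable (W n) (\<lambda>\<xi>. K * D \<xi>)" using D by simp
    show "AE \<xi> in W n. norm (\<Psi> \<xi> - (a \<xi> - b \<xi>)) \<le> norm (K * D \<xi>)"
    proof (rule AE_I2)
      fix \<xi> show "norm (\<Psi> \<xi> - (a \<xi> - b \<xi>)) \<le> norm (K * D \<xi>)" using rem[of \<xi>] by simp
    qed
  qed measurable
  have "integrable (W n) (\<lambda>\<xi>. (\<Psi> \<xi> - (a \<xi> - b \<xi>)) + (a \<xi> - b \<xi>))" using iR a b by (intro Bochner_Integration.integrable_add) auto
  then show int: "integrable (W n) \<Psi>" by simp
  have "integral\<^sup>L (W n) \<Psi> = integral\<^sup>L (W n) (\<lambda>\<xi>. \<Psi> \<xi> - (a \<xi> - b \<xi>))"
    using int a b by simp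
  also have "cmod \<dots> \<le> (\<integral>\<xi>. cmod (\<Psi> \<xi> - (a \<xi> - b \<xi>)) \<partial>W n)" by (rule integral_norm_bound)
  also have "\<dots> \<le> (\<integral>\<xi>. K * D \<xi> \<partial>W n)" using iR D rem by (intro integral_mono) auto
  also have "\<dots> = K * integral\<^sup>L (W n) D" by (rule integral_mult_right_zero)
  also have "\<dots> \<le> K * (3 / 2 * (q + q\<^sup>2))" by (rule mult_left_mono[OF ID K])
  also have "\<dots> = 3 * \<beta> * c\<^sup>2 * (q + q\<^sup>2) / (Im z) ^ 3" by (simp add: K_def)
  finally show "cmod (integral\<^sup>L (W n) \<Psi>) \<le> 3 * \<beta> * c\<^sup>2 * (q + q\<^sup>2) / (Im z) ^ 3" .
qed

text \<open>
  The sum over entries weighted with their second moments differs from the pure contraction only on the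
  diagonal, where the variance may differ from 1; this and the two lower-order terms of
  \<open>sum_unit_sym_contraction\<close> are \<open>O(n)\<close>.
\<close>

lemma contraction_error:
  fixes c :: real and \<xi> :: "nat \<times> nat \<Rightarrow> real"
  assumes B: "op_bound n \<beta> B" and \<beta>: "0 \<le> \<beta>"
  defines "v \<equiv> \<lambda>p. integral\<^sup>L (\<nu> p) (\<lambda>x. x\<^sup>2)" and "R \<equiv> noisy_resolvent n A c z \<xi>"
  shows "cmod (mat_trace R * mat_trace (R * B) - (\<Sum>p\<in>upper n. of_real (v p) * term1 n A c z B p \<xi>)) \<le>
    real n * (2 * q + 4) * (\<beta> / (Im z)\<^sup>2)"
proof -
  define Y where "Y = R * B"
  define b where "b = \<beta> / (Im z)\<^sup>2"
  have b0: "0 \<le> b" using \<beta> by (simp add: b_def)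
  have oR: "op_bound n (1 / Im z) R" unfolding R_def by (rule noisy_resolvent_op_bound[OF A z])
  have oY: "op_bound n (1 / Im z * \<beta>) Y" unfolding Y_def using oR B z by (intro op_bound_mult) auto
  have oRY: "op_bound n b (R * Y)"
    using op_bound_mult[OF oR oY] z by (simp add: b_def power2_eq_square)
  have cr: "R \<in> carrier_mat n n" "Y \<in> carrier_mat n n" using oR oY by (auto dest: op_bound_carrier)
  have sym: "transpose_mat R = R" unfolding R_def by (rule noisy_resolvent_transpose[OF A z])
  have t1: "term1 n A c z B p \<xi> = mat_trace (cmat (unit_sym n p) * (R * (cmat (unit_sym n p) * Y)))" for p
    by (simp add: term1_def[OF A z B \<beta>] R_def Y_def)
  have t1b: "cmod (term1 n A c z B p \<xi>) \<le> 2 * b" if "p \<in> upper n" for p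
    unfolding b_def by (rule term1_le[OF A z B \<beta> that])
  have v: "0 \<le> v p" "v p \<le> q" for p unfolding v_def using m2[of p] by (auto intro!: Bochner_Integration.integral_nonneg)
  have v1: "v (i, j) = 1" if "i < j" for i j unfolding v_def using var1[OF that] .
  have "mat_trace R * mat_trace Y - (\<Sum>p\<in>upper n. of_real (v p) * term1 n A c z B p \<xi>) =
      (\<Sum>p\<in>upper n. of_real (1 - v p) * term1 n A c z B p \<xi>) - mat_trace (R * Y) + (\<Sum>i<n. R $$ (i, i) * Y $$ (i, i))"
    using sum_unit_sym_contraction[OF cr sym] unfolding t1[symmetric]
    by (simp add: left_diff_distrib sum_subtractf)
  also have "cmod \<dots> \<le> cmod (\<Sum>p\<in>upper n. of_real (1 - v p) * term1 n A c z B p \<xi>) + cmod (mat_trace (R * Y)) + cmod (\<Sum>i<n. R $$ (i, i) * Y $$ (i, i))"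
    by (rule order_trans[OF norm_triangle_ineq add_right_mono[OF norm_triangle_ineq4]])
  also have "cmod (mat_trace (R * Y)) \<le> real n * b" by (rule op_bound_mat_trace[OF oRY])
  also have "cmod (\<Sum>i<n. R $$ (i, i) * Y $$ (i, i)) \<le> (\<Sum>i<n. b)"
  proof (rule sum_norm_le)
    fix i assume "i \<in> {..<n}"
    then have "cmod (R $$ (i, i)) * cmod (Y $$ (i, i)) \<le> (1 / Im z) * (1 / Im z * \<beta>)"
      using oR oY z by (intro mult_mono op_bound_entry) auto
    then show "cmod (R $$ (i, i) * Y $$ (i, i)) \<le> b" by (simp add: norm_mult b_def power2_eq_square)
  qed
  also have "cmod (\<Sum>p\<in>upper n. of_real (1 - v p) * term1 n A c z B p \<xi>) \<le> real n * (1 + q) * (2 * b)"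
  proof -
    define g where "g p = of_real (1 - v p) * term1 n A c z B p \<xi>" for p
    have "(\<lambda>i. (i, i)) ` {..<n} \<subseteq> upper n" by (auto simp: upper_def)
    then have "(\<Sum>p\<in>upper n. g p) = (\<Sum>p\<in>(\<lambda>i. (i, i)) ` {..<n}. g p)"
    proof (rule sum.mono_neutral_right[OF finite_upper])
      show "\<forall>p\<in>upper n - (\<lambda>i. (i, i)) ` {..<n}. g p = 0"
      proof
        fix p assume p: "p \<in> upper n - (\<lambda>i. (i, i)) ` {..<n}"
        then obtain i j where "p = (i, j)" "i < j" by (cases p) (auto simp: upper_def image_iff le_less)
        then show "g p = 0" using v1 by (simp add: g_def)
      qed
    qed
    also have "cmod \<dots> \<le> (\<Sum>p\<in>(\<lambda>i. (i, i)) ` {..<n}. (1 + q) * (2 * b))"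
    proof (rule sum_norm_le)
      fix p assume "p \<in> (\<lambda>i. (i, i)) ` {..<n}"
      then have "p \<in> upper n" by (auto simp: upper_def)
      moreover have "\<bar>1 - v p\<bar> \<le> 1 + q" using v[of p] by (auto simp: abs_le_iff)
      ultimately have "\<bar>1 - v p\<bar> * cmod (term1 n A c z B p \<xi>) \<le> (1 + q) * (2 * b)"
        using t1b q by (intro mult_mono) auto
      then show "cmod (g p) \<le> (1 + q) * (2 * b)" unfolding g_def by (simp only: norm_mult norm_of_real)
    qed
    also have "\<dots> = real n * (1 + q) * (2 * b)" by (simp add: card_image inj_on_def)
    finally show ?thesis unfolding g_def .
  qed
  finally show ?thesis unfolding Y_def[symmetric] b_def[symmetric] by (simp add: algebra_simps)
qed

text \<open>
  With \<open>w = z + s\<^sup>2 m\<close> the error of the equivalent splits into three parts: the bias of the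
  \<open>n\<^sup>2\<close> entries, each \<open>O(c\<^sup>2)\<close>, with prefactor \<open>c / n\<close>; the
  contraction error; and the fluctuation of the normalized trace around its mean \<open>m\<close>. Each of
  them is \<open>O(n\<^sup>-\<^sup>1\<^sup>/\<^sup>2)\<close>.
\<close>

lemma mean_deterministic_equivalent:
  assumes B: "op_bound n \<beta> B" and \<beta>: "0 \<le> \<beta>" and s: "0 \<le> s"
  defines "R \<equiv> noisy_resolvent n A (s / sqrt (real n)) z" and "\<eta> \<equiv> Im z"
  defines "m \<equiv> integral\<^sup>L (W n) (\<lambda>\<xi>. normalized_trace n (R \<xi>))"
  shows "cmod (integral\<^sup>L (W n) (\<lambda>\<xi>. normalized_trace n (B * R \<xi>)) - normalized_trace n (B * resolvent A (z + of_real (s\<^sup>2) * m)))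
    \<le> (3 * s ^ 3 * (\<beta> / \<eta>) * (q + q\<^sup>2) / \<eta> ^ 3 + s\<^sup>2 * (2 * q + 4) * (\<beta> / \<eta> / \<eta>\<^sup>2)
        + s\<^sup>2 * (\<beta> / \<eta>\<^sup>2) * (1 + 16 * s\<^sup>2 * q / \<eta> ^ 4)) / sqrt (real n)"
    and "0 \<le> Im m"
proof -
  interpret PP: prob_space "W n" by (rule prob_Pi)
  define c where "c = s / sqrt (real n)"
  have c0: "0 \<le> c" using s by (simp add: c_def)
  have \<eta>: "0 < \<eta>" using z by (simp add: \<eta>_def)
  have oR: "op_bound n (1 / \<eta>) (R \<xi>)" for \<xi> unfolding R_def \<eta>_def by (rule noisy_resolvent_op_bound[OF A z])
  have cR: "R \<xi> \<in> carrier_mat n n" for \<xi> using oR by (rule op_bound_carrier)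
  have o1: "op_bound n 1 (1\<^sub>m n)" by (simp add: op_bound_def)
  have one: "1\<^sub>m n * R \<xi> = R \<xi>" for \<xi> using cR[of \<xi>] by simp
  have dev: "(\<integral>\<xi>. cmod (normalized_trace n (R \<xi>) - m) \<partial>W n) \<le> (1 + 16 * s\<^sup>2 * q / \<eta> ^ 4) / sqrt (real n)" "integrable (W n) (\<lambda>\<xi>. normalized_trace n (R \<xi>))"
    using normalized_trace_noisy_resolvent_mean_deviation[OF n A z o1 _ s] one unfolding m_def R_def \<eta>_def by auto
  show Im_m: "0 \<le> Im m"
  proof -
    have "0 \<le> Im (normalized_trace n (R \<xi>))" for \<xi>
    proof -
      have "Im (normalized_trace n (R \<xi>)) = (\<Sum>i<n. Im (R \<xi> $$ (i, i))) / real n"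
        using cR[of \<xi>] by (simp add: normalized_trace_def mat_trace_def)
      moreover have "0 \<le> Im (R \<xi> $$ (i, i))" if "i < n" for i
        unfolding R_def noisy_resolvent_def by (rule resolvent_Im_diag[OF perturbed_symmetric[OF A z] z that])
      ultimately show ?thesis by (auto intro!: divide_nonneg_nonneg sum_nonneg)
    qed
    then have "0 \<le> (\<integral>\<xi>. Im (normalized_trace n (R \<xi>)) \<partial>W n)" by (intro Bochner_Integration.integral_nonneg)
    then show ?thesis unfolding m_def using dev(2) by simp
  qed
  define w where "w = z + of_real (s\<^sup>2) * m"
  have w: "\<eta> \<le> Im w" "0 < Im w" using Im_m \<eta> by (auto simp: w_def \<eta>_def add_pos_nonneg)
  define B' where "B' = B * resolvent A w"
  define \<beta>' where "\<beta>' = \<beta> / \<eta>"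
  have \<beta>': "0 \<le> \<beta>'" using \<beta> \<eta> by (simp add: \<beta>'_def)
  have oB': "op_bound n \<beta>' B'"
  proof -
    have "op_bound n (1 / \<eta>) (resolvent A w)"
      using w \<eta> by (intro op_bound_mono[OF resolvent_op_bound[OF A w(2)]] divide_left_mono) auto
    then have "op_bound n (\<beta> * (1 / \<eta>)) B'" unfolding B'_def using B \<beta> by (intro op_bound_mult) auto
    then show ?thesis by (simp add: \<beta>'_def)
  qed
  note cB = op_bound_carrier[OF B] op_bound_carrier[OF oB']
  define v where "v p = integral\<^sup>L (\<nu> p) (\<lambda>x. x\<^sup>2)" for p
  define t0 where "t0 = term0 n A c z B'"
  define t1 where "t1 = term1 n A c z B'"
  define \<Psi> where "\<Psi> p \<xi> = of_real (\<xi> p) * t0 p \<xi> + of_real (c * v p) * t1 p \<xi>" for p \<xi>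
  \<comment> \<open>Entry bias, contraction error and fluctuation of the trace.\<close>
  define X1 where "X1 \<xi> = of_real (c / real n) * (\<Sum>p\<in>upper n. \<Psi> p \<xi>)" for \<xi>
  define X2 where "X2 \<xi> = of_real (c\<^sup>2 / real n) * (mat_trace (R \<xi>) * mat_trace (R \<xi> * B') - (\<Sum>p\<in>upper n. of_real (v p) * t1 p \<xi>))" for \<xi>
  define X3 where "X3 \<xi> = of_real (s\<^sup>2) * (m - normalized_trace n (R \<xi>)) * normalized_trace n (R \<xi> * B')" for \<xi>
  have c2n: "c\<^sup>2 * real n = s\<^sup>2" using n by (simp add: c_def power_divide)
  have key: "normalized_trace n B' - normalized_trace n (B * R \<xi>) = X1 \<xi> + X2 \<xi> + X3 \<xi>" for \<xi>
  proof -
    have "mat_trace B' - mat_trace (B * R \<xi>) = of_real c * mat_trace (cmat (symmat n \<xi>) * (R \<xi> * B')) + of_real (s\<^sup>2) * m * mat_trace (R \<xi> * B')"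
      using mat_trace_deterministic_equivalent[OF A z w(2) cB(1), of c \<xi>] unfolding B'_def R_def c_def w_def by simp
    also have "mat_trace (cmat (symmat n \<xi>) * (R \<xi> * B')) = (\<Sum>p\<in>upper n. of_real (\<xi> p) * t0 p \<xi>)"
      using mat_trace_symmat[of "R \<xi> * B'" n \<xi>] cR[of \<xi>] cB
      unfolding t0_def term0_def[OF A z oB' \<beta>', abs_def] R_def c_def by simp
    finally have "(mat_trace B' - mat_trace (B * R \<xi>)) / of_nat n = of_real (c / real n) * (\<Sum>p\<in>upper n. of_real (\<xi> p) * t0 p \<xi>)
        + of_real (s\<^sup>2) * m * normalized_trace n (R \<xi> * B')"
      by (simp add: normalized_trace_def add_divide_distrib)
    moreover have "(\<Sum>p\<in>upper n. of_real (\<xi> p) * t0 p \<xi>) = (\<Sum>p\<in>upper n. \<Psi> p \<xi>) - of_real c * (\<Sum>p\<in>upper n. of_real (v p) * t1 p \<xi>)"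
      by (simp add: \<Psi>_def sum.distrib sum_distrib_left mult.assoc)
    moreover have "of_real (c\<^sup>2 / real n) * (mat_trace (R \<xi>) * mat_trace (R \<xi> * B')) = of_real (s\<^sup>2) * normalized_trace n (R \<xi>) * normalized_trace n (R \<xi> * B')"
      unfolding c2n[symmetric] normalized_trace_def using n by (simp add: field_simps power2_eq_square)
    ultimately show ?thesis
      unfolding X1_def X2_def X3_def by (simp add: normalized_trace_def diff_divide_distrib algebra_simps power2_eq_square)
  qed
  have i\<Psi>: "integrable (W n) (\<Psi> p)" "cmod (integral\<^sup>L (W n) (\<Psi> p)) \<le> 3 * \<beta>' * c\<^sup>2 * (q + q\<^sup>2) / \<eta> ^ 3" if "p \<in> upper n" for p
    unfolding \<Psi>_def v_def t0_def t1_def \<eta>_def using entry_bias[OF oB' \<beta>' that, of c] by auto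
  have i1: "integrable (W n) X1" unfolding X1_def using i\<Psi> by auto
  have mR: "meas_mat (W n) n R" unfolding R_def by (rule meas_noisy_resolvent_W[OF n A z])
  have mRB: "meas_mat (W n) n (\<lambda>\<xi>. R \<xi> * B')" by (rule meas_mat_mult[OF mR meas_mat_const[OF cB(2)]])
  have [measurable]: "(\<lambda>\<xi>. normalized_trace n (R \<xi>)) \<in> borel_measurable (W n)" using dev(2) by auto
  have mB[measurable]: "(\<lambda>\<xi>. normalized_trace n (R \<xi> * B')) \<in> borel_measurable (W n)" unfolding normalized_trace_def using meas_mat_mat_trace[OF mRB] by simp
  have oRB: "op_bound n (1 / \<eta> * \<beta>') (R \<xi> * B')" for \<xi> using oR oB' \<eta> by (intro op_bound_mult) auto
  have nRB: "cmod (normalized_trace n (R \<xi> * B')) \<le> \<beta> / \<eta>\<^sup>2" for \<xi>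
    using normalized_trace_le[OF oRB[of \<xi>]] \<beta> \<eta> by (simp add: \<beta>'_def power2_eq_square)
  have iB: "integrable (W n) (\<lambda>\<xi>. normalized_trace n (B * R \<xi>))" using normalized_trace_noisy_resolvent_mean_deviation(2)[OF n A z B \<beta> s] unfolding R_def .
  have i3: "integrable (W n) X3"
  proof (rule Bochner_Integration.integrable_bound[where f="\<lambda>\<xi>. s\<^sup>2 * (cmod (normalized_trace n (R \<xi>) - m) * (\<beta> / \<eta>\<^sup>2))"])
    show "integrable (W n) (\<lambda>\<xi>. s\<^sup>2 * (cmod (normalized_trace n (R \<xi>) - m) * (\<beta> / \<eta>\<^sup>2)))" using dev(2) by auto
    show "X3 \<in> borel_measurable (W n)" unfolding X3_def by measurable
    show "AE \<xi> in W n. norm (X3 \<xi>) \<le> norm (s\<^sup>2 * (cmod (normalized_trace n (R \<xi>) - m) * (\<beta> / \<eta>\<^sup>2)))"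
    proof (rule AE_I2)
      fix \<xi>
      have "norm (X3 \<xi>) = s\<^sup>2 * (cmod (normalized_trace n (R \<xi>) - m) * cmod (normalized_trace n (R \<xi> * B')))"
        by (simp only: X3_def norm_mult norm_of_real abs_power2 norm_minus_commute mult.assoc)
      also have "\<dots> \<le> s\<^sup>2 * (cmod (normalized_trace n (R \<xi>) - m) * (\<beta> / \<eta>\<^sup>2))" by (intro mult_left_mono nRB) auto
      also have "\<dots> \<le> norm (s\<^sup>2 * (cmod (normalized_trace n (R \<xi>) - m) * (\<beta> / \<eta>\<^sup>2)))" by (simp only: real_norm_def abs_ge_self)
      finally show "norm (X3 \<xi>) \<le> norm (s\<^sup>2 * (cmod (normalized_trace n (R \<xi>) - m) * (\<beta> / \<eta>\<^sup>2)))" .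
    qed
  qed
  have X3: "cmod (integral\<^sup>L (W n) X3) \<le> s\<^sup>2 * (\<beta> / \<eta>\<^sup>2) * ((1 + 16 * s\<^sup>2 * q / \<eta> ^ 4) / sqrt (real n))"
  proof -
    have "cmod (integral\<^sup>L (W n) X3) \<le> (\<integral>\<xi>. cmod (X3 \<xi>) \<partial>W n)" by (rule integral_norm_bound)
    also have "\<dots> \<le> (\<integral>\<xi>. s\<^sup>2 * (\<beta> / \<eta>\<^sup>2) * cmod (normalized_trace n (R \<xi>) - m) \<partial>W n)"
    proof (rule integral_mono)
      show "integrable (W n) (\<lambda>\<xi>. cmod (X3 \<xi>))" using i3 by simp
      show "integrable (W n) (\<lambda>\<xi>. s\<^sup>2 * (\<beta> / \<eta>\<^sup>2) * cmod (normalized_trace n (R \<xi>) - m))" using dev(2) by auto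
      fix \<xi>
      have "cmod (X3 \<xi>) = s\<^sup>2 * (cmod (normalized_trace n (R \<xi>) - m) * cmod (normalized_trace n (R \<xi> * B')))"
        by (simp only: X3_def norm_mult norm_of_real abs_power2 norm_minus_commute mult.assoc)
      also have "\<dots> \<le> s\<^sup>2 * (cmod (normalized_trace n (R \<xi>) - m) * (\<beta> / \<eta>\<^sup>2))" by (intro mult_left_mono nRB) auto
      finally show "cmod (X3 \<xi>) \<le> s\<^sup>2 * (\<beta> / \<eta>\<^sup>2) * cmod (normalized_trace n (R \<xi>) - m)" by (simp add: mult_ac)
    qed
    also have "\<dots> = s\<^sup>2 * (\<beta> / \<eta>\<^sup>2) * (\<integral>\<xi>. cmod (normalized_trace n (R \<xi>) - m) \<partial>W n)" by (rule integral_mult_right_zero)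
    also have "\<dots> \<le> s\<^sup>2 * (\<beta> / \<eta>\<^sup>2) * ((1 + 16 * s\<^sup>2 * q / \<eta> ^ 4) / sqrt (real n))"
      using dev(1) \<beta> by (intro mult_left_mono) auto
    finally show ?thesis .
  qed
  have X2eq: "X2 \<xi> = normalized_trace n B' - normalized_trace n (B * R \<xi>) - X1 \<xi> - X3 \<xi>" for \<xi> using key[of \<xi>] by (simp add: algebra_simps)
  have i2: "integrable (W n) X2" unfolding X2eq[abs_def] using iB i1 i3 by auto
  have X1: "cmod (integral\<^sup>L (W n) X1) \<le> 3 * s ^ 3 * \<beta>' * (q + q\<^sup>2) / \<eta> ^ 3 / sqrt (real n)"
  proof -
    have "integral\<^sup>L (W n) X1 = of_real (c / real n) * (\<Sum>p\<in>upper n. integral\<^sup>L (W n) (\<Psi> p))"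
      unfolding X1_def using i\<Psi> by (simp add: Bochner_Integration.integral_sum)
    then have "cmod (integral\<^sup>L (W n) X1) = c / real n * cmod (\<Sum>p\<in>upper n. integral\<^sup>L (W n) (\<Psi> p))"
      using c0 by (simp add: norm_mult norm_divide)
    also have "\<dots> \<le> c / real n * (real (card (upper n)) * (3 * \<beta>' * c\<^sup>2 * (q + q\<^sup>2) / \<eta> ^ 3))"
    proof (intro mult_left_mono)
      show "cmod (\<Sum>p\<in>upper n. integral\<^sup>L (W n) (\<Psi> p)) \<le> real (card (upper n)) * (3 * \<beta>' * c\<^sup>2 * (q + q\<^sup>2) / \<eta> ^ 3)"
        using sum_norm_le[of "upper n" "\<lambda>p. integral\<^sup>L (W n) (\<Psi> p)" "\<lambda>_. 3 * \<beta>' * c\<^sup>2 * (q + q\<^sup>2) / \<eta> ^ 3"] i\<Psi>(2) by simp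
    qed (use c0 in simp)
    also have "\<dots> \<le> c / real n * ((real n)\<^sup>2 * (3 * \<beta>' * c\<^sup>2 * (q + q\<^sup>2) / \<eta> ^ 3))"
    proof (intro mult_left_mono mult_right_mono)
      show "real (card (upper n)) \<le> (real n)\<^sup>2" using card_upper_le[of n] by (metis of_nat_le_iff of_nat_power)
      show "0 \<le> 3 * \<beta>' * c\<^sup>2 * (q + q\<^sup>2) / \<eta> ^ 3" using \<beta>' \<eta> q by simp
    qed (use c0 in simp)
    also have "\<dots> = c * (c\<^sup>2 * real n) * (3 * \<beta>' * (q + q\<^sup>2) / \<eta> ^ 3)" using n by (simp add: power2_eq_square)
    also have "\<dots> = 3 * s ^ 3 * \<beta>' * (q + q\<^sup>2) / \<eta> ^ 3 / sqrt (real n)"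
      unfolding c2n by (simp add: c_def power2_eq_square power3_eq_cube mult_ac)
    finally show ?thesis .
  qed
  have X2: "cmod (integral\<^sup>L (W n) X2) \<le> s\<^sup>2 * (2 * q + 4) * (\<beta>' / \<eta>\<^sup>2) / sqrt (real n)"
  proof (rule integral_W_le)
    show "X2 \<in> borel_measurable (W n)" using i2 by auto
    fix \<xi>
    have "cmod (X2 \<xi>) = c\<^sup>2 / real n * cmod (mat_trace (R \<xi>) * mat_trace (R \<xi> * B') - (\<Sum>p\<in>upper n. of_real (v p) * t1 p \<xi>))"
      unfolding X2_def by (simp only: norm_mult norm_of_real) simp
    also have "\<dots> \<le> c\<^sup>2 / real n * (real n * (2 * q + 4) * (\<beta>' / \<eta>\<^sup>2))"
      using contraction_error[OF oB' \<beta>', of c \<xi>] unfolding R_def c_def t1_def v_def \<eta>_def by (intro mult_left_mono) auto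
    also have "\<dots> = s\<^sup>2 * (2 * q + 4) * (\<beta>' / \<eta>\<^sup>2) / real n" unfolding c2n[symmetric] using n by simp
    also have "\<dots> \<le> s\<^sup>2 * (2 * q + 4) * (\<beta>' / \<eta>\<^sup>2) / sqrt (real n)"
    proof (rule divide_left_mono)
      have "1 \<le> sqrt (real n)" using n by simp
      then have "sqrt (real n) * 1 \<le> sqrt (real n) * sqrt (real n)" by (intro mult_left_mono) auto
      then show "sqrt (real n) \<le> real n" by simp
    qed (use n q \<beta>' in auto)
    finally show "cmod (X2 \<xi>) \<le> s\<^sup>2 * (2 * q + 4) * (\<beta>' / \<eta>\<^sup>2) / sqrt (real n)" .
  qed
  have "normalized_trace n B' - integral\<^sup>L (W n) (\<lambda>\<xi>. normalized_trace n (B * R \<xi>)) = integral\<^sup>L (W n) (\<lambda>\<xi>. normalized_trace n B' - normalized_trace n (B * R \<xi>))"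
    using iB by (simp add: PP.prob_space)
  also have "\<dots> = integral\<^sup>L (W n) X1 + integral\<^sup>L (W n) X2 + integral\<^sup>L (W n) X3"
    unfolding key using i1 i2 i3 by simp
  finally have "cmod (integral\<^sup>L (W n) (\<lambda>\<xi>. normalized_trace n (B * R \<xi>)) - normalized_trace n B') =
      cmod (integral\<^sup>L (W n) X1 + integral\<^sup>L (W n) X2 + integral\<^sup>L (W n) X3)"
    by (metis norm_minus_commute)
  also have "\<dots> \<le> cmod (integral\<^sup>L (W n) X1) + cmod (integral\<^sup>L (W n) X2) + cmod (integral\<^sup>L (W n) X3)"
    by (rule order_trans[OF norm_triangle_ineq add_right_mono[OF norm_triangle_ineq]])
  also have "\<dots> \<le> 3 * s ^ 3 * \<beta>' * (q + q\<^sup>2) / \<eta> ^ 3 / sqrt (real n) + s\<^sup>2 * (2 * q + 4) * (\<beta>' / \<eta>\<^sup>2) / sqrt (real n)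
      + s\<^sup>2 * (\<beta> / \<eta>\<^sup>2) * ((1 + 16 * s\<^sup>2 * q / \<eta> ^ 4) / sqrt (real n))"
    by (intro add_mono X1 X2 X3)
  also have "\<dots> = (3 * s ^ 3 * (\<beta> / \<eta>) * (q + q\<^sup>2) / \<eta> ^ 3 + s\<^sup>2 * (2 * q + 4) * (\<beta> / \<eta> / \<eta>\<^sup>2)
        + s\<^sup>2 * (\<beta> / \<eta>\<^sup>2) * (1 + 16 * s\<^sup>2 * q / \<eta> ^ 4)) / sqrt (real n)"
  proof -
    have "a / t + b / t + k * (x / t) = (a + b + k * x) / t" for a b k x t :: real by (simp add: add_divide_distrib)
    then show ?thesis unfolding \<beta>'_def .
  qed
  finally show "cmod (integral\<^sup>L (W n) (\<lambda>\<xi>. normalized_trace n (B * R \<xi>)) - normalized_trace n (B * resolvent A (z + of_real (s\<^sup>2) * m)))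
    \<le> (3 * s ^ 3 * (\<beta> / \<eta>) * (q + q\<^sup>2) / \<eta> ^ 3 + s\<^sup>2 * (2 * q + 4) * (\<beta> / \<eta> / \<eta>\<^sup>2)
        + s\<^sup>2 * (\<beta> / \<eta>\<^sup>2) * (1 + 16 * s\<^sup>2 * q / \<eta> ^ 4)) / sqrt (real n)"
    unfolding B'_def w_def .
qed

end

end

section \<open>The almost sure deterministic equivalent\<close>

lemma AE_tendsto_zero_if_summable_nn_integrals:
  fixes g :: "nat \<Rightarrow> 'w \<Rightarrow> real"
  assumes meas[measurable]: "\<And>n. g n \<in> borel_measurable M" and nn: "\<And>n \<omega>. 0 \<le> g n \<omega>"
    and bound: "\<And>n. (\<integral>\<^sup>+\<omega>. ennreal (g n \<omega>) \<partial>M) \<le> ennreal (c n)" and c: "summable c" "\<And>n. 0 \<le> c n"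
  shows "AE \<omega> in M. (\<lambda>n. g n \<omega>) \<longlonglongrightarrow> 0"
proof -
  have "(\<integral>\<^sup>+\<omega>. (\<Sum>n. ennreal (g n \<omega>)) \<partial>M) = (\<Sum>n. \<integral>\<^sup>+\<omega>. ennreal (g n \<omega>) \<partial>M)"
    by (rule nn_integral_suminf) measurable
  also have "\<dots> \<le> (\<Sum>n. ennreal (c n))" by (intro suminf_le bound) auto
  also have "\<dots> = ennreal (suminf c)" using c by (rule suminf_ennreal2[rotated])
  finally have "(\<integral>\<^sup>+\<omega>. (\<Sum>n. ennreal (g n \<omega>)) \<partial>M) \<noteq> \<infinity>" using ennreal_less_top[of "suminf c"] by (auto simp: top_unique)
  then have "AE \<omega> in M. (\<Sum>n. ennreal (g n \<omega>)) \<noteq> \<infinity>"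
    by (intro nn_integral_PInf_AE) auto
  then show ?thesis
  proof eventually_elim
    case (elim \<omega>)
    then have "summable (\<lambda>n. g n \<omega>)" using nn by (intro summable_suminf_not_top) auto
    then show ?case by (rule summable_LIMSEQ_zero)
  qed
qed

text \<open>
  Independence of two random variables with values in different spaces: here the data and the noise.
\<close>

definition indep_rv :: "'w measure \<Rightarrow> 'x measure \<Rightarrow> ('w \<Rightarrow> 'x) \<Rightarrow> 'y measure \<Rightarrow> ('w \<Rightarrow> 'y) \<Rightarrow> bool" where
  "indep_rv M N X W Y \<longleftrightarrow> X \<in> measurable M N \<and> Y \<in> measurable M W \<and>
     (\<forall>A\<in>sets N. \<forall>B\<in>sets W. measure M ((X -` A \<inter> space M) \<inter> (Y -` B \<inter> space M)) =
        measure M (X -` A \<inter> space M) * measure M (Y -` B \<inter> space M))"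

lemma indep_rv_joint_law:
  assumes M: "prob_space M" and ind: "indep_rv M N X W Y"
  shows "distr M N X \<Otimes>\<^sub>M distr M W Y = distr M (N \<Otimes>\<^sub>M W) (\<lambda>\<omega>. (X \<omega>, Y \<omega>))"
proof -
  interpret prob_space M by (rule M)
  have [measurable]: "X \<in> measurable M N" "Y \<in> measurable M W" using ind by (auto simp: indep_rv_def)
  interpret A: prob_space "distr M N X" by (rule prob_space_distr) measurable
  interpret B: prob_space "distr M W Y" by (rule prob_space_distr) measurable
  show ?thesis
  proof (rule pair_measure_eqI)
    show "sigma_finite_measure (distr M N X)" "sigma_finite_measure (distr M W Y)" by unfold_locales
    show "sets (distr M N X \<Otimes>\<^sub>M distr M W Y) = sets (distr M (N \<Otimes>\<^sub>M W) (\<lambda>\<omega>. (X \<omega>, Y \<omega>)))"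
      by (simp add: sets_pair_measure_cong[OF sets_distr sets_distr])
    fix A B assume "A \<in> sets (distr M N X)" "B \<in> sets (distr M W Y)"
    then have AB[measurable]: "A \<in> sets N" "B \<in> sets W" by auto
    have "(\<lambda>\<omega>. (X \<omega>, Y \<omega>)) -` (A \<times> B) \<inter> space M = (X -` A \<inter> space M) \<inter> (Y -` B \<inter> space M)" by auto
    then have "emeasure (distr M (N \<Otimes>\<^sub>M W) (\<lambda>\<omega>. (X \<omega>, Y \<omega>))) (A \<times> B) = ennreal (measure M ((X -` A \<inter> space M) \<inter> (Y -` B \<inter> space M)))"
      by (subst emeasure_distr) (auto simp: emeasure_eq_measure)
    also have "\<dots> = ennreal (measure M (X -` A \<inter> space M)) * ennreal (measure M (Y -` B \<inter> space M))"
      using ind AB unfolding indep_rv_def by (simp add: ennreal_mult')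
    also have "\<dots> = emeasure (distr M N X) A * emeasure (distr M W Y) B"
      by (simp add: emeasure_distr emeasure_eq_measure)
    finally show "emeasure (distr M N X) A * emeasure (distr M W Y) B = emeasure (distr M (N \<Otimes>\<^sub>M W) (\<lambda>\<omega>. (X \<omega>, Y \<omega>))) (A \<times> B)" ..
  qed
qed

text \<open>
  A bound that holds for every fixed value of the data \<open>X\<close> holds after averaging over them, by
  Fubini. This reduces random base matrices to deterministic ones.
\<close>

lemma nn_integral_independent_le:
  assumes M: "prob_space M" and ind: "indep_rv M N X W Y" and dY: "distr M W Y = W"
    and \<Phi>[measurable]: "\<Phi> \<in> borel_measurable (N \<Otimes>\<^sub>M W)"
    and le: "\<And>\<omega>. \<omega> \<in> space M \<Longrightarrow> (\<integral>\<^sup>+y. \<Phi> (X \<omega>, y) \<partial>W) \<le> c"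
  shows "(\<integral>\<^sup>+\<omega>. \<Phi> (X \<omega>, Y \<omega>) \<partial>M) \<le> c"
proof -
  interpret prob_space M by (rule M)
  have [measurable]: "X \<in> measurable M N" "Y \<in> measurable M W" using ind by (auto simp: indep_rv_def)
  interpret W: prob_space W using prob_space_distr[of Y W] dY by simp
  have "(\<integral>\<^sup>+\<omega>. \<Phi> (X \<omega>, Y \<omega>) \<partial>M) = (\<integral>\<^sup>+p. \<Phi> p \<partial>distr M (N \<Otimes>\<^sub>M W) (\<lambda>\<omega>. (X \<omega>, Y \<omega>)))"
    by (subst nn_integral_distr) auto
  also have "\<dots> = (\<integral>\<^sup>+p. \<Phi> p \<partial>(distr M N X \<Otimes>\<^sub>M W))" using indep_rv_joint_law[OF M ind] dY by simp
  also have "\<dots> = (\<integral>\<^sup>+x. \<integral>\<^sup>+y. \<Phi> (x, y) \<partial>W \<partial>distr M N X)"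
    by (rule W.nn_integral_fst[symmetric]) (simp add: measurable_cong_sets[OF sets_pair_measure_cong[OF sets_distr refl] refl])
  also have "\<dots> = (\<integral>\<^sup>+\<omega>. \<integral>\<^sup>+y. \<Phi> (X \<omega>, y) \<partial>W \<partial>M)" by (subst nn_integral_distr) auto
  also have "\<dots> \<le> (\<integral>\<^sup>+\<omega>. c \<partial>M)" by (intro nn_integral_mono le)
  also have "\<dots> = c" by (simp add: emeasure_space_1)
  finally show ?thesis .
qed

lemma meas_mat_compose: "meas_mat N n F \<Longrightarrow> g \<in> measurable M N \<Longrightarrow> meas_mat M n (\<lambda>\<omega>. F (g \<omega>))"
  unfolding meas_mat_def by (auto intro: measurable_compose dest: measurable_space)

lemma normalized_trace_resolvent_lipschitz:
  assumes A: "A \<in> carrier_mat n n" "transpose_mat A = A" and B: "op_bound n \<beta> B" "0 \<le> \<beta>"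
    and w: "0 < \<eta>" "\<eta> \<le> Im w" "\<eta> \<le> Im w'"
  shows "cmod (normalized_trace n (B * resolvent A w) - normalized_trace n (B * resolvent A w')) \<le> \<beta> / \<eta>\<^sup>2 * cmod (w - w')"
proof -
  define Q where "Q = resolvent A w"
  define Q' where "Q' = resolvent A w'"
  have Iw: "0 < Im w" "0 < Im w'" using w by auto
  have oQ: "op_bound n (1 / \<eta>) Q" "op_bound n (1 / \<eta>) Q'"
    unfolding Q_def Q'_def using w Iw by (auto intro!: op_bound_mono[OF resolvent_op_bound[OF A]] divide_left_mono)
  note cr = op_bound_carrier[OF oQ(1)] op_bound_carrier[OF oQ(2)] op_bound_carrier[OF B(1)]
  have "cmat (A - A) + (w - w') \<cdot>\<^sub>m 1\<^sub>m n = (w - w') \<cdot>\<^sub>m 1\<^sub>m n" using A by (intro eq_matI) auto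
  then have "Q = Q' + (Q * ((w - w') \<cdot>\<^sub>m 1\<^sub>m n)) * Q'"
    using resolvent_difference_two_matrices[OF A A Iw(2,1)] unfolding Q_def Q'_def by simp
  also have "Q * ((w - w') \<cdot>\<^sub>m 1\<^sub>m n) = (w - w') \<cdot>\<^sub>m Q"
    using mult_smult_distrib[OF cr(1) one_carrier_mat, of "w - w'"] right_mult_one_mat[OF cr(1)] by simp
  also have "((w - w') \<cdot>\<^sub>m Q) * Q' = (w - w') \<cdot>\<^sub>m (Q * Q')" by (rule mult_smult_assoc_mat[OF cr(1,2)])
  finally have "B * Q = B * (Q' + (w - w') \<cdot>\<^sub>m (Q * Q'))" by simp
  also have "\<dots> = B * Q' + B * ((w - w') \<cdot>\<^sub>m (Q * Q'))" by (rule mult_add_distrib_mat[OF cr(3,2)]) (use cr in auto)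
  also have "B * ((w - w') \<cdot>\<^sub>m (Q * Q')) = (w - w') \<cdot>\<^sub>m (B * (Q * Q'))"
    by (rule mult_smult_distrib[OF cr(3)]) (use cr in auto)
  finally have "mat_trace (B * Q) = mat_trace (B * Q') + (w - w') * mat_trace (B * (Q * Q'))"
    using cr mat_trace_add[of "B * Q'" n "(w - w') \<cdot>\<^sub>m (B * (Q * Q'))"] mat_trace_smult[of "B * (Q * Q')" n "w - w'"] by simp
  then have "normalized_trace n (B * Q) - normalized_trace n (B * Q') = (w - w') * normalized_trace n (B * (Q * Q'))"
    by (simp add: normalized_trace_def add_divide_distrib)
  moreover have "cmod (normalized_trace n (B * (Q * Q'))) \<le> \<beta> * (1 / \<eta> * (1 / \<eta>))"
    using B oQ w by (intro normalized_trace_le op_bound_mult) auto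
  ultimately show ?thesis
    using mult_left_mono[of "cmod (normalized_trace n (B * (Q * Q')))" "\<beta> * (1 / \<eta> * (1 / \<eta>))" "cmod (w - w')"]
    unfolding Q_def Q'_def by (simp add: norm_mult power2_eq_square mult.commute)
qed

context wigner_law
begin

text \<open>
  The fourth moments are \<open>O(n\<^sup>-\<^sup>2)\<close>, uniformly in the data, hence summable, and
  Borel-Cantelli applies.
\<close>

lemma AE_trace_concentration:
  fixes N :: "nat \<Rightarrow> 'x measure" and X :: "nat \<Rightarrow> 'w \<Rightarrow> 'x" and \<xi> :: "nat \<Rightarrow> 'w \<Rightarrow> nat \<times> nat \<Rightarrow> real"
    and A B :: "nat \<Rightarrow> 'x \<Rightarrow> real mat" and s :: "nat \<Rightarrow> 'x \<Rightarrow> real"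
  assumes M: "prob_space M"
    and ind: "\<And>n. indep_rv M (N n) (X n) (W n) (\<xi> n)" and law: "\<And>n. 0 < n \<Longrightarrow> distr M (W n) (\<xi> n) = W n"
    and mA: "\<And>n. meas_mat (N n) n (A n)" and mB: "\<And>n. meas_mat (N n) n (B n)"
    and ms: "\<And>n. s n \<in> borel_measurable (N n)"
    and sym: "\<And>n \<omega>. \<omega> \<in> space M \<Longrightarrow> transpose_mat (A n (X n \<omega>)) = A n (X n \<omega>)"
    and bB: "\<And>n \<omega>. \<omega> \<in> space M \<Longrightarrow> op_bound n \<beta> (cmat (B n (X n \<omega>)))" and \<beta>: "0 \<le> \<beta>"
    and s: "\<And>n \<omega>. \<omega> \<in> space M \<Longrightarrow> 0 \<le> s n (X n \<omega>) \<and> s n (X n \<omega>) \<le> S"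
    and z: "0 < Im z" and F: "F = Re \<or> F = Im"
  defines "f \<equiv> \<lambda>n x \<xi>. F (normalized_trace n (cmat (B n x) * noisy_resolvent n (A n x) (s n x / sqrt (real n)) z \<xi>))"
  shows "AE \<omega> in M. (\<lambda>n. f n (X n \<omega>) (\<xi> n \<omega>) - integral\<^sup>L (W n) (f n (X n \<omega>))) \<longlonglongrightarrow> 0"
proof -
  interpret prob_space M by (rule M)
  define G where "G n x = integral\<^sup>L (W n) (f n x)" for n x
  \<comment> \<open>The law of the noise is specified for \<open>0 < n\<close> only, so the index 0 is masked.\<close>
  define g where "g n \<omega> = (if n = 0 then 0 else (f n (X n \<omega>) (\<xi> n \<omega>) - G n (X n \<omega>)) ^ 4)" for n \<omega>
  have [measurable]: "X n \<in> measurable M (N n)" "\<xi> n \<in> measurable M (W n)" for n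
    using ind[of n] by (auto simp: indep_rv_def)
  have fm: "case_prod (f n) \<in> borel_measurable (N n \<Otimes>\<^sub>M W n)" for n
  proof -
    have [measurable]: "fst \<in> measurable (N n \<Otimes>\<^sub>M W n) (N n)" "snd \<in> measurable (N n \<Otimes>\<^sub>M W n) (W n)" by measurable
    have m1: "meas_mat (N n \<Otimes>\<^sub>M W n) n (\<lambda>p. A n (fst p) + (s n (fst p) / sqrt (real n)) \<cdot>\<^sub>m symmat n (snd p))"
    proof (rule meas_mat_perturbed)
      show "meas_mat (N n \<Otimes>\<^sub>M W n) n (\<lambda>p. A n (fst p))" by (rule meas_mat_compose[OF mA]) measurable
      show "(\<lambda>p. s n (fst p) / sqrt (real n)) \<in> borel_measurable (N n \<Otimes>\<^sub>M W n)"
        using measurable_compose[OF measurable_fst[of "N n" "W n"] ms[of n]] by simp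
      show "(\<lambda>p. snd p q) \<in> borel_measurable (N n \<Otimes>\<^sub>M W n)" if "q \<in> upper n" for q
        using measurable_compose[OF measurable_snd component_measurable[OF that]] .
    qed
    have "meas_mat (N n \<Otimes>\<^sub>M W n) n (\<lambda>p. cmat (B n (fst p)) * noisy_resolvent n (A n (fst p)) (s n (fst p) / sqrt (real n)) z (snd p))"
      unfolding noisy_resolvent_def
      by (rule meas_mat_mult[OF meas_mat_cmat[OF meas_mat_compose[OF mB measurable_fst]] meas_mat_resolvent[OF m1]]) simp
    from meas_mat_mat_trace[OF this] have "(\<lambda>p. normalized_trace n (cmat (B n (fst p)) * noisy_resolvent n (A n (fst p)) (s n (fst p) / sqrt (real n)) z (snd p))) \<in> borel_measurable (N n \<Otimes>\<^sub>M W n)"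
      unfolding normalized_trace_def by simp
    then show ?thesis using F unfolding f_def by (auto simp: case_prod_beta')
  qed
  have Gm[measurable]: "G n \<in> borel_measurable (N n)" for n
    unfolding G_def[abs_def]
    by (rule sigma_finite_measure.borel_measurable_lebesgue_integral[OF prob_space_imp_sigma_finite[OF prob_Pi] fm])
  have \<Phi>m: "(\<lambda>p. (f n (fst p) (snd p) - G n (fst p)) ^ 4) \<in> borel_measurable (N n \<Otimes>\<^sub>M W n)" for n
    using fm[of n] by (simp add: case_prod_beta')
  define V where "V = 16 * S\<^sup>2 * \<beta>\<^sup>2 * q / (Im z) ^ 4"
  have V0: "0 \<le> V" using q by (simp add: V_def)
  define c where "c n = 8 * V\<^sup>2 * (1 / (real n)\<^sup>2)" for n
  have bound: "(\<integral>\<^sup>+\<omega>. ennreal (g n \<omega>) \<partial>M) \<le> ennreal (c n)" for n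
  proof (cases "n = 0")
    case False
    then have n: "0 < n" by simp
    have "(\<integral>\<^sup>+\<omega>. ennreal ((f n (fst (X n \<omega>, \<xi> n \<omega>)) (snd (X n \<omega>, \<xi> n \<omega>)) - G n (fst (X n \<omega>, \<xi> n \<omega>))) ^ 4) \<partial>M) \<le> ennreal (c n)"
    proof (rule nn_integral_independent_le[OF M ind law[OF n]])
      show "(\<lambda>p. ennreal ((f n (fst p) (snd p) - G n (fst p)) ^ 4)) \<in> borel_measurable (N n \<Otimes>\<^sub>M W n)"
        using \<Phi>m by simp
      fix \<omega> assume w: "\<omega> \<in> space M"
      have xs: "X n \<omega> \<in> space (N n)" by (rule measurable_space[OF ind[of n, unfolded indep_rv_def, THEN conjunct1] w])
      define x where "x = X n \<omega>"
      have Ax: "A n x \<in> carrier_mat n n" "transpose_mat (A n x) = A n x"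
        using mA[of n] xs sym[OF w] by (auto simp: meas_mat_def x_def)
      have sx: "0 \<le> s n x" "s n x \<le> S" using s[OF w] by (auto simp: x_def)
      note mom = mat_trace_noisy_resolvent_moments[OF n Ax z bB[OF w, of n, folded x_def] \<beta> sx(1) F]
      have fx: "f n x = (\<lambda>\<xi>. F (normalized_trace n (cmat (B n x) * noisy_resolvent n (A n x) (s n x / sqrt (real n)) z \<xi>)))"
        by (simp add: f_def)
      have fxm: "f n x \<in> borel_measurable (W n)" and fxb: "\<bar>f n x y\<bar> \<le> \<beta> / Im z" for y
        unfolding fx using mom(1,2) by auto
      have "integrable (W n) (\<lambda>y. (f n x y - G n x) ^ 4)"
      proof (rule integrable_bounded_Pi[where B="(\<beta> / Im z + \<bar>G n x\<bar>) ^ 4"])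
        show "(\<lambda>y. (f n x y - G n x) ^ 4) \<in> borel_measurable (W n)" using fxm by simp
        fix y
        have "\<bar>f n x y - G n x\<bar> \<le> \<beta> / Im z + \<bar>G n x\<bar>" using fxb[of y] by linarith
        then show "\<bar>(f n x y - G n x) ^ 4\<bar> \<le> (\<beta> / Im z + \<bar>G n x\<bar>) ^ 4"
          unfolding power_abs by (rule power_mono) simp
      qed
      then have "(\<integral>\<^sup>+y. ennreal ((f n x y - G n x) ^ 4) \<partial>W n) = ennreal (\<integral>y. (f n x y - G n x) ^ 4 \<partial>W n)"
        by (intro nn_integral_eq_integral) auto
      also have "\<dots> \<le> ennreal (c n)"
      proof (rule ennreal_leI)
        have "(\<integral>y. (f n x y - G n x) ^ 4 \<partial>W n) \<le> 8 * ((16 * (s n x)\<^sup>2 * \<beta>\<^sup>2 * q / (Im z) ^ 4) / real n)\<^sup>2"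
          using mom(4) unfolding G_def fx .
        also have "\<dots> \<le> 8 * (V / real n)\<^sup>2"
          unfolding V_def using sx q by (intro mult_left_mono power_mono divide_right_mono mult_right_mono) auto
        also have "\<dots> = c n" by (simp add: c_def power_divide)
        finally show "(\<integral>y. (f n x y - G n x) ^ 4 \<partial>W n) \<le> c n" .
      qed
      finally show "(\<integral>\<^sup>+y. ennreal ((f n (fst (X n \<omega>, y)) (snd (X n \<omega>, y)) - G n (fst (X n \<omega>, y))) ^ 4) \<partial>W n) \<le> ennreal (c n)"
        by (simp add: x_def)
    qed
    then show ?thesis using False by (simp add: g_def)
  qed (simp add: g_def)
  have "AE \<omega> in M. (\<lambda>n. g n \<omega>) \<longlonglongrightarrow> 0"
  proof (rule AE_tendsto_zero_if_summable_nn_integrals[OF _ _ bound])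
    show "g n \<in> borel_measurable M" for n
    proof -
      have "(\<lambda>\<omega>. (f n (X n \<omega>) (\<xi> n \<omega>) - G n (X n \<omega>)) ^ 4) \<in> borel_measurable M"
        using measurable_compose[OF measurable_Pair[of "X n" M "N n" "\<xi> n" "W n"] \<Phi>m[of n]] by simp
      then show ?thesis unfolding g_def[abs_def] by (cases "n = 0") auto
    qed
    show "0 \<le> g n \<omega>" for n \<omega> by (simp add: g_def)
    show "summable c" unfolding c_def by (intro summable_mult) (use inverse_power_summable[of 2, where 'a=real] in \<open>simp add: divide_inverse power_inverse\<close>)
    show "0 \<le> c n" for n by (simp add: c_def)
  qed
  then show ?thesis
  proof eventually_elim
    case (elim \<omega>)
    have "(\<lambda>n. (f n (X n \<omega>) (\<xi> n \<omega>) - G n (X n \<omega>)) ^ 4) \<longlonglongrightarrow> 0"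
      using elim by (rule Lim_transform_eventually) (auto simp: g_def eventually_sequentially intro!: exI[of _ 1])
    then have "(\<lambda>n. root 4 ((f n (X n \<omega>) (\<xi> n \<omega>) - G n (X n \<omega>)) ^ 4)) \<longlonglongrightarrow> root 4 0"
      by (rule tendsto_real_root)
    moreover have "root 4 (y ^ 4) = \<bar>y\<bar>" for y :: real using real_root_power_cancel[of 4 "\<bar>y\<bar>"] by simp
    ultimately have "(\<lambda>n. \<bar>f n (X n \<omega>) (\<xi> n \<omega>) - G n (X n \<omega>)\<bar>) \<longlonglongrightarrow> 0" by simp
    then show ?case unfolding G_def by (simp add: tendsto_rabs_zero_iff)
  qed
qed

text \<open>
  Concentration of both traces, the bound for the mean, and finally the replacement of the mean
  \<open>m\<close> inside the spectral parameter by the random normalized trace, which is possible because the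
  resolvent is Lipschitz in the parameter.
\<close>

theorem AE_deterministic_equivalent:
  fixes N :: "nat \<Rightarrow> 'x measure" and X :: "nat \<Rightarrow> 'w \<Rightarrow> 'x" and \<xi> :: "nat \<Rightarrow> 'w \<Rightarrow> nat \<times> nat \<Rightarrow> real"
    and A B :: "nat \<Rightarrow> 'x \<Rightarrow> real mat" and s :: "nat \<Rightarrow> 'x \<Rightarrow> real"
  assumes M: "prob_space M"
    and ind: "\<And>n. indep_rv M (N n) (X n) (W n) (\<xi> n)" and law: "\<And>n. 0 < n \<Longrightarrow> distr M (W n) (\<xi> n) = W n"
    and mA: "\<And>n. meas_mat (N n) n (A n)" and mB: "\<And>n. meas_mat (N n) n (B n)"
    and ms: "\<And>n. s n \<in> borel_measurable (N n)"
    and sym: "\<And>n \<omega>. \<omega> \<in> space M \<Longrightarrow> transpose_mat (A n (X n \<omega>)) = A n (X n \<omega>)"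
    and bB: "\<And>n \<omega>. \<omega> \<in> space M \<Longrightarrow> op_bound n \<beta> (cmat (B n (X n \<omega>)))" and \<beta>: "0 \<le> \<beta>"
    and s: "\<And>n \<omega>. \<omega> \<in> space M \<Longrightarrow> 0 \<le> s n (X n \<omega>) \<and> s n (X n \<omega>) \<le> S"
    and z: "0 < Im z"
  defines "R \<equiv> \<lambda>n \<omega>. noisy_resolvent n (A n (X n \<omega>)) (s n (X n \<omega>) / sqrt (real n)) z (\<xi> n \<omega>)"
  shows "AE \<omega> in M. (\<lambda>n. normalized_trace n (cmat (B n (X n \<omega>)) * R n \<omega>)
      - normalized_trace n (cmat (B n (X n \<omega>)) * resolvent (A n (X n \<omega>)) (z + of_real ((s n (X n \<omega>))\<^sup>2) * normalized_trace n (R n \<omega>)))) \<longlonglongrightarrow> 0"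
proof -
  interpret prob_space M by (rule M)
  define I1 :: "nat \<Rightarrow> 'x \<Rightarrow> real mat" where "I1 n x = 1\<^sub>m n" for n x
  have mI: "meas_mat (N n) n (I1 n)" for n unfolding I1_def by (simp add: meas_mat_def)
  have cI: "cmat (I1 n x) = 1\<^sub>m n" for n x unfolding I1_def by (intro eq_matI) auto
  have bI: "op_bound n 1 (cmat (I1 n x))" for n x unfolding cI by (simp add: op_bound_def)
  define Rx where "Rx n x y = noisy_resolvent n (A n x) (s n x / sqrt (real n)) z y" for n x y
  have R: "R n \<omega> = Rx n (X n \<omega>) (\<xi> n \<omega>)" for n \<omega> by (simp add: R_def Rx_def)
  have "AE \<omega> in M. (\<lambda>n. Re (normalized_trace n (cmat (B n (X n \<omega>)) * Rx n (X n \<omega>) (\<xi> n \<omega>))) - integral\<^sup>L (W n) (\<lambda>y. Re (normalized_trace n (cmat (B n (X n \<omega>)) * Rx n (X n \<omega>) y)))) \<longlonglongrightarrow> 0"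
    "AE \<omega> in M. (\<lambda>n. Im (normalized_trace n (cmat (B n (X n \<omega>)) * Rx n (X n \<omega>) (\<xi> n \<omega>))) - integral\<^sup>L (W n) (\<lambda>y. Im (normalized_trace n (cmat (B n (X n \<omega>)) * Rx n (X n \<omega>) y)))) \<longlonglongrightarrow> 0"
    unfolding Rx_def by (rule AE_trace_concentration[OF M ind law mA mB ms sym bB \<beta> s z]; simp)+
  moreover have "AE \<omega> in M. (\<lambda>n. Re (normalized_trace n (cmat (I1 n (X n \<omega>)) * Rx n (X n \<omega>) (\<xi> n \<omega>))) - integral\<^sup>L (W n) (\<lambda>y. Re (normalized_trace n (cmat (I1 n (X n \<omega>)) * Rx n (X n \<omega>) y)))) \<longlonglongrightarrow> 0"
    "AE \<omega> in M. (\<lambda>n. Im (normalized_trace n (cmat (I1 n (X n \<omega>)) * Rx n (X n \<omega>) (\<xi> n \<omega>))) - integral\<^sup>L (W n) (\<lambda>y. Im (normalized_trace n (cmat (I1 n (X n \<omega>)) * Rx n (X n \<omega>) y)))) \<longlonglongrightarrow> 0"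
    unfolding Rx_def by (rule AE_trace_concentration[OF M ind law mA mI ms sym bI zero_le_one s z]; simp)+
  ultimately show ?thesis using AE_space
  proof eventually_elim
    case (elim \<omega>)
    define x where "x n = X n \<omega>" for n
    define b where "b n = cmat (B n (x n))" for n
    define r where "r n y = Rx n (x n) y" for n y
    define m where "m n = integral\<^sup>L (W n) (\<lambda>y. normalized_trace n (r n y))" for n
    define e where "e n = integral\<^sup>L (W n) (\<lambda>y. normalized_trace n (b n * r n y))" for n
    have xs: "x n \<in> space (N n)" for n
      using ind[of n] elim(5) unfolding x_def indep_rv_def by (auto dest: measurable_space)
    have Ax: "A n (x n) \<in> carrier_mat n n" "transpose_mat (A n (x n)) = A n (x n)" for n
      using mA[of n] xs[of n] sym[OF elim(5)] by (auto simp: meas_mat_def x_def)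
    have bb: "op_bound n \<beta> (b n)" for n unfolding b_def x_def using bB[OF elim(5)] .
    have sx: "0 \<le> s n (x n)" "s n (x n) \<le> S" for n using s[OF elim(5)] by (auto simp: x_def)
    have S: "0 \<le> S" using sx[of 0] by linarith
    have cr: "r n y \<in> carrier_mat n n" for n y unfolding r_def Rx_def by (rule noisy_resolvent_carrier[OF Ax z])
    have one: "cmat (I1 n (x n)) * r n y = r n y" for n y unfolding cI by (rule left_mult_one_mat[OF cr])
    have intb: "integrable (W n) (\<lambda>y. normalized_trace n (b n * r n y))" if "0 < n" for n
      unfolding r_def Rx_def by (rule normalized_trace_noisy_resolvent_mean_deviation(2)[OF that Ax z bb \<beta> sx(1)])
    have into: "integrable (W n) (\<lambda>y. normalized_trace n (r n y))" if "0 < n" for n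
      using normalized_trace_noisy_resolvent_mean_deviation(2)[OF that Ax z bI[of n "x n"] zero_le_one sx(1)[of n]] one[of n] unfolding r_def Rx_def by simp
    have lim_b: "(\<lambda>n. normalized_trace n (b n * r n (\<xi> n \<omega>)) - e n) \<longlonglongrightarrow> 0"
    proof (rule Lim_transform_eventually)
      show "(\<lambda>n. Complex (Re (normalized_trace n (b n * r n (\<xi> n \<omega>))) - integral\<^sup>L (W n) (\<lambda>y. Re (normalized_trace n (b n * r n y))))
        (Im (normalized_trace n (b n * r n (\<xi> n \<omega>))) - integral\<^sup>L (W n) (\<lambda>y. Im (normalized_trace n (b n * r n y))))) \<longlonglongrightarrow> 0"
        using tendsto_Complex[OF elim(1,2)] unfolding b_def r_def x_def by (simp add: zero_complex.code)
      show "\<forall>\<^sub>F n in sequentially. Complex (Re (normalized_trace n (b n * r n (\<xi> n \<omega>))) - integral\<^sup>L (W n) (\<lambda>y. Re (normalized_trace n (b n * r n y))))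
        (Im (normalized_trace n (b n * r n (\<xi> n \<omega>))) - integral\<^sup>L (W n) (\<lambda>y. Im (normalized_trace n (b n * r n y)))) = normalized_trace n (b n * r n (\<xi> n \<omega>)) - e n"
        using eventually_gt_at_top[of 0]
        by eventually_elim (use intb in \<open>simp add: complex_eq_iff e_def\<close>)
    qed
    have lim_m: "(\<lambda>n. normalized_trace n (r n (\<xi> n \<omega>)) - m n) \<longlonglongrightarrow> 0"
    proof (rule Lim_transform_eventually)
      show "(\<lambda>n. Complex (Re (normalized_trace n (r n (\<xi> n \<omega>))) - integral\<^sup>L (W n) (\<lambda>y. Re (normalized_trace n (r n y))))
        (Im (normalized_trace n (r n (\<xi> n \<omega>))) - integral\<^sup>L (W n) (\<lambda>y. Im (normalized_trace n (r n y))))) \<longlonglongrightarrow> 0"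
        using tendsto_Complex[OF elim(3,4)] unfolding x_def[symmetric] r_def[symmetric] one by (simp add: zero_complex.code)
      show "\<forall>\<^sub>F n in sequentially. Complex (Re (normalized_trace n (r n (\<xi> n \<omega>))) - integral\<^sup>L (W n) (\<lambda>y. Re (normalized_trace n (r n y))))
        (Im (normalized_trace n (r n (\<xi> n \<omega>))) - integral\<^sup>L (W n) (\<lambda>y. Im (normalized_trace n (r n y)))) = normalized_trace n (r n (\<xi> n \<omega>)) - m n"
        using eventually_gt_at_top[of 0]
        by eventually_elim (use into in \<open>simp add: complex_eq_iff m_def\<close>)
    qed
    define u where "u n = z + of_real ((s n (x n))\<^sup>2) * m n" for n
    define u' where "u' n = z + of_real ((s n (x n))\<^sup>2) * normalized_trace n (r n (\<xi> n \<omega>))" for n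
    define \<eta> where "\<eta> = Im z"
    define K where "K = 3 * S ^ 3 * (\<beta> / \<eta>) * (q + q\<^sup>2) / \<eta> ^ 3 + S\<^sup>2 * (2 * q + 4) * (\<beta> / \<eta> / \<eta>\<^sup>2)
        + S\<^sup>2 * (\<beta> / \<eta>\<^sup>2) * (1 + 16 * S\<^sup>2 * q / \<eta> ^ 4)"
    have \<eta>: "0 < \<eta>" using z by (simp add: \<eta>_def)
    have lim_e: "(\<lambda>n. e n - normalized_trace n (b n * resolvent (A n (x n)) (u n))) \<longlonglongrightarrow> 0"
    proof (rule Lim_null_comparison)
      show "\<forall>\<^sub>F n in sequentially. norm (e n - normalized_trace n (b n * resolvent (A n (x n)) (u n))) \<le> K * (1 / sqrt (real n))"
        using eventually_gt_at_top[of 0]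
      proof eventually_elim
        case (elim n)
        have "norm (e n - normalized_trace n (b n * resolvent (A n (x n)) (u n))) \<le>
          (3 * (s n (x n)) ^ 3 * (\<beta> / \<eta>) * (q + q\<^sup>2) / \<eta> ^ 3 + (s n (x n))\<^sup>2 * (2 * q + 4) * (\<beta> / \<eta> / \<eta>\<^sup>2)
          + (s n (x n))\<^sup>2 * (\<beta> / \<eta>\<^sup>2) * (1 + 16 * (s n (x n))\<^sup>2 * q / \<eta> ^ 4)) / sqrt (real n)"
          using mean_deterministic_equivalent(1)[OF elim Ax z bb \<beta> sx(1)]
          unfolding e_def u_def m_def r_def Rx_def \<eta>_def .
        also have "\<dots> \<le> K / sqrt (real n)"
          unfolding K_def using sx[of n] S \<beta> \<eta> q
          by (intro divide_right_mono add_mono mult_mono power_mono) auto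
        finally show ?case by simp
      qed
      have "(\<lambda>n. 1 / sqrt (real n)) \<longlonglongrightarrow> 0" by real_asymp
      from tendsto_mult_right_zero[OF this, of K] show "(\<lambda>n. K * (1 / sqrt (real n))) \<longlonglongrightarrow> 0" .
    qed
    have lim_u: "(\<lambda>n. normalized_trace n (b n * resolvent (A n (x n)) (u n)) - normalized_trace n (b n * resolvent (A n (x n)) (u' n))) \<longlonglongrightarrow> 0"
    proof (rule Lim_null_comparison)
      show "\<forall>\<^sub>F n in sequentially. norm (normalized_trace n (b n * resolvent (A n (x n)) (u n)) - normalized_trace n (b n * resolvent (A n (x n)) (u' n)))
          \<le> \<beta> / \<eta>\<^sup>2 * (S\<^sup>2 * cmod (normalized_trace n (r n (\<xi> n \<omega>)) - m n))"
        using eventually_gt_at_top[of 0]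
      proof eventually_elim
        case (elim n)
        have "0 \<le> Im (m n)" unfolding m_def r_def Rx_def by (rule mean_deterministic_equivalent(2)[OF elim Ax z bb \<beta> sx(1)])
        then have 1: "\<eta> \<le> Im (u n)" by (simp add: u_def \<eta>_def)
        have "0 \<le> Im (normalized_trace n (r n (\<xi> n \<omega>)))"
        proof -
          have "Im (normalized_trace n (r n (\<xi> n \<omega>))) = (\<Sum>i<n. Im (r n (\<xi> n \<omega>) $$ (i, i))) / real n"
            using cr[of n "\<xi> n \<omega>"] by (simp add: normalized_trace_def mat_trace_def)
          moreover have "0 \<le> Im (r n (\<xi> n \<omega>) $$ (i, i))" if "i < n" for i
            unfolding r_def Rx_def noisy_resolvent_def by (rule resolvent_Im_diag[OF perturbed_symmetric[OF Ax z] z that])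
          ultimately show ?thesis by (auto intro!: divide_nonneg_nonneg sum_nonneg)
        qed
        then have 2: "\<eta> \<le> Im (u' n)" by (simp add: u'_def \<eta>_def)
        have "u n - u' n = of_real ((s n (x n))\<^sup>2) * (m n - normalized_trace n (r n (\<xi> n \<omega>)))" by (simp add: u_def u'_def algebra_simps)
        then have "cmod (u n - u' n) = (s n (x n))\<^sup>2 * cmod (normalized_trace n (r n (\<xi> n \<omega>)) - m n)"
          by (simp only: norm_mult norm_of_real abs_power2 norm_minus_commute)
        also have "\<dots> \<le> S\<^sup>2 * cmod (normalized_trace n (r n (\<xi> n \<omega>)) - m n)" using sx by (intro mult_right_mono power_mono) auto
        finally have "\<beta> / \<eta>\<^sup>2 * cmod (u n - u' n) \<le> \<beta> / \<eta>\<^sup>2 * (S\<^sup>2 * cmod (normalized_trace n (r n (\<xi> n \<omega>)) - m n))"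
          using \<beta> by (intro mult_left_mono) auto
        then show ?case using normalized_trace_resolvent_lipschitz[OF Ax bb \<beta> \<eta> 1 2] by (rule order_trans[rotated])
      qed
      show "(\<lambda>n. \<beta> / \<eta>\<^sup>2 * (S\<^sup>2 * cmod (normalized_trace n (r n (\<xi> n \<omega>)) - m n))) \<longlonglongrightarrow> 0"
        by (intro tendsto_mult_right_zero tendsto_norm_zero lim_m)
    qed
    from tendsto_add[OF tendsto_add[OF lim_b lim_e] lim_u]
    show ?case unfolding b_def r_def u'_def R x_def by simp
  qed
qed

end

section \<open>Stieltjes transforms and weak convergence\<close>

text \<open>
  The Stieltjes transform, at \<open>z\<close>, of the weights \<open>d i / n\<close> at the points \<open>l
  i\<close>.
\<close>

definition stieltjes :: "nat \<Rightarrow> (nat \<Rightarrow> real) \<Rightarrow> (nat \<Rightarrow> real) \<Rightarrow> complex \<Rightarrow> complex" where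
  "stieltjes n d l z = (\<Sum>i = 1..n. of_real (d i) / (of_real (l i) - z)) / of_nat n"

definition cauchy_transform :: "real measure \<Rightarrow> (real \<Rightarrow> real) \<Rightarrow> complex \<Rightarrow> complex" where
  "cauchy_transform H f w = (\<integral>x. of_real (f x) / (of_real x - w) \<partial>H)"

lemma cmod_real_minus_ge: "\<bar>Im w\<bar> \<le> cmod (of_real x - w)"
  using abs_Im_le_cmod[of "of_real x - w"] by simp

lemma real_minus_nonzero: "Im w > 0 \<Longrightarrow> of_real x - w \<noteq> 0"
  by auto

lemma cmod_divide_real_minus_le:
  assumes "\<bar>a\<bar> \<le> \<beta>" "0 < \<eta>" "\<eta> \<le> Im w"
  shows "cmod (of_real a / (of_real x - w)) \<le> \<beta> / \<eta>"
proof -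
  have "\<eta> \<le> cmod (of_real x - w)" using cmod_real_minus_ge[of w x] assms by linarith
  then show ?thesis using assms by (auto simp: norm_divide intro!: frac_le)
qed

lemma cmod_resolvent_diff_le:
  assumes "\<bar>a\<bar> \<le> \<beta>" "0 < \<eta>" "\<eta> \<le> Im w" "\<eta> \<le> Im w'"
  shows "cmod (of_real a / (of_real x - w) - of_real a / (of_real x - w')) \<le> \<beta> / \<eta>\<^sup>2 * cmod (w - w')"
proof -
  have nz: "of_real x - w \<noteq> 0" "of_real x - w' \<noteq> 0" using assms by (auto intro!: real_minus_nonzero)
  have "of_real a / (of_real x - w) - of_real a / (of_real x - w') =
      of_real a / (of_real x - w) * ((w - w') / (of_real x - w'))"
    using nz by (simp add: field_simps)
  also have "cmod \<dots> = cmod (of_real a / (of_real x - w)) * (cmod (of_real 1 / (of_real x - w')) * cmod (w - w'))"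
    by (simp add: norm_mult norm_divide)
  also have "\<dots> \<le> \<beta> / \<eta> * (1 / \<eta> * cmod (w - w'))"
    using assms by (intro mult_mono cmod_divide_real_minus_le) auto
  finally show ?thesis by (simp add: power2_eq_square)
qed

lemma stieltjes_norm:
  assumes "\<And>i. i \<in> {1..n} \<Longrightarrow> \<bar>d i\<bar> \<le> \<beta>" "0 \<le> \<beta>" "0 < \<eta>" "\<eta> \<le> Im z"
  shows "cmod (stieltjes n d l z) \<le> \<beta> / \<eta>"
proof (cases "n = 0")
  case False
  have "cmod (\<Sum>i = 1..n. of_real (d i) / (of_real (l i) - z)) \<le> (\<Sum>i = 1..n. \<beta> / \<eta>)"
    using assms by (intro sum_norm_le cmod_divide_real_minus_le) auto
  then show ?thesis using False by (simp add: stieltjes_def norm_divide divide_le_eq mult.commute)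
qed (use assms in \<open>simp add: stieltjes_def\<close>)

lemma stieltjes_lipschitz:
  assumes "\<And>i. i \<in> {1..n} \<Longrightarrow> \<bar>d i\<bar> \<le> \<beta>" "0 \<le> \<beta>" "0 < \<eta>" "\<eta> \<le> Im z" "\<eta> \<le> Im z'"
  shows "cmod (stieltjes n d l z - stieltjes n d l z') \<le> \<beta> / \<eta>\<^sup>2 * cmod (z - z')"
proof (cases "n = 0")
  case False
  have "stieltjes n d l z - stieltjes n d l z' =
      (\<Sum>i = 1..n. of_real (d i) / (of_real (l i) - z) - of_real (d i) / (of_real (l i) - z')) / of_nat n"
    by (simp add: stieltjes_def sum_subtractf diff_divide_distrib)
  moreover have "cmod (\<Sum>i = 1..n. of_real (d i) / (of_real (l i) - z) - of_real (d i) / (of_real (l i) - z'))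
      \<le> (\<Sum>i = 1..n. \<beta> / \<eta>\<^sup>2 * cmod (z - z'))"
    using assms by (intro sum_norm_le cmod_resolvent_diff_le) auto
  ultimately show ?thesis using False by (simp add: norm_divide divide_le_eq mult.commute)
qed (use assms in \<open>simp add: stieltjes_def\<close>)

lemma Im_inverse_real_minus: "Im (1 / (of_real x - w)) = Im w / (cmod (of_real x - w))\<^sup>2"
  by (simp add: Im_divide cmod_power2)

lemma stieltjes_Im_nonneg: "0 < Im z \<Longrightarrow> 0 \<le> Im (stieltjes n (\<lambda>_. 1) l z)"
  by (simp add: stieltjes_def Im_inverse_real_minus sum_nonneg)

lemma integral_empirical_distr:
  fixes F :: "real \<Rightarrow> 'b::{banach, second_countable_topology}"
  assumes "F \<in> borel_measurable borel"
  shows "integral\<^sup>L (empirical_distr n x) F = (\<Sum>i = 1..n. F (x i)) /\<^sub>R real n"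
proof -
  have "integral\<^sup>L (empirical_distr n x) F = (\<integral>i. F (x i) \<partial>point_measure {1..n} (\<lambda>_. 1 / real n))"
    unfolding empirical_distr_def uniform_count_measure_def
    by (subst integral_distr) (use assms in \<open>auto simp: measurable_def\<close>)
  also have "\<dots> = (\<Sum>i = 1..n. (1 / real n) *\<^sub>R F (x i))"
    by (subst lebesgue_integral_point_measure_finite) auto
  finally show ?thesis by (simp add: scaleR_sum_right divide_inverse)
qed

lemma real_distribution_empirical_distr: "n > 0 \<Longrightarrow> real_distribution (empirical_distr n x)"
proof -
  assume "n > 0"
  then interpret U: prob_space "uniform_count_measure {1..n}"
    by (intro prob_space_uniform_count_measure) auto
  show ?thesis unfolding empirical_distr_def
    by (rule U.real_distribution_distr) (auto simp: measurable_def)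
qed

text \<open>
  Weak convergence tests one function at a time. Here the test function may vary with \<open>n\<close> within
  a bounded equicontinuous family, because the spectral parameter \<open>z + \<sigma>\<^sup>2
  m\<^sub>n\<close> does; on a Skorohod coupling this is dominated convergence.
\<close>

lemma weak_conv_equicontinuous:
  fixes F :: "nat \<Rightarrow> real \<Rightarrow> 'b::{banach, second_countable_topology}"
  assumes \<mu>: "\<And>n. real_distribution (\<mu> n)" and H: "real_distribution H" and w: "weak_conv_m \<mu> H"
    and meas: "\<And>n. F n \<in> borel_measurable borel" and bd: "\<And>n x. norm (F n x) \<le> B"
    and equi: "\<And>x e. 0 < e \<Longrightarrow> \<exists>\<delta>>0. \<forall>n y. \<bar>y - x\<bar> < \<delta> \<longrightarrow> norm (F n y - F n x) < e"
  shows "(\<lambda>n. integral\<^sup>L (\<mu> n) (F n) - integral\<^sup>L H (F n)) \<longlonglongrightarrow> 0"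
proof -
  note Skorohod[OF \<mu> H w]
  then obtain Omega Yn Y where
    ps: "prob_space Omega" and
    [measurable]: "\<And>n. Yn n \<in> borel_measurable Omega" and
    d: "\<And>n. distr Omega borel (Yn n) = \<mu> n" and
    [measurable]: "Y \<in> borel_measurable Omega" and
    dY: "distr Omega borel Y = H" and
    lim: "\<And>x :: real. x \<in> space Omega \<Longrightarrow> (\<lambda>n. Yn n x) \<longlonglongrightarrow> Y x" by force
  interpret prob_space Omega by fact
  note meas[measurable]
  have i: "integrable Omega (\<lambda>x. F n (Z x))" if [measurable]: "Z \<in> borel_measurable Omega" for Z n
    by (rule integrable_const_bound[where B=B]) (use bd in auto)
  have "(\<lambda>n. \<integral>x. F n (Yn n x) - F n (Y x) \<partial>Omega) \<longlonglongrightarrow> (\<integral>x. 0 \<partial>Omega)"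
  proof (rule integral_dominated_convergence[where w="\<lambda>_. 2 * B"])
    show "AE x in Omega. (\<lambda>n. F n (Yn n x) - F n (Y x)) \<longlonglongrightarrow> 0"
    proof (rule AE_I2)
      fix x assume x: "x \<in> space Omega"
      show "(\<lambda>n. F n (Yn n x) - F n (Y x)) \<longlonglongrightarrow> 0"
      proof (rule LIMSEQ_I)
        fix e :: real assume "0 < e"
        from equi[OF this, of "Y x"] obtain \<delta> where \<delta>: "\<delta> > 0"
          "\<And>n y. \<bar>y - Y x\<bar> < \<delta> \<Longrightarrow> norm (F n y - F n (Y x)) < e" by blast
        from LIMSEQ_D[OF lim[OF x] \<delta>(1)] obtain N where "\<And>n. n \<ge> N \<Longrightarrow> \<bar>Yn n x - Y x\<bar> < \<delta>" by auto
        then show "\<exists>N. \<forall>n\<ge>N. norm (F n (Yn n x) - F n (Y x) - 0) < e" using \<delta>(2) by auto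
      qed
    qed
    fix n show "AE x in Omega. norm (F n (Yn n x) - F n (Y x)) \<le> 2 * B"
    proof (rule AE_I2)
      fix x show "norm (F n (Yn n x) - F n (Y x)) \<le> 2 * B"
        using norm_triangle_ineq4[of "F n (Yn n x)" "F n (Y x)"] bd[of n "Yn n x"] bd[of n "Y x"] by linarith
    qed
  qed auto
  moreover have "(\<integral>x. F n (Yn n x) - F n (Y x) \<partial>Omega) = integral\<^sup>L (\<mu> n) (F n) - integral\<^sup>L H (F n)" for n
    using i unfolding d[symmetric] dY[symmetric] by (simp add: integral_distr)
  ultimately show ?thesis by simp
qed

text \<open>
  As long as the spectral parameters stay at distance at least \<open>\<eta>\<close> from the real line, the
  kernels \<open>f(x) / (x - u\<^sub>n)\<close> are equicontinuous.
\<close>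

lemma stieltjes_tendsto_cauchy_transform:
  assumes H: "real_distribution H" and w: "weak_conv_m (\<lambda>n. empirical_distr n (l n)) H"
    and f: "continuous_on UNIV f" "\<And>x. \<bar>f x\<bar> \<le> \<beta>" and \<eta>: "0 < \<eta>" "\<And>n. \<eta> \<le> Im (u n)"
  shows "(\<lambda>n. stieltjes n (\<lambda>i. f (l n i)) (l n) (u n) - cauchy_transform H f (u n)) \<longlonglongrightarrow> 0"
proof (rule LIMSEQ_imp_Suc)
  define F where "F n x = complex_of_real (f x) / (of_real x - u (Suc n))" for n x
  have nz: "of_real x - u n \<noteq> 0" for x n using \<eta>(1) \<eta>(2)[of n] by (intro real_minus_nonzero) linarith
  have meas: "F n \<in> borel_measurable borel" for n
    unfolding F_def by (intro borel_measurable_continuous_onI continuous_intros f) (use nz in auto)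
  have "(\<lambda>n. integral\<^sup>L (empirical_distr (Suc n) (l (Suc n))) (F n) - integral\<^sup>L H (F n)) \<longlonglongrightarrow> 0"
  proof (rule weak_conv_equicontinuous[OF _ H _ meas])
    show "real_distribution (empirical_distr (Suc n) (l (Suc n)))" for n
      by (rule real_distribution_empirical_distr) simp
    show "weak_conv_m (\<lambda>n. empirical_distr (Suc n) (l (Suc n))) H"
      using w unfolding weak_conv_m_def weak_conv_def by (auto intro!: LIMSEQ_Suc)
    show "norm (F n x) \<le> \<beta> / \<eta>" for n x
      unfolding F_def by (rule cmod_divide_real_minus_le[OF f(2) \<eta>])
    fix x e :: real assume e: "0 < e"
    have \<beta>: "0 \<le> \<beta>" using f(2)[of 0] by linarith
    have "isCont f x" using f(1) by (simp add: continuous_on_eq_continuous_at)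
    then obtain \<delta>1 where \<delta>1: "\<delta>1 > 0" "\<And>y. \<bar>y - x\<bar> < \<delta>1 \<Longrightarrow> \<bar>f y - f x\<bar> < e * \<eta> / 2"
    proof -
      have "0 < e * \<eta> / 2" using e \<eta> by simp
      with \<open>isCont f x\<close> have "\<exists>d>0. \<forall>y. dist y x < d \<longrightarrow> dist (f y) (f x) < e * \<eta> / 2"
        unfolding continuous_at_eps_delta by blast
      then show ?thesis using that unfolding dist_real_def by blast
    qed
    define \<delta> where "\<delta> = min \<delta>1 (e * \<eta>\<^sup>2 / (2 * (\<beta> + 1)))"
    have "\<delta> > 0" using \<delta>1 e \<eta> \<beta> by (simp add: \<delta>_def)
    moreover have "norm (F n y - F n x) < e" if y: "\<bar>y - x\<bar> < \<delta>" for n y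
    proof -
      have fy: "\<bar>f y - f x\<bar> < e * \<eta> / 2" using \<delta>1(2) y by (simp add: \<delta>_def)
      have y2: "\<bar>y - x\<bar> * (2 * (\<beta> + 1)) < e * \<eta>\<^sup>2" using y \<beta> by (simp add: \<delta>_def field_simps)
      have "F n y - F n x = of_real (f y - f x) / (of_real y - u (Suc n)) +
         (of_real (f x) / (of_real x - (u (Suc n) - of_real (y - x))) - of_real (f x) / (of_real x - u (Suc n)))"
        by (simp add: F_def diff_divide_distrib)
      also have "norm \<dots> \<le> \<bar>f y - f x\<bar> / \<eta> + \<beta> / \<eta>\<^sup>2 * cmod ((u (Suc n) - of_real (y - x)) - u (Suc n))"
        using \<eta>(2)[of "Suc n"] f(2)
        by (intro order_trans[OF norm_triangle_ineq] add_mono cmod_divide_real_minus_le cmod_resolvent_diff_le \<eta>(1)) auto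
      also have "cmod ((u (Suc n) - of_real (y - x)) - u (Suc n)) = \<bar>y - x\<bar>"
        by (metis add_diff_cancel_left' diff_diff_eq2 minus_diff_eq norm_minus_commute norm_of_real diff_add_cancel)
      also have "\<bar>f y - f x\<bar> / \<eta> < e / 2" using fy \<eta> by (simp add: field_simps)
      also have "\<beta> / \<eta>\<^sup>2 * \<bar>y - x\<bar> \<le> e / 2"
      proof -
        have "\<beta> * \<bar>y - x\<bar> * 2 \<le> \<bar>y - x\<bar> * (2 * (\<beta> + 1))" by (simp add: algebra_simps)
        then have "\<beta> * \<bar>y - x\<bar> * 2 \<le> e * \<eta>\<^sup>2" using y2 by linarith
        then show ?thesis using \<eta> by (simp add: field_simps)
      qed
      finally show ?thesis by simp
    qed
    ultimately show "\<exists>\<delta>>0. \<forall>n y. \<bar>y - x\<bar> < \<delta> \<longrightarrow> norm (F n y - F n x) < e" by blast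
  qed
  moreover have "integral\<^sup>L H (F n) = cauchy_transform H f (u (Suc n))" for n
    by (simp add: F_def[abs_def] cauchy_transform_def)
  moreover have "integral\<^sup>L (empirical_distr (Suc n) (l (Suc n))) (F n) =
      stieltjes (Suc n) (\<lambda>i. f (l (Suc n) i)) (l (Suc n)) (u (Suc n))" for n
    unfolding integral_empirical_distr[OF meas] F_def stieltjes_def
    by (simp only: scaleR_conv_of_real divide_inverse of_real_inverse of_real_of_nat_eq mult.commute)
  ultimately show "(\<lambda>n. stieltjes (Suc n) (\<lambda>i. f (l (Suc n) i)) (l (Suc n)) (u (Suc n)) - cauchy_transform H f (u (Suc n))) \<longlonglongrightarrow> 0"
    by simp
qed

section \<open>Stability of the subordination equation\<close>

context
  fixes H :: "real measure"
  assumes H: "real_distribution H"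
begin

interpretation H: real_distribution H by (rule H)

lemma integrable_cauchy_kernel:
  assumes "f \<in> borel_measurable borel" "\<And>x. \<bar>f x\<bar> \<le> \<beta>" "Im w > 0"
  shows "integrable H (\<lambda>x. of_real (f x) / (of_real x - w))"
  by (rule H.integrable_const_bound[where B="\<beta> / Im w"])
    (use assms cmod_divide_real_minus_le[OF assms(2,3)] in auto)

lemma integrable_sq_kernel: "Im w > 0 \<Longrightarrow> integrable H (\<lambda>x. 1 / (cmod (of_real x - w))\<^sup>2)"
proof (rule H.integrable_const_bound[where B="1 / (Im w)\<^sup>2"])
  assume w: "Im w > 0"
  show "AE x in H. norm (1 / (cmod (of_real x - w))\<^sup>2) \<le> 1 / (Im w)\<^sup>2"
  proof (rule AE_I2)
    fix x
    have "(Im w)\<^sup>2 \<le> (cmod (of_real x - w))\<^sup>2"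
      using cmod_real_minus_ge[of w x] w by (intro power_mono) auto
    then show "norm (1 / (cmod (of_real x - w))\<^sup>2) \<le> 1 / (Im w)\<^sup>2" using w by (simp add: frac_le)
  qed
qed measurable

text \<open>
  The quantity \<open>\<integral> |x - w|\<^sup>-\<^sup>2 dH(x)\<close> controls both the imaginary part of
  the transform and its modulus of continuity.
\<close>

definition sq_kernel :: "complex \<Rightarrow> real" where
  "sq_kernel w = (\<integral>x. 1 / (cmod (of_real x - w))\<^sup>2 \<partial>H)"

lemma Im_cauchy_transform: "Im w > 0 \<Longrightarrow> Im (cauchy_transform H (\<lambda>_. 1) w) = Im w * sq_kernel w"
proof -
  assume w: "Im w > 0"
  have i: "integrable H (\<lambda>x. 1 / (complex_of_real x - w))" using integrable_cauchy_kernel[of "\<lambda>_. 1" 1 w] w by simp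
  have "Im (cauchy_transform H (\<lambda>_. 1) w) = (\<integral>x. Im (1 / (of_real x - w)) \<partial>H)"
    using i by (simp add: cauchy_transform_def)
  also have "\<dots> = Im w * sq_kernel w" unfolding Im_inverse_real_minus sq_kernel_def
    by (subst integral_mult_right_zero[symmetric]) simp
  finally show ?thesis .
qed

lemma cauchy_transform_diff_le:
  assumes w: "Im w > 0" "Im w' > 0"
  shows "cmod (cauchy_transform H (\<lambda>_. 1) w - cauchy_transform H (\<lambda>_. 1) w') \<le>
    cmod (w - w') * ((sq_kernel w + sq_kernel w') / 2)"
proof -
  have i: "integrable H (\<lambda>x. 1 / (complex_of_real x - w))" if "Im w > 0" for w
    using integrable_cauchy_kernel[of "\<lambda>_. 1" 1 w] that by simp
  have "cmod (cauchy_transform H (\<lambda>_. 1) w - cauchy_transform H (\<lambda>_. 1) w') =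
      cmod (\<integral>x. 1 / (of_real x - w) - 1 / (of_real x - w') \<partial>H)"
    using i w by (simp add: cauchy_transform_def)
  also have "\<dots> \<le> (\<integral>x. cmod (1 / (of_real x - w) - 1 / (of_real x - w')) \<partial>H)" by (rule integral_norm_bound)
  also have "\<dots> \<le> (\<integral>x. cmod (w - w') / 2 * (1 / (cmod (of_real x - w))\<^sup>2 + 1 / (cmod (of_real x - w'))\<^sup>2) \<partial>H)"
  proof (rule integral_mono)
    show "integrable H (\<lambda>x. cmod (1 / (of_real x - w) - 1 / (of_real x - w')))"
      using i w by auto
    show "integrable H (\<lambda>x. cmod (w - w') / 2 * (1 / (cmod (of_real x - w))\<^sup>2 + 1 / (cmod (of_real x - w'))\<^sup>2))"
      using integrable_sq_kernel w by auto
    fix x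
    have nz: "of_real x - w \<noteq> 0" "of_real x - w' \<noteq> 0" using w by (auto intro!: real_minus_nonzero)
    define a b where "a = 1 / cmod (of_real x - w)" and "b = 1 / cmod (of_real x - w')"
    have "1 / (of_real x - w) - 1 / (of_real x - w') = (w - w') / ((of_real x - w) * (of_real x - w'))"
      using nz by (simp add: field_simps)
    then have "cmod (1 / (of_real x - w) - 1 / (of_real x - w')) = cmod (w - w') * (a * b)"
      by (simp add: norm_divide norm_mult a_def b_def)
    also have "\<dots> \<le> cmod (w - w') * ((a\<^sup>2 + b\<^sup>2) / 2)"
      using sum_squares_bound[of a b] by (intro mult_left_mono) auto
    finally show "cmod (1 / (of_real x - w) - 1 / (of_real x - w')) \<le>
        cmod (w - w') / 2 * (1 / (cmod (of_real x - w))\<^sup>2 + 1 / (cmod (of_real x - w'))\<^sup>2)"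
      by (simp add: a_def b_def power_divide)
  qed
  also have "\<dots> = cmod (w - w') * ((sq_kernel w + sq_kernel w') / 2)"
    using integrable_sq_kernel w by (simp add: sq_kernel_def)
  finally show ?thesis .
qed

lemma cauchy_transform_le:
  assumes w: "Im w > 0" and t: "t > 0"
  shows "cmod (cauchy_transform H (\<lambda>_. 1) w) \<le> t / 2 + sq_kernel w / (2 * t)"
proof -
  have i: "integrable H (\<lambda>x. 1 / (complex_of_real x - w))"
    using integrable_cauchy_kernel[of "\<lambda>_. 1" 1 w] w by simp
  have "cmod (cauchy_transform H (\<lambda>_. 1) w) \<le> (\<integral>x. cmod (1 / (of_real x - w)) \<partial>H)"
    unfolding cauchy_transform_def by (simp only: of_real_1) (rule integral_norm_bound)
  also have "\<dots> \<le> (\<integral>x. t / 2 + (1 / (2 * t)) * (1 / (cmod (of_real x - w))\<^sup>2) \<partial>H)"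
  proof (rule integral_mono)
    show "integrable H (\<lambda>x. cmod (1 / (of_real x - w)))" using i by auto
    show "integrable H (\<lambda>x. t / 2 + (1 / (2 * t)) * (1 / (cmod (of_real x - w))\<^sup>2))"
      using integrable_sq_kernel[OF w]
      by (intro Bochner_Integration.integrable_add integrable_mult_right) auto
    fix x
    define a where "a = 1 / cmod (of_real x - w)"
    have "2 * t * a \<le> t\<^sup>2 + a\<^sup>2" using sum_squares_bound[of t a] .
    then have "a \<le> t / 2 + (1 / (2 * t)) * a\<^sup>2" using t by (simp add: field_simps power2_eq_square)
    then show "cmod (1 / (of_real x - w)) \<le> t / 2 + (1 / (2 * t)) * (1 / (cmod (of_real x - w))\<^sup>2)"
      by (simp add: a_def norm_divide power_divide)
  qed
  also have "\<dots> = (\<integral>x. t / 2 \<partial>H) + (\<integral>x. (1 / (2 * t)) * (1 / (cmod (of_real x - w))\<^sup>2) \<partial>H)"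
    using integrable_sq_kernel[OF w] by (intro Bochner_Integration.integral_add integrable_mult_right) auto
  also have "(\<integral>x. (1 / (2 * t)) * (1 / (cmod (of_real x - w))\<^sup>2) \<partial>H) = (1 / (2 * t)) * sq_kernel w"
    unfolding sq_kernel_def by (rule integral_mult_right_zero)
  also have "(\<integral>x. t / 2 \<partial>H) + (1 / (2 * t)) * sq_kernel w = t / 2 + sq_kernel w / (2 * t)"
    using H.prob_space by simp
  finally show ?thesis .
qed

lemma cauchy_transform_lipschitz:
  assumes f: "f \<in> borel_measurable borel" "\<And>x. \<bar>f x\<bar> \<le> \<beta>" and w: "0 < \<eta>" "\<eta> \<le> Im w" "\<eta> \<le> Im w'"
  shows "cmod (cauchy_transform H f w - cauchy_transform H f w') \<le> \<beta> / \<eta>\<^sup>2 * cmod (w - w')"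
proof -
  have i: "integrable H (\<lambda>x. complex_of_real (f x) / (of_real x - w))" if "\<eta> \<le> Im w" for w
    by (rule integrable_cauchy_kernel[OF f]) (use w that in linarith)
  have "cmod (cauchy_transform H f w - cauchy_transform H f w') =
      cmod (\<integral>x. of_real (f x) / (of_real x - w) - of_real (f x) / (of_real x - w') \<partial>H)"
    using i w by (simp add: cauchy_transform_def)
  also have "\<dots> \<le> (\<integral>x. cmod (of_real (f x) / (of_real x - w) - of_real (f x) / (of_real x - w')) \<partial>H)"
    by (rule integral_norm_bound)
  also have "\<dots> \<le> (\<integral>x. \<beta> / \<eta>\<^sup>2 * cmod (w - w') \<partial>H)"
    using i w by (intro integral_mono cmod_resolvent_diff_le f) auto
  finally show ?thesis using H.prob_space by simp
qed

text \<open>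
  If \<open>m\<close> solves \<open>m = \<integral> (x - w)\<^sup>-\<^sup>1 dH(x)\<close> with \<open>w = z +
  \<sigma>\<^sup>2 m\<close>, then \<open>Im w - Im z = \<sigma>\<^sup>2 Im m = \<sigma>\<^sup>2 Im w
  \<integral> |x - w|\<^sup>-\<^sup>2 dH(x)\<close>, so \<open>\<sigma>\<^sup>2 \<integral> |x -
  w|\<^sup>-\<^sup>2 dH(x) = 1 - Im z / Im w < 1\<close>. The lemma is the version for approximate solutions.
\<close>

lemma approx_fixed_point_bounds:
  fixes m z :: complex
  assumes z: "0 < Im z" and \<sigma>: "0 < \<sigma>" and m: "0 \<le> Im m" "Im m \<le> 1 / Im z"
    and e: "cmod (m - cauchy_transform H (\<lambda>_. 1) (z + of_real (\<sigma>\<^sup>2) * m)) \<le> \<epsilon>" and small: "\<sigma>\<^sup>2 * \<epsilon> \<le> Im z / 2"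
  shows "\<sigma>\<^sup>2 * sq_kernel (z + of_real (\<sigma>\<^sup>2) * m) \<le> 1 - (Im z / 2) / (Im z + \<sigma>\<^sup>2 / Im z)"
proof -
  define w where "w = z + of_real (\<sigma>\<^sup>2) * m"
  have Iw: "Im w = Im z + \<sigma>\<^sup>2 * Im m" by (simp add: w_def)
  have Iw0: "0 < Im w" using Iw z m by (simp add: add_pos_nonneg)
  have "Im w * sq_kernel w \<le> Im m + \<epsilon>"
    unfolding Im_cauchy_transform[OF Iw0, symmetric]
    using abs_Im_le_cmod[of "m - cauchy_transform H (\<lambda>_. 1) w"] e unfolding w_def by simp
  then have "\<sigma>\<^sup>2 * (Im w * sq_kernel w) \<le> \<sigma>\<^sup>2 * (Im m + \<epsilon>)" by (intro mult_left_mono) auto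
  also have "\<dots> \<le> Im w - Im z / 2" using small Iw by (simp add: algebra_simps)
  finally have 1: "\<sigma>\<^sup>2 * sq_kernel w \<le> 1 - (Im z / 2) / Im w" using Iw0 by (simp add: field_simps)
  have "Im w \<le> Im z + \<sigma>\<^sup>2 / Im z" unfolding Iw using mult_left_mono[OF m(2), of "\<sigma>\<^sup>2"] by simp
  then have "(Im z / 2) / (Im z + \<sigma>\<^sup>2 / Im z) \<le> (Im z / 2) / Im w" using Iw0 z by (intro divide_left_mono) auto
  then show ?thesis using 1 unfolding w_def by linarith
qed

text \<open>
  By Cauchy-Schwarz \<open>|m|\<^sup>2 \<le> \<integral> |x - w|\<^sup>-\<^sup>2 dH(x) \<le>
  \<sigma>\<^sup>-\<^sup>2\<close>. The bound does not deteriorate as \<open>z\<close> approaches the real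
  line; this regularizing effect of the noise is what excludes atoms in the limiting spectrum.
\<close>

lemma approx_fixed_point_cmod_le:
  fixes m z :: complex
  assumes z: "0 < Im z" and \<sigma>: "0 < \<sigma>" and m: "0 \<le> Im m" "Im m \<le> 1 / Im z"
    and e: "cmod (m - cauchy_transform H (\<lambda>_. 1) (z + of_real (\<sigma>\<^sup>2) * m)) \<le> \<epsilon>" and small: "\<sigma>\<^sup>2 * \<epsilon> \<le> Im z / 2"
  shows "cmod m \<le> 1 / \<sigma> + \<epsilon>"
proof -
  define w where "w = z + of_real (\<sigma>\<^sup>2) * m"
  have Iw0: "0 < Im w" using z m by (simp add: w_def add_pos_nonneg)
  have "0 \<le> (Im z / 2) / (Im z + \<sigma>\<^sup>2 / Im z)" using z by simp
  then have "\<sigma>\<^sup>2 * sq_kernel w \<le> 1" using approx_fixed_point_bounds[OF assms] unfolding w_def by linarith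
  then have "sq_kernel w / (2 * (1 / \<sigma>)) \<le> 1 / (2 * \<sigma>)" using \<sigma> by (simp add: field_simps power2_eq_square)
  \<comment> \<open>The weight \<open>t = 1 / \<sigma>\<close> balances the two terms.\<close>
  moreover have "cmod (cauchy_transform H (\<lambda>_. 1) w) \<le> (1 / \<sigma>) / 2 + sq_kernel w / (2 * (1 / \<sigma>))"
    by (rule cauchy_transform_le[OF Iw0]) (use \<sigma> in simp)
  ultimately have "cmod (cauchy_transform H (\<lambda>_. 1) w) \<le> 1 / \<sigma>" by (simp add: field_simps)
  moreover have "cmod m \<le> cmod (cauchy_transform H (\<lambda>_. 1) w) + \<epsilon>"
    using e norm_triangle_sub[of m "cauchy_transform H (\<lambda>_. 1) w"] unfolding w_def by linarith
  ultimately show ?thesis by linarith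
qed

text \<open>
  The difference of the transforms at \<open>w\<close> and \<open>w'\<close> is at most \<open>|w -
  w'|\<close> times the average of the two values of \<open>sq_kernel\<close>, so by
  \<open>approx_fixed_point_bounds\<close> the fixed point map contracts between any two approximate
  solutions.
\<close>

lemma approx_fixed_point_unique:
  fixes m m' z :: complex
  assumes z: "0 < Im z" and \<sigma>: "0 < \<sigma>" and m: "0 \<le> Im m" "Im m \<le> 1 / Im z" and m': "0 \<le> Im m'" "Im m' \<le> 1 / Im z"
    and e: "cmod (m - cauchy_transform H (\<lambda>_. 1) (z + of_real (\<sigma>\<^sup>2) * m)) \<le> \<epsilon>"
      "cmod (m' - cauchy_transform H (\<lambda>_. 1) (z + of_real (\<sigma>\<^sup>2) * m')) \<le> \<epsilon>" and small: "\<sigma>\<^sup>2 * \<epsilon> \<le> Im z / 2"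
  shows "(Im z / 2) / (Im z + \<sigma>\<^sup>2 / Im z) * cmod (m - m') \<le> 2 * \<epsilon>"
proof -
  define w where "w = z + of_real (\<sigma>\<^sup>2) * m"
  define w' where "w' = z + of_real (\<sigma>\<^sup>2) * m'"
  define \<rho> where "\<rho> = (Im z / 2) / (Im z + \<sigma>\<^sup>2 / Im z)"
  have Iw: "0 < Im w" "0 < Im w'" using z m m' by (simp_all add: w_def w'_def add_pos_nonneg)
  have q: "\<sigma>\<^sup>2 * sq_kernel w \<le> 1 - \<rho>" "\<sigma>\<^sup>2 * sq_kernel w' \<le> 1 - \<rho>"
    using approx_fixed_point_bounds[OF z \<sigma> m e(1) small] approx_fixed_point_bounds[OF z \<sigma> m' e(2) small]
    unfolding w_def w'_def \<rho>_def by auto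
  define D where "D = cauchy_transform H (\<lambda>_. 1) w - cauchy_transform H (\<lambda>_. 1) w'"
  have ww: "cmod (w - w') = \<sigma>\<^sup>2 * cmod (m - m')"
  proof -
    have "w - w' = of_real (\<sigma>\<^sup>2) * (m - m')" by (simp add: w_def w'_def algebra_simps)
    then show ?thesis by (simp only: norm_mult norm_of_real) simp
  qed
  have "cmod (m - m') \<le> cmod ((m - cauchy_transform H (\<lambda>_. 1) w) - (m' - cauchy_transform H (\<lambda>_. 1) w')) + cmod D"
    using norm_triangle_ineq[of "(m - cauchy_transform H (\<lambda>_. 1) w) - (m' - cauchy_transform H (\<lambda>_. 1) w')" D]
    by (simp add: D_def)
  also have "\<dots> \<le> 2 * \<epsilon> + cmod D"
    using norm_triangle_ineq4[of "m - cauchy_transform H (\<lambda>_. 1) w" "m' - cauchy_transform H (\<lambda>_. 1) w'"] e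
    unfolding w_def w'_def by linarith
  also have "cmod D \<le> \<sigma>\<^sup>2 * cmod (m - m') * ((sq_kernel w + sq_kernel w') / 2)"
    unfolding D_def ww[symmetric] by (rule cauchy_transform_diff_le[OF Iw])
  also have "\<dots> = cmod (m - m') * ((\<sigma>\<^sup>2 * sq_kernel w + \<sigma>\<^sup>2 * sq_kernel w') / 2)" by (simp add: algebra_simps)
  also have "\<dots> \<le> cmod (m - m') * (1 - \<rho>)" using q by (intro mult_left_mono) auto
  finally show ?thesis unfolding \<rho>_def by (simp add: algebra_simps)
qed

lemma Im_cauchy_transform_ge:
  assumes supp: "AE x in H. \<bar>x\<bar> \<le> C" and w: "0 < Im w" and c: "C + cmod w \<le> D"
  shows "Im w / D\<^sup>2 \<le> Im (cauchy_transform H (\<lambda>_. 1) w)"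
proof -
  have "1 / D\<^sup>2 = (\<integral>x. 1 / D\<^sup>2 \<partial>H)" using H.prob_space by simp
  also have "\<dots> \<le> sq_kernel w"
    unfolding sq_kernel_def
  proof (rule integral_mono_AE)
    show "AE x in H. 1 / D\<^sup>2 \<le> 1 / (cmod (of_real x - w))\<^sup>2"
      using supp
    proof eventually_elim
      case (elim x)
      have "cmod (of_real x - w) \<le> D" using norm_triangle_ineq4[of "of_real x" w] elim c by simp
      then have "(cmod (of_real x - w))\<^sup>2 \<le> D\<^sup>2" by (intro power_mono) auto
      moreover have "0 < (cmod (of_real x - w))\<^sup>2" using real_minus_nonzero[OF w] by simp
      ultimately show ?case by (intro divide_left_mono) (auto intro!: mult_pos_pos)
    qed
  qed (use integrable_sq_kernel[OF w] in auto)
  finally have "Im w * (1 / D\<^sup>2) \<le> Im w * sq_kernel w" using w by (intro mult_left_mono) auto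
  then show ?thesis by (simp add: Im_cauchy_transform[OF w])
qed

end

section \<open>From Stieltjes transforms to spectral windows\<close>

lemma arctan_le_self: "0 \<le> y \<Longrightarrow> arctan y \<le> y"
proof -
  assume y: "0 \<le> y"
  have "arctan y - arctan 0 \<le> 1 * (y - 0)"
  proof (cases "y = 0")
    case False
    with y have "0 < y" by simp
    then obtain u where u: "0 < u" "u < y" "arctan y - arctan 0 = (y - 0) * inverse (1 + u\<^sup>2)"
      using MVT2[of 0 y arctan "\<lambda>x. inverse (1 + x\<^sup>2)"] DERIV_arctan by blast
    have "inverse (1 + u\<^sup>2) \<le> 1" by (simp add: inverse_le_1_iff)
    then show ?thesis unfolding u(3) using y by (simp add: mult_left_le)
  qed simp
  then show ?thesis by simp
qed

lemma arctan_ge_half_pi: "0 < t \<Longrightarrow> pi / 2 - 1 / t \<le> arctan t"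
  using arctan_inverse[of t] arctan_le_self[of "1 / t"] by (simp add: inverse_eq_divide)

text \<open>
  The indicator of \<open>[a, b]\<close> convolved with the Poisson kernel of width \<open>\<eta>\<close>.
\<close>

definition smooth_indicator :: "real \<Rightarrow> real \<Rightarrow> real \<Rightarrow> real \<Rightarrow> real" where
  "smooth_indicator a b \<eta> x = (arctan ((b - x) / \<eta>) - arctan ((a - x) / \<eta>)) / pi"

text \<open>
  Within distance \<open>\<delta>\<close> of an endpoint nothing is gained over the trivial bound 1; elsewhere
  the tail of the arctangent is at most \<open>\<eta> / \<delta>\<close>.
\<close>

lemma smooth_indicator_approx:
  assumes ab: "a \<le> b" and \<eta>: "0 < \<eta>" and \<delta>: "0 < \<delta>"
  shows "\<bar>indicator {a..b} x - smooth_indicator a b \<eta> x\<bar> \<le>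
    \<eta> / \<delta> + indicator {y. \<bar>y - a\<bar> \<le> \<delta>} x + indicator {y. \<bar>y - b\<bar> \<le> \<delta>} x"
proof -
  define u v where "u = arctan ((b - x) / \<eta>)" and "v = arctan ((a - x) / \<eta>)"
  have vu: "v \<le> u" unfolding u_def v_def using ab \<eta> by (simp add: arctan_le_iff divide_right_mono)
  have b1: "u < pi / 2" "- (pi / 2) < v" unfolding u_def v_def using arctan_bounded by auto
  have b2: "v < pi / 2" "- (pi / 2) < u" unfolding u_def v_def using arctan_bounded by auto
  have \<psi>: "smooth_indicator a b \<eta> x = (u - v) / pi" by (simp add: smooth_indicator_def u_def v_def)
  have \<psi>01: "0 \<le> (u - v) / pi" "(u - v) / pi \<le> 1" using vu b1 pi_gt_zero by (auto simp: field_simps)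
  have far: "pi / 2 - \<eta> / \<delta> \<le> arctan (y / \<eta>)" if "\<delta> < y" for y
  proof -
    have y: "0 < y" using that \<delta> by linarith
    have "\<eta> / y \<le> \<eta> / \<delta>" using that \<delta> \<eta> by (intro divide_left_mono) auto
    then show ?thesis using arctan_ge_half_pi[of "y / \<eta>"] y \<eta> by simp
  qed
  have far': "arctan (y / \<eta>) \<le> - (pi / 2 - \<eta> / \<delta>)" if "y < - \<delta>" for y
    using far[of "- y"] that by (simp add: arctan_minus)
  have p1: "2 \<le> pi" using pi_ge_two .
  have nn: "0 \<le> \<eta> / \<delta>" using \<eta> \<delta> by simp
  have dp: "(u - v) / pi \<le> u - v" using divide_left_mono[of 1 pi "u - v"] vu p1 by simp
  consider "\<bar>x - a\<bar> \<le> \<delta> \<or> \<bar>x - b\<bar> \<le> \<delta>" | "x < a - \<delta>" "x < b - \<delta>" | "b + \<delta> < x" "a + \<delta> < x" | "a + \<delta> < x" "x < b - \<delta>"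
    using ab by linarith
  then show ?thesis
  proof cases
    case 1
    have "indicator {a..b} x = (0::real) \<or> indicator {a..b} x = (1::real)" by (auto simp: indicator_def)
    then have "\<bar>indicator {a..b} x - (u - v) / pi\<bar> \<le> 1" using \<psi>01 by (elim disjE) linarith+
    moreover have "(1::real) \<le> indicator {y. \<bar>y - a\<bar> \<le> \<delta>} x + indicator {y. \<bar>y - b\<bar> \<le> \<delta>} x"
      using 1 by (auto simp: indicator_def)
    ultimately show ?thesis using nn unfolding \<psi> by linarith
  next
    case 2
    have "u - v \<le> \<eta> / \<delta>" using far[of "a - x"] b1 2 unfolding v_def by linarith
    then have "(u - v) / pi \<le> \<eta> / \<delta>" using dp by linarith
    moreover have "indicator {a..b} x = (0::real)" using 2 \<delta> by (auto simp: indicator_def)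
    ultimately show ?thesis using \<psi>01 unfolding \<psi> by (auto simp: indicator_def)
  next
    case 3
    have "u - v \<le> \<eta> / \<delta>" using far'[of "b - x"] b1 3 unfolding u_def by linarith
    then have "(u - v) / pi \<le> \<eta> / \<delta>" using dp by linarith
    moreover have "indicator {a..b} x = (0::real)" using 3 \<delta> by (auto simp: indicator_def)
    ultimately show ?thesis using \<psi>01 unfolding \<psi> by (auto simp: indicator_def)
  next
    case 4
    have "pi - 2 * (\<eta> / \<delta>) \<le> u - v" using far[of "b - x"] far'[of "a - x"] 4 unfolding u_def v_def by linarith
    then have "1 - (u - v) / pi \<le> (2 / pi) * (\<eta> / \<delta>)" by (simp add: field_simps)
    also have "\<dots> \<le> 1 * (\<eta> / \<delta>)" using p1 nn by (intro mult_right_mono) auto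
    finally have "1 - (u - v) / pi \<le> \<eta> / \<delta>" by simp
    moreover have "indicator {a..b} x = (1::real)" using 4 \<delta> by (auto simp: indicator_def)
    ultimately show ?thesis using \<psi>01 unfolding \<psi> by (auto simp: indicator_def)
  qed
qed

lemma Im_kernel: "0 < \<eta> \<Longrightarrow> Im (1 / (of_real x - Complex E \<eta>)) = \<eta> / ((E - x)\<^sup>2 + \<eta>\<^sup>2)"
  by (simp add: Im_inverse_real_minus cmod_power2 power2_commute)

lemma has_integral_Im_kernel:
  assumes ab: "a \<le> b" and \<eta>: "0 < \<eta>"
  shows "((\<lambda>E. Im (1 / (of_real x - Complex E \<eta>))) has_integral pi * smooth_indicator a b \<eta> x) {a..b}"
proof -
  have "((\<lambda>E. Im (1 / (of_real x - Complex E \<eta>))) has_integral (arctan ((b - x) / \<eta>) - arctan ((a - x) / \<eta>))) {a..b}"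
  proof (rule fundamental_theorem_of_calculus[OF ab])
    fix E assume "E \<in> {a..b}"
    have "((\<lambda>E. arctan ((E - x) / \<eta>)) has_real_derivative inverse (1 + ((E - x) / \<eta>)\<^sup>2) * (1 / \<eta>)) (at E within {a..b})"
      using \<eta> by (auto intro!: derivative_eq_intros)
    moreover have "inverse (1 + ((E - x) / \<eta>)\<^sup>2) * (1 / \<eta>) = Im (1 / (of_real x - Complex E \<eta>))"
    proof -
      have "0 < (E - x)\<^sup>2 + \<eta>\<^sup>2" using \<eta> by (simp add: add_nonneg_pos)
      then show ?thesis unfolding Im_kernel[OF \<eta>] using \<eta> by (simp add: field_simps power2_eq_square)
    qed
    ultimately show "((\<lambda>E. arctan ((E - x) / \<eta>)) has_vector_derivative Im (1 / (of_real x - Complex E \<eta>))) (at E within {a..b})"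
      by (simp add: has_real_derivative_iff_has_vector_derivative)
  qed
  then show ?thesis by (simp add: smooth_indicator_def)
qed

text \<open>
  Stieltjes inversion at positive height: integrating the imaginary part along a segment gives the smoothed
  window sum.
\<close>

lemma has_integral_Im_stieltjes:
  assumes ab: "a \<le> b" and \<eta>: "0 < \<eta>"
  shows "((\<lambda>E. Im (stieltjes n d l (Complex E \<eta>))) has_integral
     pi * ((\<Sum>i = 1..n. d i * smooth_indicator a b \<eta> (l i)) / real n)) {a..b}"
proof -
  have "((\<lambda>E. (\<Sum>i = 1..n. d i * Im (1 / (of_real (l i) - Complex E \<eta>))) / real n) has_integral
     (\<Sum>i = 1..n. d i * (pi * smooth_indicator a b \<eta> (l i))) / real n) {a..b}"
    by (intro has_integral_divide has_integral_sum has_integral_mult_right has_integral_Im_kernel assms) auto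
  moreover have "Im (stieltjes n d l z) = (\<Sum>i = 1..n. d i * Im (1 / (of_real (l i) - z))) / real n" for z
  proof -
    have "Im (of_real (d i) / w) = d i * Im (1 / w)" for i w by (simp add: Im_divide)
    then show ?thesis by (simp add: stieltjes_def)
  qed
  ultimately show ?thesis by (simp add: sum_distrib_left mult_ac)
qed

definition proportion :: "nat \<Rightarrow> (nat \<Rightarrow> real) \<Rightarrow> real set \<Rightarrow> real" where
  "proportion n l A = real (card {i\<in>{1..n}. l i \<in> A}) / real n"

lemma proportion_sum: "proportion n l A = (\<Sum>i = 1..n. indicator A (l i)) / real n"
proof -
  have "(\<Sum>i = 1..n. indicator A (l i) :: real) = (\<Sum>i\<in>{1..n}. if l i \<in> A then 1 else 0)"
    by (intro sum.cong) (auto simp: indicator_def)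
  also have "\<dots> = (\<Sum>i\<in>{i\<in>{1..n}. l i \<in> A}. 1)" by (rule sum.inter_filter[symmetric]) simp
  finally show ?thesis by (simp only: proportion_def) simp
qed

lemma proportion_mono: "A \<subseteq> B \<Longrightarrow> proportion n l A \<le> proportion n l B"
  unfolding proportion_def by (intro divide_right_mono of_nat_mono card_mono) auto

text \<open>
  The imaginary part of the kernel is at least \<open>1 / (2 \<eta>)\<close> within distance
  \<open>\<eta>\<close>, so a bounded Stieltjes transform forbids concentration of the points.
\<close>

lemma proportion_near_le:
  assumes \<eta>: "0 < \<eta>"
  shows "proportion n l {y. \<bar>y - E\<bar> \<le> \<eta>} \<le> 2 * \<eta> * cmod (stieltjes n (\<lambda>_. 1) l (Complex E \<eta>))"
proof -
  have k: "indicator {y. \<bar>y - E\<bar> \<le> \<eta>} x \<le> 2 * \<eta> * Im (1 / (of_real x - Complex E \<eta>))" for x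
  proof (cases "\<bar>x - E\<bar> \<le> \<eta>")
    case True
    then have "(E - x)\<^sup>2 \<le> \<eta>\<^sup>2" by (simp add: abs_le_square_iff[symmetric] abs_minus_commute)
    moreover have "0 < (E - x)\<^sup>2 + \<eta>\<^sup>2" using \<eta> by (simp add: add_nonneg_pos)
    ultimately show ?thesis unfolding Im_kernel[OF \<eta>] using True by (simp add: power2_eq_square field_simps)
  next
    case False
    then show ?thesis unfolding Im_kernel[OF \<eta>] using \<eta> by simp
  qed
  have "proportion n l {y. \<bar>y - E\<bar> \<le> \<eta>} \<le> (\<Sum>i = 1..n. 2 * \<eta> * Im (1 / (of_real (l i) - Complex E \<eta>))) / real n"
    unfolding proportion_sum by (intro divide_right_mono sum_mono k) simp
  also have "\<dots> = 2 * \<eta> * Im (stieltjes n (\<lambda>_. 1) l (Complex E \<eta>))"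
    by (simp add: stieltjes_def sum_distrib_left)
  also have "\<dots> \<le> 2 * \<eta> * cmod (stieltjes n (\<lambda>_. 1) l (Complex E \<eta>))"
    using \<eta> abs_Im_le_cmod[of "stieltjes n (\<lambda>_. 1) l (Complex E \<eta>)"] by (intro mult_left_mono) auto
  finally show ?thesis .
qed

text \<open>
  At \<open>z = i \<eta>\<close> each point \<open>y\<close> contributes \<open>y\<^sup>2 / (y\<^sup>2 +
  \<eta>\<^sup>2)\<close> to \<open>1 - \<eta> Im m\<close>, and this is at least one half when
  \<open>\<bar>y\<bar> \<ge> \<eta>\<close>.
\<close>

lemma proportion_tail_le:
  assumes \<eta>: "0 < \<eta>" and n: "0 < n"
  shows "proportion n l {y. \<eta> \<le> \<bar>y\<bar>} \<le> 2 * (1 - \<eta> * Im (stieltjes n (\<lambda>_. 1) l (Complex 0 \<eta>)))"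
proof -
  have k: "indicator {y. \<eta> \<le> \<bar>y\<bar>} x \<le> 2 * (1 - \<eta> * Im (1 / (of_real x - Complex 0 \<eta>)))" for x
  proof -
    have p: "0 < x\<^sup>2 + \<eta>\<^sup>2" using \<eta> by (simp add: add_nonneg_pos)
    then have "1 - \<eta> * (\<eta> / (x\<^sup>2 + \<eta>\<^sup>2)) = (x\<^sup>2 + \<eta>\<^sup>2) / (x\<^sup>2 + \<eta>\<^sup>2) - \<eta>\<^sup>2 / (x\<^sup>2 + \<eta>\<^sup>2)"
      using \<eta> by (simp add: power2_eq_square)
    also have "\<dots> = x\<^sup>2 / (x\<^sup>2 + \<eta>\<^sup>2)" by (simp only: diff_divide_distrib[symmetric]) simp
    finally have e: "1 - \<eta> * Im (1 / (of_real x - Complex 0 \<eta>)) = x\<^sup>2 / (x\<^sup>2 + \<eta>\<^sup>2)"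
      unfolding Im_kernel[OF \<eta>] by simp
    show ?thesis
    proof (cases "\<eta> \<le> \<bar>x\<bar>")
      case True
      then have "\<eta>\<^sup>2 \<le> x\<^sup>2" using \<eta> by (simp add: abs_le_square_iff[symmetric])
      then show ?thesis unfolding e using True p by (simp add: field_simps)
    qed (use p in \<open>simp add: e\<close>)
  qed
  have "proportion n l {y. \<eta> \<le> \<bar>y\<bar>} \<le> (\<Sum>i = 1..n. 2 * (1 - \<eta> * Im (1 / (of_real (l i) - Complex 0 \<eta>)))) / real n"
    unfolding proportion_sum by (intro divide_right_mono sum_mono k) simp
  also have "\<dots> = 2 * (1 - \<eta> * Im (stieltjes n (\<lambda>_. 1) l (Complex 0 \<eta>)))"
    using n by (simp add: stieltjes_def sum_distrib_left[symmetric] sum_subtractf diff_divide_distrib right_diff_distrib)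
  finally show ?thesis .
qed

definition window_mean :: "nat \<Rightarrow> (nat \<Rightarrow> real) \<Rightarrow> (nat \<Rightarrow> real) \<Rightarrow> real set \<Rightarrow> real" where
  "window_mean n d l A = (\<Sum>i = 1..n. d i * indicator A (l i)) / real n"

lemma window_mean_smooth_le:
  assumes ab: "a \<le> b" and \<eta>: "0 < \<eta>" and \<delta>: "0 < \<delta>" and d: "\<And>i. i \<in> {1..n} \<Longrightarrow> \<bar>d i\<bar> \<le> \<beta>" "0 \<le> \<beta>"
  shows "\<bar>window_mean n d l {a..b} - (\<Sum>i = 1..n. d i * smooth_indicator a b \<eta> (l i)) / real n\<bar> \<le>
    \<beta> * (\<eta> / \<delta> + proportion n l {y. \<bar>y - a\<bar> \<le> \<delta>} + proportion n l {y. \<bar>y - b\<bar> \<le> \<delta>})"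
proof (cases "n = 0")
  case False
  have "\<bar>window_mean n d l {a..b} - (\<Sum>i = 1..n. d i * smooth_indicator a b \<eta> (l i)) / real n\<bar> =
      \<bar>\<Sum>i = 1..n. d i * (indicator {a..b} (l i) - smooth_indicator a b \<eta> (l i))\<bar> / real n"
    by (simp only: window_mean_def right_diff_distrib sum_subtractf diff_divide_distrib[symmetric] abs_divide abs_of_nat)
  also have "\<dots> \<le> (\<Sum>i = 1..n. \<beta> * (\<eta> / \<delta> + indicator {y. \<bar>y - a\<bar> \<le> \<delta>} (l i) + indicator {y. \<bar>y - b\<bar> \<le> \<delta>} (l i))) / real n"
  proof (intro divide_right_mono order_trans[OF sum_abs] sum_mono)
    fix i assume "i \<in> {1..n}"
    then show "\<bar>d i * (indicator {a..b} (l i) - smooth_indicator a b \<eta> (l i))\<bar> \<le>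
        \<beta> * (\<eta> / \<delta> + indicator {y. \<bar>y - a\<bar> \<le> \<delta>} (l i) + indicator {y. \<bar>y - b\<bar> \<le> \<delta>} (l i))"
      unfolding abs_mult using smooth_indicator_approx[OF ab \<eta> \<delta>] d by (intro mult_mono) auto
  qed simp
  also have "\<dots> = \<beta> * (\<eta> / \<delta> + proportion n l {y. \<bar>y - a\<bar> \<le> \<delta>} + proportion n l {y. \<bar>y - b\<bar> \<le> \<delta>})"
    using False by (simp add: proportion_sum sum_distrib_left[symmetric] sum.distrib field_simps)
  finally show ?thesis .
qed (use assms in \<open>simp add: window_mean_def proportion_def\<close>)

text \<open>
  Equal limits of the transforms give equal limits of the smoothed window sums; since the transforms of the
  unweighted points are bounded by \<open>R\<close> up to the real line, the smoothing error is small
  uniformly in \<open>n\<close>.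
\<close>

lemma window_mean_diff_tendsto:
  fixes l l' :: "nat \<Rightarrow> nat \<Rightarrow> real"
  assumes ab: "a \<le> b"
    and d: "\<And>n i. i \<in> {1..n} \<Longrightarrow> \<bar>d n i\<bar> \<le> \<beta>" "\<And>n i. i \<in> {1..n} \<Longrightarrow> \<bar>d' n i\<bar> \<le> \<beta>" and \<beta>: "0 \<le> \<beta>"
    and lim: "\<And>z. 0 < Im z \<Longrightarrow> (\<lambda>n. stieltjes n (d n) (l n) z - stieltjes n (d' n) (l' n) z) \<longlonglongrightarrow> 0"
    and R: "\<And>z. 0 < Im z \<Longrightarrow> \<forall>\<^sub>F n in sequentially. cmod (stieltjes n (\<lambda>_. 1) (l n) z) \<le> R"
      "\<And>z. 0 < Im z \<Longrightarrow> \<forall>\<^sub>F n in sequentially. cmod (stieltjes n (\<lambda>_. 1) (l' n) z) \<le> R" and R0: "0 \<le> R"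
  shows "(\<lambda>n. window_mean n (d n) (l n) {a..b} - window_mean n (d' n) (l' n) {a..b}) \<longlonglongrightarrow> 0"
proof (rule LIMSEQ_I)
  fix e :: real assume e: "0 < e"
  define \<delta> where "\<delta> = e / (4 * (\<beta> * (1 + 4 * R) + 1))"
  have K: "0 \<le> \<beta> * (1 + 4 * R)" using \<beta> R0 by simp
  have \<delta>: "0 < \<delta>" using e K by (simp add: \<delta>_def)
  have \<delta>e: "\<beta> * (1 + 4 * R) * \<delta> \<le> e / 4"
    unfolding \<delta>_def using e K by (simp add: field_simps)
  \<comment> \<open>The smoothing width is of smaller order than the distance \<open>\<delta>\<close> from the endpoints.\<close>
  define \<eta> where "\<eta> = \<delta>\<^sup>2"
  have \<eta>: "0 < \<eta>" using \<delta> by (simp add: \<eta>_def)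
  define sm where "sm n d l = (\<Sum>i = 1..n. d i * smooth_indicator a b \<eta> (l i)) / real n" for n d l
  have near: "\<forall>\<^sub>F n in sequentially. \<bar>window_mean n (d n) (l n) {a..b} - sm n (d n) (l n)\<bar> \<le> e / 4"
    if d: "\<And>n i. i \<in> {1..n} \<Longrightarrow> \<bar>d n i\<bar> \<le> \<beta>"
      and R: "\<And>z. 0 < Im z \<Longrightarrow> \<forall>\<^sub>F n in sequentially. cmod (stieltjes n (\<lambda>_. 1) (l n) z) \<le> R" for d l :: "nat \<Rightarrow> nat \<Rightarrow> real"
  proof -
    have "\<forall>\<^sub>F n in sequentially. cmod (stieltjes n (\<lambda>_. 1) (l n) (Complex a \<delta>)) \<le> R"
      "\<forall>\<^sub>F n in sequentially. cmod (stieltjes n (\<lambda>_. 1) (l n) (Complex b \<delta>)) \<le> R" using R \<delta> by auto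
    then show ?thesis
    proof eventually_elim
      case (elim n)
      have f: "proportion n (l n) {y. \<bar>y - E\<bar> \<le> \<delta>} \<le> 2 * \<delta> * R" if "cmod (stieltjes n (\<lambda>_. 1) (l n) (Complex E \<delta>)) \<le> R" for E
        using proportion_near_le[OF \<delta>, of n "l n" E] mult_left_mono[OF that, of "2 * \<delta>"] \<delta> by linarith
      have "\<bar>window_mean n (d n) (l n) {a..b} - sm n (d n) (l n)\<bar> \<le>
        \<beta> * (\<eta> / \<delta> + proportion n (l n) {y. \<bar>y - a\<bar> \<le> \<delta>} + proportion n (l n) {y. \<bar>y - b\<bar> \<le> \<delta>})"
        unfolding sm_def by (rule window_mean_smooth_le[OF ab \<eta> \<delta> d \<beta>])
      also have "\<dots> \<le> \<beta> * (\<delta> + 2 * \<delta> * R + 2 * \<delta> * R)"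
        using f elim \<delta> \<beta> by (intro mult_left_mono add_mono) (auto simp: \<eta>_def power2_eq_square)
      also have "\<dots> = \<beta> * (1 + 4 * R) * \<delta>" by (simp add: algebra_simps)
      finally show ?case using \<delta>e by linarith
    qed
  qed
  have "(\<lambda>n. integral {a..b} (\<lambda>E. Im (stieltjes n (d n) (l n) (Complex E \<eta>)) - Im (stieltjes n (d' n) (l' n) (Complex E \<eta>)))) \<longlonglongrightarrow>
     integral {a..b} (\<lambda>E. 0)"
  proof (rule dominated_convergence(2)[where h="\<lambda>_. 2 * (\<beta> / \<eta>)"])
    fix n
    show "(\<lambda>E. Im (stieltjes n (d n) (l n) (Complex E \<eta>)) - Im (stieltjes n (d' n) (l' n) (Complex E \<eta>))) integrable_on {a..b}"
      by (intro integrable_diff has_integral_integrable[OF has_integral_Im_stieltjes[OF ab \<eta>]])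
    show "(\<lambda>_::real. 2 * (\<beta> / \<eta>)) integrable_on {a..b}" by (rule integrable_const_ivl)
    fix E :: real
    have "cmod (stieltjes n (d n) (l n) (Complex E \<eta>)) \<le> \<beta> / \<eta>" "cmod (stieltjes n (d' n) (l' n) (Complex E \<eta>)) \<le> \<beta> / \<eta>"
      using d \<beta> \<eta> by (auto intro!: stieltjes_norm)
    then show "norm (Im (stieltjes n (d n) (l n) (Complex E \<eta>)) - Im (stieltjes n (d' n) (l' n) (Complex E \<eta>))) \<le> 2 * (\<beta> / \<eta>)"
      using abs_Im_le_cmod[of "stieltjes n (d n) (l n) (Complex E \<eta>)"] abs_Im_le_cmod[of "stieltjes n (d' n) (l' n) (Complex E \<eta>)"]
      unfolding real_norm_def by linarith
  next
    fix E :: real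
    show "(\<lambda>n. Im (stieltjes n (d n) (l n) (Complex E \<eta>)) - Im (stieltjes n (d' n) (l' n) (Complex E \<eta>))) \<longlonglongrightarrow> 0"
      using tendsto_Im[OF lim[of "Complex E \<eta>"]] \<eta> by simp
  qed
  moreover have "integral {a..b} (\<lambda>E. Im (stieltjes n (d n) (l n) (Complex E \<eta>)) - Im (stieltjes n (d' n) (l' n) (Complex E \<eta>))) =
     pi * (sm n (d n) (l n) - sm n (d' n) (l' n))" for n
    unfolding right_diff_distrib sm_def by (intro integral_unique has_integral_diff has_integral_Im_stieltjes ab \<eta>)
  ultimately have A: "(\<lambda>n. pi * (sm n (d n) (l n) - sm n (d' n) (l' n))) \<longlonglongrightarrow> 0" by simp
  have "(\<lambda>n. sm n (d n) (l n) - sm n (d' n) (l' n)) \<longlonglongrightarrow> 0"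
    using tendsto_mult_left[OF A, of "inverse pi"] by simp
  then have "\<forall>\<^sub>F n in sequentially. \<bar>sm n (d n) (l n) - sm n (d' n) (l' n)\<bar> < e / 4"
    using e by (auto simp: tendsto_iff dist_real_def elim!: allE[of _ "e/4"])
  moreover have "\<forall>\<^sub>F n in sequentially. \<bar>window_mean n (d n) (l n) {a..b} - sm n (d n) (l n)\<bar> \<le> e / 4"
    by (rule near) (use d(1) R(1) in auto)
  moreover have "\<forall>\<^sub>F n in sequentially. \<bar>window_mean n (d' n) (l' n) {a..b} - sm n (d' n) (l' n)\<bar> \<le> e / 4"
    by (rule near) (use d(2) R(2) in auto)
  ultimately have "\<forall>\<^sub>F n in sequentially. norm (window_mean n (d n) (l n) {a..b} - window_mean n (d' n) (l' n) {a..b} - 0) < e"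
    unfolding real_norm_def by eventually_elim (use e in linarith)
  then show "\<exists>N. \<forall>n\<ge>N. norm (window_mean n (d n) (l n) {a..b} - window_mean n (d' n) (l' n) {a..b} - 0) < e"
    by (simp add: eventually_sequentially)
qed

text \<open>
  The indices of the points above the threshold \<open>E\<close> form an initial segment, so cutting at the
  index \<open>N\<close> and at the threshold differ only by the indices between the two cuts and by the
  points beyond \<open>T\<close>.
\<close>

lemma top_sum_vs_threshold:
  assumes n: "0 < n" and dec: "\<And>i j. i \<in> {1..n} \<Longrightarrow> j \<in> {1..n} \<Longrightarrow> i \<le> j \<Longrightarrow> l j \<le> l i"
    and d: "\<And>i. i \<in> {1..n} \<Longrightarrow> \<bar>d i\<bar> \<le> \<beta>" "0 \<le> \<beta>" and N: "N \<le> n"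
    and tail: "proportion n l {y. T \<le> \<bar>y\<bar>} \<le> \<epsilon>" and T: "0 \<le> T"
  shows "\<bar>(\<Sum>i = 1..N. d i) / real n - window_mean n d l {E..T}\<bar> \<le> \<beta> * (\<bar>real N / real n - proportion n l {E..T}\<bar> + 2 * \<epsilon>)"
proof -
  define J where "J = {i\<in>{1..n}. l i \<in> {E..T}}"
  define I where "I = {i\<in>{1..n}. E \<le> l i}"
  have fJ: "finite J" and fI: "finite I" by (auto simp: J_def I_def)
  have JI: "J \<subseteq> I" by (auto simp: J_def I_def)
  define p where "p = card I"
  have I: "I = {1..p}"
  proof (cases "I = {}")
    case False
    define q where "q = Max I"
    have q: "q \<in> I" unfolding q_def using False fI by simp
    have "I = {1..q}"
    proof
      show "I \<subseteq> {1..q}" using fI by (auto simp: q_def I_def intro!: Max_ge)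
      show "{1..q} \<subseteq> I" using q dec[of _ q] by (fastforce simp: I_def)
    qed
    then show ?thesis by (simp add: p_def)
  qed (simp add: p_def)
  have cd: "real (card (I - J)) \<le> \<epsilon> * real n"
  proof -
    have "card (I - J) \<le> card {i\<in>{1..n}. l i \<in> {y. T \<le> \<bar>y\<bar>}}"
      by (intro card_mono) (auto simp: I_def J_def)
    then have "real (card (I - J)) \<le> proportion n l {y. T \<le> \<bar>y\<bar>} * real n" using n by (simp add: proportion_def)
    also have "\<dots> \<le> \<epsilon> * real n" using tail by (intro mult_right_mono) auto
    finally show ?thesis .
  qed
  have pJ: "real p = real (card J) + real (card (I - J))"
    using card_Diff_subset[OF fJ JI] card_mono[OF fI JI] by (simp add: p_def)
  have pn: "p \<le> n" using card_mono[of "{1..n}" I] by (simp add: p_def I_def subset_iff)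
  have sd: "\<bar>sum d A - sum d B\<bar> \<le> \<beta> * real (card (A - B) + card (B - A))" if AB: "A \<subseteq> {1..n}" "B \<subseteq> {1..n}" for A B
  proof -
    have fin: "finite A" "finite B" using AB by (auto intro: finite_subset)
    have "sum d A - sum d B = sum d (A - B) - sum d (B - A)"
      using sum.Int_Diff[of A d B] sum.Int_Diff[of B d A] fin by (simp add: Int_commute)
    moreover have "\<bar>sum d C\<bar> \<le> \<beta> * real (card C)" if C: "C \<subseteq> {1..n}" for C
    proof -
      have "\<bar>sum d C\<bar> \<le> (\<Sum>i\<in>C. \<beta>)" using C d(1) by (intro order_trans[OF sum_abs] sum_mono) auto
      then show ?thesis by (simp add: mult.commute)
    qed
    then have "\<bar>sum d (A - B)\<bar> \<le> \<beta> * real (card (A - B))" "\<bar>sum d (B - A)\<bar> \<le> \<beta> * real (card (B - A))"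
      using AB by (meson Diff_subset order_trans)+
    ultimately show ?thesis by (simp add: distrib_left)
  qed
  have "\<bar>sum d {1..N} - sum d J\<bar> \<le> \<bar>sum d {1..N} - sum d I\<bar> + \<bar>sum d I - sum d J\<bar>" by linarith
  also have "\<dots> \<le> \<beta> * real (card ({1..N} - I) + card (I - {1..N})) + \<beta> * real (card (I - J) + card (J - I))"
    using N pn by (intro add_mono sd) (auto simp: I J_def)
  also have "real (card ({1..N} - I) + card (I - {1..N})) = \<bar>real N - real p\<bar>"
  proof -
    have "{1..N} - {1..p} = {p<..N}" "{1..p} - {1..N} = {N<..p}" by auto
    then show ?thesis unfolding I by simp
  qed
  also have "J - I = {}" using JI by auto
  also have "\<beta> * \<bar>real N - real p\<bar> + \<beta> * real (card (I - J) + card ({}::nat set)) \<le>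
      \<beta> * (\<bar>real N - real (card J)\<bar> + 2 * \<epsilon> * real n)"
    unfolding distrib_left[symmetric] using pJ cd d(2) by (intro mult_left_mono) auto
  finally have "\<bar>sum d {1..N} - sum d J\<bar> \<le> \<beta> * (\<bar>real N - real (card J)\<bar> + 2 * \<epsilon> * real n)" .
  then have "\<bar>sum d {1..N} - sum d J\<bar> / real n \<le> \<beta> * (\<bar>real N - real (card J)\<bar> + 2 * \<epsilon> * real n) / real n"
    by (intro divide_right_mono) auto
  also have "\<dots> = \<beta> * (\<bar>real N / real n - proportion n l {E..T}\<bar> + 2 * \<epsilon>)"
    using n by (simp add: proportion_def J_def field_simps abs_divide[symmetric] diff_divide_distrib[symmetric])
  also have "\<bar>sum d {1..N} - sum d J\<bar> / real n = \<bar>sum d {1..N} / real n - window_mean n d l {E..T}\<bar>"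
  proof -
    have "sum d J = (\<Sum>i = 1..n. d i * indicator {E..T} (l i))"
      unfolding J_def by (subst sum.inter_filter, simp, intro sum.cong refl, simp only: indicator_def, simp)
    then show ?thesis by (simp add: window_mean_def diff_divide_distrib[symmetric])
  qed
  finally show ?thesis .
qed

lemma discrete_intermediate_value:
  fixes c :: "nat \<Rightarrow> real"
  assumes step: "\<And>j. j < k \<Longrightarrow> c j \<le> c (Suc j) + \<epsilon>" and e: "0 \<le> \<epsilon>" and top: "t \<le> c 0 + \<epsilon>" and bot: "c k \<le> t + \<epsilon>"
  obtains j where "j \<le> k" "\<bar>c j - t\<bar> \<le> \<epsilon>"
proof -
  define j where "j = (LEAST j. c j \<le> t + \<epsilon>)"
  have j: "c j \<le> t + \<epsilon>" unfolding j_def by (rule LeastI[of _ k]) (rule bot)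
  have jk: "j \<le> k" unfolding j_def by (rule Least_le) (rule bot)
  have "t - \<epsilon> \<le> c j"
  proof (cases j)
    case (Suc i)
    have "\<not> c i \<le> t + \<epsilon>" using not_less_Least[of i "\<lambda>j. c j \<le> t + \<epsilon>"] Suc unfolding j_def by simp
    then show ?thesis using step[of i] Suc jk e by auto
  qed (use top in simp)
  then show ?thesis using j jk that by auto
qed

text \<open>
  A sum over the \<open>N\<close> largest points is close to a window sum above a suitable threshold, and
  window sums of the two systems agree asymptotically. The threshold depends on \<open>n\<close>, but a finite
  grid of thresholds suffices: each cell contains a small proportion of the points, so a discrete intermediate
  value argument finds a grid point above which the proportion is almost \<open>N / n\<close>.
\<close>

lemma top_sums_diff_tendsto:
  fixes l l' d d' :: "nat \<Rightarrow> nat \<Rightarrow> real"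
  assumes dec: "\<And>n i j. i \<in> {1..n} \<Longrightarrow> j \<in> {1..n} \<Longrightarrow> i \<le> j \<Longrightarrow> l n j \<le> l n i"
      "\<And>n i j. i \<in> {1..n} \<Longrightarrow> j \<in> {1..n} \<Longrightarrow> i \<le> j \<Longrightarrow> l' n j \<le> l' n i"
    and d: "\<And>n i. i \<in> {1..n} \<Longrightarrow> \<bar>d n i\<bar> \<le> \<beta>" "\<And>n i. i \<in> {1..n} \<Longrightarrow> \<bar>d' n i\<bar> \<le> \<beta>" and \<beta>: "0 \<le> \<beta>"
    and lim: "\<And>z. 0 < Im z \<Longrightarrow> (\<lambda>n. stieltjes n (d n) (l n) z - stieltjes n (d' n) (l' n) z) \<longlonglongrightarrow> 0"
    and lim1: "\<And>z. 0 < Im z \<Longrightarrow> (\<lambda>n. stieltjes n (\<lambda>_. 1) (l n) z - stieltjes n (\<lambda>_. 1) (l' n) z) \<longlonglongrightarrow> 0"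
    and R: "\<And>z. 0 < Im z \<Longrightarrow> \<forall>\<^sub>F n in sequentially. cmod (stieltjes n (\<lambda>_. 1) (l n) z) \<le> R"
      "\<And>z. 0 < Im z \<Longrightarrow> \<forall>\<^sub>F n in sequentially. cmod (stieltjes n (\<lambda>_. 1) (l' n) z) \<le> R" and R0: "0 < R"
    and tight: "\<And>e. 0 < e \<Longrightarrow> \<exists>T>0. \<forall>\<^sub>F n in sequentially. proportion n (l n) {y. T \<le> \<bar>y\<bar>} \<le> e \<and> proportion n (l' n) {y. T \<le> \<bar>y\<bar>} \<le> e"
    and N: "\<And>n. N n \<le> n"
  shows "(\<lambda>n. (\<Sum>i = 1..N n. d n i) / real n - (\<Sum>i = 1..N n. d' n i) / real n) \<longlonglongrightarrow> 0"
proof (rule LIMSEQ_I)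
  fix e :: real assume e: "0 < e"
  \<comment> \<open>The error is \<open>3 \<beta> \<epsilon>\<close> for the first system, \<open>4 \<beta> \<epsilon>\<close> for the second, whose proportion is off by another \<open>\<epsilon>\<close>, and \<open>\<epsilon>\<close> between the window sums.\<close>
  define \<epsilon> where "\<epsilon> = e / (7 * \<beta> + 2)"
  have \<epsilon>: "0 < \<epsilon>" using e \<beta> by (simp add: \<epsilon>_def add_nonneg_pos)
  have \<epsilon>e: "(7 * \<beta> + 1) * \<epsilon> < e" unfolding \<epsilon>_def using e \<beta> by (simp add: field_simps)
  obtain T where T: "0 < T" and tail: "\<forall>\<^sub>F n in sequentially. proportion n (l n) {y. T \<le> \<bar>y\<bar>} \<le> \<epsilon> \<and> proportion n (l' n) {y. T \<le> \<bar>y\<bar>} \<le> \<epsilon>"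
    using tight[OF \<epsilon>] by blast
  \<comment> \<open>The cells of the grid are so small that each contains at most the proportion \<open>\<epsilon>\<close> of the points.\<close>
  obtain k :: nat where k: "4 * T * R / \<epsilon> < real k" using reals_Archimedean2 by blast
  have k0: "0 < real k" using k T R0 \<epsilon> by (smt (verit) divide_pos_pos mult_pos_pos)
  define \<delta> where "\<delta> = 2 * T / real k"
  have \<delta>: "0 < \<delta>" using T k0 by (simp add: \<delta>_def)
  have \<delta>R: "2 * \<delta> * R \<le> \<epsilon>" using k k0 \<epsilon> by (simp add: \<delta>_def field_simps)
  define E where "E j = - T + \<delta> * real j" for j
  have Ek: "E k = T" using k0 by (simp add: E_def \<delta>_def)
  have E0: "E 0 = - T" by (simp add: E_def)
  have ET: "E j \<le> T" if "j \<le> k" for j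
  proof -
    have "\<delta> * real j \<le> \<delta> * real k" using that \<delta> by (intro mult_left_mono) auto
    then show ?thesis using Ek by (simp add: E_def)
  qed
  have c1: "\<forall>\<^sub>F n in sequentially. \<forall>j\<in>{..k}. \<bar>window_mean n (d n) (l n) {E j..T} - window_mean n (d' n) (l' n) {E j..T}\<bar> < \<epsilon>"
  proof (intro eventually_ball_finite ballI)
    fix j assume "j \<in> {..k}"
    then have "(\<lambda>n. window_mean n (d n) (l n) {E j..T} - window_mean n (d' n) (l' n) {E j..T}) \<longlonglongrightarrow> 0"
      using ET R0 by (intro window_mean_diff_tendsto[where \<beta>=\<beta> and R=R] d \<beta> lim R) auto
    then show "\<forall>\<^sub>F n in sequentially. \<bar>window_mean n (d n) (l n) {E j..T} - window_mean n (d' n) (l' n) {E j..T}\<bar> < \<epsilon>"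
      using \<epsilon> by (auto simp: tendsto_iff dist_real_def)
  qed simp
  have c2: "\<forall>\<^sub>F n in sequentially. \<forall>j\<in>{..k}. \<bar>proportion n (l n) {E j..T} - proportion n (l' n) {E j..T}\<bar> < \<epsilon>"
  proof (intro eventually_ball_finite ballI)
    fix j assume "j \<in> {..k}"
    then have "(\<lambda>n. window_mean n (\<lambda>_. 1) (l n) {E j..T} - window_mean n (\<lambda>_. 1) (l' n) {E j..T}) \<longlonglongrightarrow> 0"
      using ET R0 by (intro window_mean_diff_tendsto[where \<beta>=1 and R=R] lim1 R) auto
    then show "\<forall>\<^sub>F n in sequentially. \<bar>proportion n (l n) {E j..T} - proportion n (l' n) {E j..T}\<bar> < \<epsilon>"
      using \<epsilon> by (auto simp: tendsto_iff dist_real_def window_mean_def proportion_sum)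
  qed simp
  have c3: "\<forall>\<^sub>F n in sequentially. \<forall>j\<in>{..k}. cmod (stieltjes n (\<lambda>_. 1) (l n) (Complex (E j) \<delta>)) \<le> R"
    using R(1) \<delta> by (intro eventually_ball_finite ballI) auto
  have "\<forall>\<^sub>F n in sequentially. norm ((\<Sum>i = 1..N n. d n i) / real n - (\<Sum>i = 1..N n. d' n i) / real n - 0) < e"
    using tail c1 c2 c3 eventually_gt_at_top[of 0]
  proof eventually_elim
    case (elim n)
    define b where "b = real (N n) / real n"
    have b: "0 \<le> b" "b \<le> 1" using N[of n] elim by (auto simp: b_def)
    obtain j where j: "j \<le> k" "\<bar>proportion n (l n) {E j..T} - b\<bar> \<le> \<epsilon>"
    proof (rule discrete_intermediate_value[where c="\<lambda>j. proportion n (l n) {E j..T}" and k=k and \<epsilon>=\<epsilon> and t=b])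
      fix j assume j: "j < k"
      have "proportion n (l n) {E j..T} \<le> proportion n (l n) {y. \<bar>y - E j\<bar> \<le> \<delta>} + proportion n (l n) {E (Suc j)..T}"
      proof -
        have "indicator {E j..T} y \<le> indicator {y. \<bar>y - E j\<bar> \<le> \<delta>} y + (indicator {E (Suc j)..T} y :: real)" for y
          by (auto simp: indicator_def E_def algebra_simps abs_le_iff)
        then show ?thesis unfolding proportion_sum add_divide_distrib[symmetric] sum.distrib[symmetric]
          by (intro divide_right_mono sum_mono) auto
      qed
      moreover have "proportion n (l n) {y. \<bar>y - E j\<bar> \<le> \<delta>} \<le> \<epsilon>"
        using proportion_near_le[OF \<delta>, of n "l n" "E j"] mult_left_mono[of _ R "2 * \<delta>"] elim(4) j \<delta> \<delta>R
        by (smt (verit) atMost_iff less_imp_le)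
      ultimately show "proportion n (l n) {E j..T} \<le> proportion n (l n) {E (Suc j)..T} + \<epsilon>" by linarith
    next
      have "1 \<le> proportion n (l n) {E 0..T} + proportion n (l n) {y. T \<le> \<bar>y\<bar>}"
      proof -
        have "1 \<le> indicator {E 0..T} y + (indicator {y. T \<le> \<bar>y\<bar>} y :: real)" for y
          by (auto simp: indicator_def E0 abs_if)
        then have "(\<Sum>i = 1..n. 1) / real n \<le> proportion n (l n) {E 0..T} + proportion n (l n) {y. T \<le> \<bar>y\<bar>}"
          unfolding proportion_sum add_divide_distrib[symmetric] sum.distrib[symmetric]
          by (intro divide_right_mono sum_mono) auto
        then show ?thesis using elim by simp
      qed
      then show "b \<le> proportion n (l n) {E 0..T} + \<epsilon>" using elim(1) b by linarith
      have "proportion n (l n) {E k..T} \<le> proportion n (l n) {y. T \<le> \<bar>y\<bar>}" by (rule proportion_mono) (auto simp: Ek)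
      then show "proportion n (l n) {E k..T} \<le> b + \<epsilon>" using elim(1) b by linarith
    qed (use \<epsilon> in auto)
    have jm: "j \<in> {..k}" using j by simp
    have x1: "\<bar>window_mean n (d n) (l n) {E j..T} - window_mean n (d' n) (l' n) {E j..T}\<bar> < \<epsilon>"
      and x2: "\<bar>proportion n (l n) {E j..T} - proportion n (l' n) {E j..T}\<bar> < \<epsilon>" using elim jm by auto
    have "\<bar>(\<Sum>i = 1..N n. d n i) / real n - window_mean n (d n) (l n) {E j..T}\<bar> \<le> \<beta> * (\<bar>b - proportion n (l n) {E j..T}\<bar> + 2 * \<epsilon>)"
      unfolding b_def using elim T by (intro top_sum_vs_threshold dec d \<beta> N) auto
    also have "\<dots> \<le> \<beta> * (3 * \<epsilon>)" using j \<beta> by (intro mult_left_mono) auto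
    finally have y1: "\<bar>(\<Sum>i = 1..N n. d n i) / real n - window_mean n (d n) (l n) {E j..T}\<bar> \<le> \<beta> * (3 * \<epsilon>)" .
    have "\<bar>(\<Sum>i = 1..N n. d' n i) / real n - window_mean n (d' n) (l' n) {E j..T}\<bar> \<le> \<beta> * (\<bar>b - proportion n (l' n) {E j..T}\<bar> + 2 * \<epsilon>)"
      unfolding b_def using elim T by (intro top_sum_vs_threshold dec d \<beta> N) auto
    also have "\<dots> \<le> \<beta> * (4 * \<epsilon>)" using j x2 \<beta> by (intro mult_left_mono) auto
    finally have y2: "\<bar>(\<Sum>i = 1..N n. d' n i) / real n - window_mean n (d' n) (l' n) {E j..T}\<bar> \<le> \<beta> * (4 * \<epsilon>)" .
    have "(7 * \<beta> + 1) * \<epsilon> = \<beta> * (3 * \<epsilon>) + \<beta> * (4 * \<epsilon>) + \<epsilon>" by (simp add: algebra_simps)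
    then show ?case using x1 y1 y2 \<epsilon>e unfolding real_norm_def by linarith
  qed
  then show "\<exists>N'. \<forall>n\<ge>N'. norm ((\<Sum>i = 1..N n. d n i) / real n - (\<Sum>i = 1..N n. d' n i) / real n - 0) < e"
    by (simp add: eventually_sequentially)
qed

section \<open>Approximately subordinated systems\<close>

text \<open>
  The weights \<open>d\<close> at the points \<open>l\<close> asymptotically have the transform
  \<open>\<integral> f(x) / (x - w) dH(x)\<close> at the shifted parameter \<open>w = z + \<sigma>\<^sup>2
  m\<close>, with \<open>m\<close> the transform of the unweighted points. For \<open>f = 1\<close> and unit
  weights this is the self-consistent equation of free convolution of \<open>H\<close> with a semicircle law
  of variance \<open>\<sigma>\<^sup>2\<close>.
\<close>

definition approx_subordinated ::
  "real measure \<Rightarrow> (real \<Rightarrow> real) \<Rightarrow> real \<Rightarrow> (nat \<Rightarrow> nat \<Rightarrow> real) \<Rightarrow> (nat \<Rightarrow> nat \<Rightarrow> real) \<Rightarrow> complex \<Rightarrow> bool" where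
  "approx_subordinated H f \<sigma> d l z \<longleftrightarrow>
    (\<lambda>n. stieltjes n (d n) (l n) z - cauchy_transform H f (z + of_real (\<sigma>\<^sup>2) * stieltjes n (\<lambda>_. 1) (l n) z)) \<longlonglongrightarrow> 0"

lemma approx_subordinatedI:
  assumes H: "real_distribution H" and w: "weak_conv_m (\<lambda>n. empirical_distr n (x n)) H"
    and f: "continuous_on UNIV f" "\<And>x. \<bar>f x\<bar> \<le> \<beta>" and z: "0 < Im z" and s: "s \<longlonglongrightarrow> \<sigma>"
    and lim: "(\<lambda>n. stieltjes n (d n) (l n) z - stieltjes n (\<lambda>i. f (x n i)) (x n) (z + of_real ((s n)\<^sup>2) * stieltjes n (\<lambda>_. 1) (l n) z)) \<longlonglongrightarrow> 0"
  shows "approx_subordinated H f \<sigma> d l z"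
proof -
  define m where "m n = stieltjes n (\<lambda>_. 1) (l n) z" for n
  define u where "u n = z + of_real ((s n)\<^sup>2) * m n" for n
  define w where "w n = z + of_real (\<sigma>\<^sup>2) * m n" for n
  have Im_m: "0 \<le> Im (m n)" for n unfolding m_def by (rule stieltjes_Im_nonneg[OF z])
  have mb: "cmod (m n) \<le> 1 / Im z" for n unfolding m_def by (rule stieltjes_norm) (use z in auto)
  have Iu: "Im z \<le> Im (u n)" "Im z \<le> Im (w n)" for n using Im_m[of n] by (auto simp: u_def w_def)
  have fm: "f \<in> borel_measurable borel" using f(1) by (rule borel_measurable_continuous_onI)
  have 1: "(\<lambda>n. stieltjes n (\<lambda>i. f (x n i)) (x n) (u n) - cauchy_transform H f (u n)) \<longlonglongrightarrow> 0"
    by (rule stieltjes_tendsto_cauchy_transform[OF H \<open>weak_conv_m _ H\<close> f z Iu(1)])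
  have 2: "(\<lambda>n. cauchy_transform H f (u n) - cauchy_transform H f (w n)) \<longlonglongrightarrow> 0"
  proof (rule Lim_null_comparison)
    show "\<forall>\<^sub>F n in sequentially. norm (cauchy_transform H f (u n) - cauchy_transform H f (w n)) \<le>
        \<beta> / (Im z)\<^sup>2 * (\<bar>(s n)\<^sup>2 - \<sigma>\<^sup>2\<bar> * (1 / Im z))"
    proof (intro always_eventually allI)
      fix n
      have "0 \<le> \<beta>" using f(2)[of 0] by linarith
      have "u n - w n = of_real ((s n)\<^sup>2 - \<sigma>\<^sup>2) * m n" by (simp add: u_def w_def algebra_simps)
      then have "cmod (u n - w n) = \<bar>(s n)\<^sup>2 - \<sigma>\<^sup>2\<bar> * cmod (m n)" by (simp only: norm_mult norm_of_real)
      also have "\<dots> \<le> \<bar>(s n)\<^sup>2 - \<sigma>\<^sup>2\<bar> * (1 / Im z)" by (intro mult_left_mono mb) auto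
      finally have "\<beta> / (Im z)\<^sup>2 * cmod (u n - w n) \<le> \<beta> / (Im z)\<^sup>2 * (\<bar>(s n)\<^sup>2 - \<sigma>\<^sup>2\<bar> * (1 / Im z))"
        using \<open>0 \<le> \<beta>\<close> by (intro mult_left_mono) auto
      then show "norm (cauchy_transform H f (u n) - cauchy_transform H f (w n)) \<le>
          \<beta> / (Im z)\<^sup>2 * (\<bar>(s n)\<^sup>2 - \<sigma>\<^sup>2\<bar> * (1 / Im z))"
        using cauchy_transform_lipschitz[OF H fm f(2) z Iu] by (rule order_trans[rotated])
    qed
    have "(\<lambda>n. \<bar>(s n)\<^sup>2 - \<sigma>\<^sup>2\<bar>) \<longlonglongrightarrow> \<bar>\<sigma>\<^sup>2 - \<sigma>\<^sup>2\<bar>" by (intro tendsto_intros s)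
    then have "(\<lambda>n. \<beta> / (Im z)\<^sup>2 * (\<bar>(s n)\<^sup>2 - \<sigma>\<^sup>2\<bar> * (1 / Im z))) \<longlonglongrightarrow> \<beta> / (Im z)\<^sup>2 * (\<bar>\<sigma>\<^sup>2 - \<sigma>\<^sup>2\<bar> * (1 / Im z))"
      by (intro tendsto_mult tendsto_const)
    then show "(\<lambda>n. \<beta> / (Im z)\<^sup>2 * (\<bar>(s n)\<^sup>2 - \<sigma>\<^sup>2\<bar> * (1 / Im z))) \<longlonglongrightarrow> 0" by simp
  qed
  from tendsto_add[OF tendsto_add[OF lim[folded m_def, folded u_def] 1] 2]
  show ?thesis unfolding approx_subordinated_def m_def[symmetric] w_def by simp
qed

text \<open>
  Stability identifies the unweighted transforms of the two systems; the weighted ones follow because they are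
  Lipschitz functions of them.
\<close>

lemma stieltjes_diff_tendsto_if_approx_subordinated:
  assumes H: "real_distribution H" and \<sigma>: "0 < \<sigma>" and z: "0 < Im z"
    and f: "f \<in> borel_measurable borel" "\<And>x. \<bar>f x\<bar> \<le> \<beta>"
    and one: "approx_subordinated H (\<lambda>_. 1) \<sigma> (\<lambda>_ _. 1) l z" "approx_subordinated H (\<lambda>_. 1) \<sigma> (\<lambda>_ _. 1) l' z"
    and d: "approx_subordinated H f \<sigma> d l z" "approx_subordinated H f \<sigma> d' l' z"
  shows "(\<lambda>n. stieltjes n (\<lambda>_. 1) (l n) z - stieltjes n (\<lambda>_. 1) (l' n) z) \<longlonglongrightarrow> 0"
    and "(\<lambda>n. stieltjes n (d n) (l n) z - stieltjes n (d' n) (l' n) z) \<longlonglongrightarrow> 0"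
    and "\<forall>\<^sub>F n in sequentially. cmod (stieltjes n (\<lambda>_. 1) (l n) z) \<le> 2 / \<sigma>"
proof -
  define m where "m l n = stieltjes n (\<lambda>_. 1) (l n) z" for l :: "nat \<Rightarrow> nat \<Rightarrow> real" and n
  define w where "w l n = z + of_real (\<sigma>\<^sup>2) * m l n" for l n
  define err where "err l n = m l n - cauchy_transform H (\<lambda>_. 1) (w l n)" for l n
  have Im_m: "0 \<le> Im (m l n)" for l n unfolding m_def by (rule stieltjes_Im_nonneg[OF z])
  have mb: "cmod (m l n) \<le> 1 / Im z" for l n unfolding m_def by (rule stieltjes_norm) (use z in auto)
  have Imb: "Im (m l n) \<le> 1 / Im z" for l n using abs_Im_le_cmod[of "m l n"] mb[of l n] by linarith
  have Iw: "Im z \<le> Im (w l n)" for l n using Im_m[of l n] by (auto simp: w_def)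
  have err: "err l \<longlonglongrightarrow> 0" "err l' \<longlonglongrightarrow> 0"
    using one unfolding approx_subordinated_def err_def[abs_def] w_def m_def by auto
  define \<rho> where "\<rho> = (Im z / 2) / (Im z + \<sigma>\<^sup>2 / Im z)"
  have \<rho>: "0 < \<rho>" using z by (simp add: \<rho>_def add_pos_nonneg)
  have ev: "\<forall>\<^sub>F n in sequentially. cmod (err l n) \<le> \<epsilon>" if "err l \<longlonglongrightarrow> 0" "0 < \<epsilon>" for l \<epsilon>
  proof -
    have "\<forall>\<^sub>F n in sequentially. cmod (err l n) < \<epsilon>" using that by (auto simp: tendsto_iff)
    then show ?thesis by eventually_elim simp
  qed
  have key: "\<forall>\<^sub>F n in sequentially. cmod (m l n - m l' n) < e" if e: "0 < e" for e
  proof -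
    define \<epsilon> where "\<epsilon> = min (\<rho> * e / 4) (Im z / (2 * \<sigma>\<^sup>2))"
    have \<epsilon>: "0 < \<epsilon>" using \<rho> e z \<sigma> by (simp add: \<epsilon>_def)
    have small: "\<sigma>\<^sup>2 * \<epsilon> \<le> Im z / 2"
      using mult_left_mono[of \<epsilon> "Im z / (2 * \<sigma>\<^sup>2)" "\<sigma>\<^sup>2"] \<sigma> by (simp add: \<epsilon>_def)
    show ?thesis using ev[OF err(1) \<epsilon>] ev[OF err(2) \<epsilon>]
    proof eventually_elim
      case (elim n)
      have "\<rho> * cmod (m l n - m l' n) \<le> 2 * \<epsilon>"
        unfolding \<rho>_def using elim[unfolded err_def w_def] small
        by (intro approx_fixed_point_unique[OF H z \<sigma> Im_m Imb Im_m Imb]) auto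
      also have "\<dots> < \<rho> * e"
      proof -
        have "\<epsilon> \<le> \<rho> * e / 4" "0 < \<rho> * e" using \<rho> e by (simp_all add: \<epsilon>_def)
        then show ?thesis by linarith
      qed
      finally show ?case using \<rho> by simp
    qed
  qed
  then have mm: "(\<lambda>n. m l n - m l' n) \<longlonglongrightarrow> 0" by (auto simp: tendsto_iff)
  then show "(\<lambda>n. stieltjes n (\<lambda>_. 1) (l n) z - stieltjes n (\<lambda>_. 1) (l' n) z) \<longlonglongrightarrow> 0" by (simp add: m_def)
  have 2: "(\<lambda>n. cauchy_transform H f (w l n) - cauchy_transform H f (w l' n)) \<longlonglongrightarrow> 0"
  proof (rule Lim_null_comparison)
    show "\<forall>\<^sub>F n in sequentially. norm (cauchy_transform H f (w l n) - cauchy_transform H f (w l' n)) \<le>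
        \<beta> / (Im z)\<^sup>2 * (\<sigma>\<^sup>2 * cmod (m l n - m l' n))"
    proof (intro always_eventually allI)
      fix n
      have "w l n - w l' n = of_real (\<sigma>\<^sup>2) * (m l n - m l' n)" by (simp add: w_def algebra_simps)
      then have "cmod (w l n - w l' n) = \<sigma>\<^sup>2 * cmod (m l n - m l' n)" by (simp only: norm_mult norm_of_real) simp
      then show "norm (cauchy_transform H f (w l n) - cauchy_transform H f (w l' n)) \<le> \<beta> / (Im z)\<^sup>2 * (\<sigma>\<^sup>2 * cmod (m l n - m l' n))"
        using cauchy_transform_lipschitz[OF H f z Iw Iw, of l n l' n] by simp
    qed
    show "(\<lambda>n. \<beta> / (Im z)\<^sup>2 * (\<sigma>\<^sup>2 * cmod (m l n - m l' n))) \<longlonglongrightarrow> 0"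
      using tendsto_mult_right_zero[OF tendsto_mult_right_zero[OF tendsto_norm_zero[OF mm]]] by blast
  qed
  have "(\<lambda>n. (stieltjes n (d n) (l n) z - cauchy_transform H f (w l n)) - (stieltjes n (d' n) (l' n) z - cauchy_transform H f (w l' n))
     + (cauchy_transform H f (w l n) - cauchy_transform H f (w l' n))) \<longlonglongrightarrow> 0 - 0 + 0"
    using d unfolding approx_subordinated_def w_def m_def by (intro tendsto_add tendsto_diff 2[unfolded w_def m_def])
  then show "(\<lambda>n. stieltjes n (d n) (l n) z - stieltjes n (d' n) (l' n) z) \<longlonglongrightarrow> 0" by simp
  define \<epsilon> where "\<epsilon> = min (1 / \<sigma>) (Im z / (2 * \<sigma>\<^sup>2))"
  have \<epsilon>: "0 < \<epsilon>" using z \<sigma> by (simp add: \<epsilon>_def)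
  have small: "\<sigma>\<^sup>2 * \<epsilon> \<le> Im z / 2"
    using mult_left_mono[of \<epsilon> "Im z / (2 * \<sigma>\<^sup>2)" "\<sigma>\<^sup>2"] \<sigma> by (simp add: \<epsilon>_def)
  show "\<forall>\<^sub>F n in sequentially. cmod (stieltjes n (\<lambda>_. 1) (l n) z) \<le> 2 / \<sigma>"
    using ev[OF err(1) \<epsilon>]
  proof eventually_elim
    case (elim n)
    have "cmod (m l n) \<le> 1 / \<sigma> + \<epsilon>"
      using elim[unfolded err_def w_def] small by (intro approx_fixed_point_cmod_le[OF H z \<sigma> Im_m Imb]) auto
    also have "\<epsilon> \<le> 1 / \<sigma>" by (simp add: \<epsilon>_def)
    finally show ?case by (simp add: m_def)
  qed
qed

text \<open>
  Tightness from the equation alone: at \<open>z = i \<eta>\<close> with \<open>\<eta>\<close> large the shift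
  \<open>\<sigma>\<^sup>2 m\<close> is negligible and \<open>H\<close> has bounded support, so \<open>\<eta>
  Im m\<close> is close to 1. The height is chosen among the integers because the equation is available at
  rational points only.
\<close>

lemma proportion_tail_if_approx_subordinated:
  assumes H: "real_distribution H" and supp: "AE x in H. \<bar>x\<bar> \<le> C" and e: "0 < e"
  obtains \<eta> :: rat where "0 < \<eta>"
    "\<And>l. approx_subordinated H (\<lambda>_. 1) \<sigma> (\<lambda>_ _. 1) l (Complex 0 (of_rat \<eta>)) \<Longrightarrow>
      \<forall>\<^sub>F n in sequentially. proportion n (l n) {y. of_rat \<eta> \<le> \<bar>y\<bar>} \<le> e"
proof -
  define C' where "C' = max C 0"
  have C': "0 \<le> C'" "C \<le> C'" by (auto simp: C'_def)
  have "((\<lambda>\<eta>::real. \<eta>\<^sup>2 / (C' + \<eta> + \<sigma>\<^sup>2 / \<eta>)\<^sup>2) \<longlongrightarrow> 1) at_top" by real_asymp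
  then have "\<forall>\<^sub>F \<eta> in at_top. 1 - e / 4 < \<eta>\<^sup>2 / (C' + \<eta> + \<sigma>\<^sup>2 / \<eta>)\<^sup>2"
    using e by (intro order_tendstoD) auto
  then have "\<forall>\<^sub>F n in sequentially. 1 - e / 4 < (real n)\<^sup>2 / (C' + real n + \<sigma>\<^sup>2 / real n)\<^sup>2"
    by (rule eventually_compose_filterlim) (rule filterlim_real_sequentially)
  then have "\<forall>\<^sub>F n in sequentially. 0 < n \<and> 1 - e / 4 < (real n)\<^sup>2 / (C' + real n + \<sigma>\<^sup>2 / real n)\<^sup>2"
    using eventually_gt_at_top[of 0] by eventually_elim auto
  then obtain N :: nat where N: "0 < N" "1 - e / 4 < (real N)\<^sup>2 / (C' + real N + \<sigma>\<^sup>2 / real N)\<^sup>2"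
    by (auto simp: eventually_sequentially)
  define \<eta> where "\<eta> = real N"
  have \<eta>: "0 < \<eta>" using N by (simp add: \<eta>_def)
  define D where "D = C' + \<eta> + \<sigma>\<^sup>2 / \<eta>"
  have main: "\<forall>\<^sub>F n in sequentially. proportion n (l n) {y. \<eta> \<le> \<bar>y\<bar>} \<le> e"
    if ap: "approx_subordinated H (\<lambda>_. 1) \<sigma> (\<lambda>_ _. 1) l (Complex 0 \<eta>)" for l
  proof -
    define z where "z = Complex 0 \<eta>"
    have z: "0 < Im z" using \<eta> by (simp add: z_def)
    define m where "m n = stieltjes n (\<lambda>_. 1) (l n) z" for n
    have Im_m: "0 \<le> Im (m n)" for n unfolding m_def by (rule stieltjes_Im_nonneg[OF z])
    have mb: "cmod (m n) \<le> 1 / Im z" for n unfolding m_def by (rule stieltjes_norm) (use z in auto)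
    have "(\<lambda>n. m n - cauchy_transform H (\<lambda>_. 1) (z + of_real (\<sigma>\<^sup>2) * m n)) \<longlonglongrightarrow> 0"
      using ap unfolding approx_subordinated_def m_def z_def by simp
    then have "\<forall>\<^sub>F n in sequentially. cmod (m n - cauchy_transform H (\<lambda>_. 1) (z + of_real (\<sigma>\<^sup>2) * m n)) < e / (4 * \<eta>)"
      using e \<eta> by (auto simp: tendsto_iff)
    then show ?thesis using eventually_gt_at_top[of 0]
    proof eventually_elim
      case (elim n)
      define w where "w = z + of_real (\<sigma>\<^sup>2) * m n"
      have Iw: "\<eta> \<le> Im w" using Im_m[of n] by (simp add: w_def z_def)
      have "cmod w \<le> cmod z + \<sigma>\<^sup>2 * cmod (m n)"
        unfolding w_def by (rule order_trans[OF norm_triangle_ineq]) (simp add: norm_mult norm_power)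
      also have "\<dots> \<le> \<eta> + \<sigma>\<^sup>2 * (1 / \<eta>)"
        using mb[of n] \<eta> by (intro add_mono mult_left_mono) (auto simp: z_def cmod_def)
      finally have "C + cmod w \<le> D" using C' by (simp add: D_def)
      then have "Im w / D\<^sup>2 \<le> Im (cauchy_transform H (\<lambda>_. 1) w)"
        using Iw \<eta> by (intro Im_cauchy_transform_ge[OF H supp]) auto
      moreover have "\<eta> / D\<^sup>2 \<le> Im w / D\<^sup>2" using Iw by (intro divide_right_mono) auto
      moreover have "Im (cauchy_transform H (\<lambda>_. 1) w) \<le> Im (m n) + e / (4 * \<eta>)"
        using abs_Im_le_cmod[of "m n - cauchy_transform H (\<lambda>_. 1) w"] elim(1) unfolding w_def by simp
      ultimately have "\<eta> / D\<^sup>2 \<le> Im (m n) + e / (4 * \<eta>)" by linarith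
      then have "\<eta> * (\<eta> / D\<^sup>2) \<le> \<eta> * (Im (m n) + e / (4 * \<eta>))" using \<eta> by (intro mult_left_mono) auto
      then have "\<eta>\<^sup>2 / D\<^sup>2 \<le> \<eta> * Im (m n) + e / 4" using \<eta> by (simp add: power2_eq_square distrib_left)
      moreover have "1 - e / 4 < \<eta>\<^sup>2 / D\<^sup>2" using N(2) unfolding \<eta>_def D_def .
      ultimately have "1 - e / 4 < \<eta> * Im (m n) + e / 4" by (rule less_le_trans[rotated])
      then have "2 * (1 - \<eta> * Im (m n)) \<le> e" by (simp add: field_simps)
      moreover have "proportion n (l n) {y. \<eta> \<le> \<bar>y\<bar>} \<le> 2 * (1 - \<eta> * Im (m n))"
        unfolding m_def z_def by (rule proportion_tail_le[OF \<eta> elim(2)])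
      ultimately show ?case by linarith
    qed
  qed
  show ?thesis
  proof (rule that[of "of_nat N"])
    show "0 < (of_nat N :: rat)" using N by simp
    show "approx_subordinated H (\<lambda>_. 1) \<sigma> (\<lambda>_ _. 1) l (Complex 0 (of_rat (of_nat N))) \<Longrightarrow>
      \<forall>\<^sub>F n in sequentially. proportion n (l n) {y. of_rat (of_nat N) \<le> \<bar>y\<bar>} \<le> e" for l
      using main[of l] unfolding \<eta>_def of_rat_of_nat_eq .
  qed
qed

text \<open>
  The approximating point is taken above \<open>z\<close>, so that Lipschitz constants in terms of \<open>Im
  z\<close> remain valid.
\<close>

lemma rational_spectral_parameter:
  assumes z: "0 < Im z" and \<delta>: "0 < \<delta>"
  obtains a b :: rat where "0 < b" "Im z \<le> of_rat b" "cmod (z - Complex (of_rat a) (of_rat b)) < \<delta>"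
proof -
  obtain a :: rat where a: "Re z - \<delta> / 2 < of_rat a" "of_rat a < Re z + \<delta> / 2"
    using of_rat_dense[of "Re z - \<delta> / 2" "Re z + \<delta> / 2"] \<delta> by auto
  obtain b :: rat where b: "Im z < of_rat b" "of_rat b < Im z + \<delta> / 2"
    using of_rat_dense[of "Im z" "Im z + \<delta> / 2"] \<delta> by auto
  have "0 < b" using z b(1) by (metis less_trans zero_less_of_rat_iff)
  moreover have "cmod (z - Complex (of_rat a) (of_rat b)) < \<delta>"
  proof -
    have "cmod (z - Complex (of_rat a) (of_rat b)) \<le> \<bar>Re z - of_rat a\<bar> + \<bar>Im z - of_rat b\<bar>"
      using cmod_le[of "z - Complex (of_rat a) (of_rat b)"] by simp
    also have "\<dots> < \<delta>" using a b by linarith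
    finally show ?thesis .
  qed
  ultimately show ?thesis using that b by auto
qed

lemma stieltjes_diff_tendsto_all:
  assumes d: "\<And>n i. i \<in> {1..n} \<Longrightarrow> \<bar>d n i\<bar> \<le> \<beta>" "\<And>n i. i \<in> {1..n} \<Longrightarrow> \<bar>d' n i\<bar> \<le> \<beta>" and \<beta>: "0 \<le> \<beta>"
    and lim: "\<And>a b :: rat. 0 < b \<Longrightarrow>
      (\<lambda>n. stieltjes n (d n) (l n) (Complex (of_rat a) (of_rat b)) - stieltjes n (d' n) (l' n) (Complex (of_rat a) (of_rat b))) \<longlonglongrightarrow> 0"
    and z: "0 < Im z"
  shows "(\<lambda>n. stieltjes n (d n) (l n) z - stieltjes n (d' n) (l' n) z) \<longlonglongrightarrow> 0"
proof (rule LIMSEQ_I)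
  fix e :: real assume e: "0 < e"
  define K where "K = \<beta> / (Im z)\<^sup>2"
  have K: "0 \<le> K" using \<beta> by (simp add: K_def)
  have "0 < e / (4 * (K + 1))" using e K by simp
  then obtain a b :: rat where ab: "0 < b" "Im z \<le> of_rat b" "cmod (z - Complex (of_rat a) (of_rat b)) < e / (4 * (K + 1))"
    using rational_spectral_parameter[OF z] by blast
  define w where "w = Complex (of_rat a) (of_rat b)"
  have w: "Im z \<le> Im w" using ab by (simp add: w_def)
  have "K * cmod (z - w) \<le> K * (e / (4 * (K + 1)))" using ab K unfolding w_def by (intro mult_left_mono) auto
  also have "\<dots> \<le> e / 4" using K e by (simp add: field_simps)
  finally have Kw: "K * cmod (z - w) \<le> e / 4" .
  have near: "cmod (stieltjes n (d n) (l n) z - stieltjes n (d n) (l n) w) \<le> e / 4"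
    "cmod (stieltjes n (d' n) (l' n) z - stieltjes n (d' n) (l' n) w) \<le> e / 4" for n
  proof -
    show "cmod (stieltjes n (d n) (l n) z - stieltjes n (d n) (l n) w) \<le> e / 4"
      by (rule order_trans[OF stieltjes_lipschitz[OF d(1) \<beta> z order_refl w] Kw[unfolded K_def]])
    show "cmod (stieltjes n (d' n) (l' n) z - stieltjes n (d' n) (l' n) w) \<le> e / 4"
      by (rule order_trans[OF stieltjes_lipschitz[OF d(2) \<beta> z order_refl w] Kw[unfolded K_def]])
  qed
  obtain N where N: "\<And>n. n \<ge> N \<Longrightarrow> cmod (stieltjes n (d n) (l n) w - stieltjes n (d' n) (l' n) w) < e / 4"
    using LIMSEQ_D[OF lim[OF ab(1), of a, folded w_def], of "e / 4"] e by auto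
  have "norm (stieltjes n (d n) (l n) z - stieltjes n (d' n) (l' n) z - 0) < e" if "n \<ge> N" for n
  proof -
    have tri: "cmod (x - y) \<le> cmod (x - x') + cmod (y - y') + cmod (x' - y')" for x y x' y' :: complex
    proof -
      have "cmod ((x - x') - (y - y') + (x' - y')) \<le> cmod (x - x') + cmod (y - y') + cmod (x' - y')"
        by (rule order_trans[OF norm_triangle_ineq add_right_mono[OF norm_triangle_ineq4]])
      then show ?thesis by simp
    qed
    show ?thesis unfolding diff_0_right
      using tri[of "stieltjes n (d n) (l n) z" "stieltjes n (d' n) (l' n) z" "stieltjes n (d n) (l n) w" "stieltjes n (d' n) (l' n) w"]
        near[of n] N[OF that] e by linarith
  qed
  then show "\<exists>N. \<forall>n\<ge>N. norm (stieltjes n (d n) (l n) z - stieltjes n (d' n) (l' n) z - 0) < e" by blast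
qed

lemma stieltjes_bounded_all:
  assumes R: "\<And>a b :: rat. 0 < b \<Longrightarrow> \<forall>\<^sub>F n in sequentially. cmod (stieltjes n (\<lambda>_. 1) (l n) (Complex (of_rat a) (of_rat b))) \<le> R"
    and z: "0 < Im z" and r: "0 < r"
  shows "\<forall>\<^sub>F n in sequentially. cmod (stieltjes n (\<lambda>_. 1) (l n) z) \<le> R + r"
proof -
  have "0 < r * (Im z)\<^sup>2" using r z by simp
  then obtain a b :: rat where ab: "0 < b" "Im z \<le> of_rat b" "cmod (z - Complex (of_rat a) (of_rat b)) < r * (Im z)\<^sup>2"
    using rational_spectral_parameter[OF z] by blast
  define w where "w = Complex (of_rat a) (of_rat b)"
  have w: "Im z \<le> Im w" using ab by (simp add: w_def)
  show ?thesis using R[OF ab(1), of a, folded w_def]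
  proof eventually_elim
    case (elim n)
    have "cmod (stieltjes n (\<lambda>_. 1) (l n) z - stieltjes n (\<lambda>_. 1) (l n) w) \<le> 1 / (Im z)\<^sup>2 * cmod (z - w)"
      using z w by (intro stieltjes_lipschitz) auto
    also have "\<dots> \<le> 1 / (Im z)\<^sup>2 * (r * (Im z)\<^sup>2)" using ab(3) unfolding w_def by (intro mult_left_mono) auto
    also have "\<dots> = r" using z by simp
    finally show ?case
      using elim norm_triangle_sub[of "stieltjes n (\<lambda>_. 1) (l n) z" "stieltjes n (\<lambda>_. 1) (l n) w"] by linarith
  qed
qed

text \<open>
  Subordination at the rational points of the upper half plane, with the same \<open>H\<close>,
  \<open>\<sigma>\<close> and \<open>f\<close>, determines all sums over top indices up to
  \<open>o(1)\<close>.
\<close>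

theorem top_sums_diff_if_approx_subordinated:
  fixes l l' d d' :: "nat \<Rightarrow> nat \<Rightarrow> real"
  assumes H: "real_distribution H" and supp: "AE x in H. \<bar>x\<bar> \<le> C" and \<sigma>: "0 < \<sigma>"
    and f: "f \<in> borel_measurable borel" "\<And>x. \<bar>f x\<bar> \<le> \<beta>"
    and dec: "\<And>n i j. i \<in> {1..n} \<Longrightarrow> j \<in> {1..n} \<Longrightarrow> i \<le> j \<Longrightarrow> l n j \<le> l n i"
      "\<And>n i j. i \<in> {1..n} \<Longrightarrow> j \<in> {1..n} \<Longrightarrow> i \<le> j \<Longrightarrow> l' n j \<le> l' n i"
    and d: "\<And>n i. i \<in> {1..n} \<Longrightarrow> \<bar>d n i\<bar> \<le> \<beta>" "\<And>n i. i \<in> {1..n} \<Longrightarrow> \<bar>d' n i\<bar> \<le> \<beta>"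
    and ap1: "\<And>a b :: rat. 0 < b \<Longrightarrow> approx_subordinated H (\<lambda>_. 1) \<sigma> (\<lambda>_ _. 1) l (Complex (of_rat a) (of_rat b))"
      "\<And>a b :: rat. 0 < b \<Longrightarrow> approx_subordinated H (\<lambda>_. 1) \<sigma> (\<lambda>_ _. 1) l' (Complex (of_rat a) (of_rat b))"
    and apd: "\<And>a b :: rat. 0 < b \<Longrightarrow> approx_subordinated H f \<sigma> d l (Complex (of_rat a) (of_rat b))"
      "\<And>a b :: rat. 0 < b \<Longrightarrow> approx_subordinated H f \<sigma> d' l' (Complex (of_rat a) (of_rat b))"
    and N: "\<And>n. N n \<le> n"
  shows "(\<lambda>n. (\<Sum>i = 1..N n. d n i) / real n - (\<Sum>i = 1..N n. d' n i) / real n) \<longlonglongrightarrow> 0"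
proof -
  have \<beta>: "0 \<le> \<beta>" using f(2)[of 0] by linarith
  note cd = stieltjes_diff_tendsto_if_approx_subordinated[OF H \<sigma> _ f]
  have im: "0 < Im (Complex (of_rat a) (of_rat b))" if "0 < b" for a b :: rat using that by simp
  show ?thesis
  proof (rule top_sums_diff_tendsto[where R="2 / \<sigma> + 1 / \<sigma>", OF dec d \<beta> _ _ _ _ _ _ N])
    show "(\<lambda>n. stieltjes n (d n) (l n) z - stieltjes n (d' n) (l' n) z) \<longlonglongrightarrow> 0" if "0 < Im z" for z
      by (rule stieltjes_diff_tendsto_all[OF d \<beta> cd(2)[OF im ap1 apd] that])
    show "(\<lambda>n. stieltjes n (\<lambda>_. 1) (l n) z - stieltjes n (\<lambda>_. 1) (l' n) z) \<longlonglongrightarrow> 0" if "0 < Im z" for z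
      by (rule stieltjes_diff_tendsto_all[where \<beta>=1, OF _ _ _ cd(1)[OF im ap1 apd] that]) auto
    show "\<forall>\<^sub>F n in sequentially. cmod (stieltjes n (\<lambda>_. 1) (l n) z) \<le> 2 / \<sigma> + 1 / \<sigma>" if "0 < Im z" for z
      using \<sigma> by (intro stieltjes_bounded_all[OF cd(3)[OF im ap1 apd] that]) auto
    show "\<forall>\<^sub>F n in sequentially. cmod (stieltjes n (\<lambda>_. 1) (l' n) z) \<le> 2 / \<sigma> + 1 / \<sigma>" if "0 < Im z" for z
      using \<sigma> by (intro stieltjes_bounded_all[OF cd(3)[OF im ap1(2,1) apd(2,1)] that]) auto
    show "0 < 2 / \<sigma> + 1 / \<sigma>" using \<sigma> by simp
    show "\<exists>T>0. \<forall>\<^sub>F n in sequentially. proportion n (l n) {y. T \<le> \<bar>y\<bar>} \<le> e \<and> proportion n (l' n) {y. T \<le> \<bar>y\<bar>} \<le> e" if e: "0 < e" for e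
    proof -
      obtain \<eta> :: rat where \<eta>: "0 < \<eta>"
        "\<And>l. approx_subordinated H (\<lambda>_. 1) \<sigma> (\<lambda>_ _. 1) l (Complex 0 (of_rat \<eta>)) \<Longrightarrow>
          \<forall>\<^sub>F n in sequentially. proportion n (l n) {y. of_rat \<eta> \<le> \<bar>y\<bar>} \<le> e"
        using proportion_tail_if_approx_subordinated[OF H supp e] by blast
      have "\<forall>\<^sub>F n in sequentially. proportion n (l n) {y. of_rat \<eta> \<le> \<bar>y\<bar>} \<le> e"
        "\<forall>\<^sub>F n in sequentially. proportion n (l' n) {y. of_rat \<eta> \<le> \<bar>y\<bar>} \<le> e"
        using ap1(1)[OF \<eta>(1), of 0] ap1(2)[OF \<eta>(1), of 0] by (auto intro!: \<eta>(2))
      then have "\<forall>\<^sub>F n in sequentially. proportion n (l n) {y. of_rat \<eta> \<le> \<bar>y\<bar>} \<le> e \<and> proportion n (l' n) {y. of_rat \<eta> \<le> \<bar>y\<bar>} \<le> e"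
        by eventually_elim auto
      then show ?thesis using \<eta>(1) by (intro exI[of _ "of_rat \<eta>"]) auto
    qed
  qed
qed

section \<open>Averages over points with a limiting distribution\<close>

lemma empirical_mean_tendsto:
  fixes g :: "real \<Rightarrow> real"
  assumes H: "real_distribution H" and w: "weak_conv_m (\<lambda>n. empirical_distr n (x n)) H"
    and g: "continuous_on UNIV g" "\<And>y. \<bar>g y\<bar> \<le> B"
  shows "(\<lambda>n. (\<Sum>i = 1..n. g (x n i)) / real n) \<longlonglongrightarrow> integral\<^sup>L H g"
proof (rule LIMSEQ_imp_Suc)
  have gm: "g \<in> borel_measurable borel" using g(1) by (rule borel_measurable_continuous_onI)
  have "(\<lambda>n. integral\<^sup>L (empirical_distr (Suc n) (x (Suc n))) g) \<longlonglongrightarrow> integral\<^sup>L H g"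
  proof (rule weak_conv_imp_integral_bdd_continuous_conv[OF _ H])
    show "real_distribution (empirical_distr (Suc n) (x (Suc n)))" for n
      by (rule real_distribution_empirical_distr) simp
    show "weak_conv_m (\<lambda>n. empirical_distr (Suc n) (x (Suc n))) H"
      using w unfolding weak_conv_m_def weak_conv_def by (auto intro!: LIMSEQ_Suc)
    show "isCont g y" for y using g(1) by (simp add: continuous_on_eq_continuous_at)
    show "norm (g y) \<le> B" for y using g(2) by simp
  qed
  then show "(\<lambda>n. (\<Sum>i = 1..Suc n. g (x (Suc n) i)) / real (Suc n)) \<longlonglongrightarrow> integral\<^sup>L H g"
    unfolding integral_empirical_distr[OF gm] by (simp only: real_scaleR_def divide_inverse mult.commute)
qed

definition interval_dist :: "real \<Rightarrow> real \<Rightarrow> real \<Rightarrow> real" where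
  "interval_dist a b x = max 0 (max (a - x) (x - b))"

lemma interval_dist_continuous: "continuous_on UNIV (interval_dist a b)"
  unfolding interval_dist_def[abs_def] by (intro continuous_intros)

text \<open>
  Integrate the truncated distance from the interval.
\<close>

lemma limit_supported_on_interval:
  assumes H: "real_distribution H" and w: "weak_conv_m (\<lambda>n. empirical_distr n (x n)) H"
    and b: "\<forall>\<^sub>F n in sequentially. \<forall>i\<in>{1..n}. x n i \<in> {a..b}"
  shows "AE y in H. y \<in> {a..b}"
proof -
  interpret H: real_distribution H by (rule H)
  define g where "g y = min 1 (interval_dist a b y)" for y
  have gc: "continuous_on UNIV g" unfolding g_def[abs_def] by (intro continuous_intros interval_dist_continuous)
  have g0: "0 \<le> g y" "g y \<le> 1" for y by (auto simp: g_def interval_dist_def)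
  have gb: "\<bar>g y\<bar> \<le> 1" for y using g0[of y] by simp
  have gm: "g \<in> borel_measurable borel" using gc by (rule borel_measurable_continuous_onI)
  have "\<forall>\<^sub>F n in sequentially. (\<Sum>i = 1..n. g (x n i)) / real n = 0"
    using b by eventually_elim (auto simp: g_def interval_dist_def intro!: sum.neutral)
  then have "(\<lambda>n. (\<Sum>i = 1..n. g (x n i)) / real n) \<longlonglongrightarrow> 0" by (rule tendsto_eventually)
  with empirical_mean_tendsto[OF H w gc gb] have "integral\<^sup>L H g = 0" by (rule LIMSEQ_unique)
  moreover have "integrable H g" by (rule H.integrable_const_bound[where B=1]) (use gb gm in auto)
  ultimately have "AE y in H. g y = 0"
    by (subst integral_nonneg_eq_0_iff_AE[symmetric]) (use g0 in auto)
  then show ?thesis by eventually_elim (auto simp: g_def interval_dist_def min_def max_def split: if_splits)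
qed

text \<open>
  By compactness \<open>u\<close> is small on a neighbourhood of the interval, and only a vanishing proportion
  of the points lies outside it. The function \<open>u\<close> need not extend continuously to the line, so it
  is dominated by a function that does.
\<close>

lemma empirical_mean_vanishing:
  fixes u :: "real \<Rightarrow> real"
  assumes H: "real_distribution H" and w: "weak_conv_m (\<lambda>n. empirical_distr n (x n)) H"
    and supp: "AE y in H. y \<in> {a..b}" and ab: "a \<le> b"
    and U: "open U" "{a..b} \<subseteq> U" and xU: "\<And>n i. i \<in> {1..n} \<Longrightarrow> x n i \<in> U"
    and u: "continuous_on U u" "\<And>y. y \<in> U \<Longrightarrow> \<bar>u y\<bar> \<le> B" "\<And>y. y \<in> {a..b} \<Longrightarrow> u y = 0"
  shows "(\<lambda>n. (\<Sum>i = 1..n. \<bar>u (x n i)\<bar>) / real n) \<longlonglongrightarrow> 0"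
proof (rule LIMSEQ_I)
  fix e :: real assume e: "0 < e"
  interpret H: real_distribution H by (rule H)
  have B: "0 \<le> B" using u(2)[of a] U(2) ab by force
  define V where "V = {y\<in>U. \<bar>u y\<bar> < e / 2}"
  have "open V"
  proof -
    have "continuous_on U (\<lambda>y. \<bar>u y\<bar>)" by (intro continuous_intros u)
    from continuous_open_preimage[OF this U(1), of "{..<e/2}"] have "open (U \<inter> (\<lambda>y. \<bar>u y\<bar>) -` {..<e/2})" by simp
    moreover have "U \<inter> (\<lambda>y. \<bar>u y\<bar>) -` {..<e/2} = V" by (auto simp: V_def)
    ultimately show ?thesis by simp
  qed
  moreover have "{a..b} \<subseteq> V" using U(2) u(3) e by (auto simp: V_def)
  ultimately obtain \<delta> where \<delta>: "\<delta> > 0" "(\<Union>y\<in>{a..b}. ball y \<delta>) \<subseteq> V"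
    using compact_subset_open_imp_ball_epsilon_subset[of "{a..b}" V] by auto
  define g where "g y = min 1 (interval_dist a b y / \<delta>)" for y
  have gc: "continuous_on UNIV g" unfolding g_def[abs_def] using \<delta> by (intro continuous_intros interval_dist_continuous) auto
  have g0: "0 \<le> g y" "g y \<le> 1" for y using \<delta> by (auto simp: g_def interval_dist_def)
  have gb: "\<bar>g y\<bar> \<le> 1" for y using g0[of y] by simp
  \<comment> \<open>The continuous majorant.\<close>
  have le: "\<bar>u y\<bar> \<le> e / 2 + B * g y" if y: "y \<in> U" for y
  proof (cases "interval_dist a b y < \<delta>")
    case True
    have "y \<in> ball (max a (min b y)) \<delta>"
      using True ab by (auto simp: interval_dist_def dist_real_def min_def max_def split: if_splits)
    moreover have "max a (min b y) \<in> {a..b}" using ab by auto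
    ultimately have "y \<in> V" using \<delta>(2) by blast
    then show ?thesis using g0[of y] B by (simp add: V_def add_increasing2 less_imp_le)
  next
    case False
    then have "g y = 1" using \<delta> by (simp add: g_def)
    then show ?thesis using u(2)[OF y] e by simp
  qed
  have "integral\<^sup>L H g = (\<integral>y. 0 \<partial>H)"
  proof (rule integral_cong_AE)
    show "AE y in H. g y = 0" using supp by eventually_elim (auto simp: g_def interval_dist_def)
    show "g \<in> borel_measurable H" using borel_measurable_continuous_onI[OF gc] by simp
  qed simp
  then have "(\<lambda>n. (\<Sum>i = 1..n. g (x n i)) / real n) \<longlonglongrightarrow> 0" using empirical_mean_tendsto[OF H w gc gb] by simp
  then have "(\<lambda>n. B * ((\<Sum>i = 1..n. g (x n i)) / real n)) \<longlonglongrightarrow> 0" by (rule tendsto_mult_right_zero)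
  then obtain N where N: "\<And>n. n \<ge> N \<Longrightarrow> \<bar>B * ((\<Sum>i = 1..n. g (x n i)) / real n)\<bar> < e / 2"
    using LIMSEQ_D[of "\<lambda>n. B * ((\<Sum>i = 1..n. g (x n i)) / real n)" 0 "e / 2"] e by auto
  have "norm ((\<Sum>i = 1..n. \<bar>u (x n i)\<bar>) / real n - 0) < e" if n: "n \<ge> N" for n
  proof (cases "n = 0")
    case False
    have "(\<Sum>i = 1..n. \<bar>u (x n i)\<bar>) / real n \<le> (\<Sum>i = 1..n. e / 2 + B * g (x n i)) / real n"
      by (intro divide_right_mono sum_mono le xU) auto
    also have "\<dots> = e / 2 + B * ((\<Sum>i = 1..n. g (x n i)) / real n)"
      using False by (simp add: sum.distrib sum_distrib_left add_divide_distrib)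
    also have "\<dots> < e" using N[OF n] by linarith
    finally show ?thesis by (simp add: sum_nonneg)
  qed (use e in simp)
  then show "\<exists>N. \<forall>n\<ge>N. norm ((\<Sum>i = 1..n. \<bar>u (x n i)\<bar>) / real n - 0) < e" by blast
qed

section \<open>Entry laws and independence\<close>

text \<open>
  The maximum with 1 serves both moment bounds: the fourth moment is at most its square.
\<close>

lemma wigner_law_of_variable:
  assumes M: "prob_space M" and X[measurable]: "X \<in> borel_measurable M"
    and i4: "integrable M (\<lambda>\<omega>. X \<omega> ^ 4)" and mean: "prob_space.expectation M X = 0" and var: "prob_space.variance M X = 1"
  shows "wigner_law (\<lambda>_. distr M borel X) (max 1 (prob_space.expectation M (\<lambda>\<omega>. X \<omega> ^ 4)))"
proof -
  interpret prob_space M by (rule M)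
  define \<kappa> where "\<kappa> = expectation (\<lambda>\<omega>. X \<omega> ^ 4)"
  define q where "q = max 1 \<kappa>"
  have q1: "1 \<le> q" "\<kappa> \<le> q" by (auto simp: q_def)
  have "q * 1 \<le> q * q" using q1 by (intro mult_left_mono) auto
  then have q2: "\<kappa> \<le> q\<^sup>2" unfolding power2_eq_square using q1 by linarith
  have v: "expectation (\<lambda>\<omega>. (X \<omega>)\<^sup>2) = 1" using var mean by simp
  have i2: "integrable M (\<lambda>\<omega>. (X \<omega>)\<^sup>2)"
  proof (rule Bochner_Integration.integrable_bound[where f="\<lambda>\<omega>. 1 + X \<omega> ^ 4"])
    show "AE \<omega> in M. norm ((X \<omega>)\<^sup>2) \<le> norm (1 + X \<omega> ^ 4)"
    proof (rule AE_I2)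
      fix \<omega>
      have gen: "y \<le> 1 + t" if "2 * y \<le> 1 + t" "0 \<le> y" for y t :: real using that by linarith
      have "2 * (X \<omega>)\<^sup>2 \<le> 1 + X \<omega> ^ 4" using sum_squares_bound[of 1 "(X \<omega>)\<^sup>2"] by simp
      then have "(X \<omega>)\<^sup>2 \<le> 1 + X \<omega> ^ 4" by (rule gen) simp
      then show "norm ((X \<omega>)\<^sup>2) \<le> norm (1 + X \<omega> ^ 4)" by simp
    qed
  qed (use i4 in auto)
  have law: "prob_space (distr M borel X)" by (rule prob_space_distr) simp
  have e4: "integrable (distr M borel X) (\<lambda>x. x ^ 4)" using i4 by (simp add: integrable_distr_eq)
  have b4: "(\<integral>x. x ^ 4 \<partial>distr M borel X) \<le> q\<^sup>2" using q2 by (simp add: integral_distr \<kappa>_def)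
  have e2: "integrable (distr M borel X) (\<lambda>x. x\<^sup>2)" using i2 by (simp add: integrable_distr_eq)
  have v2: "(\<integral>x. x\<^sup>2 \<partial>distr M borel X) = 1" using v by (simp add: integral_distr)
  have v1: "(\<integral>x. x \<partial>distr M borel X) = 0" using mean by (simp add: integral_distr)
  show ?thesis
    unfolding wigner_law_def wigner_law_axioms_def real_product_prob_def \<kappa>_def[symmetric] q_def[symmetric]
    using law e4 b4 e2 v2 v1 q1 by simp
qed

definition goe_law :: "nat \<times> nat \<Rightarrow> real measure" where
  "goe_law p = density lborel (normal_density 0 (if fst p = snd p then sqrt 2 else 1))"

lemma normal_law_moments:
  assumes s: "0 < (s::real)"
  defines "\<mu> \<equiv> density lborel (normal_density 0 s)"
  shows "integrable \<mu> (\<lambda>x. x ^ 4)" "(\<integral>x. x ^ 4 \<partial>\<mu>) = 3 * s ^ 4"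
    "integrable \<mu> (\<lambda>x. x\<^sup>2)" "(\<integral>x. x\<^sup>2 \<partial>\<mu>) = s\<^sup>2" "(\<integral>x. x \<partial>\<mu>) = 0"
proof -
  have int: "integrable \<mu> (\<lambda>x. x ^ k)" for k
    unfolding \<mu>_def using integrable_normal_moment[OF s, of 0 k] by (subst integrable_real_density) auto
  have val: "(\<integral>x. x ^ k \<partial>\<mu>) = (\<integral>x. normal_density 0 s x * (x - 0) ^ k \<partial>lborel)" for k
    unfolding \<mu>_def by (subst integral_real_density) auto
  show "integrable \<mu> (\<lambda>x. x ^ 4)" "integrable \<mu> (\<lambda>x. x\<^sup>2)" by (rule int)+
  show "(\<integral>x. x ^ 4 \<partial>\<mu>) = 3 * s ^ 4"
    using val[of 4] integral_normal_moment_even[OF s, of 0 2] s by (simp add: fact_numeral power2_eq_square power4_eq_xxxx field_simps)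
  show "(\<integral>x. x\<^sup>2 \<partial>\<mu>) = s\<^sup>2"
    using val[of 2] integral_normal_moment_even[OF s, of 0 1] s by (simp add: fact_numeral)
  show "(\<integral>x. x \<partial>\<mu>) = 0"
    using val[of 1] integral_normal_moment_odd[OF s, of 0 0] by simp
qed

lemma wigner_law_goe: "wigner_law goe_law 4"
proof -
  have fact: "prob_space (goe_law p) \<and> sets (goe_law p) = sets borel \<and> integrable (goe_law p) (\<lambda>x. x ^ 4)
      \<and> integrable (goe_law p) (\<lambda>x. x\<^sup>2) \<and> (\<integral>x. x \<partial>goe_law p) = 0 \<and> (\<integral>x. x ^ 4 \<partial>goe_law p) \<le> 4\<^sup>2
      \<and> (\<integral>x. x\<^sup>2 \<partial>goe_law p) \<le> 4" for p
  proof -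
    define s :: real where "s = (if fst p = snd p then sqrt 2 else 1)"
    have s: "0 < s" by (simp add: s_def)
    have e: "goe_law p = density lborel (normal_density 0 s)" by (simp add: goe_law_def s_def)
    have s2: "s\<^sup>2 \<le> 2" by (simp add: s_def)
    then have "(s\<^sup>2)\<^sup>2 \<le> 2\<^sup>2" by (intro power_mono) auto
    then have s4: "s ^ 4 \<le> 4" by simp
    note m = normal_law_moments[OF s]
    show ?thesis
    proof (intro conjI)
      show "prob_space (goe_law p)" unfolding e by (rule prob_space_normal_density[OF s])
      show "sets (goe_law p) = sets borel" by (simp add: goe_law_def)
      show "integrable (goe_law p) (\<lambda>x. x ^ 4)" unfolding e by (rule m)
      show "integrable (goe_law p) (\<lambda>x. x\<^sup>2)" unfolding e by (rule m)
      show "(\<integral>x. x \<partial>goe_law p) = 0" unfolding e by (rule m)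
      show "(\<integral>x. x ^ 4 \<partial>goe_law p) \<le> 4\<^sup>2" unfolding e m(2) using s4 by simp
      show "(\<integral>x. x\<^sup>2 \<partial>goe_law p) \<le> 4" unfolding e m(4) using s2 by simp
    qed
  qed
  have off: "(\<integral>x. x\<^sup>2 \<partial>goe_law (i, j)) = 1" if "i < j" for i j
  proof -
    have e: "goe_law (i, j) = density lborel (normal_density 0 1)" using that by (simp add: goe_law_def)
    show ?thesis unfolding e using normal_law_moments(4)[of 1] by simp
  qed
  show ?thesis
    unfolding wigner_law_def wigner_law_axioms_def real_product_prob_def
    using fact off by simp
qed

lemma distr_restrict_eq_PiM:
  assumes M: "prob_space M" and I: "I \<noteq> {}" and ind: "prob_space.indep_vars M (\<lambda>_. borel) Y I"
    and law: "\<And>p. p \<in> I \<Longrightarrow> distr M borel (Y p) = \<nu> p" and sets: "\<And>p. sets (\<nu> p) = sets (borel :: real measure)"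
  shows "distr M (Pi\<^sub>M I \<nu>) (\<lambda>\<omega>. \<lambda>p\<in>I. Y p \<omega>) = Pi\<^sub>M I \<nu>"
proof -
  interpret prob_space M by (rule M)
  have rv: "random_variable borel (Y p)" if "p \<in> I" for p using ind that unfolding indep_vars_def by auto
  have "distr M (Pi\<^sub>M I \<nu>) (\<lambda>\<omega>. \<lambda>p\<in>I. Y p \<omega>) = distr M (Pi\<^sub>M I (\<lambda>_. borel)) (\<lambda>\<omega>. \<lambda>p\<in>I. Y p \<omega>)"
    by (intro distr_cong refl sets_PiM_cong sets)
  also have "\<dots> = Pi\<^sub>M I (\<lambda>p. distr M borel (Y p))"
    using indep_vars_iff_distr_eq_PiM'[OF I rv] ind by simp
  also have "\<dots> = Pi\<^sub>M I \<nu>" by (intro PiM_cong refl law)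
  finally show ?thesis .
qed

lemma indep_rv_compose:
  assumes ind: "indep_rv M N X E Y" and T: "T \<in> measurable E W"
  shows "indep_rv M N X W (\<lambda>\<omega>. T (Y \<omega>))"
  unfolding indep_rv_def
proof (intro conjI ballI)
  have X: "X \<in> measurable M N" and Y: "Y \<in> measurable M E" using ind by (auto simp: indep_rv_def)
  show "X \<in> measurable M N" by (rule X)
  show "(\<lambda>\<omega>. T (Y \<omega>)) \<in> measurable M W" by (rule measurable_compose[OF Y T])
  fix A B assume A: "A \<in> sets N" and B: "B \<in> sets W"
  have e: "(\<lambda>\<omega>. T (Y \<omega>)) -` B \<inter> space M = Y -` (T -` B \<inter> space E) \<inter> space M"
    using measurable_space[OF Y] by auto
  have "T -` B \<inter> space E \<in> sets E" using T B by (rule measurable_sets)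
  then show "measure M ((X -` A \<inter> space M) \<inter> ((\<lambda>\<omega>. T (Y \<omega>)) -` B \<inter> space M)) =
      measure M (X -` A \<inter> space M) * measure M ((\<lambda>\<omega>. T (Y \<omega>)) -` B \<inter> space M)"
    unfolding e using ind A unfolding indep_rv_def by blast
qed

lemma indep_rv_of_indep_var:
  assumes M: "prob_space M" and ind: "prob_space.indep_var M N X E Y"
  shows "indep_rv M N X E Y"
  unfolding indep_rv_def
proof (intro conjI ballI)
  interpret prob_space M by (rule M)
  show "X \<in> measurable M N" "Y \<in> measurable M E" using ind indep_var_rv1 indep_var_rv2 by blast+
  fix A B assume AB: "A \<in> sets N" "B \<in> sets E"
  have "(\<lambda>x. (X x, Y x)) -` (A \<times> B) \<inter> space M = (X -` A \<inter> space M) \<inter> (Y -` B \<inter> space M)" by auto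
  then show "measure M ((X -` A \<inter> space M) \<inter> (Y -` B \<inter> space M)) = measure M (X -` A \<inter> space M) * measure M (Y -` B \<inter> space M)"
    using indep_varD[OF ind AB] by simp
qed

lemma entries_in_space [simp]: "entries n A \<in> space (entry_space n)"
  by (auto simp: entries_def entry_space_def space_PiM)

text \<open>
  Each run is treated on its own, hence the restriction to the indices 0, which stands for the data, and
  \<open>k\<close>.
\<close>

lemma indep_rv_of_mc_sampling:
  assumes M: "prob_space M" and mc: "mc_sampling M n K G A Z s x" and k: "k \<in> {1..K}"
  shows "indep_rv M ((entry_space n \<Otimes>\<^sub>M entry_space n) \<Otimes>\<^sub>M (borel \<Otimes>\<^sub>M PiM {1..n} (\<lambda>_. borel)))
     (\<lambda>\<omega>. ((entries n (A \<omega>), entries n (Z \<omega>)), (s \<omega>, restrict (x \<omega>) {1..n})))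
     (entry_space n) (\<lambda>\<omega>. entries n (G k \<omega>))"
    (is "indep_rv M ?N ?X _ _")
  unfolding indep_rv_def
proof (intro conjI ballI)
  interpret prob_space M by (rule M)
  define F where "F = (\<lambda>k. if k = 0 then events_of M ?N ?X else events_of M (entry_space n) (\<lambda>\<omega>. entries n (G k \<omega>)))"
  have ind: "indep_sets F {0..K}" using mc unfolding mc_sampling_def F_def by simp
  have sub: "F i \<subseteq> events" if "i \<in> {0..K}" for i using ind that unfolding indep_sets_def by blast
  show "?X \<in> measurable M ?N"
  proof (rule measurableI)
    show "?X \<omega> \<in> space ?N" for \<omega> by (auto simp: space_pair_measure space_PiM)
    show "?X -` B \<inter> space M \<in> sets M" if "B \<in> sets ?N" for B
      using sub[of 0] that by (auto simp: F_def events_of_def)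
  qed
  show "(\<lambda>\<omega>. entries n (G k \<omega>)) \<in> measurable M (entry_space n)"
  proof (rule measurableI)
    show "(\<lambda>\<omega>. entries n (G k \<omega>)) -` B \<inter> space M \<in> sets M" if "B \<in> sets (entry_space n)" for B
      using sub[of k] k that by (auto simp: F_def events_of_def)
  qed simp
  fix B1 B2 assume B: "B1 \<in> sets ?N" "B2 \<in> sets (entry_space n)"
  define E where "E j = (if j = 0 then ?X -` B1 \<inter> space M else (\<lambda>\<omega>. entries n (G k \<omega>)) -` B2 \<inter> space M)" for j :: nat
  have "prob (\<Inter>j\<in>{0, k}. E j) = (\<Prod>j\<in>{0, k}. prob (E j))"
  proof (rule indep_setsD[OF ind])
    show "\<forall>j\<in>{0, k}. E j \<in> F j" using B k by (auto simp: E_def F_def events_of_def)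
  qed (use k in auto)
  then show "prob ((?X -` B1 \<inter> space M) \<inter> ((\<lambda>\<omega>. entries n (G k \<omega>)) -` B2 \<inter> space M)) =
      prob (?X -` B1 \<inter> space M) * prob ((\<lambda>\<omega>. entries n (G k \<omega>)) -` B2 \<inter> space M)"
    using k by (simp add: E_def)
qed

lemma restrict_upper_measurable:
  assumes "\<And>p. sets (\<nu> p) = sets (borel :: real measure)"
  shows "(\<lambda>e. restrict e (upper n)) \<in> measurable (entry_space n) (Pi\<^sub>M (upper n) \<nu>)"
  unfolding entry_space_def by (rule measurable_restrict_subset'[OF upper_subset]) (simp add: assms)

lemma restrict_entries: "restrict (entries n A) (upper n) = (\<lambda>p\<in>upper n. A $$ p)"
  using upper_subset[of n] by (auto simp: entries_def restrict_def fun_eq_iff)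

lemma symmat_of_symmetric:
  assumes "A \<in> carrier_mat n n" "transpose_mat A = A"
  shows "symmat n (\<lambda>p\<in>upper n. A $$ p) = A"
proof (rule eq_matI)
  fix i j assume "i < dim_row A" "j < dim_col A"
  then have ij: "i < n" "j < n" using assms by auto
  then have "A $$ (i, j) = A $$ (j, i)" using assms by (metis carrier_matD index_transpose_mat(1))
  then show "symmat n (\<lambda>p\<in>upper n. A $$ p) $$ (i, j) = A $$ (i, j)"
    using ij by (auto simp: symmat_def upper_def min_def max_def)
qed (use assms in \<open>auto simp: symmat_def\<close>)

section \<open>Functional calculus is measurable in the matrix\<close>

lemma pow_mat_spectral:
  assumes E: "ordered_eigensystem n S l v" and S: "transpose_mat S = S" and rs: "r < n" "s < n"
  shows "(S ^\<^sub>m k) $$ (r, s) = (\<Sum>i = 1..n. l i ^ k * v i $ r * v i $ s)"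
  using rs
proof (induction k arbitrary: s)
  case 0
  then show ?case using orthonormal_completeness[OF E rs(1) 0(2)] ordered_eigensystemD(1)[OF E] by simp
next
  case (Suc k)
  note D = ordered_eigensystemD[OF E]
  have sym: "S $$ (i, j) = S $$ (j, i)" if "i < n" "j < n" for i j
    using D(1) S that by (metis carrier_matD index_transpose_mat(1))
  have Sv: "(\<Sum>t<n. v i $ t * S $$ (t, s)) = l i * v i $ s" if i: "i \<in> {1..n}" for i
  proof -
    have "(\<Sum>t<n. v i $ t * S $$ (t, s)) = (S *\<^sub>v v i) $ s"
      using D(1) D(2)[OF i] Suc.prems by (auto simp: scalar_prod_def atLeast0LessThan sym mult.commute intro!: sum.cong)
    then show ?thesis using D(2,3)[OF i] Suc.prems by simp
  qed
  have c: "S ^\<^sub>m k \<in> carrier_mat n n" using D(1) by simp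
  have "(S ^\<^sub>m Suc k) $$ (r, s) = (\<Sum>t<n. (S ^\<^sub>m k) $$ (r, t) * S $$ (t, s))"
    using c D(1) Suc.prems by (auto simp: scalar_prod_def atLeast0LessThan intro!: sum.cong)
  also have "\<dots> = (\<Sum>t<n. \<Sum>i = 1..n. l i ^ k * v i $ r * (v i $ t * S $$ (t, s)))"
    using Suc.IH[OF Suc.prems(1)] by (intro sum.cong refl) (simp add: sum_distrib_right mult.assoc)
  also have "\<dots> = (\<Sum>i = 1..n. l i ^ k * v i $ r * (\<Sum>t<n. v i $ t * S $$ (t, s)))"
    by (subst sum.swap) (simp add: sum_distrib_left)
  also have "\<dots> = (\<Sum>i = 1..n. l i ^ Suc k * v i $ r * v i $ s)"
    by (intro sum.cong refl) (simp add: Sv mult_ac)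
  finally show ?case .
qed

lemma mat_of_entries: "A \<in> carrier_mat n n \<Longrightarrow> mat n n (entries n A) = A"
  by (intro eq_matI) (auto simp: entries_def)

lemma meas_mat_entries: "meas_mat (entry_space n) n (\<lambda>e. mat n n e)"
proof -
  have "(\<lambda>e. e (i, j)) \<in> borel_measurable (entry_space n)" if "i < n" "j < n" for i j
    unfolding entry_space_def using that by (intro measurable_component_singleton) auto
  then show ?thesis by (auto simp: meas_mat_def)
qed

text \<open>
  The eigenvectors are arbitrary choices and need not be measurable, but \<open>f(A)\<close> is a limit of
  polynomials in \<open>A\<close>. The polynomials approximate \<open>f\<close> on growing intervals, so that
  the limit exists whatever the spectrum is.
\<close>

lemma measurable_functional_calculus:
  assumes f: "continuous_on UNIV (f :: real \<Rightarrow> real)"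
  obtains F :: "(nat \<times> nat \<Rightarrow> real) \<Rightarrow> real mat" where "meas_mat (entry_space n) n F"
    "\<And>A l v. transpose_mat A = A \<Longrightarrow> ordered_eigensystem n A l v \<Longrightarrow> F (entries n A) = spectral_sum n f l v"
proof -
  have "\<exists>a N. \<forall>x\<in>{- real k..real k}. \<bar>f x - (\<Sum>m\<le>N. a m * x ^ m)\<bar> < 1 / real (Suc k)" for k
  proof -
    obtain g where "real_polynomial_function g" "\<And>x. x \<in> {- real k..real k} \<Longrightarrow> \<bar>f x - g x\<bar> < 1 / real (Suc k)"
      using Stone_Weierstrass_real_polynomial_function[of "{- real k..real k}" f "1 / real (Suc k)"] continuous_on_subset[OF f] by auto
    then show ?thesis unfolding real_polynomial_function_iff_sum by blast
  qed
  then obtain a :: "nat \<Rightarrow> nat \<Rightarrow> real" and N :: "nat \<Rightarrow> nat"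
    where P: "\<And>k x. x \<in> {- real k..real k} \<Longrightarrow> \<bar>f x - (\<Sum>m\<le>N k. a k m * x ^ m)\<bar> < 1 / real (Suc k)" by metis
  define G where "G k e i j = (\<Sum>m\<le>N k. a k m * ((mat n n e :: real mat) ^\<^sub>m m) $$ (i, j))" for k e i j
  define F where "F e = mat n n (\<lambda>(i, j). lim (\<lambda>k. G k e i j))" for e
  have mp: "meas_mat (entry_space n) n (\<lambda>e. (mat n n e :: real mat) ^\<^sub>m m)" for m
  proof (induction m)
    case 0 then show ?case by (simp add: meas_mat_def)
  next
    case (Suc m) then show ?case using meas_mat_mult[OF Suc meas_mat_entries] by simp
  qed
  have Gm: "(\<lambda>e. G k e i j) \<in> borel_measurable (entry_space n)" if "i < n" "j < n" for k i j
    unfolding G_def using mp that by (auto simp: meas_mat_def intro!: borel_measurable_sum borel_measurable_times)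
  show ?thesis
  proof (rule that[of F])
    show "meas_mat (entry_space n) n F"
      unfolding meas_mat_def F_def using Gm by (auto intro!: borel_measurable_lim_metric)
    fix A l v assume A: "transpose_mat A = A" and E: "ordered_eigensystem n A l v"
    have Ac: "A \<in> carrier_mat n n" by (rule ordered_eigensystemD(1)[OF E])
    have lim: "(\<lambda>k. \<Sum>m\<le>N k. a k m * x ^ m) \<longlonglongrightarrow> f x" for x
    proof (rule LIMSEQ_I)
      fix e :: real assume e: "0 < e"
      obtain k0 where k0: "\<bar>x\<bar> < real k0" using reals_Archimedean2 by blast
      obtain k1 where k1: "1 / real (Suc k1) < e" using nat_approx_posE[OF e] by blast
      have "norm ((\<Sum>m\<le>N k. a k m * x ^ m) - f x) < e" if k: "k \<ge> max k0 k1" for k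
      proof -
        have "\<bar>f x - (\<Sum>m\<le>N k. a k m * x ^ m)\<bar> < 1 / real (Suc k)" using k0 k by (intro P) auto
        also have "\<dots> \<le> 1 / real (Suc k1)" using k by (intro divide_left_mono) auto
        finally show ?thesis using k1 by (simp add: abs_minus_commute)
      qed
      then show "\<exists>no. \<forall>k\<ge>no. norm ((\<Sum>m\<le>N k. a k m * x ^ m) - f x) < e" by blast
    qed
    have Ge: "G k (entries n A) i j = (\<Sum>t = 1..n. (\<Sum>m\<le>N k. a k m * l t ^ m) * v t $ i * v t $ j)" if ij: "i < n" "j < n" for k i j
    proof -
      have "G k (entries n A) i j = (\<Sum>m\<le>N k. \<Sum>t = 1..n. a k m * l t ^ m * v t $ i * v t $ j)"
        unfolding G_def mat_of_entries[OF Ac] pow_mat_spectral[OF E A ij] by (simp add: sum_distrib_left mult.assoc)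
      also have "\<dots> = (\<Sum>t = 1..n. \<Sum>m\<le>N k. a k m * l t ^ m * v t $ i * v t $ j)" by (rule sum.swap)
      finally show ?thesis by (simp add: sum_distrib_right)
    qed
    have "lim (\<lambda>k. G k (entries n A) i j) = (\<Sum>t = 1..n. f (l t) * v t $ i * v t $ j)" if ij: "i < n" "j < n" for i j
      unfolding Ge[OF ij] by (intro limI tendsto_sum tendsto_mult lim tendsto_const)
    then show "F (entries n A) = spectral_sum n f l v"
      unfolding F_def spectral_sum_def by (intro cong_mat) auto
  qed
qed

section \<open>The subordination equation for eigenvector quadratic forms\<close>

lemma quad_form_one:
  assumes "u \<in> carrier_vec n" "(\<Sum>r<n. u $ r * u $ r) = 1"
  shows "quad_form (1\<^sub>m n) u = 1"
  using assms by (auto simp: quad_form_def scalar_prod_def atLeast0LessThan)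

lemma normalized_trace_resolvent_eq_stieltjes:
  assumes E: "ordered_eigensystem n S l v" and S: "transpose_mat S = S" and z: "0 < Im z" and B: "B \<in> carrier_mat n n"
  shows "normalized_trace n (cmat B * resolvent S z) = stieltjes n (\<lambda>i. quad_form B (v i)) l z"
    and "normalized_trace n (resolvent S z) = stieltjes n (\<lambda>_. 1) l z"
proof -
  show "normalized_trace n (cmat B * resolvent S z) = stieltjes n (\<lambda>i. quad_form B (v i)) l z"
    unfolding normalized_trace_def stieltjes_def mat_trace_mult_resolvent_spectral[OF E S z B] ..
  have one: "cmat (1\<^sub>m n) * resolvent S z = resolvent S z"
  proof -
    have "cmat (1\<^sub>m n) = 1\<^sub>m n" by (intro eq_matI) auto
    then show ?thesis using left_mult_one_mat[OF resolvent_carrier[OF ordered_eigensystemD(1)[OF E], of z]] by simp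
  qed
  have "quad_form (1\<^sub>m n) (v i) = 1" if "i \<in> {1..n}" for i
    using ordered_eigensystemD(2)[OF E that] ordered_eigensystemD(4)[OF E that that] by (intro quad_form_one) auto
  then have "(\<Sum>i = 1..n. complex_of_real (quad_form (1\<^sub>m n) (v i)) / (of_real (l i) - z)) = (\<Sum>i = 1..n. of_real 1 / (of_real (l i) - z))"
    by (intro sum.cong) auto
  then show "normalized_trace n (resolvent S z) = stieltjes n (\<lambda>_. 1) l z"
    using mat_trace_mult_resolvent_spectral[OF E S z one_carrier_mat] unfolding one normalized_trace_def stieltjes_def by simp
qed

context wigner_law
begin

text \<open>
  Combines the deterministic equivalent, for \<open>B\<close> and for the identity matrix, with the weak
  convergence of the spectrum of the base matrix. The data \<open>X\<close> carry everything that is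
  independent of the noise. The exceptional null set may depend on \<open>z\<close>, hence the restriction to
  countably many.
\<close>

theorem AE_approx_subordinated:
  fixes N :: "nat \<Rightarrow> 'x measure" and X :: "nat \<Rightarrow> 'w \<Rightarrow> 'x" and \<xi> :: "nat \<Rightarrow> 'w \<Rightarrow> nat \<times> nat \<Rightarrow> real"
    and A B :: "nat \<Rightarrow> 'x \<Rightarrow> real mat" and s :: "nat \<Rightarrow> 'x \<Rightarrow> real" and f :: "real \<Rightarrow> real"
    and x l :: "nat \<Rightarrow> 'w \<Rightarrow> nat \<Rightarrow> real" and g :: "nat \<Rightarrow> 'w \<Rightarrow> nat \<Rightarrow> real vec"
  assumes M: "prob_space M"
    and ind: "\<And>n. indep_rv M (N n) (X n) (W n) (\<xi> n)" and law: "\<And>n. 0 < n \<Longrightarrow> distr M (W n) (\<xi> n) = W n"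
    and mA: "\<And>n. meas_mat (N n) n (A n)" and mB: "\<And>n. meas_mat (N n) n (B n)"
    and ms: "\<And>n. s n \<in> borel_measurable (N n)"
    and sym: "\<And>n \<omega>. \<omega> \<in> space M \<Longrightarrow> transpose_mat (A n (X n \<omega>)) = A n (X n \<omega>)"
    and bB: "\<And>n \<omega>. \<omega> \<in> space M \<Longrightarrow> op_bound n \<beta> (cmat (B n (X n \<omega>)))" and \<beta>: "0 \<le> \<beta>"
    and s: "\<And>n \<omega>. \<omega> \<in> space M \<Longrightarrow> 0 \<le> s n (X n \<omega>) \<and> s n (X n \<omega>) \<le> S"
    and H: "real_distribution H" and f: "continuous_on UNIV f" "\<And>y. \<bar>f y\<bar> \<le> \<beta>"
    and trB: "\<And>n \<omega> w. \<omega> \<in> space M \<Longrightarrow> 0 < Im w \<Longrightarrow>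
       normalized_trace n (cmat (B n (X n \<omega>)) * resolvent (A n (X n \<omega>)) w) = stieltjes n (\<lambda>i. f (x n \<omega> i)) (x n \<omega>) w"
    and tr1: "\<And>n \<omega> w. \<omega> \<in> space M \<Longrightarrow> 0 < Im w \<Longrightarrow> normalized_trace n (resolvent (A n (X n \<omega>)) w) = stieltjes n (\<lambda>_. 1) (x n \<omega>) w"
    and eig: "AE \<omega> in M. \<forall>\<^sub>F n in sequentially.
       ordered_eigensystem n (A n (X n \<omega>) + (s n (X n \<omega>) / sqrt (real n)) \<cdot>\<^sub>m symmat n (\<xi> n \<omega>)) (l n \<omega>) (g n \<omega>)"
    and weak: "AE \<omega> in M. weak_conv_m (\<lambda>n. empirical_distr n (x n \<omega>)) H"
    and slim: "AE \<omega> in M. (\<lambda>n. s n (X n \<omega>)) \<longlonglongrightarrow> \<sigma>"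
  shows "AE \<omega> in M. \<forall>a b :: rat. 0 < b \<longrightarrow>
     approx_subordinated H (\<lambda>_. 1) \<sigma> (\<lambda>_ _. 1) (\<lambda>n. l n \<omega>) (Complex (of_rat a) (of_rat b)) \<and>
     approx_subordinated H f \<sigma> (\<lambda>n i. quad_form (B n (X n \<omega>)) (g n \<omega> i)) (\<lambda>n. l n \<omega>) (Complex (of_rat a) (of_rat b))"
  unfolding AE_all_countable
proof (intro allI)
  fix a b :: rat
  define z where "z = Complex (of_rat a) (of_rat b)"
  show "AE \<omega> in M. 0 < b \<longrightarrow>
     approx_subordinated H (\<lambda>_. 1) \<sigma> (\<lambda>_ _. 1) (\<lambda>n. l n \<omega>) (Complex (of_rat a) (of_rat b)) \<and>
     approx_subordinated H f \<sigma> (\<lambda>n i. quad_form (B n (X n \<omega>)) (g n \<omega> i)) (\<lambda>n. l n \<omega>) (Complex (of_rat a) (of_rat b))"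
  proof (cases "0 < b")
    case True
    then have z: "0 < Im z" by (simp add: z_def)
    define I1 :: "nat \<Rightarrow> 'x \<Rightarrow> real mat" where "I1 n x = 1\<^sub>m n" for n x
    have mI: "meas_mat (N n) n (I1 n)" for n unfolding I1_def by (simp add: meas_mat_def)
    have cI: "cmat (I1 n x) = 1\<^sub>m n" for n x unfolding I1_def by (intro eq_matI) auto
    have bI: "op_bound n 1 (cmat (I1 n x))" for n x unfolding cI by (simp add: op_bound_def)
    define R where "R n \<omega> = noisy_resolvent n (A n (X n \<omega>)) (s n (X n \<omega>) / sqrt (real n)) z (\<xi> n \<omega>)" for n \<omega>
    have deB: "AE \<omega> in M. (\<lambda>n. normalized_trace n (cmat (B n (X n \<omega>)) * R n \<omega>)
      - normalized_trace n (cmat (B n (X n \<omega>)) * resolvent (A n (X n \<omega>)) (z + of_real ((s n (X n \<omega>))\<^sup>2) * normalized_trace n (R n \<omega>)))) \<longlonglongrightarrow> 0"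
      unfolding R_def by (rule AE_deterministic_equivalent[OF M ind law mA mB ms sym bB \<beta> s z]; simp)
    have de1: "AE \<omega> in M. (\<lambda>n. normalized_trace n (cmat (I1 n (X n \<omega>)) * R n \<omega>)
      - normalized_trace n (cmat (I1 n (X n \<omega>)) * resolvent (A n (X n \<omega>)) (z + of_real ((s n (X n \<omega>))\<^sup>2) * normalized_trace n (R n \<omega>)))) \<longlonglongrightarrow> 0"
      unfolding R_def by (rule AE_deterministic_equivalent[OF M ind law mA mI ms sym bI zero_le_one s z]; simp)
    show ?thesis using deB de1 eig weak slim AE_space
    proof eventually_elim
      case (elim \<omega>)
      define d where "d n i = quad_form (B n (X n \<omega>)) (g n \<omega> i)" for n i
      have Xs: "X n \<omega> \<in> space (N n)" for n
        by (rule measurable_space[OF ind[of n, unfolded indep_rv_def, THEN conjunct1] elim(6)])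
      have Ac: "A n (X n \<omega>) \<in> carrier_mat n n" and Bc: "B n (X n \<omega>) \<in> carrier_mat n n" for n
        using mA[of n] mB[of n] Xs by (auto simp: meas_mat_def)
      note pS = perturbed_symmetric[OF Ac sym[OF elim(6)] z]
      have ev: "\<forall>\<^sub>F n in sequentially. normalized_trace n (cmat (B n (X n \<omega>)) * R n \<omega>) = stieltjes n (d n) (l n \<omega>) z \<and> normalized_trace n (R n \<omega>) = stieltjes n (\<lambda>_. 1) (l n \<omega>) z"
        using elim(3)
      proof eventually_elim
        case (elim n)
        show ?case unfolding R_def noisy_resolvent_def d_def using normalized_trace_resolvent_eq_stieltjes[OF elim pS(2) z Bc] by simp
      qed
      have Ru: "0 < Im (z + of_real ((s n (X n \<omega>))\<^sup>2) * stieltjes n (\<lambda>_. 1) (l n \<omega>) z)" for n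
        using stieltjes_Im_nonneg[OF z, of n "l n \<omega>"] z by (simp add: add_pos_nonneg)
      have one: "1\<^sub>m n * resolvent (A n (X n \<omega>)) w = resolvent (A n (X n \<omega>)) w" "1\<^sub>m n * R n \<omega> = R n \<omega>" for n w
        using left_mult_one_mat[OF resolvent_carrier[OF Ac[of n], of w]]
          left_mult_one_mat[OF noisy_resolvent_carrier[OF Ac[of n] sym[OF elim(6)] z]] unfolding R_def by blast+
      have c1: "continuous_on UNIV (\<lambda>_::real. 1::real)" by simp
      have c2: "\<bar>1::real\<bar> \<le> 1" by simp
      have "(\<lambda>n. stieltjes n (d n) (l n \<omega>) z - stieltjes n (\<lambda>i. f (x n \<omega> i)) (x n \<omega>) (z + of_real ((s n (X n \<omega>))\<^sup>2) * stieltjes n (\<lambda>_. 1) (l n \<omega>) z)) \<longlonglongrightarrow> 0"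
        using elim(1)
      proof (rule Lim_transform_eventually)
        show "\<forall>\<^sub>F n in sequentially. normalized_trace n (cmat (B n (X n \<omega>)) * R n \<omega>) -
            normalized_trace n (cmat (B n (X n \<omega>)) * resolvent (A n (X n \<omega>)) (z + of_real ((s n (X n \<omega>))\<^sup>2) * normalized_trace n (R n \<omega>))) =
            stieltjes n (d n) (l n \<omega>) z - stieltjes n (\<lambda>i. f (x n \<omega> i)) (x n \<omega>) (z + of_real ((s n (X n \<omega>))\<^sup>2) * stieltjes n (\<lambda>_. 1) (l n \<omega>) z)"
          using ev by eventually_elim (simp only: trB[OF elim(6) Ru])
      qed
      then have "approx_subordinated H f \<sigma> d (\<lambda>n. l n \<omega>) z"
        by (rule approx_subordinatedI[OF H elim(4) f z elim(5)])
      moreover have "(\<lambda>n. stieltjes n (\<lambda>_. 1) (l n \<omega>) z - stieltjes n (\<lambda>i. 1) (x n \<omega>) (z + of_real ((s n (X n \<omega>))\<^sup>2) * stieltjes n (\<lambda>_. 1) (l n \<omega>) z)) \<longlonglongrightarrow> 0"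
        using elim(2)
      proof (rule Lim_transform_eventually)
        show "\<forall>\<^sub>F n in sequentially. normalized_trace n (cmat (I1 n (X n \<omega>)) * R n \<omega>) -
            normalized_trace n (cmat (I1 n (X n \<omega>)) * resolvent (A n (X n \<omega>)) (z + of_real ((s n (X n \<omega>))\<^sup>2) * normalized_trace n (R n \<omega>))) =
            stieltjes n (\<lambda>_. 1) (l n \<omega>) z - stieltjes n (\<lambda>i. 1) (x n \<omega>) (z + of_real ((s n (X n \<omega>))\<^sup>2) * stieltjes n (\<lambda>_. 1) (l n \<omega>) z)"
          using ev by eventually_elim (simp only: cI one tr1[OF elim(6) Ru])
      qed
      then have "approx_subordinated H (\<lambda>_. 1) \<sigma> (\<lambda>_ _. 1) (\<lambda>n. l n \<omega>) z"
        by (rule approx_subordinatedI[OF H elim(4) c1 c2 z elim(5)])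
      ultimately show ?case unfolding z_def d_def[abs_def] by simp
    qed
  qed simp
qed

end

lemma sum_block:
  fixes u :: "nat \<Rightarrow> real"
  assumes "Nb \<le> n"
  shows "(\<Sum>i\<in>{Na..Nb} \<inter> {1..n}. u i) = (\<Sum>i = 1..Nb. u i) - (\<Sum>i = 1..min (Na - 1) Nb. u i)"
proof -
  have e: "{1..Nb} = ({Na..Nb} \<inter> {1..n}) \<union> {1..min (Na - 1) Nb}" using assms by auto
  have d: "({Na..Nb} \<inter> {1..n}) \<inter> {1..min (Na - 1) Nb} = {}" by auto
  have "(\<Sum>i = 1..Nb. u i) = (\<Sum>i\<in>({Na..Nb} \<inter> {1..n}) \<union> {1..min (Na - 1) Nb}. u i)" using e by simp
  also have "\<dots> = (\<Sum>i\<in>{Na..Nb} \<inter> {1..n}. u i) + (\<Sum>i = 1..min (Na - 1) Nb. u i)"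
    by (rule sum.union_disjoint) (use d in auto)
  finally show ?thesis by simp
qed

lemma quad_form_diag:
  assumes "u \<in> carrier_vec n"
  shows "quad_form (diag_of n y) u = (\<Sum>j = 1..n. y j * (u $ (j - 1))\<^sup>2)"
proof -
  have "quad_form (diag_of n y) u = (\<Sum>r<n. \<Sum>s<n. u $ r * (if r = s then y (Suc s) else 0) * u $ s)"
    unfolding quad_form_sum[OF diag_of_carrier assms] by (intro sum.cong refl) (simp add: diag_of_def mat_diag_def)
  also have "\<dots> = (\<Sum>r<n. y (Suc r) * (u $ r)\<^sup>2)"
  proof (intro sum.cong refl)
    fix r assume r: "r \<in> {..<n}"
    have "(\<Sum>s<n. u $ r * (if r = s then y (Suc s) else 0) * u $ s) = (\<Sum>s<n. if s = r then y (Suc r) * (u $ r)\<^sup>2 else 0)"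
      by (intro sum.cong) (auto simp: power2_eq_square)
    then show "(\<Sum>s<n. u $ r * (if r = s then y (Suc s) else 0) * u $ s) = y (Suc r) * (u $ r)\<^sup>2" using r by simp
  qed
  finally show ?thesis by (simp add: sum.atLeast1_atMost_eq)
qed

text \<open>
  Completeness of the eigenbasis: each diagonal entry is distributed over the eigenvectors with total weight
  1.
\<close>

lemma sum_quad_form_diag_diff_le:
  assumes E: "ordered_eigensystem n S l g" and I: "I \<subseteq> {1..n}"
  shows "\<bar>(\<Sum>i\<in>I. quad_form (diag_of n y) (g i)) - (\<Sum>i\<in>I. quad_form (diag_of n y') (g i))\<bar> \<le> (\<Sum>j = 1..n. \<bar>y j - y' j\<bar>)"
proof -
  note D = ordered_eigensystemD[OF E]
  have fI: "finite I" using I finite_subset by blast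
  have "\<bar>(\<Sum>i\<in>I. quad_form (diag_of n y) (g i)) - (\<Sum>i\<in>I. quad_form (diag_of n y') (g i))\<bar> =
      \<bar>\<Sum>i\<in>I. \<Sum>j = 1..n. (y j - y' j) * (g i $ (j - 1))\<^sup>2\<bar>"
    unfolding sum_subtractf[symmetric]
    by (intro arg_cong[where f=abs] sum.cong refl, subst (1 2) quad_form_diag)
      (use D(2) I in \<open>auto simp: sum_subtractf[symmetric] left_diff_distrib\<close>)
  also have "\<dots> \<le> (\<Sum>i\<in>I. \<Sum>j = 1..n. \<bar>y j - y' j\<bar> * (g i $ (j - 1))\<^sup>2)"
    by (rule order_trans[OF sum_abs], intro sum_mono, rule order_trans[OF sum_abs]) (simp add: abs_mult)
  also have "\<dots> \<le> (\<Sum>i\<in>{1..n}. \<Sum>j = 1..n. \<bar>y j - y' j\<bar> * (g i $ (j - 1))\<^sup>2)"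
    using I by (intro sum_mono2 sum_nonneg) auto
  also have "\<dots> = (\<Sum>j = 1..n. \<Sum>i = 1..n. \<bar>y j - y' j\<bar> * (g i $ (j - 1) * g i $ (j - 1)))"
    unfolding power2_eq_square by (rule sum.swap)
  also have "\<dots> = (\<Sum>j = 1..n. \<bar>y j - y' j\<bar> * 1)"
  proof (intro sum.cong refl)
    fix j assume "j \<in> {1..n}"
    then have "(\<Sum>i = 1..n. g i $ (j - 1) * g i $ (j - 1)) = 1"
      using orthonormal_completeness[OF E, of "j - 1" "j - 1"] by auto
    then show "(\<Sum>i = 1..n. \<bar>y j - y' j\<bar> * (g i $ (j - 1) * g i $ (j - 1))) = \<bar>y j - y' j\<bar> * 1"
      by (simp only: sum_distrib_left[symmetric])
  qed
  finally show ?thesis by simp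
qed

lemma nat_floor_le: "t \<in> {0..1} \<Longrightarrow> nat \<lfloor>real n * t\<rfloor> \<le> n"
proof -
  assume t: "t \<in> {0..1}"
  then have "real n * t \<le> real n" by (simp add: mult_left_le)
  then have "\<lfloor>real n * t\<rfloor> \<le> int n" by (simp add: floor_le_iff)
  then show ?thesis by simp
qed

section \<open>The two random matrix models\<close>

lemma diag_of_cong: "(\<And>i. i \<in> {1..n} \<Longrightarrow> f i = g i) \<Longrightarrow> diag_of n f = diag_of n g"
  by (intro eq_matI) (auto simp: diag_of_def mat_diag_def)

lemma meas_mat_diag_of:
  assumes "\<And>i. i \<in> {1..n} \<Longrightarrow> (\<lambda>\<omega>. y \<omega> i) \<in> borel_measurable N"
  shows "meas_mat N n (\<lambda>\<omega>. diag_of n (y \<omega>))"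
  unfolding meas_mat_def
proof (intro conjI ballI allI impI)
  fix i j assume ij: "i < n" "j < n"
  have "(\<lambda>\<omega>. diag_of n (y \<omega>) $$ (i, j)) = (\<lambda>\<omega>. if i = j then y \<omega> (Suc i) else 0)"
    using ij by (auto simp: diag_of_def mat_diag_def fun_eq_iff)
  then show "(\<lambda>\<omega>. diag_of n (y \<omega>) $$ (i, j)) \<in> borel_measurable N"
    using assms[of "Suc i"] ij by simp
qed simp

lemma normalized_trace_diag_resolvent:
  assumes z: "0 < Im z"
  shows "normalized_trace n (cmat (diag_of n f) * resolvent (diag_of n x) z) = stieltjes n f x z"
    and "normalized_trace n (resolvent (diag_of n x) z) = stieltjes n (\<lambda>_. 1) x z"
proof -
  show *: "normalized_trace n (cmat (diag_of n f) * resolvent (diag_of n x) z) = stieltjes n f x z" for f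
    unfolding normalized_trace_def stieltjes_def mat_trace_diag_resolvent[OF z] ..
  have "cmat (diag_of n (\<lambda>_. 1)) = 1\<^sub>m n" by (intro eq_matI) (auto simp: diag_of_def mat_diag_def)
  then have "cmat (diag_of n (\<lambda>_. 1)) * resolvent (diag_of n x) z = resolvent (diag_of n x) z"
    using left_mult_one_mat[OF resolvent_carrier[OF diag_of_carrier[of n x], of z]] by simp
  then show "normalized_trace n (resolvent (diag_of n x) z) = stieltjes n (\<lambda>_. 1) x z" using *[of "\<lambda>_. 1"] by simp
qed

text \<open>
  Here the data are the entries of \<open>A\<^sub>n\<close>, the noise consists of the entries of
  \<open>Z\<^sub>n\<close> on and above the diagonal, and \<open>B = f(A\<^sub>n)\<close>.
\<close>

lemma wigner_approx_subordinated:
  fixes A :: "nat \<Rightarrow> 'w \<Rightarrow> real mat" and Z :: "nat \<Rightarrow> nat \<Rightarrow> 'w \<Rightarrow> real"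
    and lam lamhat :: "nat \<Rightarrow> 'w \<Rightarrow> nat \<Rightarrow> real" and v what :: "nat \<Rightarrow> 'w \<Rightarrow> nat \<Rightarrow> real vec"
    and f :: "real \<Rightarrow> real"
  assumes M: "prob_space M" and \<sigma>: "\<sigma> > 0"
    and A_sym: "\<And>n \<omega>. \<omega> \<in> space M \<Longrightarrow> transpose_mat (A n \<omega>) = A n \<omega>"
    and A_eig: "\<And>n \<omega>. \<omega> \<in> space M \<Longrightarrow> ordered_eigensystem n (A n \<omega>) (lam n \<omega>) (v n \<omega>)"
    and H: "real_distribution H"
    and A_esd: "AE \<omega> in M. weak_conv_m (\<lambda>n. empirical_distr n (lam n \<omega>)) H"
    and Z_iid: "iid_symmetric_array M Z"
    and Z_moment4: "integrable M (\<lambda>\<omega>. (Z 0 0 \<omega>) ^ 4)"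
    and Z_mean: "prob_space.expectation M (Z 0 0) = 0"
    and Z_var: "prob_space.variance M (Z 0 0) = 1"
    and Z_indep: "\<And>n. prob_space.indep_var M
        (entry_space n) (\<lambda>\<omega>. entries n (A n \<omega>)) (entry_space n) (\<lambda>\<omega>. entries n (top_left n Z \<omega>))"
    and Ahat_eig: "\<And>n \<omega>. \<omega> \<in> space M \<Longrightarrow>
        ordered_eigensystem n (A n \<omega> + (\<sigma> / sqrt (real n)) \<cdot>\<^sub>m top_left n Z \<omega>) (lamhat n \<omega>) (what n \<omega>)"
    and f: "continuous_on UNIV f" "\<And>y. \<bar>f y\<bar> \<le> \<beta>"
  shows "AE \<omega> in M. \<forall>a b :: rat. 0 < b \<longrightarrow>
     approx_subordinated H (\<lambda>_. 1) \<sigma> (\<lambda>_ _. 1) (\<lambda>n. lamhat n \<omega>) (Complex (of_rat a) (of_rat b)) \<and>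
     approx_subordinated H f \<sigma> (\<lambda>n i. quad_form (spectral_sum n f (lam n \<omega>) (v n \<omega>)) (what n \<omega> i))
       (\<lambda>n. lamhat n \<omega>) (Complex (of_rat a) (of_rat b))"
proof -
  interpret prob_space M by (rule M)
  define \<nu> where "\<nu> = (\<lambda>_ :: nat \<times> nat. distr M borel (Z 0 0))"
  have indZ: "indep_vars (\<lambda>_. borel) (\<lambda>(i, j). Z i j) {(i, j). i \<le> j}"
    and lawZ: "\<And>i j. i \<le> j \<Longrightarrow> distr M borel (Z i j) = distr M borel (Z 0 0)"
    and symZ: "\<And>i j \<omega>. \<omega> \<in> space M \<Longrightarrow> Z i j \<omega> = Z j i \<omega>"
    using Z_iid unfolding iid_symmetric_array_def by blast+
  have "random_variable borel ((\<lambda>(i, j). Z i j) (0, 0))" using indZ unfolding indep_vars_def by blast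
  then have Z00: "Z 0 0 \<in> borel_measurable M" by simp
  interpret Wg: wigner_law \<nu> "max 1 (expectation (\<lambda>\<omega>. Z 0 0 \<omega> ^ 4))"
    unfolding \<nu>_def by (rule wigner_law_of_variable[OF M Z00 Z_moment4 Z_mean Z_var])
  define P where "P n F \<longleftrightarrow> meas_mat (entry_space n) n F \<and>
    (\<forall>A l v. transpose_mat A = A \<longrightarrow> ordered_eigensystem n A l v \<longrightarrow> F (entries n A) = spectral_sum n f l v)"
    for n and F :: "(nat \<times> nat \<Rightarrow> real) \<Rightarrow> real mat"
  have "\<exists>F. P n F" for n
  proof (rule measurable_functional_calculus[OF f(1), of n])
    fix F :: "(nat \<times> nat \<Rightarrow> real) \<Rightarrow> real mat"
    assume a: "meas_mat (entry_space n) n F"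
      "\<And>A l v. transpose_mat A = A \<Longrightarrow> ordered_eigensystem n A l v \<Longrightarrow> F (entries n A) = spectral_sum n f l v"
    have "P n F" unfolding P_def
    proof (intro conjI allI impI)
      show "meas_mat (entry_space n) n F" by (rule a(1))
      fix A l v assume "transpose_mat A = A" "ordered_eigensystem n A l v"
      then show "F (entries n A) = spectral_sum n f l v" by (rule a(2))
    qed
    then show ?thesis by blast
  qed
  then obtain F where P: "P n (F n)" for n by metis
  have mF: "meas_mat (entry_space n) n (F n)" for n using P[of n] unfolding P_def by (rule conjunct1)
  have F: "F n (entries n A) = spectral_sum n f l v" if "transpose_mat A = A" "ordered_eigensystem n A l v" for n A l v
    using P[of n] that unfolding P_def by blast
  define \<xi> where "\<xi> n \<omega> = (\<lambda>p\<in>upper n. top_left n Z \<omega> $$ p)" for n \<omega>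
  have Ac: "A n \<omega> \<in> carrier_mat n n" if "\<omega> \<in> space M" for n \<omega> by (rule ordered_eigensystemD(1)[OF A_eig[OF that]])
  have AX: "mat n n (entries n (A n \<omega>)) = A n \<omega>" if "\<omega> \<in> space M" for n \<omega> by (rule mat_of_entries[OF Ac[OF that]])
  have FX: "F n (entries n (A n \<omega>)) = spectral_sum n f (lam n \<omega>) (v n \<omega>)" if "\<omega> \<in> space M" for n \<omega>
    by (rule F[OF A_sym[OF that] A_eig[OF that]])
  have sZ: "symmat n (\<xi> n \<omega>) = top_left n Z \<omega>" if "\<omega> \<in> space M" for n \<omega>
    unfolding \<xi>_def
  proof (rule symmat_of_symmetric)
    show "transpose_mat (top_left n Z \<omega>) = top_left n Z \<omega>"
      by (intro eq_matI) (simp_all add: top_left_def symZ[OF that, symmetric])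
  qed (simp add: top_left_def)
  have \<beta>: "0 \<le> \<beta>" using f(2)[of 0] by linarith
  have main: "AE \<omega> in M. \<forall>a b :: rat. 0 < b \<longrightarrow>
     approx_subordinated H (\<lambda>_. 1) \<sigma> (\<lambda>_ _. 1) (\<lambda>n. lamhat n \<omega>) (Complex (of_rat a) (of_rat b)) \<and>
     approx_subordinated H f \<sigma> (\<lambda>n i. quad_form (F n (entries n (A n \<omega>))) (what n \<omega> i))
       (\<lambda>n. lamhat n \<omega>) (Complex (of_rat a) (of_rat b))"
  proof (rule Wg.AE_approx_subordinated[where N=entry_space and X="\<lambda>n \<omega>. entries n (A n \<omega>)" and \<xi>=\<xi>
        and A="\<lambda>n e. mat n n e" and B=F and s="\<lambda>_ _. \<sigma>" and S=\<sigma> and x=lam and \<beta>=\<beta>, OF M _ _ _ mF])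
    show "indep_rv M (entry_space n) (\<lambda>\<omega>. entries n (A n \<omega>)) (Wg.W n) (\<xi> n)" for n
    proof -
      have "indep_rv M (entry_space n) (\<lambda>\<omega>. entries n (A n \<omega>)) (Wg.W n)
        (\<lambda>\<omega>. restrict (entries n (top_left n Z \<omega>)) (upper n))"
        by (rule indep_rv_compose[OF indep_rv_of_indep_var[OF M Z_indep] restrict_upper_measurable[OF Wg.sets_eq]])
      then show ?thesis unfolding restrict_entries \<xi>_def[abs_def] .
    qed
    show "distr M (Wg.W n) (\<xi> n) = Wg.W n" if n: "0 < n" for n
    proof -
      have e: "\<xi> n = (\<lambda>\<omega>. \<lambda>p\<in>upper n. (case p of (i, j) \<Rightarrow> Z i j) \<omega>)"
        by (auto simp: \<xi>_def fun_eq_iff restrict_def upper_def top_left_def)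
      show ?thesis
        unfolding e
      proof (rule distr_restrict_eq_PiM[OF M])
        show "upper n \<noteq> {}" using n by (auto simp: upper_def)
        show "indep_vars (\<lambda>_. borel) (\<lambda>(i, j). Z i j) (upper n)"
          by (rule indep_vars_subset[OF indZ]) (auto simp: upper_def)
        show "distr M borel (case p of (i, j) \<Rightarrow> Z i j) = \<nu> p" if "p \<in> upper n" for p
        proof -
          obtain i j where "p = (i, j)" "i \<le> j" using \<open>p \<in> upper n\<close> by (auto simp: upper_def)
          then show ?thesis using lawZ[of i j] by (simp only: \<nu>_def prod.case)
        qed
        show "sets (\<nu> p) = sets borel" for p by (rule Wg.sets_eq)
      qed
    qed
    show "meas_mat (entry_space n) n (mat n n)" for n by (rule meas_mat_entries)
    show "(\<lambda>_. \<sigma>) \<in> borel_measurable (entry_space n)" for n by simp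
    show "transpose_mat (mat n n (entries n (A n \<omega>))) = mat n n (entries n (A n \<omega>))" if "\<omega> \<in> space M" for n \<omega>
      unfolding AX[OF that] by (rule A_sym[OF that])
    show "op_bound n \<beta> (cmat (F n (entries n (A n \<omega>))))" if "\<omega> \<in> space M" for n \<omega>
      unfolding FX[OF that] by (rule spectral_sum_op_bound[OF A_eig[OF that] f(2) \<beta>])
    show "0 \<le> \<beta>" by (rule \<beta>)
    show "0 \<le> \<sigma> \<and> \<sigma> \<le> \<sigma>" for n :: nat and \<omega> :: 'w using \<sigma> by simp
    show "real_distribution H" "continuous_on UNIV f" "\<And>y. \<bar>f y\<bar> \<le> \<beta>" by (rule H f)+
    show "normalized_trace n (cmat (F n (entries n (A n \<omega>))) * resolvent (mat n n (entries n (A n \<omega>))) w) =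
        stieltjes n (\<lambda>i. f (lam n \<omega> i)) (lam n \<omega>) w" if w: "\<omega> \<in> space M" "0 < Im w" for n \<omega> w
    proof -
      have c: "spectral_sum n f (lam n \<omega>) (v n \<omega>) \<in> carrier_mat n n" by (simp add: spectral_sum_def)
      show ?thesis
        unfolding FX[OF w(1)] AX[OF w(1)] normalized_trace_resolvent_eq_stieltjes(1)[OF A_eig[OF w(1)] A_sym[OF w(1)] w(2) c] stieltjes_def
        by (intro arg_cong2[where f="(/)"] sum.cong refl) (simp only: quad_form_spectral_sum[OF A_eig[OF w(1)]])
    qed
    show "normalized_trace n (resolvent (mat n n (entries n (A n \<omega>))) w) = stieltjes n (\<lambda>_. 1) (lam n \<omega>) w"
      if w: "\<omega> \<in> space M" "0 < Im w" for n \<omega> w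
      unfolding AX[OF w(1)] by (rule normalized_trace_resolvent_eq_stieltjes(2)[OF A_eig[OF w(1)] A_sym[OF w(1)] w(2) Ac[OF w(1)]])
    show "AE \<omega> in M. \<forall>\<^sub>F n in sequentially. ordered_eigensystem n
        (mat n n (entries n (A n \<omega>)) + (\<sigma> / sqrt (real n)) \<cdot>\<^sub>m symmat n (\<xi> n \<omega>)) (lamhat n \<omega>) (what n \<omega>)"
      using AE_space by eventually_elim (simp only: AX sZ Ahat_eig eventually_True)
    show "AE \<omega> in M. weak_conv_m (\<lambda>n. empirical_distr n (lam n \<omega>)) H" by (rule A_esd)
    show "AE \<omega> in M. (\<lambda>n. \<sigma>) \<longlonglongrightarrow> \<sigma>" by simp
  qed
  show ?thesis using main AE_space by eventually_elim (simp only: FX)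
qed

text \<open>
  One Monte-Carlo run. The data are all random inputs that the sampled matrix is independent of; the base
  matrix and \<open>B\<close> are diagonal with entries \<open>\<lambda>\<^sub>i\<close> and
  \<open>f(\<lambda>\<^sub>i)\<close> formed from the inputs.
\<close>

lemma monte_carlo_approx_subordinated:
  fixes A Zn :: "nat \<Rightarrow> 'w \<Rightarrow> real mat" and G :: "nat \<Rightarrow> nat \<Rightarrow> 'w \<Rightarrow> real mat"
    and sigt :: "nat \<Rightarrow> 'w \<Rightarrow> real" and lamt mu :: "nat \<Rightarrow> 'w \<Rightarrow> nat \<Rightarrow> real" and g :: "nat \<Rightarrow> 'w \<Rightarrow> nat \<Rightarrow> real vec"
    and f :: "real \<Rightarrow> real"
  assumes M: "prob_space M" and \<sigma>: "\<sigma> > 0" and H: "real_distribution H" and k: "k \<in> {1..K}"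
    and sampling: "\<And>n. mc_sampling M n K (G n) (A n) (Zn n) (sigt n) (lamt n)"
    and mc_eig: "\<And>n \<omega>. \<omega> \<in> space M \<Longrightarrow>
        ordered_eigensystem n (mc_matrix n (sigt n \<omega>) (lamt n \<omega>) (G n k \<omega>)) (mu n \<omega>) (g n \<omega>)"
    and sigt_lim: "AE \<omega> in M. (\<lambda>n. sigt n \<omega>) \<longlonglongrightarrow> \<sigma>"
    and lamt_esd: "AE \<omega> in M. weak_conv_m (\<lambda>n. empirical_distr n (lamt n \<omega>)) H"
    and f: "continuous_on UNIV f" "\<And>y. \<bar>f y\<bar> \<le> \<beta>"
  shows "AE \<omega> in M. \<forall>a b :: rat. 0 < b \<longrightarrow>
     approx_subordinated H (\<lambda>_. 1) \<sigma> (\<lambda>_ _. 1) (\<lambda>n. mu n \<omega>) (Complex (of_rat a) (of_rat b)) \<and>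
     approx_subordinated H f \<sigma> (\<lambda>n i. quad_form (diag_of n (\<lambda>j. f (lamt n \<omega> j))) (g n \<omega> i))
       (\<lambda>n. mu n \<omega>) (Complex (of_rat a) (of_rat b))"
proof -
  interpret prob_space M by (rule M)
  interpret Wg: wigner_law goe_law 4 by (rule wigner_law_goe)
  define N :: "nat \<Rightarrow> (((nat \<times> nat \<Rightarrow> real) \<times> (nat \<times> nat \<Rightarrow> real)) \<times> real \<times> (nat \<Rightarrow> real)) measure"
    where "N n = (entry_space n \<Otimes>\<^sub>M entry_space n) \<Otimes>\<^sub>M (borel \<Otimes>\<^sub>M PiM {1..n} (\<lambda>_. borel))" for n
  define X where "X n \<omega> = ((entries n (A n \<omega>), entries n (Zn n \<omega>)), (sigt n \<omega>, restrict (lamt n \<omega>) {1..n}))" for n \<omega>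
  define \<xi> where "\<xi> n \<omega> = (\<lambda>p\<in>upper n. G n k \<omega> $$ p)" for n \<omega>
  \<comment> \<open>The noise level is truncated to a bounded range, which makes the error bounds uniform in the data; as it tends to \<open>\<sigma>\<close>, the truncation has no effect for large \<open>n\<close>.\<close>
  define s where "s n x = max 0 (min (2 * \<sigma>) (fst (snd x)))" for n :: nat and x :: "((nat \<times> nat \<Rightarrow> real) \<times> (nat \<times> nat \<Rightarrow> real)) \<times> real \<times> (nat \<Rightarrow> real)"
  have goe: "is_GOE M n (G n k)" for n using sampling[of n] k by (auto simp: mc_sampling_def)
  have DX: "diag_of n (snd (snd (X n \<omega>))) = diag_of n (lamt n \<omega>)" for n \<omega>
    unfolding X_def by (intro diag_of_cong) simp
  have BX: "diag_of n (\<lambda>j. f (snd (snd (X n \<omega>)) j)) = diag_of n (\<lambda>j. f (lamt n \<omega> j))" for n \<omega>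
    unfolding X_def by (intro diag_of_cong) simp
  have comp: "(\<lambda>x. snd (snd x) i) \<in> borel_measurable (N n)" if "i \<in> {1..n}" for n i
    unfolding N_def using that
    by (intro measurable_compose[OF measurable_compose[OF measurable_snd measurable_snd] measurable_component_singleton]) auto
  have fm: "f \<in> borel_measurable borel" using f(1) by (rule borel_measurable_continuous_onI)
  have \<beta>: "0 \<le> \<beta>" using f(2)[of 0] by linarith
  have sG: "symmat n (\<xi> n \<omega>) = G n k \<omega>" if "\<omega> \<in> space M" for n \<omega>
    unfolding \<xi>_def using goe[of n] that by (intro symmat_of_symmetric) (auto simp: is_GOE_def)
  have "AE \<omega> in M. \<forall>a b :: rat. 0 < b \<longrightarrow>
     approx_subordinated H (\<lambda>_. 1) \<sigma> (\<lambda>_ _. 1) (\<lambda>n. mu n \<omega>) (Complex (of_rat a) (of_rat b)) \<and>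
     approx_subordinated H f \<sigma> (\<lambda>n i. quad_form (diag_of n (\<lambda>j. f (snd (snd (X n \<omega>)) j))) (g n \<omega> i))
       (\<lambda>n. mu n \<omega>) (Complex (of_rat a) (of_rat b))"
  proof (rule Wg.AE_approx_subordinated[where N=N and X=X and \<xi>=\<xi>
        and A="\<lambda>n x. diag_of n (snd (snd x))" and B="\<lambda>n x. diag_of n (\<lambda>j. f (snd (snd x) j))"
        and s=s and S="2 * \<sigma>" and x=lamt and \<beta>=\<beta>, OF M])
    show "indep_rv M (N n) (X n) (Wg.W n) (\<xi> n)" for n
    proof -
      have "indep_rv M (N n) (X n) (Wg.W n) (\<lambda>\<omega>. restrict (entries n (G n k \<omega>)) (upper n))"
        unfolding N_def X_def[abs_def]
        by (rule indep_rv_compose[OF indep_rv_of_mc_sampling[OF M sampling k] restrict_upper_measurable[OF Wg.sets_eq]])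
      then show ?thesis unfolding restrict_entries \<xi>_def[abs_def] .
    qed
    show "distr M (Wg.W n) (\<xi> n) = Wg.W n" if n: "0 < n" for n
      unfolding \<xi>_def[abs_def]
    proof (rule distr_restrict_eq_PiM[OF M])
      show "upper n \<noteq> {}" using n by (auto simp: upper_def)
      show "indep_vars (\<lambda>_. borel) (\<lambda>p \<omega>. G n k \<omega> $$ p) (upper n)"
        using goe[of n] unfolding is_GOE_def upper_def by blast
      show "distr M borel (\<lambda>\<omega>. G n k \<omega> $$ p) = goe_law p" if p: "p \<in> upper n" for p
      proof -
        obtain i j where ij: "p = (i, j)" "i \<le> j" "j < n" using p by (auto simp: upper_def)
        have "distributed M lborel (\<lambda>\<omega>. G n k \<omega> $$ p) (normal_density 0 (if i = j then sqrt 2 else 1))"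
          using goe[of n] ij unfolding is_GOE_def by blast
        from distributed_distr_eq_density[OF this]
        have "distr M lborel (\<lambda>\<omega>. G n k \<omega> $$ p) = goe_law p" by (simp add: goe_law_def ij)
        then show ?thesis by (simp cong: distr_cong)
      qed
      show "sets (goe_law p) = sets borel" for p by (rule Wg.sets_eq)
    qed
    show "meas_mat (N n) n (\<lambda>x. diag_of n (snd (snd x)))" for n by (rule meas_mat_diag_of[OF comp])
    show "meas_mat (N n) n (\<lambda>x. diag_of n (\<lambda>j. f (snd (snd x) j)))" for n
      by (rule meas_mat_diag_of[OF measurable_compose[OF comp fm]])
    show "s n \<in> borel_measurable (N n)" for n
      unfolding s_def N_def by measurable
    show "transpose_mat (diag_of n (snd (snd (X n \<omega>)))) = diag_of n (snd (snd (X n \<omega>)))" for n \<omega> by simp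
    show "op_bound n \<beta> (cmat (diag_of n (\<lambda>j. f (snd (snd (X n \<omega>)) j))))" for n \<omega> by (rule diag_of_op_bound[OF f(2) \<beta>])
    show "0 \<le> \<beta>" by (rule \<beta>)
    show "0 \<le> s n (X n \<omega>) \<and> s n (X n \<omega>) \<le> 2 * \<sigma>" for n \<omega> using \<sigma> by (simp add: s_def)
    show "real_distribution H" "continuous_on UNIV f" "\<And>y. \<bar>f y\<bar> \<le> \<beta>" by (rule H f)+
    show "normalized_trace n (cmat (diag_of n (\<lambda>j. f (snd (snd (X n \<omega>)) j))) * resolvent (diag_of n (snd (snd (X n \<omega>)))) w) =
        stieltjes n (\<lambda>i. f (lamt n \<omega> i)) (lamt n \<omega>) w" if "0 < Im w" for n \<omega> w
      unfolding BX DX by (rule normalized_trace_diag_resolvent(1)[OF that])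
    show "normalized_trace n (resolvent (diag_of n (snd (snd (X n \<omega>)))) w) = stieltjes n (\<lambda>_. 1) (lamt n \<omega>) w" if "0 < Im w" for n \<omega> w
      unfolding DX by (rule normalized_trace_diag_resolvent(2)[OF that])
    have ev: "\<forall>\<^sub>F n in sequentially. s n (X n \<omega>) = sigt n \<omega>" if "(\<lambda>n. sigt n \<omega>) \<longlonglongrightarrow> \<sigma>" for \<omega>
    proof -
      have "\<forall>\<^sub>F n in sequentially. 0 < sigt n \<omega>" "\<forall>\<^sub>F n in sequentially. sigt n \<omega> < 2 * \<sigma>"
        using order_tendstoD[OF that] \<sigma> by auto
      then show ?thesis by eventually_elim (simp add: s_def X_def)
    qed
    show "AE \<omega> in M. \<forall>\<^sub>F n in sequentially. ordered_eigensystem n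
        (diag_of n (snd (snd (X n \<omega>))) + (s n (X n \<omega>) / sqrt (real n)) \<cdot>\<^sub>m symmat n (\<xi> n \<omega>)) (mu n \<omega>) (g n \<omega>)"
      using sigt_lim AE_space
    proof eventually_elim
      case (elim \<omega>)
      from ev[OF elim(1)] show ?case
        by eventually_elim (use mc_eig[OF elim(2)] in \<open>simp add: DX sG[OF elim(2)] mc_matrix_def\<close>)
    qed
    show "AE \<omega> in M. weak_conv_m (\<lambda>n. empirical_distr n (lamt n \<omega>)) H" by (rule lamt_esd)
    show "AE \<omega> in M. (\<lambda>n. s n (X n \<omega>)) \<longlonglongrightarrow> \<sigma>"
      using sigt_lim
    proof eventually_elim
      case (elim \<omega>)
      show ?case by (rule Lim_transform_eventually[OF elim]) (use ev[OF elim] in \<open>simp add: eq_commute\<close>)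
    qed
  qed
  then show ?thesis unfolding BX .
qed

lemma eigenvector_quad_form_bound:
  assumes E: "ordered_eigensystem n S l w" and B: "op_bound n \<beta> (cmat B)" and i: "i \<in> {1..n}"
  shows "\<bar>quad_form B (w i)\<bar> \<le> \<beta>"
  using ordered_eigensystemD(2)[OF E i] ordered_eigensystemD(4)[OF E i i] by (intro quad_form_bound[OF B]) auto

section \<open>The two shrinkage procedures agree asymptotically\<close>

theorem theorem3p2:
  fixes M :: "'w measure"
    and A :: "nat \<Rightarrow> 'w \<Rightarrow> real mat"
    and Z :: "nat \<Rightarrow> nat \<Rightarrow> 'w \<Rightarrow> real"
    and lam lamhat :: "nat \<Rightarrow> 'w \<Rightarrow> nat \<Rightarrow> real"
    and v what :: "nat \<Rightarrow> 'w \<Rightarrow> nat \<Rightarrow> real vec"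
    and \<sigma> :: real
    and H :: "real measure"
    and h1 h2 :: real
    and h :: "real \<Rightarrow> real"
    and U :: "real set"
    and K :: nat
    and sigt :: "nat \<Rightarrow> 'w \<Rightarrow> real"
    and lamt :: "nat \<Rightarrow> 'w \<Rightarrow> nat \<Rightarrow> real"
    and G :: "nat \<Rightarrow> nat \<Rightarrow> 'w \<Rightarrow> real mat"
    and mu :: "nat \<Rightarrow> 'w \<Rightarrow> nat \<Rightarrow> nat \<Rightarrow> real"
    and g :: "nat \<Rightarrow> 'w \<Rightarrow> nat \<Rightarrow> nat \<Rightarrow> real vec"
    and a b :: real
  assumes M: "prob_space M"
    and \<sigma>: "\<sigma> > 0"
    and A_sym: "\<And>n \<omega>. \<omega> \<in> space M \<Longrightarrow> A n \<omega> \<in> carrier_mat n n \<and> transpose_mat (A n \<omega>) = A n \<omega>"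
    and A_eig: "\<And>n \<omega>. \<omega> \<in> space M \<Longrightarrow> ordered_eigensystem n (A n \<omega>) (lam n \<omega>) (v n \<omega>)"
    and H: "real_distribution H"
    and A_esd: "AE \<omega> in M. weak_conv_m (\<lambda>n. empirical_distr n (lam n \<omega>)) H"
    and H_supp: "\<exists>c d. measure_support H \<subseteq> {c..d}"
    and A_bound: "AE \<omega> in M. eventually (\<lambda>n. \<forall>i\<in>{1..n}. lam n \<omega> i \<in> {h1..h2}) sequentially"
    and Z_iid: "iid_symmetric_array M Z"
    and Z_moment4: "integrable M (\<lambda>\<omega>. (Z 0 0 \<omega>) ^ 4)"
    and Z_mean: "prob_space.expectation M (Z 0 0) = 0"
    and Z_var: "prob_space.variance M (Z 0 0) = 1"
    and Z_indep: "\<And>n. prob_space.indep_var M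
        (entry_space n) (\<lambda>\<omega>. entries n (A n \<omega>)) (entry_space n) (\<lambda>\<omega>. entries n (top_left n Z \<omega>))"
    and U: "open U" "measure_support H \<subseteq> U" "{h1..h2} \<subseteq> U"
    and h: "continuous_on U h" "bounded (h ` U)"
    and Ahat_eig: "\<And>n \<omega>. \<omega> \<in> space M \<Longrightarrow>
        ordered_eigensystem n (A n \<omega> + (\<sigma> / sqrt (real n)) \<cdot>\<^sub>m top_left n Z \<omega>) (lamhat n \<omega>) (what n \<omega>)"
    and K: "K \<ge> 1"
    and lamt_dom: "\<And>n \<omega> i. \<omega> \<in> space M \<Longrightarrow> i \<in> {1..n} \<Longrightarrow> lamt n \<omega> i \<in> U"
    and sampling: "\<And>n. mc_sampling M n K (G n) (A n) (top_left n Z) (sigt n) (lamt n)"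
    and mc_eig: "\<And>n k \<omega>. \<omega> \<in> space M \<Longrightarrow> k \<in> {1..K} \<Longrightarrow>
        ordered_eigensystem n (mc_matrix n (sigt n \<omega>) (lamt n \<omega>) (G n k \<omega>)) (mu n \<omega> k) (g n \<omega> k)"
    and sigt_lim: "AE \<omega> in M. (\<lambda>n. sigt n \<omega>) \<longlonglongrightarrow> \<sigma>"
    and lamt_esd: "AE \<omega> in M. weak_conv_m (\<lambda>n. empirical_distr n (lamt n \<omega>)) H"
    and ab: "a \<in> {0..1}" "b \<in> {0..1}"
  shows "AE \<omega> in M.
    (\<lambda>n. (1 / real n) * (\<Sum>i \<in> {nat \<lfloor>real n * a\<rfloor>..nat \<lfloor>real n * b\<rfloor>} \<inter> {1..n}.
              quad_form (fun_of_mat h (A n \<omega>)) (what n \<omega> i))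
       - (1 / real n) * (\<Sum>i \<in> {nat \<lfloor>real n * a\<rfloor>..nat \<lfloor>real n * b\<rfloor>} \<inter> {1..n}.
              mc_shrinkage n K h (lamt n \<omega>) (g n \<omega>) i)) \<longlonglongrightarrow> 0"
proof -
  interpret prob_space M by (rule M)
  \<comment> \<open>Otherwise the interval that eventually contains the spectrum would be empty.\<close>
  have h12: "h1 \<le> h2"
  proof (rule ccontr)
    assume c: "\<not> h1 \<le> h2"
    from A_bound have "AE \<omega> in M. False"
    proof eventually_elim
      case (elim \<omega>)
      then obtain n0 where "\<forall>n\<ge>n0. \<forall>i\<in>{1..n}. lam n \<omega> i \<in> {h1..h2}" by (auto simp: eventually_sequentially)
      then have "lam (Suc n0) \<omega> 1 \<in> {h1..h2}" by auto
      then show False using c by auto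
    qed
    then show False by (simp add: AE_False)
  qed
  obtain \<beta> where \<beta>: "0 < \<beta>" "\<And>y. y \<in> U \<Longrightarrow> \<bar>h y\<bar> \<le> \<beta>"
    using h(2) unfolding bounded_pos by auto
  \<comment> \<open>A continuous extension of \<open>h\<close> from the interval to the line, with the bound of \<open>h\<close>.\<close>
  define cl where "cl y = max h1 (min h2 y)" for y :: real
  define f where "f y = h (cl y)" for y
  have cl: "cl y \<in> {h1..h2}" for y using h12 by (auto simp: cl_def)
  have clU: "cl y \<in> U" for y using cl U(3) by blast
  have fh: "f y = h y" if "y \<in> {h1..h2}" for y
  proof -
    have "cl y = y" using that by (auto simp: cl_def)
    then show ?thesis by (simp add: f_def)
  qed
  have fc: "continuous_on UNIV f"
    unfolding f_def
  proof (rule continuous_on_compose2[OF h(1)])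
    show "continuous_on UNIV cl" unfolding cl_def by (intro continuous_intros)
    show "range cl \<subseteq> U" using clU by blast
  qed
  have fb: "\<bar>f y\<bar> \<le> \<beta>" for y unfolding f_def by (rule \<beta>(2)[OF clU])
  have fm: "f \<in> borel_measurable borel" using fc by (rule borel_measurable_continuous_onI)
  have wigner: "AE \<omega> in M. \<forall>a b :: rat. 0 < b \<longrightarrow>
     approx_subordinated H (\<lambda>_. 1) \<sigma> (\<lambda>_ _. 1) (\<lambda>n. lamhat n \<omega>) (Complex (of_rat a) (of_rat b)) \<and>
     approx_subordinated H f \<sigma> (\<lambda>n i. quad_form (spectral_sum n f (lam n \<omega>) (v n \<omega>)) (what n \<omega> i))
       (\<lambda>n. lamhat n \<omega>) (Complex (of_rat a) (of_rat b))"
    using A_sym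
    by (intro wigner_approx_subordinated[OF M \<sigma> _ A_eig H A_esd Z_iid Z_moment4 Z_mean Z_var Z_indep Ahat_eig fc fb]) auto
  have mc: "AE \<omega> in M. \<forall>k\<in>{1..K}. \<forall>a b :: rat. 0 < b \<longrightarrow>
     approx_subordinated H (\<lambda>_. 1) \<sigma> (\<lambda>_ _. 1) (\<lambda>n. mu n \<omega> k) (Complex (of_rat a) (of_rat b)) \<and>
     approx_subordinated H f \<sigma> (\<lambda>n i. quad_form (diag_of n (\<lambda>j. f (lamt n \<omega> j))) (g n \<omega> k i))
       (\<lambda>n. mu n \<omega> k) (Complex (of_rat a) (of_rat b))"
  proof (rule AE_finite_allI)
    fix k assume k: "k \<in> {1..K}"
    show "AE \<omega> in M. \<forall>a b :: rat. 0 < b \<longrightarrow>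
     approx_subordinated H (\<lambda>_. 1) \<sigma> (\<lambda>_ _. 1) (\<lambda>n. mu n \<omega> k) (Complex (of_rat a) (of_rat b)) \<and>
     approx_subordinated H f \<sigma> (\<lambda>n i. quad_form (diag_of n (\<lambda>j. f (lamt n \<omega> j))) (g n \<omega> k i))
       (\<lambda>n. mu n \<omega> k) (Complex (of_rat a) (of_rat b))"
      by (rule monte_carlo_approx_subordinated[OF M \<sigma> H k sampling mc_eig[OF _ k] sigt_lim lamt_esd fc fb])
  qed simp
  show ?thesis
    using wigner mc A_bound A_esd lamt_esd AE_space
  proof eventually_elim
    case (elim \<omega>)
    note \<omega> = elim(6)
    have supp: "AE y in H. y \<in> {h1..h2}" by (rule limit_supported_on_interval[OF H elim(4,3)])
    then have suppC: "AE y in H. \<bar>y\<bar> \<le> max \<bar>h1\<bar> \<bar>h2\<bar>" by eventually_elim auto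
    define I where "I n = {nat \<lfloor>real n * a\<rfloor>..nat \<lfloor>real n * b\<rfloor>} \<inter> {1..n}" for n
    \<comment> \<open>Quadratic forms with \<open>h\<close> and with its replacement \<open>f\<close>, for the perturbed matrix and for the \<open>k\<close>-th Monte-Carlo run.\<close>
    define dh where "dh n i = quad_form (fun_of_mat h (A n \<omega>)) (what n \<omega> i)" for n i
    define df where "df n i = quad_form (spectral_sum n f (lam n \<omega>) (v n \<omega>)) (what n \<omega> i)" for n i
    define eh where "eh k n i = quad_form (diag_of n (\<lambda>j. h (lamt n \<omega> j))) (g n \<omega> k i)" for k n i
    define ef where "ef k n i = quad_form (diag_of n (\<lambda>j. f (lamt n \<omega> j))) (g n \<omega> k i)" for k n i
    have df_b: "\<bar>df n i\<bar> \<le> \<beta>" if "i \<in> {1..n}" for n i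
      unfolding df_def using spectral_sum_op_bound[OF A_eig[OF \<omega>] fb] \<beta>(1)
      by (intro eigenvector_quad_form_bound[OF Ahat_eig[OF \<omega>] _ that]) auto
    have ef_b: "\<bar>ef k n i\<bar> \<le> \<beta>" if "k \<in> {1..K}" "i \<in> {1..n}" for k n i
      unfolding ef_def using diag_of_op_bound[of n "\<lambda>j. f (lamt n \<omega> j)" \<beta>] fb \<beta>(1)
      by (intro eigenvector_quad_form_bound[OF mc_eig[OF \<omega> that(1)] _ that(2)]) auto
    have top: "(\<lambda>n. (\<Sum>i = 1..N n. df n i) / real n - (\<Sum>i = 1..N n. ef k n i) / real n) \<longlonglongrightarrow> 0"
      if k: "k \<in> {1..K}" and N: "\<And>n. N n \<le> n" for k N
    proof (rule top_sums_diff_if_approx_subordinated[OF H suppC \<sigma> fm fb, where l="\<lambda>n. lamhat n \<omega>" and l'="\<lambda>n. mu n \<omega> k"])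
      show "\<And>n i j. i \<in> {1..n} \<Longrightarrow> j \<in> {1..n} \<Longrightarrow> i \<le> j \<Longrightarrow> lamhat n \<omega> j \<le> lamhat n \<omega> i"
        by (rule ordered_eigensystemD(5)[OF Ahat_eig[OF \<omega>]])
      show "\<And>n i j. i \<in> {1..n} \<Longrightarrow> j \<in> {1..n} \<Longrightarrow> i \<le> j \<Longrightarrow> mu n \<omega> k j \<le> mu n \<omega> k i"
        by (rule ordered_eigensystemD(5)[OF mc_eig[OF \<omega> k]])
    qed (use df_b ef_b[OF k] N elim(1) elim(2) k in \<open>auto simp: df_def[abs_def] ef_def[abs_def]\<close>)
    have block_f: "(\<lambda>n. (\<Sum>i\<in>I n. df n i) / real n - (\<Sum>i\<in>I n. ef k n i) / real n) \<longlonglongrightarrow> 0" if k: "k \<in> {1..K}" for k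
    proof -
      have Nb: "nat \<lfloor>real n * b\<rfloor> \<le> n" for n by (rule nat_floor_le[OF ab(2)])
      have Na: "min (nat \<lfloor>real n * a\<rfloor> - 1) (nat \<lfloor>real n * b\<rfloor>) \<le> n" for n using Nb[of n] by linarith
      from tendsto_diff[OF top[OF k Nb] top[OF k Na]]
      show ?thesis unfolding I_def sum_block[OF Nb] by (simp add: diff_divide_distrib algebra_simps)
    qed
    \<comment> \<open>For large \<open>n\<close> the spectrum of \<open>A n \<omega>\<close> lies where \<open>f\<close> and \<open>h\<close> agree.\<close>
    have dh_df: "\<forall>\<^sub>F n in sequentially. dh n = df n"
      using elim(3)
    proof eventually_elim
      case (elim n)
      have "fun_of_mat h (A n \<omega>) = spectral_sum n h (lam n \<omega>) (v n \<omega>)"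
        using A_sym[OF \<omega>] by (intro fun_of_mat_eq[OF _ A_eig[OF \<omega>]]) auto
      also have "\<dots> = spectral_sum n f (lam n \<omega>) (v n \<omega>)"
        unfolding spectral_sum_def using elim fh by (intro cong_mat refl) (auto intro!: sum.cong)
      finally show ?case by (simp add: dh_def[abs_def] df_def[abs_def])
    qed
    \<comment> \<open>The inputs may lie outside the interval for every \<open>n\<close>, but only a vanishing proportion of them far from it.\<close>
    have lim0: "(\<lambda>n. (\<Sum>j = 1..n. \<bar>f (lamt n \<omega> j) - h (lamt n \<omega> j)\<bar>) / real n) \<longlonglongrightarrow> 0"
    proof (rule empirical_mean_vanishing[OF H elim(5) supp h12 U(1) U(3) lamt_dom[OF \<omega>], where u="\<lambda>y. f y - h y" and B="\<beta> + \<beta>"])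
      show "continuous_on U (\<lambda>y. f y - h y)"
        using continuous_on_subset[OF fc, of U] h(1) by (intro continuous_on_diff) auto
      show "\<bar>f y - h y\<bar> \<le> \<beta> + \<beta>" if "y \<in> U" for y using fb[of y] \<beta>(2)[OF that] by linarith
    qed (use fh in auto)
    have ef_eh: "(\<lambda>n. (\<Sum>i\<in>I n. ef k n i) / real n - (\<Sum>i\<in>I n. eh k n i) / real n) \<longlonglongrightarrow> 0" if k: "k \<in> {1..K}" for k
    proof (rule Lim_null_comparison[OF _ lim0], rule always_eventually, rule allI)
      fix n
      have "\<bar>(\<Sum>i\<in>I n. ef k n i) - (\<Sum>i\<in>I n. eh k n i)\<bar> \<le> (\<Sum>j = 1..n. \<bar>f (lamt n \<omega> j) - h (lamt n \<omega> j)\<bar>)"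
        unfolding ef_def eh_def by (rule sum_quad_form_diag_diff_le[OF mc_eig[OF \<omega> k]]) (auto simp: I_def)
      then have "\<bar>(\<Sum>i\<in>I n. ef k n i) - (\<Sum>i\<in>I n. eh k n i)\<bar> / real n \<le> (\<Sum>j = 1..n. \<bar>f (lamt n \<omega> j) - h (lamt n \<omega> j)\<bar>) / real n"
        by (rule divide_right_mono) simp
      then show "norm ((\<Sum>i\<in>I n. ef k n i) / real n - (\<Sum>i\<in>I n. eh k n i) / real n) \<le> (\<Sum>j = 1..n. \<bar>f (lamt n \<omega> j) - h (lamt n \<omega> j)\<bar>) / real n"
        by (simp add: diff_divide_distrib[symmetric])
    qed
    have block_h: "(\<lambda>n. (\<Sum>i\<in>I n. dh n i) / real n - (\<Sum>i\<in>I n. eh k n i) / real n) \<longlonglongrightarrow> 0" if k: "k \<in> {1..K}" for k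
    proof (rule Lim_transform_eventually)
      show "(\<lambda>n. ((\<Sum>i\<in>I n. df n i) / real n - (\<Sum>i\<in>I n. ef k n i) / real n)
          + ((\<Sum>i\<in>I n. ef k n i) / real n - (\<Sum>i\<in>I n. eh k n i) / real n)) \<longlonglongrightarrow> 0"
        using tendsto_add[OF block_f[OF k] ef_eh[OF k]] by simp
      show "\<forall>\<^sub>F n in sequentially. ((\<Sum>i\<in>I n. df n i) / real n - (\<Sum>i\<in>I n. ef k n i) / real n)
          + ((\<Sum>i\<in>I n. ef k n i) / real n - (\<Sum>i\<in>I n. eh k n i) / real n)
          = (\<Sum>i\<in>I n. dh n i) / real n - (\<Sum>i\<in>I n. eh k n i) / real n"
        using dh_df by eventually_elim simp
    qed
    have avg: "(1 / real n) * (\<Sum>i\<in>I n. dh n i) - (1 / real n) * (\<Sum>i\<in>I n. mc_shrinkage n K h (lamt n \<omega>) (g n \<omega>) i)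
        = (1 / real K) * (\<Sum>k = 1..K. (\<Sum>i\<in>I n. dh n i) / real n - (\<Sum>i\<in>I n. eh k n i) / real n)" for n
    proof -
      have "(\<Sum>i\<in>I n. mc_shrinkage n K h (lamt n \<omega>) (g n \<omega>) i) = (1 / real K) * (\<Sum>k = 1..K. \<Sum>i\<in>I n. eh k n i)"
        unfolding mc_shrinkage_def eh_def[symmetric] sum_distrib_left[symmetric] by (subst sum.swap) simp
      moreover have "(\<Sum>k = 1..K. (\<Sum>i\<in>I n. dh n i) / real n - (\<Sum>i\<in>I n. eh k n i) / real n)
          = real K * ((\<Sum>i\<in>I n. dh n i) / real n) - (\<Sum>k = 1..K. \<Sum>i\<in>I n. eh k n i) / real n"
        by (simp add: sum_subtractf sum_divide_distrib)
      ultimately show ?thesis using K by (simp add: right_diff_distrib)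
    qed
    have "(\<lambda>n. (1 / real K) * (\<Sum>k = 1..K. (\<Sum>i\<in>I n. dh n i) / real n - (\<Sum>i\<in>I n. eh k n i) / real n)) \<longlonglongrightarrow> (1 / real K) * (\<Sum>k = 1..K. 0)"
      by (intro tendsto_mult tendsto_const tendsto_sum block_h)
    then have "(\<lambda>n. (1 / real n) * (\<Sum>i\<in>I n. dh n i) - (1 / real n) * (\<Sum>i\<in>I n. mc_shrinkage n K h (lamt n \<omega>) (g n \<omega>) i)) \<longlonglongrightarrow> 0"
      unfolding avg by (simp only: sum.neutral_const mult_zero_right)
    then show ?case unfolding I_def dh_def .
  qed
qed

end
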